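(* Let $\mathcal{D}=(G,\chi,g,0)$ be a group datum of nilpotent type over $\mathbb{C}$ with $n\ge 2$ the order of $\chi(g)$, let $H=H_{\mathcal D}$, and let $R(H)=\mathbb{C}\otimes_{\mathbb Z}r(H)$ be the complexified Green ring. Let $m$ be the number of simple $\mathbb{C}G$-modules up to isomorphism and $d_3$ the integer defined in the context. (1) $R(H)$ has exactly $mn-d_3$ simple modules (up to isomorphism) and each of them is of dimension one. (2) The dimension of the Jacobson radical $J(R(H))$ of $R(H)$ is $d_3$.
   Context: The ground field is $\mathbb{C}$; modules over Hopf algebras are finite dimensional left modules. Group datum: $G$ is a finite group, $g$ an element of the center of $G$, $\chi:G\to\mathbb{C}^\times$ a linear character, $q=\chi(g)$ has order $n\ge 2$. $H=H_{\mathcal D}$ is the $\mathbb C$-algebra generated by $y$ and the elements $h\in G$, containing $\mathbb{C}G$ as a subalgebra, with relations $y^n=0$ and $yh=\chi(h)hy$ for $h\in G$; it has basis $\{y^ih\mid h\in G,\ 0\le i\le n-1\}$. It is a Hopf algebra with $\Delta(y)=y\otimes g+1\otimes y$, $\varepsilon(y)=0$, $S(y)=-yg^{-1}$, and $\Delta(h)=h\otimes h$, $\varepsilon(h)=1$, $S(h)=h^{-1}$ for $h\in G$. The Green ring $r(A)$ of a Hopf algebra $A$ is the free abelian group on isomorphism classes $[V]$ of finite dimensional $A$-modules modulo $[M\oplus N]=[M]+[N]$, with product $[M][N]=[M\otimes N]$. Let $l$ be the order of $\chi$; it is divisible by $n$. $V_{\chi^{-1}}$ is the one-dimensional $\mathbb{C}G$-module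 with character $\chi^{-1}$, and $a=[V_{\chi^{-1}}]\in r(\mathbb{C}G)$ has order $l$. $R(\mathbb{C}G)=\mathbb{C}\otimes_{\mathbb Z}r(\mathbb{C}G)$ is a commutative semisimple algebra of dimension $m$; let $W_1,\dots,W_m$ be its non-isomorphic simple (one-dimensional) modules. The element $a$ acts on $W_j$ by $\omega^{t_j}$, where $\omega=\cos\frac{2\pi}{l}+i\sin\frac{2\pi}{l}$ and $0\le t_j\le l-1$. $\Omega_3=\{j\mid 1\le j\le m,\ t_j\ne0\text{ and }\frac{l}{n}\mid t_j\}$ and $d_3=|\Omega_3|$. *)

theory Defs
  imports
    "HOL-Library.Poly_Mapping"
    "HOL-Algebra.QuotRing"
    "HOL-Algebra.Generated_Groups"
    "HOL-Algebra.Multiplicative_Group"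
    "Jordan_Normal_Form.VS_Connect"
begin

section \<open>Modules over a not necessarily commutative ring\<close>

text \<open>The locale \<open>module\<close> of \<open>HOL-Algebra\<close> demands a commutative ring of scalars.  The fields
  \<open>mult\<close> and \<open>one\<close> of a module record play no role.\<close>

locale left_module = R?: ring R + M?: abelian_group M
  for R :: "('a, 'k) ring_scheme" and M :: "('a, 'v, 'm) module_scheme" (structure) +
  assumes lm_smult_closed:
      "\<lbrakk>a \<in> carrier R; x \<in> carrier M\<rbrakk> \<Longrightarrow> a \<odot>\<^bsub>M\<^esub> x \<in> carrier M"
    and lm_smult_l_distr:
      "\<lbrakk>a \<in> carrier R; b \<in> carrier R; x \<in> carrier M\<rbrakk> \<Longrightarrow>
        (a \<oplus>\<^bsub>R\<^esub> b) \<odot>\<^bsub>M\<^esub> x = a \<odot>\<^bsub>M\<^esub> x \<oplus>\<^bsub>M\<^esub> b \<odot>\<^bsub>M\<^esub> x"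
    and lm_smult_r_distr:
      "\<lbrakk>a \<in> carrier R; x \<in> carrier M; y \<in> carrier M\<rbrakk> \<Longrightarrow>
        a \<odot>\<^bsub>M\<^esub> (x \<oplus>\<^bsub>M\<^esub> y) = a \<odot>\<^bsub>M\<^esub> x \<oplus>\<^bsub>M\<^esub> a \<odot>\<^bsub>M\<^esub> y"
    and lm_smult_assoc:
      "\<lbrakk>a \<in> carrier R; b \<in> carrier R; x \<in> carrier M\<rbrakk> \<Longrightarrow>
        (a \<otimes>\<^bsub>R\<^esub> b) \<odot>\<^bsub>M\<^esub> x = a \<odot>\<^bsub>M\<^esub> (b \<odot>\<^bsub>M\<^esub> x)"
    and lm_smult_one: "x \<in> carrier M \<Longrightarrow> \<one>\<^bsub>R\<^esub> \<odot>\<^bsub>M\<^esub> x = x"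

definition module_iso :: "('a, 'k) ring_scheme \<Rightarrow> ('a, 'v) module \<Rightarrow> ('a, 'w) module \<Rightarrow> bool" where
  "module_iso R M N \<longleftrightarrow> (\<exists>f. bij_betw f (carrier M) (carrier N) \<and>
     (\<forall>x\<in>carrier M. \<forall>y\<in>carrier M. f (x \<oplus>\<^bsub>M\<^esub> y) = f x \<oplus>\<^bsub>N\<^esub> f y) \<and>
     (\<forall>a\<in>carrier R. \<forall>x\<in>carrier M. f (a \<odot>\<^bsub>M\<^esub> x) = a \<odot>\<^bsub>N\<^esub> f x))"

definition simple_module :: "('a, 'k) ring_scheme \<Rightarrow> ('a, 'v) module \<Rightarrow> bool" where
  "simple_module R M \<longleftrightarrow> left_module R M \<and> carrier M \<noteq> {\<zero>\<^bsub>M\<^esub>} \<and>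
     (\<forall>U. Module.submodule U R M \<longrightarrow> U = {\<zero>\<^bsub>M\<^esub>} \<or> U = carrier M)"

text \<open>Isomorphism classes of simple modules.  A type has to be chosen for the underlying sets;
  the type \<open>'a set\<close> is large enough, since every simple \<open>R\<close>-module is isomorphic to some \<open>R/I\<close>,
  whose elements are subsets of \<open>R\<close> (see lemma \<open>simple_module_universe\<close> below).\<close>

definition simple_classes :: "('a, 'k) ring_scheme \<Rightarrow> ('a, 'a set) module set set" where
  "simple_classes R = {M. simple_module R M} //
     {(M, N). simple_module R M \<and> simple_module R N \<and> module_iso R M N}"

lemma simple_module_transport:
  fixes M :: "('a, 'v) module" and f :: "'v \<Rightarrow> 'w"
  assumes M: "simple_module R M" and inj: "inj_on f (carrier M)"
  shows "\<exists>N :: ('a, 'w) module. simple_module R N \<and> module_iso R M N"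
proof -
  interpret left_module R M using M by (simp add: simple_module_def)
  define i where "i = inv_into (carrier M) f"
  define N :: "('a, 'w) module" where "N = \<lparr>carrier = f ` carrier M, mult = undefined, one = undefined,
    zero = f \<zero>\<^bsub>M\<^esub>, add = (\<lambda>x y. f (i x \<oplus>\<^bsub>M\<^esub> i y)), smult = (\<lambda>a x. f (a \<odot>\<^bsub>M\<^esub> i x))\<rparr>"
  have i [simp]: "i (f x) = x" if "x \<in> carrier M" for x
    using that inj by (simp add: i_def)
  note clo [simp] = lm_smult_closed
  have N [simp]: "carrier N = f ` carrier M" "zero N = f \<zero>\<^bsub>M\<^esub>"
    "add N x y = f (i x \<oplus>\<^bsub>M\<^esub> i y)" "smult N a x = f (a \<odot>\<^bsub>M\<^esub> i x)" for x y a
    by (simp_all add: N_def)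
  have ab: "abelian_group N"
  proof (rule abelian_groupI)
    fix x assume "x \<in> carrier N"
    then obtain u where u: "u \<in> carrier M" "x = f u" by auto
    show "\<exists>y\<in>carrier N. y \<oplus>\<^bsub>N\<^esub> x = \<zero>\<^bsub>N\<^esub>"
      using u by (auto intro!: bexI[of _ "\<ominus>\<^bsub>M\<^esub> u"] simp: M.l_neg)
  qed (auto simp: M.a_ac)
  have lm: "left_module R N"
    by (intro left_module.intro left_module_axioms.intro R.ring_axioms ab)
      (auto simp: lm_smult_l_distr lm_smult_r_distr lm_smult_assoc lm_smult_one)
  have nz: "carrier N \<noteq> {\<zero>\<^bsub>N\<^esub>}"
  proof
    assume *: "carrier N = {\<zero>\<^bsub>N\<^esub>}"
    have "x = \<zero>\<^bsub>M\<^esub>" if "x \<in> carrier M" for x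
    proof -
      have "f x \<in> carrier N" using that by simp
      then have "f x = f \<zero>\<^bsub>M\<^esub>" unfolding * by simp
      then show ?thesis by (rule inj_onD[OF inj _ that M.zero_closed])
    qed
    then have "carrier M = {\<zero>\<^bsub>M\<^esub>}" using M.zero_closed by blast
    then show False using M by (simp add: simple_module_def)
  qed
  have sub: "U = {\<zero>\<^bsub>N\<^esub>} \<or> U = carrier N" if U: "Module.submodule U R N" for U
  proof -
    have sg: "subgroup U (add_monoid N)" and
      sm: "\<And>a x. a \<in> carrier R \<Longrightarrow> x \<in> U \<Longrightarrow> a \<odot>\<^bsub>N\<^esub> x \<in> U"
      using U by (auto simp: Module.submodule_def Module.submodule_axioms_def)
    have UN: "U \<subseteq> f ` carrier M" using subgroup.subset[OF sg] by simp
    have iU: "i y \<in> carrier M" "f (i y) = y" if y: "y \<in> U" for y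
    proof -
      obtain u where "u \<in> carrier M" "y = f u" using UN y by (meson imageE subsetD)
      then show "i y \<in> carrier M" "f (i y) = y" by simp_all
    qed
    have inv: "inv\<^bsub>add_monoid N\<^esub> x = f (\<ominus>\<^bsub>M\<^esub> (i x))" if x: "x \<in> U" for x
    proof -
      have "\<ominus>\<^bsub>N\<^esub> x = f (\<ominus>\<^bsub>M\<^esub> (i x))"
      proof (rule abelian_group.minus_equality[OF ab])
        show "x \<in> carrier N" using UN x by auto
        show "f (\<ominus>\<^bsub>M\<^esub> (i x)) \<in> carrier N" using iU(1)[OF x] by simp
        show "f (\<ominus>\<^bsub>M\<^esub> (i x)) \<oplus>\<^bsub>N\<^esub> x = \<zero>\<^bsub>N\<^esub>" using iU(1)[OF x] by (simp add: M.l_neg)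
      qed
      then show ?thesis by (simp add: a_inv_def)
    qed
    have "Module.submodule (i ` U) R M"
    proof (intro Module.submodule.intro Module.submodule_axioms.intro group.subgroupI)
      show "group (add_monoid M)" by (rule M.a_group)
      show "i ` U \<subseteq> carrier (add_monoid M)" using iU(1) by (simp add: image_subset_iff)
      show "i ` U \<noteq> {}" using subgroup.one_closed[OF sg] by blast
    next
      fix a assume "a \<in> i ` U"
      then obtain x where x: "x \<in> U" "a = i x" by blast
      then have "i (f (\<ominus>\<^bsub>M\<^esub> (i x))) \<in> i ` U"
        using subgroup.m_inv_closed[OF sg x(1)] inv[OF x(1)] by (simp only: imageI)
      then show "inv\<^bsub>add_monoid M\<^esub> a \<in> i ` U" using x iU(1)[OF x(1)] by (simp add: a_inv_def)
    next
      fix a b assume "a \<in> i ` U" "b \<in> i ` U"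
      then obtain x y where x: "x \<in> U" "a = i x" "y \<in> U" "b = i y" by blast
      then have "x \<otimes>\<^bsub>add_monoid N\<^esub> y \<in> U" by (simp only: subgroup.m_closed[OF sg])
      then have "i (x \<otimes>\<^bsub>add_monoid N\<^esub> y) \<in> i ` U" by (rule imageI)
      then show "a \<otimes>\<^bsub>add_monoid M\<^esub> b \<in> i ` U"
        using x iU(1)[OF x(1)] iU(1)[OF x(3)] by simp
    next
      fix a x assume a: "a \<in> carrier R" and "x \<in> i ` U"
      then obtain y where y: "y \<in> U" "x = i y" by blast
      then have "i (a \<odot>\<^bsub>N\<^esub> y) \<in> i ` U" using sm[OF a y(1)] by (simp only: imageI)
      then show "a \<odot>\<^bsub>M\<^esub> x \<in> i ` U" using y a iU(1)[OF y(1)] by simp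
    qed
    then have "i ` U = {\<zero>\<^bsub>M\<^esub>} \<or> i ` U = carrier M" using M by (simp add: simple_module_def)
    moreover have "f ` (i ` U) = U" using iU(2) by (simp add: image_image)
    ultimately show ?thesis by (metis N(1,2) image_empty image_insert)
  qed
  have "module_iso R M N"
    unfolding module_iso_def using inj
    by (intro exI[of _ f]) (auto simp: bij_betw_def)
  moreover have "simple_module R N" unfolding simple_module_def using lm nz sub by blast
  ultimately show ?thesis by blast
qed

lemma simple_module_universe:
  fixes R :: "('a, 'k) ring_scheme" and M :: "('a, 'v) module"
  assumes M: "simple_module R M"
  shows "\<exists>N :: ('a, 'a set) module. simple_module R N \<and> module_iso R M N"
proof -
  interpret left_module R M using M by (simp add: simple_module_def)
  obtain v where v: "v \<in> carrier M" "v \<noteq> \<zero>\<^bsub>M\<^esub>"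
    using M M.zero_closed unfolding simple_module_def by blast
  let ?U = "(\<lambda>a. a \<odot>\<^bsub>M\<^esub> v) ` carrier R"
  have "Module.submodule ?U R M"
  proof (intro Module.submodule.intro Module.submodule_axioms.intro group.subgroupI)
    show "group (add_monoid M)" by (rule M.a_group)
    show "?U \<subseteq> carrier (add_monoid M)" using v lm_smult_closed by auto
    show "?U \<noteq> {}" using R.one_closed by blast
  next
    fix x assume "x \<in> ?U"
    then obtain a where a: "a \<in> carrier R" "x = a \<odot>\<^bsub>M\<^esub> v" by blast
    have z: "\<zero>\<^bsub>R\<^esub> \<odot>\<^bsub>M\<^esub> v = \<zero>\<^bsub>M\<^esub>"
      using lm_smult_l_distr[of "\<zero>\<^bsub>R\<^esub>" "\<zero>\<^bsub>R\<^esub>" v] v lm_smult_closed[of "\<zero>\<^bsub>R\<^esub>" v]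
      by (metis M.add.l_cancel_one' R.zero_closed R.l_zero)
    have "(\<ominus>\<^bsub>R\<^esub> a) \<odot>\<^bsub>M\<^esub> v \<oplus>\<^bsub>M\<^esub> x = \<zero>\<^bsub>M\<^esub>"
      using a v z by (simp flip: lm_smult_l_distr add: R.l_neg)
    then have "\<ominus>\<^bsub>M\<^esub> x = (\<ominus>\<^bsub>R\<^esub> a) \<odot>\<^bsub>M\<^esub> v"
      using a v by (intro M.minus_equality) (auto simp: lm_smult_closed)
    then show "inv\<^bsub>add_monoid M\<^esub> x \<in> ?U" using a by (simp add: a_inv_def)
  next
    fix x y assume "x \<in> ?U" "y \<in> ?U"
    then show "x \<otimes>\<^bsub>add_monoid M\<^esub> y \<in> ?U"
      using v by (auto simp flip: lm_smult_l_distr)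
  next
    fix a x assume "a \<in> carrier R" "x \<in> ?U"
    then show "a \<odot>\<^bsub>M\<^esub> x \<in> ?U" using v by (auto simp flip: lm_smult_assoc)
  qed
  moreover have "v \<in> ?U" using lm_smult_one[OF v(1)] R.one_closed by force
  ultimately have U: "?U = carrier M" using M v(2) unfolding simple_module_def by blast
  have "inj_on (\<lambda>x. {a \<in> carrier R. a \<odot>\<^bsub>M\<^esub> v = x}) (carrier M)"
  proof (rule inj_onI)
    fix x y assume "x \<in> carrier M"
      and eq: "{a \<in> carrier R. a \<odot>\<^bsub>M\<^esub> v = x} = {a \<in> carrier R. a \<odot>\<^bsub>M\<^esub> v = y}"
    then have "x \<in> ?U" using U by simp
    then obtain a where "a \<in> carrier R" "a \<odot>\<^bsub>M\<^esub> v = x" by blast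
    then have "a \<in> {a \<in> carrier R. a \<odot>\<^bsub>M\<^esub> v = y}" unfolding eq[symmetric] by simp
    then show "x = y" using \<open>a \<odot>\<^bsub>M\<^esub> v = x\<close> by simp
  qed
  then show ?thesis by (rule simple_module_transport[OF M])
qed

definition regular_module :: "('a, 'k) ring_scheme \<Rightarrow> ('a, 'a) module" where
  "regular_module R = \<lparr>carrier = carrier R, mult = mult R, one = one R, zero = zero R,
     add = add R, smult = mult R\<rparr>"

definition maximal_left_ideal :: "('a, 'k) ring_scheme \<Rightarrow> 'a set \<Rightarrow> bool" where
  "maximal_left_ideal R I \<longleftrightarrow> Module.submodule I R (regular_module R) \<and> I \<noteq> carrier R \<and>
     (\<forall>K. Module.submodule K R (regular_module R) \<longrightarrow> I \<subseteq> K \<longrightarrow> K = I \<or> K = carrier R)"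

definition jacobson_radical :: "('a, 'k) ring_scheme \<Rightarrow> 'a set" where
  "jacobson_radical R = carrier R \<inter> \<Inter> {I. maximal_left_ideal R I}"


section \<open>Algebras given by structure constants\<close>

abbreviation "keys \<equiv> Poly_Mapping.keys"
abbreviation "lookup \<equiv> Poly_Mapping.lookup"
abbreviation "single \<equiv> Poly_Mapping.single"

text \<open>Elements of a free module are finitely supported coefficient functions; \<open>single b c\<close>
  is \<open>c\<close> times the basis vector \<open>b\<close>.\<close>

definition scale :: "'r::comm_ring_1 \<Rightarrow> ('b \<Rightarrow>\<^sub>0 'r) \<Rightarrow> ('b \<Rightarrow>\<^sub>0 'r)" where
  "scale c f = Poly_Mapping.map ((*) c) f"

definition lin_ext :: "('a \<Rightarrow> ('c \<Rightarrow>\<^sub>0 'r)) \<Rightarrow> ('a \<Rightarrow>\<^sub>0 'r::comm_ring_1) \<Rightarrow> ('c \<Rightarrow>\<^sub>0 'r)" where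
  "lin_ext \<beta> f = (\<Sum>x\<in>keys f. scale (lookup f x) (\<beta> x))"

definition bilin_ext ::
  "('a \<Rightarrow> 'b \<Rightarrow> ('c \<Rightarrow>\<^sub>0 'r)) \<Rightarrow> ('a \<Rightarrow>\<^sub>0 'r::comm_ring_1) \<Rightarrow> ('b \<Rightarrow>\<^sub>0 'r) \<Rightarrow> ('c \<Rightarrow>\<^sub>0 'r)" where
  "bilin_ext \<beta> f k = (\<Sum>x\<in>keys f. \<Sum>y\<in>keys k. scale (lookup f x * lookup k y) (\<beta> x y))"

definition structure_ring ::
  "'b set \<Rightarrow> ('b \<Rightarrow> 'b \<Rightarrow> ('b \<Rightarrow>\<^sub>0 'r::comm_ring_1)) \<Rightarrow> ('b \<Rightarrow>\<^sub>0 'r) \<Rightarrow> ('b \<Rightarrow>\<^sub>0 'r) ring" where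
  "structure_ring B \<beta> u = \<lparr>carrier = {f. keys f \<subseteq> B}, mult = bilin_ext \<beta>, one = u,
     zero = 0, add = (+)\<rparr>"

definition monoid_ring :: "('b, 'k) monoid_scheme \<Rightarrow> ('b \<Rightarrow>\<^sub>0 'r::comm_ring_1) ring" where
  "monoid_ring M =
     structure_ring (carrier M) (\<lambda>x y. single (x \<otimes>\<^bsub>M\<^esub> y) 1) (single \<one>\<^bsub>M\<^esub> 1)"

record 'b based_algebra =
  basis :: "'b set"
  bmult :: "'b \<Rightarrow> 'b \<Rightarrow> ('b \<Rightarrow>\<^sub>0 complex)"
  unity :: "'b \<Rightarrow>\<^sub>0 complex"

text \<open>The structure maps of a Hopf algebra are stored through their values on the basis.
  The antipode does not enter the Green ring.\<close>

record 'b hopf_algebra = "'b based_algebra" +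
  comult :: "'b \<Rightarrow> ('b \<times> 'b \<Rightarrow>\<^sub>0 complex)"
  counit :: "'b \<Rightarrow> complex"
  antipode :: "'b \<Rightarrow> ('b \<Rightarrow>\<^sub>0 complex)"

definition alg :: "('b, 'k) based_algebra_scheme \<Rightarrow> ('b \<Rightarrow>\<^sub>0 complex) ring" where
  "alg A = structure_ring (basis A) (bmult A) (unity A)"

definition tensor_elt :: "('a \<Rightarrow>\<^sub>0 complex) \<Rightarrow> ('b \<Rightarrow>\<^sub>0 complex) \<Rightarrow> ('a \<times> 'b \<Rightarrow>\<^sub>0 complex)" where
  "tensor_elt = bilin_ext (\<lambda>x y. single (x, y) 1)"

definition tensor_square :: "('b, 'k) based_algebra_scheme \<Rightarrow> ('b \<times> 'b) based_algebra" where
  "tensor_square A = \<lparr>basis = basis A \<times> basis A,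
     bmult = (\<lambda>(a, b) (a', b'). tensor_elt (bmult A a a') (bmult A b b')),
     unity = tensor_elt (unity A) (unity A)\<rparr>"


section \<open>Finite-dimensional modules over a Hopf algebra\<close>

text \<open>A \<open>d\<close>-dimensional left module is written in a basis: the pair \<open>(d, \<rho>)\<close> consists of
  the dimension and the algebra homomorphism \<open>\<rho>\<close> into the \<open>d \<times> d\<close> matrices.  The zero module
  is the case \<open>d = 0\<close>.\<close>

type_synonym 'b rep = "nat \<times> (('b \<Rightarrow>\<^sub>0 complex) \<Rightarrow> complex mat)"

definition fd_module :: "('b, 'k) based_algebra_scheme \<Rightarrow> 'b rep \<Rightarrow> bool" where
  "fd_module A = (\<lambda>(d, \<rho>).
     (\<forall>a\<in>carrier (alg A). \<rho> a \<in> carrier_mat d d) \<and>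
     \<rho> \<one>\<^bsub>alg A\<^esub> = 1\<^sub>m d \<and>
     (\<forall>a\<in>carrier (alg A). \<forall>b\<in>carrier (alg A). \<rho> (a \<otimes>\<^bsub>alg A\<^esub> b) = \<rho> a * \<rho> b) \<and>
     (\<forall>a\<in>carrier (alg A). \<forall>b\<in>carrier (alg A). \<rho> (a + b) = \<rho> a + \<rho> b) \<and>
     (\<forall>c. \<forall>a\<in>carrier (alg A). \<rho> (scale c a) = c \<cdot>\<^sub>m \<rho> a))"

definition as_module :: "'b rep \<Rightarrow> ('b \<Rightarrow>\<^sub>0 complex, complex vec) module" where
  "as_module = (\<lambda>(d, \<rho>). \<lparr>carrier = carrier_vec d, mult = undefined, one = undefined,
     zero = 0\<^sub>v d, add = (+), smult = (\<lambda>a v. \<rho> a *\<^sub>v v)\<rparr>)"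

definition iso_class :: "('b, 'k) based_algebra_scheme \<Rightarrow> 'b rep \<Rightarrow> 'b rep set" where
  "iso_class A M = {N. fd_module A N \<and> module_iso (alg A) (as_module M) (as_module N)}"

definition rep_sum :: "'b rep \<Rightarrow> 'b rep \<Rightarrow> 'b rep" where
  "rep_sum = (\<lambda>(d, \<rho>) (e, \<sigma>).
     (d + e, \<lambda>a. four_block_mat (\<rho> a) (0\<^sub>m d e) (0\<^sub>m e d) (\<sigma> a)))"

text \<open>The action \<open>a (v \<otimes> w) = \<Sum> a\<^sub>1 v \<otimes> a\<^sub>2 w\<close>, in the basis \<open>v\<^sub>i \<otimes> w\<^sub>j\<close> numbered by \<open>i * e + j\<close>.\<close>

definition rep_tensor :: "'b hopf_algebra \<Rightarrow> 'b rep \<Rightarrow> 'b rep \<Rightarrow> 'b rep" where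
  "rep_tensor A = (\<lambda>(d, \<rho>) (e, \<sigma>). (d * e, \<lambda>a. mat (d * e) (d * e) (\<lambda>(i, j).
     \<Sum>(b, c)\<in>keys (lin_ext (comult A) a). lookup (lin_ext (comult A) a) (b, c) *
       \<rho> (single b 1) $$ (i div e, j div e) * \<sigma> (single c 1) $$ (i mod e, j mod e))))"

definition one_dim_rep :: "('b \<Rightarrow> complex) \<Rightarrow> 'b rep" where
  "one_dim_rep \<epsilon> = (1, \<lambda>a. mat 1 1 (\<lambda>_. \<Sum>b\<in>keys a. lookup a b * \<epsilon> b))"


section \<open>The Green ring and its complexification\<close>

definition iso_class_monoid :: "'b hopf_algebra \<Rightarrow> 'b rep set monoid" where
  "iso_class_monoid A = \<lparr>carrier = {iso_class A M | M. fd_module A M},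
     mult = (\<lambda>X Y. \<Union>M\<in>X. \<Union>N\<in>Y. iso_class A (rep_tensor A M N)),
     one = iso_class A (one_dim_rep (counit A))\<rparr>"

definition green_free :: "'b hopf_algebra \<Rightarrow> ('b rep set \<Rightarrow>\<^sub>0 int) ring" where
  "green_free A = monoid_ring (iso_class_monoid A)"

definition green_relations :: "'b hopf_algebra \<Rightarrow> ('b rep set \<Rightarrow>\<^sub>0 int) set" where
  "green_relations A = generate (add_monoid (green_free A))
     {single (iso_class A (rep_sum M N)) 1 - single (iso_class A M) 1 - single (iso_class A N) 1
       | M N. fd_module A M \<and> fd_module A N}"

definition green_ring :: "'b hopf_algebra \<Rightarrow> ('b rep set \<Rightarrow>\<^sub>0 int) set ring" where
  "green_ring A = green_free A Quot green_relations A"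

definition green_class :: "'b hopf_algebra \<Rightarrow> 'b rep \<Rightarrow> ('b rep set \<Rightarrow>\<^sub>0 int) set" where
  "green_class A M = green_relations A +>\<^bsub>green_free A\<^esub> single (iso_class A M) 1"

text \<open>The tensor product of \<open>\<complex>\<close> with a ring \<open>R\<close> over the integers: \<open>single r c\<close> represents
  \<open>c \<otimes> r\<close>.  Additivity in \<open>c\<close> already holds in the group of finitely supported functions, so only
  additivity in \<open>r\<close> is imposed; the product is \<open>(c \<otimes> r) (c' \<otimes> r') = c c' \<otimes> r r'\<close>.\<close>

definition complex_free :: "('a, 'k) ring_scheme \<Rightarrow> ('a \<Rightarrow>\<^sub>0 complex) ring" where
  "complex_free R = monoid_ring R"

definition complex_relations :: "('a, 'k) ring_scheme \<Rightarrow> ('a \<Rightarrow>\<^sub>0 complex) set" where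
  "complex_relations R = generate (add_monoid (complex_free R))
     {single (r \<oplus>\<^bsub>R\<^esub> s) c - single r c - single s c
       | r s c. r \<in> carrier R \<and> s \<in> carrier R}"

definition complexification :: "('a, 'k) ring_scheme \<Rightarrow> ('a \<Rightarrow>\<^sub>0 complex) set ring" where
  "complexification R = complex_free R Quot complex_relations R"

definition complex_tensor ::
  "('a, 'k) ring_scheme \<Rightarrow> complex \<Rightarrow> 'a \<Rightarrow> ('a \<Rightarrow>\<^sub>0 complex) set" where
  "complex_tensor R c r = complex_relations R +>\<^bsub>complex_free R\<^esub> single r c"

text \<open>A module over the complexification, viewed as a complex vector space along
  \<open>c \<mapsto> c \<otimes> 1\<close>.\<close>

definition complex_space :: "('a, 'k) ring_scheme \<Rightarrow>
    (('a \<Rightarrow>\<^sub>0 complex) set, 'v) module \<Rightarrow> (complex, 'v) module" where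
  "complex_space R M = \<lparr>carrier = carrier M, mult = mult M, one = one M, zero = zero M,
     add = add M, smult = (\<lambda>c x. complex_tensor R c \<one>\<^bsub>R\<^esub> \<odot>\<^bsub>M\<^esub> x)\<rparr>"

text \<open>The value of \<open>vectorspace.dim\<close> is meaningful only in finite dimension.\<close>

definition has_complex_dim :: "(complex, 'v) module \<Rightarrow> nat \<Rightarrow> bool" where
  "has_complex_dim V d \<longleftrightarrow> vectorspace class_ring V \<and>
     vectorspace.fin_dim class_ring V \<and> vectorspace.dim class_ring V = d"

definition complex_green_ring ::
  "'b hopf_algebra \<Rightarrow> (('b rep set \<Rightarrow>\<^sub>0 int) set \<Rightarrow>\<^sub>0 complex) set ring" where
  "complex_green_ring A = complexification (green_ring A)"


section \<open>The Hopf algebras of a group datum\<close>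

locale group_datum = group G for G (structure) +
  fixes \<chi> :: "'a \<Rightarrow> complex" and g :: 'a
  assumes finite_carrier: "finite (carrier G)"
    and g_closed: "g \<in> carrier G"
    and g_central: "h \<in> carrier G \<Longrightarrow> g \<otimes> h = h \<otimes> g"
    and character: "\<chi> \<in> hom G (mult_of class_ring)"

definition q_order :: "('g \<Rightarrow> complex) \<Rightarrow> 'g \<Rightarrow> nat" where
  "q_order \<chi> g = group.ord (mult_of class_ring) (\<chi> g)"

definition character_order :: "('g, 'k) monoid_scheme \<Rightarrow> ('g \<Rightarrow> complex) \<Rightarrow> nat" where
  "character_order G \<chi> = (LEAST k. 0 < k \<and> (\<forall>h\<in>carrier G. \<chi> h ^ k = 1))"

definition group_hopf :: "('g, 'k) monoid_scheme \<Rightarrow> 'g hopf_algebra" where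
  "group_hopf G = \<lparr>basis = carrier G, bmult = (\<lambda>h k. single (h \<otimes>\<^bsub>G\<^esub> k) 1),
     unity = single \<one>\<^bsub>G\<^esub> 1, comult = (\<lambda>h. single (h, h) 1), counit = (\<lambda>h. 1),
     antipode = (\<lambda>h. single (inv\<^bsub>G\<^esub> h) 1)\<rparr>"

text \<open>The algebra \<open>H\<close>, on its basis \<open>y\<^sup>i h\<close>, here \<open>(i, h)\<close>.  The relation \<open>y h = \<chi>(h) h y\<close> gives
  \<open>h y\<^sup>j = \<chi>(h)\<^sup>-\<^sup>j y\<^sup>j h\<close>, whence \<open>(y\<^sup>i h) (y\<^sup>j k) = \<chi>(h)\<^sup>-\<^sup>j y\<^sup>i\<^sup>+\<^sup>j h k\<close>, and this vanishes
  for \<open>i + j \<ge> n\<close>.\<close>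

definition H_algebra ::
  "('g, 'k) monoid_scheme \<Rightarrow> ('g \<Rightarrow> complex) \<Rightarrow> 'g \<Rightarrow> (nat \<times> 'g) based_algebra" where
  "H_algebra G \<chi> g = (let n = q_order \<chi> g in \<lparr>basis = {..<n} \<times> carrier G,
     bmult = (\<lambda>(i, h) (j, k).
       if i + j < n then single (i + j, h \<otimes>\<^bsub>G\<^esub> k) (inverse (\<chi> h) ^ j) else 0),
     unity = single (0, \<one>\<^bsub>G\<^esub>) 1\<rparr>)"

definition H_y :: "('g, 'k) monoid_scheme \<Rightarrow> (nat \<times> 'g \<Rightarrow>\<^sub>0 complex)" where
  "H_y G = single (1, \<one>\<^bsub>G\<^esub>) 1"

definition H_grp :: "'g \<Rightarrow> (nat \<times> 'g \<Rightarrow>\<^sub>0 complex)" where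
  "H_grp h = single (0, h) 1"

lemma lookup_scale [simp]: "lookup (scale c f) x = c * lookup f x"
  by (simp add: scale_def Poly_Mapping.map.rep_eq when_def)

lemma scale_zero [simp]: "scale c 0 = 0" "scale 0 f = 0"
  by (rule poly_mapping_eqI; simp)+

lemma scale_single: "scale c (single x d) = single x (c * d)"
  by (rule poly_mapping_eqI) (simp add: lookup_single when_def)

lemma bilin_ext_single:
  "bilin_ext \<beta> (single x c) (single y d) = scale (c * d) (\<beta> x y)"
  by (simp add: bilin_ext_def)

lemma H_mult:
  assumes "n = q_order \<chi> g"
  shows "single (i, h) c \<otimes>\<^bsub>alg (H_algebra G \<chi> g)\<^esub> single (j, k) d =
    (if i + j < n then single (i + j, h \<otimes>\<^bsub>G\<^esub> k) (c * d * inverse (\<chi> h) ^ j) else 0)"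
  using assms
  by (auto simp: alg_def structure_ring_def H_algebra_def Let_def bilin_ext_single scale_single)

context group_datum
begin

lemma char_one: "\<chi> \<one> = 1" and char_nonzero: "h \<in> carrier G \<Longrightarrow> \<chi> h \<noteq> 0"
proof -
  show nz: "\<chi> h \<noteq> 0" if "h \<in> carrier G" for h
    using character that by (auto simp: hom_def mult_of_def Pi_iff)
  have "\<forall>x\<in>carrier G. \<forall>y\<in>carrier G. \<chi> (x \<otimes> y) = \<chi> x * \<chi> y"
    using character by (simp add: hom_def mult_of_def)
  then have "\<chi> (\<one> \<otimes> \<one>) = \<chi> \<one> * \<chi> \<one>" using one_closed by blast
  then show "\<chi> \<one> = 1"
    using nz[OF one_closed] by (metis l_one one_closed mult_cancel_left2)
qed

text \<open>The defining relations of \<open>H\<close>, and the meaning of the basis.\<close>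

lemma H_group_relation:
  assumes "2 \<le> q_order \<chi> g"
  shows "H_grp h \<otimes>\<^bsub>alg (H_algebra G \<chi> g)\<^esub> H_grp k = H_grp (h \<otimes> k)"
  using assms by (simp add: H_grp_def H_mult)

lemma H_commutation_relation:
  assumes "2 \<le> q_order \<chi> g" "h \<in> carrier G"
  shows "H_y G \<otimes>\<^bsub>alg (H_algebra G \<chi> g)\<^esub> H_grp h =
    scale (\<chi> h) (H_grp h \<otimes>\<^bsub>alg (H_algebra G \<chi> g)\<^esub> H_y G)"
  using assms by (simp add: H_y_def H_grp_def H_mult scale_single char_nonzero)

lemma H_y_power:
  assumes "2 \<le> q_order \<chi> g"
  shows "H_y G [^]\<^bsub>alg (H_algebra G \<chi> g)\<^esub> (i :: nat) =
    (if i < q_order \<chi> g then single (i, \<one>) 1 else 0)"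
proof (induction i)
  case 0
  then show ?case
    using assms by (simp add: nat_pow_def alg_def structure_ring_def H_algebra_def Let_def)
next
  case (Suc i)
  have "0 \<otimes>\<^bsub>alg (H_algebra G \<chi> g)\<^esub> H_y G = 0"
    by (simp add: alg_def structure_ring_def bilin_ext_def)
  then show ?case
    using Suc by (simp add: nat_pow_def) (simp add: H_y_def H_mult char_one)
qed

lemma H_y_nilpotent:
  assumes "2 \<le> q_order \<chi> g"
  shows "H_y G [^]\<^bsub>alg (H_algebra G \<chi> g)\<^esub> q_order \<chi> g = 0"
  using assms by (simp add: H_y_power)

lemma H_basis:
  assumes "2 \<le> q_order \<chi> g" "i < q_order \<chi> g" "h \<in> carrier G"
  shows "H_y G [^]\<^bsub>alg (H_algebra G \<chi> g)\<^esub> i \<otimes>\<^bsub>alg (H_algebra G \<chi> g)\<^esub> H_grp h =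
    single (i, h) 1"
  using assms by (simp add: H_y_power) (simp add: H_grp_def H_mult)

end

text \<open>Comultiplication and antipode on \<open>y\<^sup>i h\<close> are determined by their values on \<open>y\<close> and \<open>h\<close>:
  \<open>\<Delta>(y\<^sup>i h) = (y \<otimes> g + 1 \<otimes> y)\<^sup>i (h \<otimes> h)\<close> and \<open>S(y\<^sup>i h) = h\<^sup>-\<^sup>1 (- y g\<^sup>-\<^sup>1)\<^sup>i\<close>.\<close>

definition H_hopf ::
  "('g, 'k) monoid_scheme \<Rightarrow> ('g \<Rightarrow> complex) \<Rightarrow> 'g \<Rightarrow> (nat \<times> 'g) hopf_algebra" where
  "H_hopf G \<chi> g = (let A = H_algebra G \<chi> g; R = alg A; T = alg (tensor_square A) in
     based_algebra.extend A \<lparr>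
       comult = (\<lambda>(i, h).
         (tensor_elt (H_y G) (H_grp g) + tensor_elt \<one>\<^bsub>R\<^esub> (H_y G)) [^]\<^bsub>T\<^esub> i
           \<otimes>\<^bsub>T\<^esub> tensor_elt (H_grp h) (H_grp h)),
       counit = (\<lambda>(i, h). if i = 0 then 1 else 0),
       antipode = (\<lambda>(i, h).
         H_grp (inv\<^bsub>G\<^esub> h) \<otimes>\<^bsub>R\<^esub> (- (H_y G \<otimes>\<^bsub>R\<^esub> H_grp (inv\<^bsub>G\<^esub> g))) [^]\<^bsub>R\<^esub> i)\<rparr>)"


section \<open>The numbers \<open>m\<close> and \<open>d\<^sub>3\<close>\<close>

definition num_simple_reps :: "('g, 'k) monoid_scheme \<Rightarrow> nat" where
  "num_simple_reps G = card {iso_class (group_hopf G) M | M.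
     fd_module (group_hopf G) M \<and> simple_module (alg (group_hopf G)) (as_module M)}"

definition element_a :: "('g, 'k) monoid_scheme \<Rightarrow> ('g \<Rightarrow> complex) \<Rightarrow>
    ('g rep set \<Rightarrow>\<^sub>0 int) set" where
  "element_a G \<chi> = green_class (group_hopf G) (one_dim_rep (\<lambda>h. inverse (\<chi> h)))"

text \<open>The index \<open>j\<close> of \<open>W\<^sub>j\<close> is replaced by the isomorphism class \<open>X\<close> of \<open>W\<^sub>j\<close>; the condition on
  \<open>t\<close> says that \<open>a\<close> acts on \<open>W\<^sub>j\<close> by \<open>\<omega>\<^sup>t\<close>, that is, \<open>t = t\<^sub>j\<close>.\<close>

definition Omega3 :: "('g, 'k) monoid_scheme \<Rightarrow> ('g \<Rightarrow> complex) \<Rightarrow> 'g \<Rightarrow>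
    ((('g rep set \<Rightarrow>\<^sub>0 int) set \<Rightarrow>\<^sub>0 complex) set,
     (('g rep set \<Rightarrow>\<^sub>0 int) set \<Rightarrow>\<^sub>0 complex) set set) module set set" where
  "Omega3 G \<chi> g = (let l = character_order G \<chi>; n = q_order \<chi> g; r = green_ring (group_hopf G);
      \<omega> = cis (2 * pi / real l) in
    {X \<in> simple_classes (complex_green_ring (group_hopf G)).
      \<exists>t<l. (\<forall>W\<in>X. \<forall>w\<in>carrier W.
          complex_tensor r 1 (element_a G \<chi>) \<odot>\<^bsub>W\<^esub> w = complex_tensor r (\<omega> ^ t) \<one>\<^bsub>r\<^esub> \<odot>\<^bsub>W\<^esub> w) \<and>
        t \<noteq> 0 \<and> (l div n) dvd t})"

definition d3 :: "('g, 'k) monoid_scheme \<Rightarrow> ('g \<Rightarrow> complex) \<Rightarrow> 'g \<Rightarrow> nat" where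
  "d3 G \<chi> g = card (Omega3 G \<chi> g)"

end

theory Submission
  imports Defs "HOL-Computational_Algebra.Polynomial_Factorial" "HOL-Library.Function_Algebras"
begin

text \<open>A module over \<open>H\<close> is a sum of modules \<open>W \<otimes> M\<^sub>k\<close> with \<open>W\<close> simple over \<open>G\<close> and \<open>M\<^sub>k\<close> the
  uniserial module of length \<open>k \<le> n\<close> with trivial top.  The traces of \<open>h \<in> G\<close> on the layers
  \<open>y\<^sup>i V / y\<^sup>i\<^sup>+\<^sup>1 V\<close> recover the multiplicities, so the polynomial-valued function on \<open>G\<close> that sends
  \<open>W \<otimes> M\<^sub>k\<close> to \<open>h \<mapsto> \<chi>\<^sub>W(h) F\<^sub>k(\<alpha>(h), z)\<close> is a complete invariant.  Here \<open>\<alpha> = \<chi>\<^sup>-\<^sup>1\<close>, and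
  \<open>F\<^sub>k\<^sub>+\<^sub>2 = z F\<^sub>k\<^sub>+\<^sub>1 - \<alpha> F\<^sub>k\<close> mirrors the rule \<open>M\<^sub>2 \<otimes> M\<^sub>k = M\<^sub>k\<^sub>+\<^sub>1 + \<alpha> M\<^sub>k\<^sub>-\<^sub>1\<close> for \<open>k < n\<close>; since
  \<open>M\<^sub>2 \<otimes> M\<^sub>n = (1 + \<alpha>) M\<^sub>n\<close>, tensor products become products modulo \<open>(z - 1 - \<alpha>) F\<^sub>n\<close>.
  Thus \<open>R(H)\<close> is the product, over the joint level sets of the irreducible characters of \<open>G\<close>, of the
  algebras \<open>\<complex>[z] / ((z - 1 - a) F\<^sub>n(a, z))\<close> with \<open>a\<close> the value of \<open>\<alpha>\<close>.  There are \<open>m\<close> such level sets.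
  The \<open>n - 1\<close> roots of \<open>F\<^sub>n(a, z)\<close> are distinct, and \<open>F\<^sub>n(a, 1 + a) = 1 + a + \<dots> + a\<^sup>n\<^sup>-\<^sup>1\<close>, so a factor
  is reduced unless \<open>a\<^sup>n = 1 \<noteq> a\<close>; in that case it has \<open>n - 1\<close> points and a radical of dimension one
  spanned by \<open>F\<^sub>n\<close>.  These exceptional level sets are the \<open>d\<^sub>3\<close> elements of \<open>\<Omega>\<^sub>3\<close>.\<close>

section \<open>Finitely supported matrices\<close>

text \<open>The Green ring is presented by generators and relations and complexified by a second
  presentation, so the burden is to show that the relations fill the whole kernel of the invariant.
  This takes a splitting of every module into modules W \<otimes> M_k and the linear independence
  over \<complex> of their invariants. The invariant also spares explicit isomorphisms: the
  splitting of M_k \<otimes> M_2 is inferred from traces. Traces on tensor products are computed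
  only when one factor is killed by y or is M_2; the rest follows because every M_k is reached from
  M_2 and \<alpha> by the recursion, and a summand whose products are known can be subtracted. The
  group enters through averaging alone: it yields complements, generalized inverses of y^i
  compatible with G, and orthogonality of characters. That there are m level sets holds because the
  irreducible characters and the indicators of the level sets are two bases of one space. Once both
  rings are described by finitely many points and a nil ideal, simple modules and radical are read
  off from the points.\<close>

text \<open>All sizes live in one type: a \<open>d \<times> d\<close> matrix \<open>A\<close> is recognised by \<open>E d * A = A = A * E d\<close>, where
  \<open>E d\<close> is the truncated identity.  The ring has no unit.\<close>

typedef fmat = "{f :: nat \<Rightarrow> nat \<Rightarrow> complex. \<exists>d. \<forall>i j. f i j \<noteq> 0 \<longrightarrow> i < d \<and> j < d}"
  morphisms ent Abs_fmat
  by (rule exI[of _ "\<lambda>_ _. 0"]) simp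

setup_lifting type_definition_fmat

lemma fmat_eqI: "(\<And>i j. ent A i j = ent B i j) \<Longrightarrow> A = B"
  by (metis ent_inject ext)

lemma fmat_bound: "\<exists>d. \<forall>i j. ent A i j \<noteq> 0 \<longrightarrow> i < d \<and> j < d"
  using ent[of A] by simp

lemma fmat_supp_max:
  fixes f k :: "nat \<Rightarrow> nat \<Rightarrow> complex"
  assumes "\<exists>d. \<forall>i j. f i j \<noteq> 0 \<longrightarrow> i < d \<and> j < d"
    and "\<exists>d. \<forall>i j. k i j \<noteq> 0 \<longrightarrow> i < d \<and> j < d"
  obtains d where "\<And>i j. f i j \<noteq> 0 \<Longrightarrow> i < d \<and> j < d" "\<And>i j. k i j \<noteq> 0 \<Longrightarrow> i < d \<and> j < d"
proof -
  obtain d e where "\<forall>i j. f i j \<noteq> 0 \<longrightarrow> i < d \<and> j < d" "\<forall>i j. k i j \<noteq> 0 \<longrightarrow> i < e \<and> j < e"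
    using assms by blast
  then show ?thesis by (intro that[of "max d e"]) (auto simp: less_max_iff_disj)
qed

instantiation fmat :: ring
begin

lift_definition zero_fmat :: fmat is "\<lambda>_ _. 0" by simp
lift_definition plus_fmat :: "fmat \<Rightarrow> fmat \<Rightarrow> fmat" is "\<lambda>f k i j. f i j + k i j"
  subgoal for f k by (erule (1) fmat_supp_max) (metis add.right_neutral)
  done
lift_definition minus_fmat :: "fmat \<Rightarrow> fmat \<Rightarrow> fmat" is "\<lambda>f k i j. f i j - k i j"
  subgoal for f k by (erule (1) fmat_supp_max) (metis diff_zero)
  done
lift_definition uminus_fmat :: "fmat \<Rightarrow> fmat" is "\<lambda>f i j. - f i j"
  by simp
text \<open>The index set is finite by itself, so the product needs no size;
  \<open>ent_mult_row\<close> and \<open>ent_mult_col\<close> replace it by any bound on the nonzero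
  columns of the left or the nonzero rows of the right factor.\<close>

lift_definition times_fmat :: "fmat \<Rightarrow> fmat \<Rightarrow> fmat" is "\<lambda>f k i j. \<Sum>l | f i l \<noteq> 0. f i l * k l j"
proof -
  fix f k :: "nat \<Rightarrow> nat \<Rightarrow> complex"
  assume "\<exists>d. \<forall>i j. f i j \<noteq> 0 \<longrightarrow> i < d \<and> j < d" "\<exists>d. \<forall>i j. k i j \<noteq> 0 \<longrightarrow> i < d \<and> j < d"
  then obtain d where d: "\<And>i j. f i j \<noteq> 0 \<Longrightarrow> i < d \<and> j < d" "\<And>i j. k i j \<noteq> 0 \<Longrightarrow> i < d \<and> j < d"
    by (rule fmat_supp_max) blast
  have "i < d \<and> j < d" if nz: "(\<Sum>l | f i l \<noteq> 0. f i l * k l j) \<noteq> 0" for i j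
  proof -
    obtain l where "f i l * k l j \<noteq> 0" using nz by (rule sum.not_neutral_contains_not_neutral)
    then show ?thesis using d(1)[of i l] d(2)[of l j] by auto
  qed
  then show "\<exists>d. \<forall>i j. (\<Sum>l | f i l \<noteq> 0. f i l * k l j) \<noteq> 0 \<longrightarrow> i < d \<and> j < d" by blast
qed

lemma ent_mult_row:
  assumes "\<And>l. ent A i l \<noteq> 0 \<Longrightarrow> l < d"
  shows "ent (A * B) i j = (\<Sum>l<d. ent A i l * ent B l j)"
  unfolding times_fmat.rep_eq
  by (rule sum.mono_neutral_left) (use assms in auto)

lemma ent_mult_col:
  assumes "\<And>l. ent B l j \<noteq> 0 \<Longrightarrow> l < d"
  shows "ent (A * B) i j = (\<Sum>l<d. ent A i l * ent B l j)"
proof -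
  obtain e where e: "\<forall>i j. ent A i j \<noteq> 0 \<longrightarrow> i < e \<and> j < e" using fmat_bound by blast
  have "ent (A * B) i j = (\<Sum>l<max d e. ent A i l * ent B l j)"
    by (rule ent_mult_row) (use e in \<open>auto simp: less_max_iff_disj\<close>)
  also have "\<dots> = (\<Sum>l<d. ent A i l * ent B l j)"
    by (rule sum.mono_neutral_right) (use assms in \<open>force simp: less_max_iff_disj\<close>)+
  finally show ?thesis .
qed

instance
proof
  fix A B C :: fmat
  show "A + B + C = A + (B + C)" "A + B = B + A" "0 + A = A" "- A + A = 0" "A - B = A + - B"
    by (transfer; simp add: fun_eq_iff)+
  obtain d where d: "\<And>i j. ent A i j \<noteq> 0 \<Longrightarrow> i < d \<and> j < d" "\<And>i j. ent B i j \<noteq> 0 \<Longrightarrow> i < d \<and> j < d"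
    using fmat_supp_max[OF fmat_bound fmat_bound] by blast
  have mA: "ent (A * X) i j = (\<Sum>l<d. ent A i l * ent X l j)" for X i j
    by (rule ent_mult_row) (use d in blast)
  have mB: "ent (B * X) i j = (\<Sum>l<d. ent B i l * ent X l j)" for X i j
    by (rule ent_mult_row) (use d in blast)
  have dAB: "l < d" if nz: "ent (A * B) i l \<noteq> 0" for i l
  proof -
    obtain k where "ent A i k * ent B k l \<noteq> 0"
      using nz unfolding mA by (rule sum.not_neutral_contains_not_neutral)
    then show ?thesis using d(2)[of k l] by auto
  qed
  have dpl: "l < d" if "ent (A + B) i l \<noteq> 0" for i l
    using that d(1)[of i l] d(2)[of i l] by (cases "ent A i l = 0") (auto simp: plus_fmat.rep_eq)
  have mAB: "ent (A * B * X) i j = (\<Sum>l<d. ent (A * B) i l * ent X l j)"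
    "ent ((A + B) * X) i j = (\<Sum>l<d. ent (A + B) i l * ent X l j)" for X i j
    by (rule ent_mult_row; use dAB dpl in blast)+
  show "A * B * C = A * (B * C)"
  proof (rule fmat_eqI)
    fix i j
    have "ent (A * B * C) i j = (\<Sum>l<d. (\<Sum>k<d. ent A i k * ent B k l) * ent C l j)"
      by (simp only: mAB mA)
    also have "\<dots> = (\<Sum>k<d. ent A i k * (\<Sum>l<d. ent B k l * ent C l j))"
      by (simp add: sum_distrib_left sum_distrib_right mult.assoc) (rule sum.swap)
    also have "\<dots> = ent (A * (B * C)) i j"
      by (simp only: mA mB)
    finally show "ent (A * B * C) i j = ent (A * (B * C)) i j" .
  qed
  show "(A + B) * C = A * C + B * C"
    by (rule fmat_eqI) (simp add: mAB mA mB plus_fmat.rep_eq sum.distrib algebra_simps)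
  show "C * (A + B) = C * A + C * B"
  proof (rule fmat_eqI)
    fix i j
    obtain e where e: "\<forall>i j. ent C i j \<noteq> 0 \<longrightarrow> i < e \<and> j < e" using fmat_bound by blast
    then show "ent (C * (A + B)) i j = ent (C * A + C * B) i j"
      by (simp add: ent_mult_row[of C _ e] plus_fmat.rep_eq sum.distrib algebra_simps)
  qed
qed

end

lemmas ent_simps [simp] = zero_fmat.rep_eq plus_fmat.rep_eq minus_fmat.rep_eq uminus_fmat.rep_eq

lift_definition smul :: "complex \<Rightarrow> fmat \<Rightarrow> fmat" is "\<lambda>c f i j. c * f i j"
  by auto

declare smul.rep_eq [simp]

global_interpretation fm: vector_space smul
  by unfold_locales (rule fmat_eqI; simp add: algebra_simps)+

lemma smul_mult [simp]: "smul c A * B = smul c (A * B)" "A * smul c B = smul c (A * B)"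
proof -
  obtain d where d: "\<forall>i j. ent A i j \<noteq> 0 \<longrightarrow> i < d \<and> j < d" using fmat_bound by blast
  have mA: "ent (A * X) i j = (\<Sum>l<d. ent A i l * ent X l j)"
    "ent (smul c A * X) i j = (\<Sum>l<d. ent (smul c A) i l * ent X l j)" for X i j
    by (rule ent_mult_row; use d in auto)+
  show "smul c A * B = smul c (A * B)" "A * smul c B = smul c (A * B)"
    by (rule fmat_eqI; simp add: mA sum_distrib_left mult_ac)+
qed

lift_definition E :: "nat \<Rightarrow> fmat" is "\<lambda>d i j. if i = j \<and> i < d then 1 else 0"
  by (metis zero_neq_one)

lift_definition munit :: "nat \<Rightarrow> nat \<Rightarrow> fmat" is "\<lambda>a b i j. if i = a \<and> j = b then 1 else 0"
  subgoal for a b by (rule exI[of _ "Suc (max a b)"]) auto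
  done

declare E.rep_eq [simp] munit.rep_eq [simp]

lemma ent_E_mult [simp]: "ent (E d * A) i j = (if i < d then ent A i j else 0)"
  by (subst ent_mult_row[of _ _ d]) (auto split: if_splits simp: if_distrib[of "\<lambda>x. x * _"] cong: if_cong)

lemma ent_mult_E [simp]: "ent (A * E d) i j = (if j < d then ent A i j else 0)"
  by (subst ent_mult_col[of _ _ d]) (auto split: if_splits simp: if_distrib[of "\<lambda>x. _ * x"] cong: if_cong)

lemma E_mult_eq_iff: "E d * A = A \<longleftrightarrow> (\<forall>i j. ent A i j \<noteq> 0 \<longrightarrow> i < d)"
  by (metis fmat_eqI ent_E_mult)

lemma mult_E_eq_iff: "A * E d = A \<longleftrightarrow> (\<forall>i j. ent A i j \<noteq> 0 \<longrightarrow> j < d)"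
  by (metis fmat_eqI ent_mult_E)

lemma E_mult_E [simp]: "E d * E e = E (min d e)"
  by (rule fmat_eqI) auto

lemma E_0 [simp]: "E 0 = 0"
  by (rule fmat_eqI) auto

lemma E_eq_0_iff [simp]: "E d = 0 \<longleftrightarrow> d = 0"
proof
  assume "E d = 0"
  then have "ent (E d) 0 0 = 0" by simp
  then show "d = 0" by (simp split: if_splits)
qed simp

lemma ent_munit_mult [simp]: "ent (munit a b * A) i j = (if i = a then ent A b j else 0)"
  by (subst ent_mult_row[of _ _ "Suc b"]) (auto split: if_splits simp: if_distrib[of "\<lambda>x. x * _"] cong: if_cong)

lemma ent_mult_munit [simp]: "ent (A * munit a b) i j = (if j = b then ent A i a else 0)"
  by (subst ent_mult_col[of _ _ "Suc a"]) (auto split: if_splits simp: if_distrib[of "\<lambda>x. _ * x"] cong: if_cong)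

text \<open>Vectors are encoded as matrices supported in column 0, that is by
  \<open>X * E 1 = X\<close>; in this form \<open>A * munit j 0\<close> is column \<open>j\<close>
  of \<open>A\<close>.\<close>

lemma fmat_eq_colsI:
  assumes "\<And>j. A * munit j 0 = B * munit j 0"
  shows "A = B"
proof (rule fmat_eqI)
  fix i j
  have "ent (A * munit j 0) i 0 = ent (B * munit j 0) i 0" using assms by simp
  then show "ent A i j = ent B i j" by simp
qed

section \<open>Traces and Kronecker products\<close>

definition tr :: "fmat \<Rightarrow> complex" where
  "tr A = (\<Sum>i | ent A i i \<noteq> 0. ent A i i)"

lemma tr_bound: "(\<And>i. ent A i i \<noteq> 0 \<Longrightarrow> i < d) \<Longrightarrow> tr A = (\<Sum>i<d. ent A i i)"
  unfolding tr_def by (rule sum.mono_neutral_left) auto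

lemma fmat_bound2:
  obtains d where "\<And>i j. ent A i j \<noteq> 0 \<Longrightarrow> i < d \<and> j < d" "\<And>i j. ent B i j \<noteq> 0 \<Longrightarrow> i < d \<and> j < d"
  using fmat_supp_max[OF fmat_bound[of A] fmat_bound[of B]] by blast

lemma tr_add: "tr (A + B) = tr A + tr B"
proof -
  obtain d where d: "\<And>i j. ent A i j \<noteq> 0 \<Longrightarrow> i < d \<and> j < d" "\<And>i j. ent B i j \<noteq> 0 \<Longrightarrow> i < d \<and> j < d"
    using fmat_bound2 by blast
  have "i < d" if "ent (A + B) i i \<noteq> 0" for i
    using that d(1)[of i i] d(2)[of i i] by (cases "ent A i i = 0") auto
  then have "tr (A + B) = (\<Sum>i<d. ent (A + B) i i)" by (rule tr_bound)
  also have "\<dots> = tr A + tr B" by (simp add: sum.distrib tr_bound[of _ d] d)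
  finally show ?thesis .
qed

lemma tr_smul: "tr (smul c A) = c * tr A"
  unfolding tr_def by (cases "c = 0") (auto simp: sum_distrib_left)

lemma tr_0 [simp]: "tr 0 = 0" by (simp add: tr_def)

lemma tr_diff: "tr (A - B) = tr A - tr B"
  using tr_add[of "A - B" B] by simp

lemma tr_sum: "tr (sum f I) = (\<Sum>i\<in>I. tr (f i))"
  by (induction I rule: infinite_finite_induct) (auto simp: tr_add)

lemma tr_mult_commute: "tr (A * B) = tr (B * A)"
proof -
  obtain d where d: "\<And>i j. ent A i j \<noteq> 0 \<Longrightarrow> i < d \<and> j < d" "\<And>i j. ent B i j \<noteq> 0 \<Longrightarrow> i < d \<and> j < d"
    using fmat_bound2 by blast
  have *: "tr (A * B) = (\<Sum>i<d. \<Sum>l<d. ent A i l * ent B l i)"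
    if d: "\<And>i j. ent A i j \<noteq> 0 \<Longrightarrow> i < d \<and> j < d" for A B
  proof -
    have m: "ent (A * B) i j = (\<Sum>l<d. ent A i l * ent B l j)" for i j
      by (rule ent_mult_row) (use d in auto)
    have "i < d" if nz: "ent (A * B) i i \<noteq> 0" for i
    proof -
      obtain k where "ent A i k * ent B k i \<noteq> 0"
        using nz unfolding m by (rule sum.not_neutral_contains_not_neutral)
      then show ?thesis using d[of i k] by auto
    qed
    then have "tr (A * B) = (\<Sum>i<d. ent (A * B) i i)" by (rule tr_bound)
    then show ?thesis by (simp only: m)
  qed
  have 1: "tr (A * B) = (\<Sum>i<d. \<Sum>l<d. ent A i l * ent B l i)" by (rule *) (use d(1) in blast)
  have 2: "tr (B * A) = (\<Sum>i<d. \<Sum>l<d. ent B i l * ent A l i)" by (rule *) (use d(2) in blast)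
  show ?thesis unfolding 1 2 by (subst sum.swap) (simp add: mult.commute)
qed

lemma tr_E [simp]: "tr (E d) = of_nat d"
  by (subst tr_bound[of _ d]) (auto split: if_splits)

text \<open>The Kronecker product with a right factor of \<open>r\<close> rows and \<open>c\<close>
  columns. The two numbers are arguments because an \<open>fmat\<close> does not carry its
  size.\<close>

lift_definition kr :: "nat \<Rightarrow> nat \<Rightarrow> fmat \<Rightarrow> fmat \<Rightarrow> fmat" is
  "\<lambda>r c f k i j. f (i div r) (j div c) * k (i mod r) (j mod c)"
proof -
  fix r c :: nat and f k :: "nat \<Rightarrow> nat \<Rightarrow> complex"
  assume "\<exists>d. \<forall>i j. f i j \<noteq> 0 \<longrightarrow> i < d \<and> j < d" "\<exists>d. \<forall>i j. k i j \<noteq> 0 \<longrightarrow> i < d \<and> j < d"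
  then obtain d where d: "\<And>i j. f i j \<noteq> 0 \<Longrightarrow> i < d \<and> j < d" "\<And>i j. k i j \<noteq> 0 \<Longrightarrow> i < d \<and> j < d"
    by (rule fmat_supp_max) blast
  have *: "i < d * s + d" if "i div s < d" "i mod s < d" for i s
  proof -
    have "i = i div s * s + i mod s" by simp
    also have "\<dots> < d * s + d" by (rule add_le_less_mono) (use that in auto)
    finally show ?thesis .
  qed
  show "\<exists>d. \<forall>i j. f (i div r) (j div c) * k (i mod r) (j mod c) \<noteq> 0 \<longrightarrow> i < d \<and> j < d"
  proof (intro exI[of _ "max (d * r + d) (d * c + d)"] allI impI)
    fix i j assume "f (i div r) (j div c) * k (i mod r) (j mod c) \<noteq> 0"
    then have "i div r < d" "i mod r < d" "j div c < d" "j mod c < d"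
      using d(1)[of "i div r" "j div c"] d(2)[of "i mod r" "j mod c"] by auto
    then show "i < max (d * r + d) (d * c + d) \<and> j < max (d * r + d) (d * c + d)"
      using * by (simp add: less_max_iff_disj)
  qed
qed

declare kr.rep_eq [simp]

lemma kr_add: "kr r c (A + A') B = kr r c A B + kr r c A' B" "kr r c A (B + B') = kr r c A B + kr r c A B'"
  by (rule fmat_eqI; simp add: algebra_simps)+

lemma kr_diff: "kr r c (A - A') B = kr r c A B - kr r c A' B" "kr r c A (B - B') = kr r c A B - kr r c A B'"
  by (rule fmat_eqI; simp add: algebra_simps)+

lemma kr_0 [simp]: "kr r c 0 B = 0" "kr r c A 0 = 0"
  by (rule fmat_eqI; simp)+

lemma kr_smul [simp]: "kr r c (smul a A) B = smul a (kr r c A B)" "kr r c A (smul a B) = smul a (kr r c A B)"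
  by (rule fmat_eqI; simp)+

lemma sum_div_mod:
  fixes f :: "nat \<Rightarrow> nat \<Rightarrow> 'a::comm_monoid_add"
  shows "(\<Sum>k<d * s. f (k div s) (k mod s)) = (\<Sum>a<d. \<Sum>b<s. f a b)"
proof -
  have "(\<Sum>k<d * s. f (k div s) (k mod s)) = (\<Sum>m<d. \<Sum>k = m * s..<m * s + s. f (k div s) (k mod s))"
    by (rule sum.nat_group[symmetric])
  also have "\<dots> = (\<Sum>a<d. \<Sum>b<s. f a b)"
  proof (rule sum.cong[OF refl])
    fix m
    have *: "a div s = m" "a mod s = a - m * s" if "m * s \<le> a" "a < m * s + s" for a
    proof -
      show "a div s = m" by (rule div_nat_eqI) (use that in \<open>auto simp: mult.commute\<close>)
      then show "a mod s = a - m * s" by (metis minus_div_mult_eq_mod)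
    qed
    show "(\<Sum>k = m * s..<m * s + s. f (k div s) (k mod s)) = (\<Sum>b<s. f m b)"
      by (rule sum.reindex_bij_witness[of _ "\<lambda>b. m * s + b" "\<lambda>k. k - m * s"])
        (auto simp: *)
  qed
  finally show ?thesis .
qed

text \<open>The inner index \<open>l\<close> is the pair of \<open>l div s\<close> and
  \<open>l mod s\<close>, so the sum splits as soon as all nonzero columns of \<open>B\<close> lie
  below \<open>s\<close>; the size of \<open>A\<close> does not enter the index arithmetic.\<close>

lemma kr_mult:
  assumes "\<And>i j. ent B i j \<noteq> 0 \<Longrightarrow> j < s"
  shows "kr p s A B * kr s t A' B' = kr p t (A * A') (B * B')"
proof (rule fmat_eqI)
  fix i j
  obtain d where d: "\<And>i j. ent A i j \<noteq> 0 \<Longrightarrow> i < d \<and> j < d" using fmat_bound by blast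
  have mA: "ent (A * X) i j = (\<Sum>l<d. ent A i l * ent X l j)" for X i j
    by (rule ent_mult_row) (use d in blast)
  have mB: "ent (B * X) i j = (\<Sum>l<s. ent B i l * ent X l j)" for X i j
    by (rule ent_mult_row) (use assms in blast)
  have "l < d * s" if "ent (kr p s A B) i l \<noteq> 0" for l
  proof -
    have *: "l div s < d" "l mod s < s"
      using that d[of "i div p" "l div s"] assms[of "i mod p" "l mod s"] by auto
    have "l = l div s * s + l mod s" by simp
    also have "\<dots> < Suc (l div s) * s" unfolding mult_Suc using *(2) by linarith
    also have "\<dots> \<le> d * s" using *(1) by (intro mult_le_mono1) simp
    finally show ?thesis .
  qed
  then have "ent (kr p s A B * kr s t A' B') i j =
    (\<Sum>l<d * s. ent (kr p s A B) i l * ent (kr s t A' B') l j)"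
    by (rule ent_mult_row)
  also have "\<dots> = (\<Sum>l<d * s. (\<lambda>a b. ent A (i div p) a * ent B (i mod p) b *
      (ent A' a (j div t) * ent B' b (j mod t))) (l div s) (l mod s))" by simp
  also have "\<dots> = (\<Sum>a<d. \<Sum>b<s. ent A (i div p) a * ent B (i mod p) b *
      (ent A' a (j div t) * ent B' b (j mod t)))" by (rule sum_div_mod)
  also have "\<dots> = ent (kr p t (A * A') (B * B')) i j"
    by (simp add: mA mB sum_product mult_ac)
  finally show "ent (kr p s A B * kr s t A' B') i j = ent (kr p t (A * A') (B * B')) i j" .
qed

lemma kr_mult_E:
  assumes "B * E s = B"
  shows "kr p s A B * kr s t A' B' = kr p t (A * A') (B * B')"
  by (rule kr_mult) (use assms mult_E_eq_iff in blast)

text \<open>Both sides cut an index into the same three digits. Tensor products of modules are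
  therefore associative by equality (\<open>tens_assoc\<close>), and no associativity isomorphisms
  appear later.\<close>

lemma kr_assoc: "kr s c (kr r k A B) C = kr (s * r) (c * k) A (kr s c B C)"
  by (rule fmat_eqI; cases "s = 0"; cases "c = 0") (auto simp: div_mult2_eq mod_mult2_eq)

lemma kr_E [simp]: "kr e e (E d) (E e) = E (d * e)"
proof (rule fmat_eqI)
  fix i j
  show "ent (kr e e (E d) (E e)) i j = ent (E (d * e)) i j"
  proof (cases "e = 0")
    case False
    have "i = j \<longleftrightarrow> i div e = j div e \<and> i mod e = j mod e" by (metis div_mult_mod_eq)
    moreover have "i div e < d \<longleftrightarrow> i < d * e" using False by (simp add: div_less_iff_less_mult)
    ultimately show ?thesis using False by auto
  qed simp
qed

lemma tr_kr:
  assumes "B * E e = B"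
  shows "tr (kr e e A B) = tr A * tr B"
proof -
  obtain d where d: "\<And>i j. ent A i j \<noteq> 0 \<Longrightarrow> i < d \<and> j < d" using fmat_bound by blast
  have A: "E d * A = A" unfolding E_mult_eq_iff using d by blast
  have B: "ent B i j \<noteq> 0 \<Longrightarrow> j < e" for i j using assms mult_E_eq_iff by blast
  have "E (d * e) * kr e e A (E e * B) = kr e e A (E e * B)"
    by (simp flip: kr_E add: kr_mult_E A flip: mult.assoc)
  have *: "i < d * e" if "ent (kr e e A B) i i \<noteq> 0" for i
  proof -
    have "i div e < d" "i mod e < e" using that d[of "i div e" "i div e"] B[of "i mod e" "i mod e"] by auto
    moreover from this have "e > 0" by (cases e) auto
    ultimately show ?thesis by (simp add: div_less_iff_less_mult)
  qed
  have "tr (kr e e A B) = (\<Sum>i<d * e. (\<lambda>a b. ent A a a * ent B b b) (i div e) (i mod e))"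
    using * by (subst tr_bound) auto
  also have "\<dots> = (\<Sum>a<d. \<Sum>b<e. ent A a a * ent B b b)" by (rule sum_div_mod)
  also have "\<dots> = tr A * tr B"
    using d B by (subst (1 2) tr_bound[symmetric] | simp add: sum_product tr_bound[of A d] tr_bound[of B e])+
  finally show ?thesis .
qed

subsection \<open>Matrices with explicit dimensions\<close>

lift_definition tf :: "complex mat \<Rightarrow> fmat" is
  "\<lambda>A i j. if i < dim_row A \<and> j < dim_col A then A $$ (i, j) else 0"
  subgoal for A by (rule exI[of _ "max (dim_row A) (dim_col A)"]) (auto simp: less_max_iff_disj)
  done

declare tf.rep_eq [simp]

definition of_f :: "nat \<Rightarrow> nat \<Rightarrow> fmat \<Rightarrow> complex mat" where
  "of_f r c A = mat r c (\<lambda>(i, j). ent A i j)"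

lemma of_f_carrier [simp]: "of_f r c A \<in> carrier_mat r c" "dim_row (of_f r c A) = r" "dim_col (of_f r c A) = c"
  by (simp_all add: of_f_def)

lemma of_f_tf: "A \<in> carrier_mat r c \<Longrightarrow> of_f r c (tf A) = A"
  by (rule eq_matI) (auto simp: of_f_def)

lemma tf_of_f [simp]: "tf (of_f r c A) = E r * A * E c"
  by (rule fmat_eqI) (auto simp: of_f_def)

lemma tf_inj: "tf A = tf B \<Longrightarrow> A \<in> carrier_mat r c \<Longrightarrow> B \<in> carrier_mat r c \<Longrightarrow> A = B"
  by (metis of_f_tf)

lemma tf_E: "A \<in> carrier_mat r c \<Longrightarrow> E r * tf A = tf A" "A \<in> carrier_mat r c \<Longrightarrow> tf A * E c = tf A"
  by (rule fmat_eqI; auto)+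

lemma tf_one [simp]: "tf (1\<^sub>m d) = E d"
  by (rule fmat_eqI) auto

lemma tf_add: "A \<in> carrier_mat r c \<Longrightarrow> B \<in> carrier_mat r c \<Longrightarrow> tf (A + B) = tf A + tf B"
  by (rule fmat_eqI) auto

lemma tf_smult: "tf (c \<cdot>\<^sub>m A) = smul c (tf A)"
  by (rule fmat_eqI) auto

lemma tf_mult:
  assumes "A \<in> carrier_mat r s" "B \<in> carrier_mat s c"
  shows "tf (A * B) = tf A * tf B"
proof (rule fmat_eqI)
  fix i j
  have "ent (tf A * tf B) i j = (\<Sum>l<s. ent (tf A) i l * ent (tf B) l j)"
    by (rule ent_mult_row) (use assms in \<open>auto split: if_splits\<close>)
  also have "\<dots> = ent (tf (A * B)) i j"
    using assms by (auto simp: scalar_prod_def lessThan_atLeast0)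
  finally show "ent (tf (A * B)) i j = ent (tf A * tf B) i j" by simp
qed

subsection \<open>Subspaces and idempotents\<close>

lemma munit_mult [simp]: "munit a b * munit c d = (if b = c then munit a d else 0)"
  by (rule fmat_eqI) auto

lemma E_Suc: "E (Suc e) = E e + munit e e"
  by (rule fmat_eqI) auto

lemma E_mult_munit [simp]: "E d * munit a b = (if a < d then munit a b else 0)"
  "munit a b * E d = (if b < d then munit a b else 0)"
  by (rule fmat_eqI; auto)+

text \<open>For \<open>e\<close> larger than \<open>d\<close> both factors can be padded to square
  matrices of size \<open>e\<close>, where a one-sided inverse is two-sided; but the rows of
  \<open>B * C\<close> from \<open>d\<close> on vanish, so this product is not
  \<open>E e\<close>.\<close>

lemma left_inverse_bound:
  assumes "E d * B = B" "C * E d = C" "C * B = E e"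
  shows "e \<le> d"
proof (rule ccontr)
  assume "\<not> e \<le> d"
  then have de: "d < e" by simp
  define B' C' where "B' = of_f e e B" and "C' = of_f e e C"
  have c: "B' \<in> carrier_mat e e" "C' \<in> carrier_mat e e" by (simp_all add: B'_def C'_def)
  have "E e * (E d * B) = E d * B" using de by (simp flip: mult.assoc)
  then have EB: "E e * B = B" using assms(1) by simp
  then have EB': "E e * (B * X) = B * X" for X by (simp flip: mult.assoc)
  have "tf (C' * B') = E e * (C * (B * E e))"
    using c by (simp add: tf_mult[of _ e e _ e] B'_def C'_def mult.assoc EB')
  also have "\<dots> = E e * (C * B) * E e" by (simp add: mult.assoc)
  also have "\<dots> = tf (1\<^sub>m e)" by (simp add: assms)
  finally have "C' * B' = 1\<^sub>m e" using c by (intro tf_inj[of _ _ e e]) auto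
  then have "B' * C' = 1\<^sub>m e" by (rule mat_mult_left_right_inverse[OF c(2,1)])
  then have "tf (B' * C') = E e" by simp
  moreover have "tf (B' * C') = E d * tf (B' * C')"
    using c de by (simp add: tf_mult[of _ e e _ e] B'_def C'_def mult.assoc)
      (metis E_mult_E assms(1) min.absorb3 min.commute mult.assoc)
  ultimately have "E e = E d" using de by simp
  then have "ent (E e) d d = ent (E d) d d" by simp
  then show False using de by simp
qed

text \<open>The columns of \<open>B\<close> are a basis of \<open>U\<close> and the rows of
  \<open>C\<close> are coordinates on it. The number \<open>e\<close> is taken maximal among
  independent systems in \<open>U\<close>; a vector of \<open>U\<close> not fixed by
  \<open>B * C\<close> would allow a longer one.\<close>

lemma subspace_basis:
  assumes zero: "0 \<in> U"
    and add: "\<And>X Y. X \<in> U \<Longrightarrow> Y \<in> U \<Longrightarrow> X + Y \<in> U"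
    and smul: "\<And>c X. X \<in> U \<Longrightarrow> smul c X \<in> U"
    and dim: "\<And>X. X \<in> U \<Longrightarrow> E d * X = X" "\<And>X. X \<in> U \<Longrightarrow> X * E 1 = X"
  obtains e B C where "E d * B = B" "B * E e = B" "E e * C = C" "C * E d = C" "C * B = E e"
    "\<And>X. X \<in> U \<Longrightarrow> B * (C * X) = X" "\<And>X. X * E 1 = X \<Longrightarrow> B * X \<in> U"
proof -
  define P where "P e \<longleftrightarrow> (\<exists>B C. E d * B = B \<and> B * E e = B \<and> E e * C = C \<and> C * E d = C \<and> C * B = E e \<and>
    (\<forall>X. X * E 1 = X \<longrightarrow> B * X \<in> U))" for e
  have "P 0" unfolding P_def by (rule exI[of _ 0], rule exI[of _ 0]) (simp add: zero)
  moreover have bd: "\<And>e. P e \<Longrightarrow> e \<le> d" unfolding P_def by (meson left_inverse_bound)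
  ultimately have "P (Greatest P)" and max: "\<not> P (Suc (Greatest P))"
    using GreatestI_nat[of P 0 d] Greatest_le_nat[of P "Suc (Greatest P)" d] by auto
  then obtain e B C where e: "e = Greatest P"
    and B: "E d * B = B" "B * E e = B" "E e * C = C" "C * E d = C" "C * B = E e"
      "\<And>X. X * E 1 = X \<Longrightarrow> B * X \<in> U"
    unfolding P_def by blast
  have "B * (C * X) = X" if X: "X \<in> U" for X
  proof (rule ccontr)
    assume ne: "B * (C * X) \<noteq> X"
    define u where "u = X - B * (C * X)"
    have u1: "u * E 1 = u" "E d * u = u"
      using dim[OF X] B(1) by (simp_all add: u_def algebra_simps mult.assoc flip: mult.assoc[of "E d"])
    have "C * X * E 1 = C * X" using dim[OF X] by (simp add: mult.assoc)
    then have "B * (C * X) \<in> U" by (rule B(6))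
    then have uU: "u \<in> U" using add[OF X smul[of "B * (C * X)" "-1"]] by (simp add: u_def)
    have Cu: "C * u = 0" using B(3,5) by (simp add: u_def algebra_simps flip: mult.assoc)
    have "u \<noteq> 0" using ne by (simp add: u_def)
    then obtain i j where ij: "ent u i j \<noteq> 0" by (metis fmat_eqI zero_fmat.rep_eq)
    then have j: "j = 0" using u1(1) unfolding mult_E_eq_iff by force
    have i: "i < d" using u1(2) ij unfolding E_mult_eq_iff by blast
    \<comment> \<open>The new coordinate \<open>r\<close> must be 1 on \<open>u\<close> and 0 on the
      columns of \<open>B\<close>. It reads a row \<open>i\<close> where \<open>u\<close> has a
      nonzero entry, after the projection \<open>E d - B * C\<close> that fixes \<open>u\<close> and
      kills \<open>B\<close>.\<close>
    define c where "c = 1 / ent u i 0"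
    define r where "r = smul c (munit e i * (E d - B * C))"
    define B' C' where "B' = B + u * munit 0 e" and "C' = C + r"
    have eu: "munit e i * u = smul (ent u i 0) (munit e 0)"
      by (rule fmat_eqI) (use u1(1) in \<open>auto simp: mult_E_eq_iff; force\<close>)
    have rB: "r * B = 0"
    proof -
      have "(E d - B * C) * B = 0" using B by (simp add: algebra_simps mult.assoc)
      then show ?thesis by (simp add: r_def mult.assoc)
    qed
    have ru: "r * u = munit e 0"
    proof -
      have "(E d - B * C) * u = u" using u1 Cu by (simp add: algebra_simps mult.assoc)
      then show ?thesis using ij j by (simp add: r_def mult.assoc eu c_def)
    qed
    have "P (Suc e)"
      unfolding P_def
    proof (intro exI conjI allI impI)
      have ms: "min e (Suc e) = e" by simp
      show "E d * B' = B'" using B u1 by (simp add: B'_def algebra_simps flip: mult.assoc)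
      have "B * E (Suc e) = B" by (metis B(2) E_mult_E mult.assoc ms)
      then show "B' * E (Suc e) = B'" by (simp add: B'_def algebra_simps mult.assoc)
      have "E (Suc e) * C = C" by (metis B(3) E_mult_E mult.assoc ms min.commute)
      moreover have "E (Suc e) * r = r" by (simp add: r_def flip: mult.assoc)
      ultimately show "E (Suc e) * C' = C'" by (simp add: C'_def algebra_simps)
      have "r * E d = r" using B(4) by (simp add: r_def mult.assoc left_diff_distrib)
      then show "C' * E d = C'" using B(4) by (simp add: C'_def algebra_simps)
      have "C' * B' = C * B + C * u * munit 0 e + (r * B + r * u * munit 0 e)"
        by (simp add: B'_def C'_def distrib_left distrib_right mult.assoc)
      then show "C' * B' = E (Suc e)" by (simp add: B(5) Cu rB ru E_Suc)
      fix Y assume Y: "Y * E 1 = Y"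
      have "munit 0 e * Y = smul (ent Y e 0) (E 1)"
        by (rule fmat_eqI) (use Y in \<open>auto simp: mult_E_eq_iff\<close>)
      then have "u * munit 0 e * Y = smul (ent Y e 0) u" using u1(1) by (simp add: mult.assoc)
      then show "B' * Y \<in> U" unfolding B'_def distrib_right
        using add[OF B(6)[OF Y] smul[OF uU]] by metis
    qed
    then show False using max e by simp
  qed
  then show thesis by (intro that[of B e C] B)
qed

text \<open>A basis of the column space of \<open>A\<close>. The equation \<open>B = A * W\<close>
  records that the basis vectors are values of \<open>A\<close>; it is what turns
  \<open>W * C\<close> into a generalized inverse.\<close>

lemma rank_factorization:
  assumes "E r * A = A"
  obtains e B C W where "E r * B = B" "B * E e = B" "E e * C = C" "C * E r = C" "C * B = E e"
    "B * C * A = A" "B = A * W"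
proof -
  define U where "U = {A * X | X. X * E 1 = X}"
  have ex: "\<exists>Z. A * X + A * Y = A * Z \<and> Z * E 1 = Z" if "X * E 1 = X" "Y * E 1 = Y" for X Y
    by (rule exI[of _ "X + Y"]) (use that in \<open>simp add: algebra_simps\<close>)
  have ex': "\<exists>Z. smul c (A * X) = A * Z \<and> Z * E 1 = Z" if "X * E 1 = X" for X c
    by (rule exI[of _ "smul c X"]) (use that in simp)
  obtain e B C where B: "E r * B = B" "B * E e = B" "E e * C = C" "C * E r = C" "C * B = E e"
    "\<And>X. X \<in> U \<Longrightarrow> B * (C * X) = X" "\<And>X. X * E 1 = X \<Longrightarrow> B * X \<in> U"
  proof (rule subspace_basis[of U r])
    show "0 \<in> U" unfolding U_def by (auto intro: exI[of _ 0])
  next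
    fix X Y assume "X \<in> U" "Y \<in> U" then show "X + Y \<in> U" unfolding U_def using ex by blast
  next
    fix c X assume "X \<in> U" then show "smul c X \<in> U" unfolding U_def using ex' by blast
  next
    fix X assume "X \<in> U" then show "E r * X = X"
      unfolding U_def using assms by (auto simp flip: mult.assoc)
  next
    fix X assume "X \<in> U" then show "X * E 1 = X" unfolding U_def by (auto simp: mult.assoc)
  qed blast
  have "B * C * A = A"
  proof (rule fmat_eq_colsI)
    fix j
    have "A * munit j 0 \<in> U" unfolding U_def by (auto intro!: exI[of _ "munit j 0"])
    then show "B * C * A * munit j 0 = A * munit j 0" using B(6) by (simp add: mult.assoc)
  qed
  moreover have "\<exists>X. B * munit j 0 = A * X" for j
    using B(7)[of "munit j 0"] unfolding U_def by auto
  then obtain x where x: "\<And>j. B * munit j 0 = A * x j" by metis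
  have "B = A * (\<Sum>j<e. x j * munit 0 j)"
  proof -
    have "B = B * E e" using B by simp
    also have "E e = (\<Sum>j<e. munit j 0 * munit 0 j)" by (induction e) (auto simp: E_Suc)
    finally show ?thesis by (simp only: sum_distrib_left x mult.assoc[symmetric])
  qed
  ultimately show thesis using that B by blast
qed

lemma generalized_inverse:
  assumes "E r * A = A"
  obtains Z where "A * Z * A = A"
proof -
  obtain e B C W where "E r * B = B" "B * E e = B" "E e * C = C" "C * E r = C" "C * B = E e"
    "B * C * A = A" "B = A * W"
    by (rule rank_factorization[OF assms])
  then have "A * (W * C) * A = A" by (simp add: mult.assoc)
  then show thesis by (rule that)
qed

text \<open>The \<open>C\<close> of a rank factorization is just some left inverse of
  \<open>B\<close>; composing it with \<open>Q\<close> makes \<open>B * C\<close> equal to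
  \<open>Q\<close>.\<close>

lemma split_idempotent:
  assumes "E d * Q = Q" "Q * E d = Q" "Q * Q = Q"
  obtains e B C where "E d * B = B" "B * E e = B" "E e * C = C" "C * E d = C" "C * B = E e" "B * C = Q"
    "Q * B = B" "C * Q = C"
proof -
  obtain e B C W where B: "E d * B = B" "B * E e = B" "E e * C = C" "C * E d = C" "C * B = E e"
    "B * C * Q = Q" "B = Q * W"
    by (rule rank_factorization[OF assms(1)])
  have QB: "Q * B = B" using assms(3) B(7) by (metis mult.assoc)
  show thesis
  proof (rule that[of B e "C * Q"])
    show "E e * (C * Q) = C * Q" "B * (C * Q) = Q" using B(3,6) by (simp_all flip: mult.assoc)
    show "C * Q * E d = C * Q" "C * Q * B = E e" "C * Q * Q = C * Q"
      using B(5) assms QB by (simp_all add: mult.assoc)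
  qed (use B QB in auto)
qed

text \<open>The trace of an idempotent is its rank, and in characteristic zero the rank is
  determined by it. This replaces dimension counts throughout.\<close>

lemma tr_idempotent:
  assumes "E d * Q = Q" "Q * E d = Q" "Q * Q = Q" "tr Q = 0"
  shows "Q = 0"
proof -
  obtain e B C where B: "B * E e = B" "C * B = E e" "B * C = Q"
    using split_idempotent[OF assms(1-3)] by metis
  have "tr Q = of_nat e" using tr_mult_commute[of B C] B by simp
  then have "e = 0" using assms(4) by simp
  then have "B = 0" using B(1) by simp
  then show ?thesis using B(3) by simp
qed

section \<open>The q-binomial theorem\<close>

fun qbin :: "complex \<Rightarrow> nat \<Rightarrow> nat \<Rightarrow> complex" where
  "qbin q m 0 = 1"
| "qbin q 0 (Suc k) = 0"
| "qbin q (Suc m) (Suc k) = qbin q m k + q ^ Suc k * qbin q m (Suc k)"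

lemma qbin_gt: "m < k \<Longrightarrow> qbin q m k = 0"
proof (induction m arbitrary: k)
  case 0
  then show ?case by (cases k) auto
next
  case (Suc m)
  then show ?case by (cases k) auto
qed

text \<open>A division-free form of the quotient formula for Gaussian binomials, so it stays
  meaningful at roots of unity, where the quantum factorials vanish.\<close>

lemma qbin_absorb:
  "(1 - q ^ Suc k) * qbin q (Suc m) (Suc k) = (1 - q ^ Suc m) * qbin q m k"
proof (induction m arbitrary: k)
  case 0
  then show ?case by (cases k) auto
next
  case (Suc m)
  note IH = Suc
  \<comment> \<open>Absorption with respect to the complementary index m + 1 - k, multiplied by
    \<open>q ^ k\<close> so that no subtraction occurs in an exponent.\<close>
  have comp: "q ^ k * ((1 - q ^ Suc m) * qbin q m k) = (q ^ k - q ^ Suc m) * qbin q (Suc m) k"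
  proof (cases k)
    case (Suc j)
    have "q ^ k * ((1 - q ^ Suc m) * qbin q m k) =
        (1 - q ^ Suc m) * qbin q (Suc m) k - (1 - q ^ Suc m) * qbin q m j"
      by (simp add: Suc algebra_simps)
    also have "\<dots> = (1 - q ^ Suc m) * qbin q (Suc m) k - (1 - q ^ Suc j) * qbin q (Suc m) (Suc j)"
      using IH[of j] by simp
    finally show ?thesis by (simp add: Suc algebra_simps)
  qed simp
  have "(1 - q ^ Suc k) * qbin q (Suc (Suc m)) (Suc k) =
    (1 - q ^ Suc k) * qbin q (Suc m) k + q ^ Suc k * ((1 - q ^ Suc k) * qbin q (Suc m) (Suc k))"
    by (simp only: qbin.simps(3)) (simp add: algebra_simps)
  also have "\<dots> = (1 - q ^ Suc k) * qbin q (Suc m) k + q * (q ^ k * ((1 - q ^ Suc m) * qbin q m k))"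
    using IH[of k] by simp
  also have "\<dots> = (1 - q ^ Suc (Suc m)) * qbin q (Suc m) k"
    by (simp only: comp) (simp add: algebra_simps)
  finally show ?case .
qed

lemma qbin_root_of_unity:
  assumes "q ^ n = 1" "\<And>i. 0 < i \<Longrightarrow> i < n \<Longrightarrow> q ^ i \<noteq> 1" "0 < k" "k < n"
  shows "qbin q n k = 0"
proof -
  obtain m j where mj: "n = Suc m" "k = Suc j" using assms by (metis Suc_pred less_trans)
  have "(1 - q ^ k) * qbin q n k = 0"
    using qbin_absorb[of q j m] assms(1) mj by simp
  then show ?thesis using assms(2)[of k] assms(3,4) by simp
qed

text \<open>Powers appear as iterated multiplication onto some \<open>x\<close> because the ring of
  \<open>fmat\<close> has no unit.\<close>

lemma qbinomial_theorem:
  assumes "v * u = smul q (u * v)"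
  shows "((*) (u + v) ^^ m) x = (\<Sum>k\<le>m. smul (qbin q m k) (((*) u ^^ k) (((*) v ^^ (m - k)) x)))"
proof (induction m)
  case 0
  then show ?case by simp
next
  case (Suc m)
  define t where "t k j = ((*) u ^^ k) (((*) v ^^ j) x)" for k j
  have vt: "v * t k j = smul (q ^ k) (t k (Suc j))" for k j
  proof (induction k)
    case (Suc k)
    have "v * t (Suc k) j = smul q (u * (v * t k j))"
      by (simp add: t_def assms flip: mult.assoc)
    then show ?case by (simp add: Suc) (simp add: t_def)
  qed (simp add: t_def)
  have ut: "u * t k j = t (Suc k) j" for k j by (simp add: t_def)
  have "((*) (u + v) ^^ Suc m) x = (u + v) * (\<Sum>k\<le>m. smul (qbin q m k) (t k (m - k)))"
    using Suc by (simp add: t_def)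
  also have "\<dots> = (\<Sum>k\<le>m. smul (qbin q m k) (t (Suc k) (m - k))) +
      (\<Sum>k\<le>m. smul (q ^ k * qbin q m k) (t k (Suc (m - k))))"
    by (simp add: distrib_right sum_distrib_left sum.distrib fm.scale_right_distrib ut vt mult.commute)
  also have "(\<Sum>k\<le>m. smul (q ^ k * qbin q m k) (t k (Suc (m - k)))) =
      (\<Sum>k\<le>Suc m. smul (q ^ k * qbin q m k) (t k (Suc m - k)))"
    by (auto simp: qbin_gt Suc_diff_le intro: sum.cong)
  also have "\<dots> = t 0 (Suc m) + (\<Sum>k\<le>m. smul (q ^ Suc k * qbin q m (Suc k)) (t (Suc k) (m - k)))"
    by (subst sum.atMost_Suc_shift) simp
  also have "(\<Sum>k\<le>m. smul (qbin q m k) (t (Suc k) (m - k))) +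
      (t 0 (Suc m) + (\<Sum>k\<le>m. smul (q ^ Suc k * qbin q m (Suc k)) (t (Suc k) (m - k)))) =
      t 0 (Suc m) + (\<Sum>k\<le>m. smul (qbin q (Suc m) (Suc k)) (t (Suc k) (m - k)))"
    by (simp add: fm.scale_left_distrib sum.distrib algebra_simps)
  also have "\<dots> = (\<Sum>k\<le>Suc m. smul (qbin q (Suc m) k) (t k (Suc m - k)))"
    unfolding sum.atMost_Suc_shift[of _ m] by simp
  finally show ?case by (simp add: t_def)
qed

text \<open>At a primitive n-th root of unity the inner coefficients vanish, and the two outer terms
  vanish by assumption. Applied to the two summands of \<Delta>(y), this makes y nilpotent on tensor
  products.\<close>

lemma qbinomial_nilpotent:
  assumes "v * u = smul q (u * v)" "q ^ n = 1" "\<And>i. 0 < i \<Longrightarrow> i < n \<Longrightarrow> q ^ i \<noteq> 1"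
    and "((*) u ^^ n) x = 0" "((*) v ^^ n) x = 0"
  shows "((*) (u + v) ^^ n) x = 0"
proof -
  have "smul (qbin q n k) (((*) u ^^ k) (((*) v ^^ (n - k)) x)) = 0" if "k \<le> n" for k
  proof -
    consider "k = 0" | "0 < k" "k < n" | "k = n" using \<open>k \<le> n\<close> by linarith
    then show ?thesis
      by cases (use assms(4,5) qbin_root_of_unity[OF assms(2,3)] in auto)
  qed
  then show ?thesis unfolding qbinomial_theorem[OF assms(1)] by (intro sum.neutral) blast
qed

section \<open>Nilpotent twisted representations\<close>

locale pointed_datum = group_datum +
  fixes n :: nat
  assumes n_def: "n = q_order \<chi> g" and n_ge_2: "2 \<le> n"
begin

definition "\<alpha> h = inverse (\<chi> h)"

abbreviation "q \<equiv> \<chi> g"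

lemma chi_mult: "h \<in> carrier G \<Longrightarrow> k \<in> carrier G \<Longrightarrow> \<chi> (h \<otimes> k) = \<chi> h * \<chi> k"
  using character by (simp add: hom_def mult_of_def)

lemma alpha_mult: "h \<in> carrier G \<Longrightarrow> k \<in> carrier G \<Longrightarrow> \<alpha> (h \<otimes> k) = \<alpha> h * \<alpha> k"
  by (simp add: \<alpha>_def chi_mult)

lemma alpha_one [simp]: "\<alpha> \<one> = 1" by (simp add: \<alpha>_def char_one)

lemma alpha_nonzero: "h \<in> carrier G \<Longrightarrow> \<alpha> h \<noteq> 0" by (simp add: \<alpha>_def char_nonzero)

lemma mult_of_pow: "x [^]\<^bsub>mult_of class_ring\<^esub> (i::nat) = (x :: complex) ^ i"
  by (induction i) (auto simp: nat_pow_def mult_of_def)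

lemma q_power: "q ^ n = 1" "0 < i \<Longrightarrow> i < n \<Longrightarrow> q ^ i \<noteq> 1"
proof -
  interpret C: group "mult_of (class_ring :: complex ring)"
    by (rule field.field_mult_group) (rule class_field)
  have q: "q \<in> carrier (mult_of class_ring)" using char_nonzero[OF g_closed] by (simp add: mult_of_def)
  have one: "\<one>\<^bsub>mult_of class_ring\<^esub> = (1 :: complex)" by (simp add: mult_of_def)
  show "q ^ n = 1" using C.pow_ord_eq_1[OF q] unfolding mult_of_pow one n_def q_order_def .
  show "q ^ i \<noteq> 1" if "0 < i" "i < n"
    using C.pow_eq_id[OF q, of i] that
    unfolding mult_of_pow one n_def q_order_def by (auto dest: nat_dvd_not_less)
qed

end

text \<open>An \<open>H\<close>-module on \<open>\<complex>\<^sup>d\<close>, with \<open>d = dm V\<close>: the matrices \<open>ac V h\<close> of the group elements and the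
  matrix \<open>nl V\<close> of \<open>y\<close>.  Off \<open>carrier G\<close> the values of \<open>ac V\<close> are irrelevant.\<close>

record 'g obj =
  dm :: nat
  ac :: "'g \<Rightarrow> fmat"
  nl :: fmat

definition ypow :: "'g obj \<Rightarrow> nat \<Rightarrow> fmat" where
  "ypow V i = ((*) (nl V) ^^ i) (E (dm V))"

lemma ypow_0 [simp]: "ypow V 0 = E (dm V)" and ypow_Suc: "ypow V (Suc i) = nl V * ypow V i"
  by (simp_all add: ypow_def)

definition generalized_inverse_of :: "fmat \<Rightarrow> fmat \<Rightarrow> bool" where
  "generalized_inverse_of A Z \<longleftrightarrow> A * Z * A = A"

text \<open>The trace of \<open>h\<close> on the image of \<open>y\<^sup>i\<close>: with \<open>A Z A = A\<close>, the product \<open>A Z\<close> is a projection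
  onto the image of \<open>A\<close>.\<close>

definition image_trace :: "'g obj \<Rightarrow> nat \<Rightarrow> 'g \<Rightarrow> complex" where
  "image_trace V i h = tr (ac V h * ypow V i * (SOME Z. generalized_inverse_of (ypow V i) Z))"

context pointed_datum
begin

text \<open>The commutation rule is y h = \<chi>(h) h y solved for h y. The size conditions on
  \<open>ac V h\<close> are consequences of the first two clauses, see \<open>objD\<close>.\<close>

definition obj :: "'a obj \<Rightarrow> bool" where
  "obj V \<longleftrightarrow> ac V \<one> = E (dm V) \<and> (\<forall>h\<in>carrier G. \<forall>k\<in>carrier G. ac V (h \<otimes> k) = ac V h * ac V k) \<and>
     E (dm V) * nl V = nl V \<and> nl V * E (dm V) = nl V \<and>
     (\<forall>h\<in>carrier G. ac V h * nl V = smul (\<alpha> h) (nl V * ac V h)) \<and> ypow V n = 0"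

definition mor :: "fmat \<Rightarrow> 'a obj \<Rightarrow> 'a obj \<Rightarrow> bool" where
  "mor X N V \<longleftrightarrow> E (dm V) * X = X \<and> X * E (dm N) = X \<and>
     (\<forall>h\<in>carrier G. X * ac N h = ac V h * X) \<and> X * nl N = nl V * X"

definition iso :: "'a obj \<Rightarrow> 'a obj \<Rightarrow> bool" where
  "iso V N \<longleftrightarrow> (\<exists>\<iota> \<pi>. mor \<iota> N V \<and> mor \<pi> V N \<and> \<pi> * \<iota> = E (dm N) \<and> \<iota> * \<pi> = E (dm V))"

definition dsum :: "'a obj \<Rightarrow> 'a obj \<Rightarrow> 'a obj \<Rightarrow> bool" where
  "dsum V N N' \<longleftrightarrow> (\<exists>\<iota> \<pi> \<iota>' \<pi>'. mor \<iota> N V \<and> mor \<pi> V N \<and> mor \<iota>' N' V \<and> mor \<pi>' V N' \<and>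
     \<pi> * \<iota> = E (dm N) \<and> \<pi>' * \<iota>' = E (dm N') \<and> \<iota> * \<pi> + \<iota>' * \<pi>' = E (dm V))"

lemma objD:
  assumes "obj V"
  shows "ac V \<one> = E (dm V)"
    "h \<in> carrier G \<Longrightarrow> k \<in> carrier G \<Longrightarrow> ac V (h \<otimes> k) = ac V h * ac V k"
    "E (dm V) * nl V = nl V" "nl V * E (dm V) = nl V"
    "h \<in> carrier G \<Longrightarrow> ac V h * nl V = smul (\<alpha> h) (nl V * ac V h)"
    "ypow V n = 0"
    "h \<in> carrier G \<Longrightarrow> E (dm V) * ac V h = ac V h" "h \<in> carrier G \<Longrightarrow> ac V h * E (dm V) = ac V h"
proof -
  show 1: "ac V \<one> = E (dm V)"
    and 2: "h \<in> carrier G \<Longrightarrow> k \<in> carrier G \<Longrightarrow> ac V (h \<otimes> k) = ac V h * ac V k" for h k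
    using assms by (simp_all add: obj_def)
  show "E (dm V) * nl V = nl V" "nl V * E (dm V) = nl V" "ypow V n = 0"
    "h \<in> carrier G \<Longrightarrow> ac V h * nl V = smul (\<alpha> h) (nl V * ac V h)"
    using assms by (simp_all add: obj_def)
  show "h \<in> carrier G \<Longrightarrow> E (dm V) * ac V h = ac V h" "h \<in> carrier G \<Longrightarrow> ac V h * E (dm V) = ac V h"
    using 2[of \<one> h] 2[of h \<one>] 1 by simp_all
qed

lemma ac_inv:
  assumes "obj V" "h \<in> carrier G"
  shows "ac V h * ac V (inv h) = E (dm V)" "ac V (inv h) * ac V h = E (dm V)"
  using objD(1,2)[OF assms(1)] assms(2) by (metis inv_closed r_inv l_inv)+

lemma ypow_E: assumes "obj V" shows "E (dm V) * ypow V i = ypow V i" "ypow V i * E (dm V) = ypow V i"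
  using objD[OF assms] by (induction i; simp add: ypow_Suc mult.assoc; simp flip: mult.assoc)+

lemma ypow_add: assumes "obj V" shows "ypow V (i + j) = ypow V i * ypow V j"
  by (induction i) (auto simp: ypow_Suc mult.assoc ypow_E[OF assms])

lemma ypow_Suc2: assumes "obj V" shows "ypow V (Suc i) = ypow V i * nl V"
  using ypow_add[OF assms, of i 1] objD(4)[OF assms] by (simp add: ypow_Suc)

lemma ypow_big: assumes "obj V" "n \<le> i" shows "ypow V i = 0"
  using ypow_add[OF assms(1), of n "i - n"] objD(6)[OF assms(1)] assms(2) by simp

lemma ac_ypow:
  assumes "obj V" "h \<in> carrier G"
  shows "ac V h * ypow V i = smul (\<alpha> h ^ i) (ypow V i * ac V h)"
proof (induction i)
  case (Suc i)
  have "ac V h * ypow V (Suc i) = smul (\<alpha> h) (nl V * (ac V h * ypow V i))"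
    by (simp add: ypow_Suc objD(5)[OF assms] flip: mult.assoc)
  then show ?case by (simp add: Suc ypow_Suc mult.assoc)
qed (simp add: objD[OF assms(1)] assms(2))

lemma morD:
  assumes "mor X N V"
  shows "E (dm V) * X = X" "X * E (dm N) = X" "h \<in> carrier G \<Longrightarrow> X * ac N h = ac V h * X"
    "X * nl N = nl V * X"
  using assms by (simp_all add: mor_def)

lemma mor_ypow: assumes "mor X N V" shows "X * ypow N i = ypow V i * X"
proof (induction i)
  case (Suc i)
  have "X * ypow N (Suc i) = nl V * (X * ypow N i)"
    by (simp add: ypow_Suc morD(4)[OF assms] flip: mult.assoc)
  then show ?case by (simp add: Suc ypow_Suc mult.assoc)
qed (simp add: morD[OF assms])

lemma mor_comp: "mor X N V \<Longrightarrow> mor X' V P \<Longrightarrow> mor (X' * X) N P"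
  unfolding mor_def by (metis mult.assoc)

lemma mor_E: "obj V \<Longrightarrow> mor (E (dm V)) V V"
  unfolding mor_def using objD by simp

lemma iso_refl: "obj V \<Longrightarrow> iso V V"
  unfolding iso_def using mor_E by fastforce

lemma iso_sym: "iso V N \<Longrightarrow> iso N V"
  unfolding iso_def by blast

lemma iso_trans: assumes "iso V N" "iso N P" shows "iso V P"
proof -
  obtain \<iota> \<pi> \<iota>' \<pi>' where 1: "mor \<iota> N V" "mor \<pi> V N" "\<pi> * \<iota> = E (dm N)" "\<iota> * \<pi> = E (dm V)"
    and 2: "mor \<iota>' P N" "mor \<pi>' N P" "\<pi>' * \<iota>' = E (dm P)" "\<iota>' * \<pi>' = E (dm N)"
    using assms unfolding iso_def by blast
  have "\<pi>' * \<pi> * (\<iota> * \<iota>') = \<pi>' * (\<pi> * \<iota> * \<iota>')" by (simp add: mult.assoc)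
  moreover have "\<iota> * \<iota>' * (\<pi>' * \<pi>) = \<iota> * (\<iota>' * \<pi>' * \<pi>)" by (simp add: mult.assoc)
  ultimately show ?thesis unfolding iso_def
    using 1 2 mor_comp[OF 2(1) 1(1)] mor_comp[OF 1(2) 2(2)] morD(1)[OF 2(1)] morD(1)[OF 1(2)]
    by (intro exI[of _ "\<iota> * \<iota>'"] exI[of _ "\<pi>' * \<pi>"]) simp
qed

lemma dsum_dm: assumes "dsum V N N'" shows "dm V = dm N + dm N'"
proof -
  obtain \<iota> \<pi> \<iota>' \<pi>' where 1: "\<pi> * \<iota> = E (dm N)" "\<pi>' * \<iota>' = E (dm N')" "\<iota> * \<pi> + \<iota>' * \<pi>' = E (dm V)"
    using assms unfolding dsum_def by blast
  have "of_nat (dm V) = tr (\<iota> * \<pi> + \<iota>' * \<pi>')" using 1 by simp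
  also have "\<dots> = tr (\<pi> * \<iota>) + tr (\<pi>' * \<iota>')"
    by (simp only: tr_add tr_mult_commute[of \<iota>] tr_mult_commute[of \<iota>'])
  also have "\<dots> = of_nat (dm N + dm N')" by (simp only: 1 tr_E of_nat_add)
  finally show ?thesis by (simp only: of_nat_eq_iff)
qed

lemma generalized_inverse_ex:
  assumes "obj V" obtains Z where "generalized_inverse_of (ypow V i) Z" "Z * E (dm V) = Z"
proof -
  obtain Z where Z: "ypow V i * Z * ypow V i = ypow V i"
    using generalized_inverse ypow_E(1)[OF assms] by metis
  have "ypow V i * (Z * E (dm V)) * ypow V i = ypow V i"
    using Z by (simp add: mult.assoc ypow_E(1)[OF assms])
  then show thesis by (intro that[of "Z * E (dm V)"]) (simp_all add: generalized_inverse_of_def mult.assoc)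
qed

text \<open>For two generalized inverses of A the products with A are projections onto the same
  image, and h preserves this image because it commutes with A up to a scalar. Inserting A Z' A for
  A and rotating the trace trades one inverse for the other.\<close>

lemma image_trace_eq:
  assumes V: "obj V" and h: "h \<in> carrier G" and Z: "generalized_inverse_of (ypow V i) Z"
  shows "image_trace V i h = tr (ac V h * ypow V i * Z)"
proof -
  define A where "A = ypow V i"
  define Z' where "Z' = (SOME Z. generalized_inverse_of A Z)"
  have 1: "A * Z * A = A" using Z by (simp add: generalized_inverse_of_def A_def)
  have 2: "A * Z' * A = A"
    unfolding Z'_def using Z someI[of "generalized_inverse_of A" Z] by (simp add: generalized_inverse_of_def A_def)
  have c: "ac V h * A = smul (\<alpha> h ^ i) (A * ac V h)" using ac_ypow[OF V h] by (simp add: A_def)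
  have "tr (ac V h * A * Z) = tr (ac V h * (A * Z' * A) * Z)" by (simp only: 2)
  also have "\<dots> = tr (ac V h * A * (Z' * (A * Z)))" by (simp add: mult.assoc)
  also have "\<dots> = tr (smul (\<alpha> h ^ i) (A * ac V h) * (Z' * (A * Z)))" by (simp add: c)
  also have "\<dots> = tr (A * Z * smul (\<alpha> h ^ i) (A * ac V h) * Z')"
    using tr_mult_commute[of "smul (\<alpha> h ^ i) (A * ac V h) * Z'" "A * Z"] by (simp add: mult.assoc)
  also have "\<dots> = tr (smul (\<alpha> h ^ i) (A * Z * A * ac V h) * Z')" by (simp add: mult.assoc)
  also have "\<dots> = tr (ac V h * A * Z')" by (simp add: 1 c)
  finally show ?thesis by (simp add: image_trace_def A_def Z'_def)
qed

text \<open>Generalized inverses on the summands glue to \<open>X\<close> on the sum because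
  inclusions and projections commute with powers of y; rotating the trace then brings each part back
  to its summand.\<close>

lemma image_trace_dsum:
  assumes o: "obj V" "obj N" "obj N'" and s: "dsum V N N'" and h: "h \<in> carrier G"
  shows "image_trace V i h = image_trace N i h + image_trace N' i h"
proof -
  obtain \<iota> \<pi> \<iota>' \<pi>' where m: "mor \<iota> N V" "mor \<pi> V N" "mor \<iota>' N' V" "mor \<pi>' V N'"
    and e: "\<pi> * \<iota> = E (dm N)" "\<pi>' * \<iota>' = E (dm N')" "\<iota> * \<pi> + \<iota>' * \<pi>' = E (dm V)"
    using s unfolding dsum_def by blast
  obtain Z where Z: "generalized_inverse_of (ypow N i) Z" using generalized_inverse_ex[OF o(2)] by blast
  obtain Z' where Z': "generalized_inverse_of (ypow N' i) Z'" using generalized_inverse_ex[OF o(3)] by blast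
  define X where "X = \<iota> * Z * \<pi> + \<iota>' * Z' * \<pi>'"
  have p: "ypow V i * \<iota> = \<iota> * ypow N i" "ypow V i * \<iota>' = \<iota>' * ypow N' i"
    "\<pi> * ypow V i = ypow N i * \<pi>" "\<pi>' * ypow V i = ypow N' i * \<pi>'"
    using mor_ypow m by metis+
  have AX: "ypow V i * X = \<iota> * ypow N i * Z * \<pi> + \<iota>' * ypow N' i * Z' * \<pi>'"
    by (simp add: X_def distrib_left p flip: mult.assoc)
  have "ypow V i * X * ypow V i = \<iota> * (ypow N i * Z * ypow N i) * \<pi> + \<iota>' * (ypow N' i * Z' * ypow N' i) * \<pi>'"
    unfolding AX distrib_right by (simp add: p mult.assoc)
  also have "\<dots> = ypow V i * (\<iota> * \<pi> + \<iota>' * \<pi>')"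
    using Z Z' by (simp add: generalized_inverse_of_def distrib_left p flip: mult.assoc)
  also have "\<dots> = ypow V i" by (simp add: e ypow_E[OF o(1)])
  finally have "generalized_inverse_of (ypow V i) X" by (simp add: generalized_inverse_of_def)
  then have "image_trace V i h = tr (ac V h * (ypow V i * X))"
    using image_trace_eq[OF o(1) h] by (simp add: mult.assoc)
  also have "\<dots> = tr (\<iota> * (ac N h * ypow N i * Z * \<pi>)) + tr (\<iota>' * (ac N' h * ypow N' i * Z' * \<pi>'))"
    unfolding AX using morD(3)[OF m(1) h] morD(3)[OF m(3) h]
    by (simp add: distrib_left tr_add flip: mult.assoc)
  also have "\<dots> = tr (ac N h * ypow N i * Z * (\<pi> * \<iota>)) + tr (ac N' h * ypow N' i * Z' * (\<pi>' * \<iota>'))"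
    unfolding tr_mult_commute[of \<iota>] tr_mult_commute[of \<iota>'] by (simp add: mult.assoc)
  also have "tr (ac N h * ypow N i * Z * (\<pi> * \<iota>)) = tr (\<pi> * \<iota> * (ac N h * ypow N i * Z))"
    by (rule tr_mult_commute)
  also have "tr (ac N' h * ypow N' i * Z' * (\<pi>' * \<iota>')) = tr (\<pi>' * \<iota>' * (ac N' h * ypow N' i * Z'))"
    by (rule tr_mult_commute)
  also have "\<pi> * \<iota> * (ac N h * ypow N i * Z) = ac N h * ypow N i * Z"
    using objD(7)[OF o(2) h] by (simp add: e flip: mult.assoc)
  also have "\<pi>' * \<iota>' * (ac N' h * ypow N' i * Z') = ac N' h * ypow N' i * Z'"
    using objD(7)[OF o(3) h] by (simp add: e flip: mult.assoc)
  finally show ?thesis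
    using image_trace_eq[OF o(2) h Z] image_trace_eq[OF o(3) h Z'] by simp
qed

end

context pointed_datum
begin

subsection \<open>Tensor products\<close>

text \<open>The third component is the action of \<Delta>(y) = y \<otimes> g + 1 \<otimes>
  y.\<close>

definition tens :: "'a obj \<Rightarrow> 'a obj \<Rightarrow> 'a obj" where
  "tens V N = \<lparr>dm = dm V * dm N, ac = (\<lambda>h. kr (dm N) (dm N) (ac V h) (ac N h)),
     nl = kr (dm N) (dm N) (nl V) (ac N g) + kr (dm N) (dm N) (E (dm V)) (nl N)\<rparr>"

lemma tens_simps [simp]: "dm (tens V N) = dm V * dm N"
  "ac (tens V N) h = kr (dm N) (dm N) (ac V h) (ac N h)"
  "nl (tens V N) = kr (dm N) (dm N) (nl V) (ac N g) + kr (dm N) (dm N) (E (dm V)) (nl N)"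
  by (simp_all add: tens_def)

lemma alpha_chi: "h \<in> carrier G \<Longrightarrow> \<alpha> h * \<chi> h = 1" "h \<in> carrier G \<Longrightarrow> \<chi> h * \<alpha> h = 1"
  by (simp_all add: \<alpha>_def char_nonzero)

lemma alpha_pow: "h \<in> carrier G \<Longrightarrow> \<alpha> (h [^] (i::nat)) = \<alpha> h ^ i"
  by (induction i) (auto simp: alpha_mult)

lemma tens_u_pow:
  assumes "obj V" "obj N"
  shows "((*) (kr (dm N) (dm N) (nl V) (ac N g)) ^^ i) (E (dm V * dm N)) =
    kr (dm N) (dm N) (ypow V i) (ac N (g [^] i))"
proof (induction i)
  case (Suc i)
  have "g [^] Suc i = g \<otimes> g [^] i" using g_closed by (metis nat_pow_Suc2)
  then show ?case
    using Suc objD(2,8)[OF assms(2)] g_closed by (simp add: kr_mult_E ypow_Suc)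
qed (simp add: objD[OF assms(2)])

lemma tens_v_pow:
  assumes "obj N"
  shows "((*) (kr (dm N) (dm N) (E d) (nl N)) ^^ i) (E (d * dm N)) =
    kr (dm N) (dm N) (E d) (ypow N i)"
  by (induction i) (use objD[OF assms] in \<open>simp_all add: kr_mult_E ypow_Suc\<close>)

lemma obj_tens:
  assumes V: "obj V" and N: "obj N"
  shows "obj (tens V N)"
  unfolding obj_def
proof (intro conjI ballI)
  let ?e = "dm N"
  note VD = objD[OF V] and ND = objD[OF N]
  show "ac (tens V N) \<one> = E (dm (tens V N))" by (simp add: VD ND)
  show "E (dm (tens V N)) * nl (tens V N) = nl (tens V N)" "nl (tens V N) * E (dm (tens V N)) = nl (tens V N)"
    using VD ND g_closed by (simp_all add: distrib_left distrib_right kr_mult_E flip: kr_E)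
  fix h assume h: "h \<in> carrier G"
  have hg: "ac N h * ac N g = ac N g * ac N h"
    using ND(2)[of h g] ND(2)[of g h] g_central[OF h] g_closed h by simp
  show "ac (tens V N) h * nl (tens V N) = smul (\<alpha> h) (nl (tens V N) * ac (tens V N) h)"
    using VD ND h g_closed hg by (simp add: algebra_simps kr_mult_E fm.scale_right_distrib)
  fix k assume "k \<in> carrier G"
  then show "ac (tens V N) (h \<otimes> k) = ac (tens V N) h * ac (tens V N) k"
    using VD ND h by (simp add: kr_mult_E)
next
  let ?e = "dm N"
  note VD = objD[OF V] and ND = objD[OF N]
  have "((*) (kr ?e ?e (nl V) (ac N g) + kr ?e ?e (E (dm V)) (nl N)) ^^ n) (E (dm V * dm N)) = 0"
  \<comment> \<open>With u = y \<otimes> g and v = 1 \<otimes> y one has v u = q u v, because y g =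
    \<chi>(g) g y on the second factor.\<close>
  proof (rule qbinomial_nilpotent[where q = q])
    have "kr ?e ?e (E (dm V)) (nl N) * kr ?e ?e (nl V) (ac N g) = kr ?e ?e (nl V) (nl N * ac N g)"
      using VD ND by (simp add: kr_mult_E)
    also have "nl N * ac N g = smul q (ac N g * nl N)"
      using ND(5)[OF g_closed] alpha_chi[OF g_closed] by simp
    finally show "kr ?e ?e (E (dm V)) (nl N) * kr ?e ?e (nl V) (ac N g) =
        smul q (kr ?e ?e (nl V) (ac N g) * kr ?e ?e (E (dm V)) (nl N))"
      using VD ND g_closed by (simp add: kr_mult_E)
    show "((*) (kr ?e ?e (nl V) (ac N g)) ^^ n) (E (dm V * dm N)) = 0"
      using tens_u_pow[OF V N] VD(6) by simp
    show "((*) (kr ?e ?e (E (dm V)) (nl N)) ^^ n) (E (dm V * dm N)) = 0"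
      using tens_v_pow[OF N] ND(6) by simp
  qed (use q_power in auto)
  then show "ypow (tens V N) n = 0" by (simp add: ypow_def)
qed

lemma tens_assoc: "tens (tens V N) P = tens V (tens N P)"
proof -
  have "kr (dm P) (dm P) (E (dm V * dm N)) X = kr (dm P * dm N) (dm P * dm N) (E (dm V)) (kr (dm P) (dm P) (E (dm N)) X)" for X
    by (simp only: kr_E[symmetric] kr_assoc)
  then show ?thesis
    by (simp add: tens_def kr_assoc kr_add mult.commute mult.assoc mult.left_commute add.assoc)
qed

lemma kr_mult_E':
  assumes "E s * B' = B'"
  shows "kr p s A B * kr s t A' B' = kr p t (A * A') (B * B')"
proof (cases "s = 0")
  case True
  then show ?thesis using assms by simp
next
  case False
  then have "kr p s A B = kr p s A (B * E s)" by (intro fmat_eqI) auto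
  also have "\<dots> * kr s t A' B' = kr p t (A * A') (B * E s * B')"
    by (rule kr_mult_E) (simp add: mult.assoc)
  finally show ?thesis by (simp add: mult.assoc assms)
qed

lemma mor_tens:
  assumes P: "obj P" and X: "mor X N V"
  shows "mor (kr (dm P) (dm P) X (E (dm P))) (tens N P) (tens V P)"
    and "mor (kr (dm V) (dm N) (E (dm P)) X) (tens P N) (tens P V)"
  unfolding mor_def using objD[OF P] morD[OF X] g_closed
  by (simp_all add: kr_mult_E kr_mult_E' distrib_left distrib_right flip: kr_E)

lemma dsum_tens_left:
  assumes P: "obj P" and s: "dsum V N N'"
  shows "dsum (tens V P) (tens N P) (tens N' P)"
proof -
  obtain \<iota> \<pi> \<iota>' \<pi>' where m: "mor \<iota> N V" "mor \<pi> V N" "mor \<iota>' N' V" "mor \<pi>' V N'"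
    and e: "\<pi> * \<iota> = E (dm N)" "\<pi>' * \<iota>' = E (dm N')" "\<iota> * \<pi> + \<iota>' * \<pi>' = E (dm V)"
    using s unfolding dsum_def by blast
  let ?k = "\<lambda>X. kr (dm P) (dm P) X (E (dm P))"
  show ?thesis unfolding dsum_def
  proof (intro exI conjI)
    show "mor (?k \<iota>) (tens N P) (tens V P)" "mor (?k \<pi>) (tens V P) (tens N P)"
      "mor (?k \<iota>') (tens N' P) (tens V P)" "mor (?k \<pi>') (tens V P) (tens N' P)"
      using m mor_tens(1)[OF P] by blast+
    show "?k \<pi> * ?k \<iota> = E (dm (tens N P))" "?k \<pi>' * ?k \<iota>' = E (dm (tens N' P))"
      using e by (simp_all add: kr_mult_E)
    show "?k \<iota> * ?k \<pi> + ?k \<iota>' * ?k \<pi>' = E (dm (tens V P))"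
      using e(3) by (simp add: kr_mult_E flip: kr_add)
  qed
qed

lemma dsum_tens_right:
  assumes P: "obj P" and s: "dsum V N N'"
  shows "dsum (tens P V) (tens P N) (tens P N')"
proof -
  obtain \<iota> \<pi> \<iota>' \<pi>' where m: "mor \<iota> N V" "mor \<pi> V N" "mor \<iota>' N' V" "mor \<pi>' V N'"
    and e: "\<pi> * \<iota> = E (dm N)" "\<pi>' * \<iota>' = E (dm N')" "\<iota> * \<pi> + \<iota>' * \<pi>' = E (dm V)"
    using s unfolding dsum_def by blast
  let ?k = "\<lambda>N V X. kr (dm V) (dm N) (E (dm P)) X"
  show ?thesis unfolding dsum_def
  proof (intro exI conjI)
    show "mor (?k N V \<iota>) (tens P N) (tens P V)" "mor (?k V N \<pi>) (tens P V) (tens P N)"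
      "mor (?k N' V \<iota>') (tens P N') (tens P V)" "mor (?k V N' \<pi>') (tens P V) (tens P N')"
      using m mor_tens(2)[OF P] by blast+
    show "?k V N \<pi> * ?k N V \<iota> = E (dm (tens P N))" "?k V N' \<pi>' * ?k N' V \<iota>' = E (dm (tens P N'))"
      using e morD(2)[OF m(2)] morD(2)[OF m(4)] by (simp_all add: kr_mult_E)
    show "?k N V \<iota> * ?k V N \<pi> + ?k N' V \<iota>' * ?k V N' \<pi>' = E (dm (tens P V))"
      using e(3) morD(2)[OF m(1)] morD(2)[OF m(3)] by (simp add: kr_mult_E flip: kr_add)
  qed
qed

lemma iso_tens_left:
  assumes P: "obj P" and s: "iso V N"
  shows "iso (tens V P) (tens N P)"
proof -
  obtain \<iota> \<pi> where m: "mor \<iota> N V" "mor \<pi> V N" and e: "\<pi> * \<iota> = E (dm N)" "\<iota> * \<pi> = E (dm V)"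
    using s unfolding iso_def by blast
  show ?thesis unfolding iso_def
    using mor_tens(1)[OF P m(1)] mor_tens(1)[OF P m(2)] e
    by (intro exI conjI) (assumption | simp add: kr_mult_E)+
qed

section \<open>Modules annihilated by y\<close>

definition pure :: "'a obj \<Rightarrow> bool" where
  "pure W \<longleftrightarrow> obj W \<and> nl W = 0"

definition gchar :: "'a obj \<Rightarrow> 'a \<Rightarrow> complex" where
  "gchar V h = tr (ac V h)"

lemma pure_obj: "pure W \<Longrightarrow> obj W" by (simp add: pure_def)

lemma image_trace_0: "obj V \<Longrightarrow> h \<in> carrier G \<Longrightarrow> image_trace V 0 h = gchar V h"
  using image_trace_eq[of V h 0 "E (dm V)"] by (simp add: generalized_inverse_of_def gchar_def objD mult.assoc)

lemma image_trace_tens_pure_left: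
  assumes W: "pure W" and V: "obj V" and h: "h \<in> carrier G"
  shows "image_trace (tens W V) i h = gchar W h * image_trace V i h"
proof -
  note WD = objD[OF pure_obj[OF W]] and VD = objD[OF V]
  have yp: "ypow (tens W V) i = kr (dm V) (dm V) (E (dm W)) (ypow V i)"
    using W tens_v_pow[OF V] by (simp add: ypow_def pure_def)
  obtain Z where Z: "generalized_inverse_of (ypow V i) Z" "Z * E (dm V) = Z"
    using generalized_inverse_ex[OF V] by blast
  have "generalized_inverse_of (ypow (tens W V) i) (kr (dm V) (dm V) (E (dm W)) Z)"
    using Z by (simp add: generalized_inverse_of_def yp kr_mult_E ypow_E[OF V] mult.assoc)
  from image_trace_eq[OF obj_tens[OF pure_obj[OF W] V] h this]
  have "image_trace (tens W V) i h = tr (kr (dm V) (dm V) (ac W h) (ac V h * ypow V i * Z))"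
    using WD VD h Z by (simp add: yp kr_mult_E ypow_E[OF V] mult.assoc)
  also have "\<dots> = gchar W h * tr (ac V h * ypow V i * Z)"
    using Z by (subst tr_kr) (simp_all add: gchar_def mult.assoc)
  finally show ?thesis using image_trace_eq[OF V h Z(1)] by simp
qed

text \<open>Here y^i acts as y^i \<otimes> g^i. The second factor is invertible, so \<open>Z\<close>
  tensored with the inverse of g^i is a generalized inverse and the two powers of g cancel in the
  trace.\<close>

lemma image_trace_tens_pure_right:
  assumes W: "pure W" and V: "obj V" and h: "h \<in> carrier G"
  shows "image_trace (tens V W) i h = image_trace V i h * gchar W h"
proof -
  note WD = objD[OF pure_obj[OF W]] and VD = objD[OF V]
  define k where "k = g [^] i"
  have k: "k \<in> carrier G" using g_closed by (simp add: k_def)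
  note ki = ac_inv[OF pure_obj[OF W] k]
  have yp: "ypow (tens V W) i = kr (dm W) (dm W) (ypow V i) (ac W k)"
    using W tens_u_pow[OF V pure_obj[OF W]] by (simp add: ypow_def[of "tens V W"] pure_def k_def)
  obtain Z where Z: "generalized_inverse_of (ypow V i) Z" "Z * E (dm V) = Z"
    using generalized_inverse_ex[OF V] by blast
  have "generalized_inverse_of (ypow (tens V W) i) (kr (dm W) (dm W) Z (ac W (inv k)))"
    using Z k WD by (simp add: generalized_inverse_of_def yp kr_mult_E ypow_E[OF V] mult.assoc ki)
  from image_trace_eq[OF obj_tens[OF V pure_obj[OF W]] h this]
  have "image_trace (tens V W) i h = tr (kr (dm W) (dm W) (ac V h * ypow V i * Z) (ac W h))"
    using WD VD h Z k by (simp add: yp kr_mult_E ypow_E[OF V] mult.assoc ki)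
  also have "\<dots> = tr (ac V h * ypow V i * Z) * gchar W h"
    using WD(8)[OF h] by (subst tr_kr) (simp_all add: gchar_def mult.assoc)
  finally show ?thesis using image_trace_eq[OF V h Z(1)] by simp
qed

subsection \<open>Uniserial modules\<close>

end

lift_definition shift_down :: "nat \<Rightarrow> nat \<Rightarrow> fmat" is "\<lambda>k i a b. if a = b + i \<and> a < k then 1 else 0"
  subgoal for k i by (rule exI[of _ k]) auto
  done

lift_definition shift_up :: "nat \<Rightarrow> nat \<Rightarrow> fmat" is "\<lambda>k i a b. if b = a + i \<and> b < k then 1 else 0"
  subgoal for k i by (rule exI[of _ k]) auto
  done

lift_definition diag_pow :: "nat \<Rightarrow> complex \<Rightarrow> fmat" is "\<lambda>k c a b. if a = b \<and> a < k then c ^ a else 0"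
  subgoal for k i by (rule exI[of _ k]) auto
  done

declare shift_down.rep_eq [simp] shift_up.rep_eq [simp] diag_pow.rep_eq [simp]

lemma ent_shift_down_mult [simp]:
  "ent (shift_down k i * A) a b = (if i \<le> a \<and> a < k then ent A (a - i) b else 0)"
proof -
  have "ent (shift_down k i * A) a b = (\<Sum>l<k. ent (shift_down k i) a l * ent A l b)"
    by (rule ent_mult_row) (auto split: if_splits)
  also have "\<dots> = (\<Sum>l<k. if l = a - i then if i \<le> a \<and> a < k then ent A l b else 0 else 0)"
    by (rule sum.cong) auto
  finally show ?thesis by auto
qed

lemma ent_shift_up_mult [simp]:
  "ent (shift_up k i * A) a b = (if a + i < k then ent A (a + i) b else 0)"
proof -
  have "ent (shift_up k i * A) a b = (\<Sum>l<k. ent (shift_up k i) a l * ent A l b)"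
    by (rule ent_mult_row) (auto split: if_splits)
  also have "\<dots> = (\<Sum>l<k. if l = a + i then if a + i < k then ent A l b else 0 else 0)"
    by (rule sum.cong) auto
  finally show ?thesis by auto
qed

lemma ent_diag_pow_mult [simp]:
  "ent (diag_pow k c * A) a b = (if a < k then c ^ a * ent A a b else 0)"
proof -
  have "ent (diag_pow k c * A) a b = (\<Sum>l<k. ent (diag_pow k c) a l * ent A l b)"
    by (rule ent_mult_row) (auto split: if_splits)
  also have "\<dots> = (\<Sum>l<k. if l = a then if a < k then c ^ a * ent A l b else 0 else 0)"
    by (rule sum.cong) auto
  finally show ?thesis by auto
qed

lemma shift_down_0: "shift_down k 0 = E k" and shift_up_0: "shift_up k 0 = E k"
  by (rule fmat_eqI; auto)+

lemma shift_down_add: "shift_down k i * shift_down k j = shift_down k (i + j)"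
  by (rule fmat_eqI) auto

lemma shift_down_eq_0: "k \<le> i \<Longrightarrow> shift_down k i = 0"
  by (rule fmat_eqI) auto

lemma shift_down_E [simp]: "E k * shift_down k i = shift_down k i" "shift_down k i * E k = shift_down k i"
  by (rule fmat_eqI; auto)+

lemma shift_up_E [simp]: "E k * shift_up k i = shift_up k i" "shift_up k i * E k = shift_up k i"
  by (rule fmat_eqI; auto)+

lemma shift_pow: "((*) (shift_down k (Suc 0)) ^^ i) (E k) = shift_down k i"
  by (induction i) (simp_all add: shift_down_0 shift_down_add)

lemma shift_down_up_down: "shift_down k i * shift_up k i * shift_down k i = shift_down k i"
  by (rule fmat_eqI) (auto simp: mult.assoc)

context pointed_datum
begin

text \<open>The basis is v, y v, ..., y^(k-1) v for a generator v fixed by G, so h acts on y^a v by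
  the power a of \<alpha>(h).\<close>

definition Mk :: "nat \<Rightarrow> 'a obj" where
  "Mk k = \<lparr>dm = k, ac = (\<lambda>h. diag_pow k (\<alpha> h)), nl = shift_down k 1\<rparr>"

definition one_obj :: "('a \<Rightarrow> complex) \<Rightarrow> 'a obj" where
  "one_obj \<epsilon> = \<lparr>dm = 1, ac = (\<lambda>h. smul (\<epsilon> h) (E 1)), nl = 0\<rparr>"

lemma Mk_simps [simp]: "dm (Mk k) = k" "ac (Mk k) h = diag_pow k (\<alpha> h)" "nl (Mk k) = shift_down k 1"
  by (simp_all add: Mk_def)

lemma ypow_Mk: "ypow (Mk k) i = shift_down k i"
  by (simp add: ypow_def shift_pow)

lemma obj_Mk: assumes "k \<le> n" shows "obj (Mk k)"
  unfolding obj_def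
proof (intro conjI ballI)
  show "ypow (Mk k) n = 0" using assms by (simp add: ypow_Mk shift_down_eq_0)
  show "ac (Mk k) \<one> = E (dm (Mk k))" by (rule fmat_eqI) auto
  show "E (dm (Mk k)) * nl (Mk k) = nl (Mk k)" "nl (Mk k) * E (dm (Mk k)) = nl (Mk k)" by auto
next
  fix h assume h: "h \<in> carrier G"
  have "c ^ (Suc a) = c * c ^ a" for c :: complex and a by simp
  then show "ac (Mk k) h * nl (Mk k) = smul (\<alpha> h) (nl (Mk k) * ac (Mk k) h)"
    by (intro fmat_eqI) auto
  fix h' assume "h' \<in> carrier G"
  then show "ac (Mk k) (h \<otimes> h') = ac (Mk k) h * ac (Mk k) h'"
    using h by (intro fmat_eqI) (auto simp: alpha_mult power_mult_distrib)
qed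

lemma pure_one_obj:
  assumes "\<epsilon> \<one> = 1" "\<And>h k. h \<in> carrier G \<Longrightarrow> k \<in> carrier G \<Longrightarrow> \<epsilon> (h \<otimes> k) = \<epsilon> h * \<epsilon> k"
  shows "pure (one_obj \<epsilon>)"
proof -
  obtain m where m: "n = Suc m" using n_ge_2 by (cases n) auto
  have "ypow (one_obj \<epsilon>) n = 0" unfolding m ypow_Suc by (simp add: one_obj_def)
  then show ?thesis using assms by (simp add: pure_def obj_def one_obj_def)
qed

lemma gchar_one_obj [simp]: "gchar (one_obj \<epsilon>) h = \<epsilon> h"
  by (simp add: gchar_def one_obj_def tr_smul)

lemma sum_lessThan_if_ge:
  fixes f :: "nat \<Rightarrow> complex"
  shows "(\<Sum>a<k. if i \<le> a then f a else 0) = (\<Sum>a\<in>{i..<k}. f a)"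
  by (rule sum.mono_neutral_cong_right) auto

lemma tr_diag_shift: "tr (diag_pow k c * (shift_down k i * shift_up k i)) = (\<Sum>a\<in>{i..<k}. c ^ a)"
  by (subst tr_bound[of _ k])
    (auto split: if_splits simp flip: sum_lessThan_if_ge intro!: sum.cong)

lemma image_trace_Mk:
  assumes "k \<le> n" "h \<in> carrier G"
  shows "image_trace (Mk k) i h = (\<Sum>j\<in>{i..<k}. \<alpha> h ^ j)"
proof -
  have "generalized_inverse_of (ypow (Mk k) i) (shift_up k i)"
    by (simp add: generalized_inverse_of_def ypow_Mk shift_down_up_down)
  from image_trace_eq[OF obj_Mk[OF assms(1)] assms(2) this]
  show ?thesis by (simp add: ypow_Mk tr_diag_shift mult.assoc)
qed

end

section \<open>Tensoring uniserial modules with the two-dimensional one\<close>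

context pointed_datum
begin

text \<open>The quantum integer at \<open>\<alpha> g\<close>, the inverse of q. It is the
  coefficient of the mixed term in powers of y \<otimes> g + 1 \<otimes> y once y squares to zero on
  the right factor.\<close>

definition qint :: "nat \<Rightarrow> complex" where
  "qint i = (\<Sum>t<i. \<alpha> g ^ t)"

lemma qint_0 [simp]: "qint 0 = 0" by (simp add: qint_def)

lemma qint_Suc: "qint (Suc i) = 1 + \<alpha> g * qint i"
  unfolding qint_def by (subst sum.lessThan_Suc_shift) (simp add: sum_distrib_left)

lemma alpha_g_pow: "\<alpha> g ^ i * q ^ i = 1" "q ^ i * \<alpha> g ^ i = 1"
  using alpha_chi[OF g_closed] by (simp_all flip: power_mult_distrib)

lemma qint_nonzero: assumes "0 < k" "k < n" shows "qint k \<noteq> 0"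
proof
  assume "qint k = 0"
  moreover have "(\<alpha> g - 1) * qint k = \<alpha> g ^ k - 1"
    unfolding qint_def by (rule power_diff_1_eq[symmetric])
  ultimately have "\<alpha> g ^ k = 1" by simp
  then have "q ^ k = 1" using alpha_g_pow(1)[of k] by simp
  then show False using q_power(2) assms by blast
qed

text \<open>The operator on \<open>Mk k\<close> tensor \<open>Mk 2\<close> with block
  \<open>X\<close> in position (a, b) of a 2 by 2 block matrix; the block index is the one of
  \<open>Mk 2\<close>.\<close>

abbreviation K :: "fmat \<Rightarrow> nat \<Rightarrow> nat \<Rightarrow> fmat" where
  "K X a b \<equiv> kr 2 2 X (munit a b)"

lemma K_mult: "b < 2 \<Longrightarrow> K X a b * K X' c d = (if b = c then K (X * X') a d else 0)"
  by (subst kr_mult_E) auto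

lemma tr_munit: "tr (munit a b) = (if a = b then 1 else 0)"
  by (subst tr_bound[of _ "Suc (max a b)"]) (auto split: if_splits)

lemma tr_K: "b < 2 \<Longrightarrow> tr (K X a b) = (if a = b then tr X else 0)"
  by (subst tr_kr) (auto simp: tr_munit)

lemma diag_pow_2: "diag_pow 2 c = munit 0 0 + smul c (munit 1 1)"
  by (rule fmat_eqI) (auto simp: less_2_cases_iff)

lemma shift_down_2: "shift_down 2 (Suc 0) = munit 1 0"
  by (rule fmat_eqI) auto

lemma E_2: "E 2 = munit 0 0 + munit 1 1"
  by (rule fmat_eqI) auto

lemma E_2_kr: "E (k * 2) = K (E k) 0 0 + K (E k) 1 1"
  by (simp only: kr_E[symmetric] E_2 kr_add)

text \<open>Since y^2 = 0 on \<open>Mk 2\<close>, the expansion has just the diagonal blocks y^i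
  \<otimes> g^i and one mixed term below them. For i = 0 the truncated \<open>i - 1\<close> is
  harmless, as \<open>qint 0 = 0\<close>.\<close>

lemma ypow_Mk_M2:
  "ypow (tens (Mk k) (Mk 2)) i = K (shift_down k i) 0 0 + smul (\<alpha> g ^ i) (K (shift_down k i) 1 1) +
     smul (qint i) (K (shift_down k (i - 1)) 1 0)"
proof (induction i)
  case 0
  then show ?case by (simp add: shift_down_0 E_2_kr)
next
  case (Suc i)
  have *: "qint i = 0 \<or> Suc (i - Suc 0) = i" by (cases i) auto
  show ?case unfolding ypow_Suc Suc
    using * by (auto simp: diag_pow_2 shift_down_2 kr_add distrib_left distrib_right K_mult
        shift_down_add qint_Suc fm.scale_left_distrib mult.commute)
qed

text \<open>This is the lower left block of the equation A Z A = A in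
  \<open>image_trace_Mk_M2\<close>. It fails to make sense at i = 0, where that block carries the
  coefficient \<open>qint 0 = 0\<close>.\<close>

lemma sdu_identity:
  assumes "0 < i" "i < k"
  shows "shift_down k i * shift_up k i * shift_down k (i - 1) +
    (shift_down k (i - 1) * shift_up k i - shift_down k i * shift_up k (Suc i)) * shift_down k i =
    shift_down k (i - 1)"
proof (rule fmat_eqI)
  fix a b
  show "ent (shift_down k i * shift_up k i * shift_down k (i - 1) +
    (shift_down k (i - 1) * shift_up k i - shift_down k i * shift_up k (Suc i)) * shift_down k i) a b =
    ent (shift_down k (i - 1)) a b"
    using assms by (simp add: mult.assoc left_diff_distrib) (auto)
qed

lemma image_trace_Mk_M2:
  assumes k: "0 < k" "k \<le> n" and h: "h \<in> carrier G"
  shows "image_trace (tens (Mk k) (Mk 2)) i h =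
    (if i < k then (1 + \<alpha> h) * (\<Sum>j\<in>{i..<k}. \<alpha> h ^ j) else if i = k \<and> k < n then \<alpha> h ^ k else 0)"
proof -
  let ?V = "tens (Mk k) (Mk 2)" and ?D = "shift_down k" and ?S = "shift_up k"
  have V: "obj ?V" using obj_tens obj_Mk k n_ge_2 by simp
  have ac: "ac ?V h = K (diag_pow k (\<alpha> h)) 0 0 + smul (\<alpha> h) (K (diag_pow k (\<alpha> h)) 1 1)"
    by (simp add: diag_pow_2 kr_add)
  consider (lt) "i < k" | (eq) "i = k" "k < n" | (z) "k \<le> i" "\<not> (i = k \<and> k < n)" by linarith
  then show ?thesis
  proof cases
    case lt
    \<comment> \<open>Modelled on the inverse of a lower triangular block matrix: inverse shifts on
      the diagonal, with q^i undoing the scalar of g^i, and in the corner minus the product of the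
      outer inverses with the corner block, simplified to a single shift.\<close>
    define Z where "Z = K (?S i) 0 0 + smul (q ^ i) (K (?S i) 1 1) - smul (qint i * q ^ i) (K (?S (Suc i)) 1 0)"
    have AZ: "ypow ?V i * Z = K (?D i * ?S i) 0 0 + K (?D i * ?S i) 1 1 +
        smul (qint i) (K (?D (i - 1) * ?S i - ?D i * ?S (Suc i)) 1 0)"
      unfolding ypow_Mk_M2 Z_def
      by (simp add: distrib_left distrib_right right_diff_distrib left_diff_distrib K_mult alpha_g_pow kr_diff
          fm.scale_right_diff_distrib mult.left_commute[of "\<alpha> g ^ i"])
    have "ypow ?V i * Z * ypow ?V i = K (?D i) 0 0 + smul (\<alpha> g ^ i) (K (?D i) 1 1) +
        smul (qint i) (K (?D i * ?S i * ?D (i - 1) + (?D (i - 1) * ?S i - ?D i * ?S (Suc i)) * ?D i) 1 0)"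
      unfolding AZ unfolding ypow_Mk_M2
      by (simp add: distrib_left distrib_right left_diff_distrib K_mult mult.assoc
          shift_down_up_down[unfolded mult.assoc] kr_add kr_diff fm.scale_right_distrib
          fm.scale_right_diff_distrib del: One_nat_def)
    also have "\<dots> = ypow ?V i"
      using sdu_identity[of i k] lt unfolding ypow_Mk_M2 by (cases "i = 0") auto
    finally have "generalized_inverse_of (ypow ?V i) Z" by (simp add: generalized_inverse_of_def)
    then have "image_trace ?V i h = tr (ac ?V h * (ypow ?V i * Z))"
      using image_trace_eq[OF V h] by (simp add: mult.assoc)
    also have "\<dots> = (1 + \<alpha> h) * (\<Sum>j\<in>{i..<k}. \<alpha> h ^ j)"
      unfolding AZ ac by (simp add: distrib_left distrib_right K_mult tr_add tr_K tr_smul tr_diag_shift)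
    finally show ?thesis using lt by simp
  next
    case eq
    \<comment> \<open>For i = k the diagonal blocks are gone and only the mixed term is left. Its
      coefficient is nonzero as long as k < n, because q has order n. This is the top layer by which
      \<open>Mk (Suc k)\<close> exceeds \<open>Mk k\<close>, and it disappears for k = n.\<close>
    have nz: "qint k \<noteq> 0" using qint_nonzero k eq by simp
    define Z where "Z = smul (1 / qint k) (K (?S (k - 1)) 0 1)"
    have A: "ypow ?V i = smul (qint k) (K (?D (k - 1)) 1 0)"
      unfolding ypow_Mk_M2 by (simp add: eq shift_down_eq_0)
    have AZ: "ypow ?V i * Z = K (?D (k - 1) * ?S (k - 1)) 1 1"
      unfolding A Z_def using nz by (simp add: K_mult)
    have "generalized_inverse_of (ypow ?V i) Z"
      unfolding generalized_inverse_of_def AZ unfolding A by (simp add: K_mult shift_down_up_down)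
    then have "image_trace ?V i h = tr (ac ?V h * (ypow ?V i * Z))"
      using image_trace_eq[OF V h] by (simp add: mult.assoc)
    also have "\<dots> = \<alpha> h * (\<Sum>j\<in>{k - 1..<k}. \<alpha> h ^ j)"
      unfolding AZ ac by (simp add: distrib_right K_mult tr_add tr_K tr_smul tr_diag_shift)
    also have "{k - 1..<k} = {k - 1}" using k by auto
    finally show ?thesis using eq k by (simp flip: power_Suc)
  next
    case z
    have "ypow ?V i = 0"
    proof (cases "n \<le> i")
      case True
      then show ?thesis using ypow_big[OF V] by simp
    next
      case False
      then have "k \<le> i - 1" using z by auto
      then show ?thesis using z unfolding ypow_Mk_M2 by (simp add: shift_down_eq_0)
    qed
    then show ?thesis using image_trace_eq[OF V h, of i 0] z by (auto simp: generalized_inverse_of_def)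
  qed
qed

text \<open>Only traces are compared here. The actual splitting of \<open>tens (Mk k) (Mk 2)\<close>
  is deduced from this in \<open>dsum_Mk_M2\<close>, once traces are known to determine a
  module.\<close>

lemma image_trace_Mk_M2_less:
  assumes k: "0 < k" "k < n" and h: "h \<in> carrier G"
  shows "image_trace (tens (Mk k) (Mk 2)) i h =
    image_trace (Mk (Suc k)) i h + \<alpha> h * image_trace (Mk (k - 1)) i h"
proof -
  have *: "\<alpha> h * (\<Sum>j\<in>{i..<k - 1}. \<alpha> h ^ j) = (\<Sum>j\<in>{Suc i..<k}. \<alpha> h ^ j)"
  proof -
    have "{Suc i..<k} = {Suc i..<Suc (k - 1)}" using k by simp
    then show ?thesis by (simp only: sum.shift_bounds_Suc_ivl sum_distrib_left power_Suc)
  qed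
  have **: "(\<Sum>j\<in>{i..<k}. \<alpha> h ^ j) + \<alpha> h ^ k = \<alpha> h ^ i + \<alpha> h * (\<Sum>j\<in>{i..<k}. \<alpha> h ^ j)" if "i \<le> k"
  proof -
    have "(\<Sum>j\<in>{i..<Suc k}. \<alpha> h ^ j) = \<alpha> h ^ i + (\<Sum>j\<in>{Suc i..<Suc k}. \<alpha> h ^ j)"
      using that by (intro sum.atLeast_Suc_lessThan) simp
    then show ?thesis
      using that by (simp only: sum.shift_bounds_Suc_ivl sum_distrib_left power_Suc sum.atLeastLessThan_Suc)
  qed
  show ?thesis
  proof (cases "i < k")
    case True
    have "(\<Sum>j\<in>{i..<k}. \<alpha> h ^ j) = \<alpha> h ^ i + (\<Sum>j\<in>{Suc i..<k}. \<alpha> h ^ j)"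
      using True by (simp add: sum.atLeast_Suc_lessThan)
    then show ?thesis
      using True k h n_ge_2 **  by (simp add: image_trace_Mk_M2 image_trace_Mk *[simplified] algebra_simps)
  next
    case False
    then show ?thesis
      using k h n_ge_2 by (auto simp: image_trace_Mk_M2 image_trace_Mk)
  qed
qed

lemma image_trace_Mn_M2:
  assumes h: "h \<in> carrier G"
  shows "image_trace (tens (Mk n) (Mk 2)) i h = (1 + \<alpha> h) * image_trace (Mk n) i h"
  using n_ge_2 h by (auto simp: image_trace_Mk_M2 image_trace_Mk)

subsection \<open>Group averages\<close>

lemma ent_sum: "ent (sum f I) i j = (\<Sum>x\<in>I. ent (f x) i j)"
  by (induction I rule: infinite_finite_induct) auto

definition avg :: "('a \<Rightarrow> fmat) \<Rightarrow> fmat" where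
  "avg f = smul (1 / of_nat (card (carrier G))) (\<Sum>h\<in>carrier G. f h)"

lemma card_G: "of_nat (card (carrier G)) \<noteq> (0 :: complex)"
  using finite_carrier one_closed by auto

lemma avg_mult: "X * avg f = avg (\<lambda>h. X * f h)" "avg f * X = avg (\<lambda>h. f h * X)"
  by (simp_all add: avg_def sum_distrib_left sum_distrib_right)

lemma avg_cong: "(\<And>h. h \<in> carrier G \<Longrightarrow> f h = f' h) \<Longrightarrow> avg f = avg f'"
  by (simp add: avg_def)

lemma avg_const: "avg (\<lambda>_. X) = X"
  using card_G by (intro fmat_eqI) (simp add: avg_def ent_sum)

lemma avg_shift:
  assumes k: "k \<in> carrier G"
  shows "avg (\<lambda>h. f (h \<otimes> k)) = avg f"
proof -
  have "(\<Sum>h\<in>carrier G. f (h \<otimes> k)) = (\<Sum>h\<in>carrier G. f h)"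
    by (rule sum.reindex_bij_witness[of _ "\<lambda>h. h \<otimes> inv k" "\<lambda>h. h \<otimes> k"])
      (use k in \<open>auto simp: m_assoc\<close>)
  then show ?thesis by (simp add: avg_def)
qed

text \<open>A projection onto the matrices that commute with the group up to the character
  \<open>c\<close>. The case c = 1 produces intertwiners; c = \<chi>^i is needed for generalized
  inverses of y^i, which commutes with G up to \<alpha>^i.\<close>

definition tw :: "('a \<Rightarrow> complex) \<Rightarrow> 'a obj \<Rightarrow> 'a obj \<Rightarrow> fmat \<Rightarrow> fmat" where
  "tw c V N X = avg (\<lambda>h. smul (c h) (ac V (inv h) * X * ac N h))"

lemma tw_equivariant:
  assumes V: "obj V" and N: "obj N" and k: "k \<in> carrier G"
    and c: "\<And>h k. h \<in> carrier G \<Longrightarrow> k \<in> carrier G \<Longrightarrow> c (h \<otimes> k) = c h * c k"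
  shows "smul (c k) (tw c V N X * ac N k) = ac V k * tw c V N X"
proof -
  have "ac V k * tw c V N X = avg (\<lambda>h. smul (c h) (ac V k * (ac V (inv h) * X * ac N h)))"
    by (simp add: tw_def avg_mult)
  also have "\<dots> = avg (\<lambda>h. smul (c (h \<otimes> k)) (ac V k * (ac V (inv (h \<otimes> k)) * X * ac N (h \<otimes> k))))"
    by (rule avg_shift[OF k, symmetric])
  also have "\<dots> = avg (\<lambda>h. smul (c k) (smul (c h) (ac V (inv h) * X * ac N h) * ac N k))"
  proof (rule avg_cong)
    fix h assume h: "h \<in> carrier G"
    have "ac V k * ac V (inv (h \<otimes> k)) = ac V (k \<otimes> (inv k \<otimes> inv h))"
      using objD(2)[OF V k] h k by (simp add: inv_mult_group)
    also have "k \<otimes> (inv k \<otimes> inv h) = inv h" using h k by (simp flip: m_assoc)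
    finally have "ac V k * ac V (inv (h \<otimes> k)) = ac V (inv h)" .
    then have "ac V k * (ac V (inv (h \<otimes> k)) * Y) = ac V (inv h) * Y" for Y by (simp flip: mult.assoc)
    then show "smul (c (h \<otimes> k)) (ac V k * (ac V (inv (h \<otimes> k)) * X * ac N (h \<otimes> k))) =
      smul (c k) (smul (c h) (ac V (inv h) * X * ac N h) * ac N k)"
      using h k objD(2)[OF N h k] by (simp add: c mult.assoc mult.commute)
  qed
  also have "\<dots> = smul (c k) (tw c V N X * ac N k)"
    by (simp add: tw_def avg_mult(2)) (simp add: avg_def fm.scale_sum_right mult.commute)
  finally show ?thesis by simp
qed

lemma tw_E:
  assumes "obj V" "obj N"
  shows "E (dm V) * tw c V N X = tw c V N X" "tw c V N X * E (dm N) = tw c V N X"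
  unfolding tw_def avg_mult
  by (rule avg_cong; use objD[OF assms(1)] objD[OF assms(2)] in \<open>simp add: mult.assoc\<close>;
      use objD[OF assms(1)] objD[OF assms(2)] in \<open>simp flip: mult.assoc\<close>)+

lemma alpha_inv: "h \<in> carrier G \<Longrightarrow> \<alpha> (inv h) = \<chi> h"
  using alpha_mult[of h "inv h"] alpha_chi(1)[of h] alpha_nonzero[of h]
  by (metis alpha_one inv_closed mult_left_cancel r_inv)

end

lemma finite_chain_zero:
  fixes f :: "nat \<Rightarrow> 'z::zero"
  assumes "f k = 0" "\<And>m. m < k \<Longrightarrow> f (Suc m) = 0 \<Longrightarrow> f m = 0"
  shows "f 0 = 0"
proof -
  have "f (k - j) = 0" if "j \<le> k" for j
    using that
  proof (induction j)
    case (Suc j)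
    then have "Suc (k - Suc j) = k - j" by simp
    then show ?case using assms(2)[of "k - Suc j"] Suc by simp
  qed (simp add: assms)
  from this[of k] show ?thesis by simp
qed

lemma sum_shift_index:
  fixes f :: "nat \<Rightarrow> 'z::comm_monoid_add"
  assumes "f k = 0"
  shows "(\<Sum>i<k. if i = 0 then 0 else f i) = (\<Sum>i<k. f (Suc i))"
proof (cases k)
  case (Suc m)
  have "(\<Sum>i<Suc m. if i = 0 then 0 else f i) = (\<Sum>i<m. f (Suc i))"
    by (subst sum.lessThan_Suc_shift) simp
  then show ?thesis using assms Suc by simp
qed simp

context pointed_datum
begin

subsection \<open>Decomposition into uniserial summands\<close>

lemma summand_obj:
  assumes V: "obj V" and Q: "mor Q V V" "Q * Q = Q"
  obtains N B C where "obj N" "mor B N V" "mor C V N" "C * B = E (dm N)" "B * C = Q"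
    "nl V = 0 \<Longrightarrow> nl N = 0"
proof -
  obtain e B C where B: "E (dm V) * B = B" "B * E e = B" "E e * C = C" "C * E (dm V) = C"
    "C * B = E e" "B * C = Q" "Q * B = B" "C * Q = C"
    using split_idempotent[OF morD(1,2)[OF Q(1)] Q(2)] by blast
  define N where "N = \<lparr>dm = e, ac = (\<lambda>h. C * ac V h * B), nl = C * nl V * B\<rparr>"
  note VD = objD[OF V] and QD = morD[OF Q(1)]
  \<comment> \<open>The compression sending X to C X B is multiplicative on matrices that commute
    with the idempotent, as do \<open>nl V\<close> and all \<open>ac V h\<close>; hence the
    relations pass to the summand.\<close>
  have cm: "C * X * B * C = C * X" "B * (C * X * B) = X * B" if "Q * X = X * Q" for X
  proof -
    have "C * X * B * C = C * (X * Q)" using B by (simp add: mult.assoc)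
    also have "\<dots> = C * X" unfolding that[symmetric] using B by (simp flip: mult.assoc)
    finally show "C * X * B * C = C * X" .
    have "B * (C * X * B) = Q * X * B" using B by (simp flip: mult.assoc)
    then show "B * (C * X * B) = X * B" using B by (simp add: that mult.assoc)
  qed
  have nlN: "nl N = C * nl V * B" by (simp add: N_def)
  have ypN: "ypow N i = C * ypow V i * B" for i
  proof (induction i)
    case (Suc i)
    have "ypow N (Suc i) = C * nl V * B * C * (ypow V i * B)"
      by (simp add: ypow_Suc Suc nlN mult.assoc)
    also have "\<dots> = C * nl V * (ypow V i * B)" by (simp only: cm(1)[OF QD(4)])
    finally show ?case by (simp only: ypow_Suc mult.assoc)
  qed (simp add: N_def B)
  have "obj N"
    unfolding obj_def
  proof (intro conjI ballI)
    show "ac N \<one> = E (dm N)" using VD B by (simp add: N_def)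
    show "E (dm N) * nl N = nl N" "nl N * E (dm N) = nl N"
      using B by (simp_all add: N_def mult.assoc) (simp flip: mult.assoc)
    show "ypow N n = 0" using VD(6) by (simp add: ypN)
  next
    fix h assume h: "h \<in> carrier G"
    have "ac N h * nl N = C * ac V h * B * C * (nl V * B)" by (simp add: N_def mult.assoc)
    also have "\<dots> = C * (ac V h * nl V) * B" using cm(1)[of "ac V h"] QD(3)[OF h] by (simp add: mult.assoc)
    also have "\<dots> = smul (\<alpha> h) (C * nl V * (ac V h * B))" using VD(5)[OF h] by (simp add: mult.assoc)
    also have "\<dots> = smul (\<alpha> h) (C * nl V * B * C * (ac V h * B))" using cm(1)[of "nl V"] QD by simp
    finally show "ac N h * nl N = smul (\<alpha> h) (nl N * ac N h)" by (simp add: N_def mult.assoc)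
    fix k assume k: "k \<in> carrier G"
    have "ac N h * ac N k = C * ac V h * B * C * (ac V k * B)" by (simp add: N_def mult.assoc)
    also have "\<dots> = C * (ac V h * ac V k) * B" using cm(1)[of "ac V h"] QD(3)[OF h] by (simp add: mult.assoc)
    finally show "ac N (h \<otimes> k) = ac N h * ac N k" using VD(2)[OF h k] by (simp add: N_def)
  qed
  moreover have "mor B N V" "mor C V N"
    unfolding mor_def using B cm QD by (simp_all add: N_def)
  ultimately show thesis using B by (intro that[of N B C]) (simp_all add: N_def)
qed

lemma dsum_retract:
  assumes V: "obj V" and m: "mor \<iota> N V" "mor \<pi> V N" "\<pi> * \<iota> = E (dm N)"
  obtains N' where "obj N'" "dsum V N N'" "nl V = 0 \<Longrightarrow> nl N' = 0"
proof -
  let ?Q = "E (dm V) - \<iota> * \<pi>"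
  have "mor (\<iota> * \<pi>) V V" using mor_comp[OF m(2,1)] .
  then have Q: "mor ?Q V V" using mor_E[OF V] unfolding mor_def by (simp add: left_diff_distrib right_diff_distrib)
  have "\<iota> * \<pi> * (\<iota> * \<pi>) = \<iota> * (\<pi> * \<iota> * \<pi>)" by (simp only: mult.assoc)
  then have "\<iota> * \<pi> * (\<iota> * \<pi>) = \<iota> * \<pi>" using m(3) morD(1)[OF m(2)] by simp
  then have QQ: "?Q * ?Q = ?Q" using morD[OF \<open>mor (\<iota> * \<pi>) V V\<close>] by (simp add: left_diff_distrib right_diff_distrib)
  obtain N' B C where N': "obj N'" "mor B N' V" "mor C V N'" "C * B = E (dm N')" "B * C = ?Q" "nl V = 0 \<Longrightarrow> nl N' = 0"
    using summand_obj[OF V Q QQ] by metis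
  have "dsum V N N'" unfolding dsum_def
    by (rule exI[of _ \<iota>], rule exI[of _ \<pi>], rule exI[of _ B], rule exI[of _ C]) (simp add: m N')
  then show thesis using N' by (intro that[of N']) auto
qed

text \<open>Simplicity over G, expressed through idempotents because averages and traces produce
  idempotents. The equivalence with simple modules is \<open>simple_indec\<close> and
  \<open>indec_simple\<close>.\<close>

definition indec :: "'a obj \<Rightarrow> bool" where
  "indec W \<longleftrightarrow> pure W \<and> 0 < dm W \<and> (\<forall>P. mor P W W \<and> P * P = P \<longrightarrow> P = 0 \<or> P = E (dm W))"

lemma indec_summand:
  assumes "pure W" "0 < dm W"
  shows "\<exists>W' \<iota> \<pi>. indec W' \<and> mor \<iota> W' W \<and> mor \<pi> W W' \<and> \<pi> * \<iota> = E (dm W')"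
  using assms
proof (induction "dm W" arbitrary: W rule: less_induct)
  case less
  show ?case
  proof (cases "indec W")
    case True
    have "mor (E (dm W)) W W" using mor_E less.prems by (simp add: pure_def)
    then show ?thesis using True by (intro exI[of _ W] exI[of _ "E (dm W)"]) simp
  next
    case False
    then obtain P where P: "mor P W W" "P * P = P" "P \<noteq> 0" "P \<noteq> E (dm W)"
      using less.prems unfolding indec_def by blast
    have W: "obj W" "nl W = 0" using less.prems by (auto simp: pure_def)
    obtain N B C where N: "obj N" "mor B N W" "mor C W N" "C * B = E (dm N)" "B * C = P" "nl N = 0"
      using summand_obj[OF W(1) P(1,2)] W(2) by metis
    obtain N' where N': "dsum W N N'" "obj N'" using dsum_retract[OF W(1) N(2-4)] by metis
    have "dm N' \<noteq> 0"
    proof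
      assume "dm N' = 0"
      then have "tr (E (dm W) - P) = 0"
        using dsum_dm[OF N'(1)] N(4,5) tr_mult_commute[of B C] by (simp add: tr_diff)
      moreover have "(E (dm W) - P) * (E (dm W) - P) = E (dm W) - P"
        using P morD[OF P(1)] by (simp add: left_diff_distrib right_diff_distrib)
      ultimately have "E (dm W) - P = 0"
        using morD(1,2)[OF P(1)]
        by (intro tr_idempotent[of "dm W"]) (simp_all add: left_diff_distrib right_diff_distrib)
      then show False using P by simp
    qed
    then have "dm N < dm W" using dsum_dm[OF N'(1)] by simp
    moreover have "dm N \<noteq> 0"
    proof
      assume "dm N = 0"
      then have "B = 0" using morD(2)[OF N(2)] by simp
      then show False using N(5) P(3) by simp
    qed
    ultimately obtain W' \<iota> \<pi> where W': "indec W'" "mor \<iota> W' N" "mor \<pi> N W'" "\<pi> * \<iota> = E (dm W')"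
      using less.hyps[of N] N by (auto simp: pure_def)
    have "\<pi> * C * (B * \<iota>) = \<pi> * (C * B * \<iota>)" by (simp only: mult.assoc)
    then have "\<pi> * C * (B * \<iota>) = E (dm W')" using N(4) W' morD(1)[OF W'(2)] by simp
    then show ?thesis using W'(1) mor_comp[OF W'(2) N(2)] mor_comp[OF N(3) W'(3)] by blast
  qed
qed

text \<open>Injectivity makes a generalized inverse S a left inverse, and then 1 - T S is an
  idempotent of trace zero. The inverse commutes with everything that T commutes with, so it is a
  morphism.\<close>

lemma injective_endo_invertible:
  assumes U: "obj U" and T: "mor T U U" and inj: "\<And>X. E (dm U) * X = X \<Longrightarrow> T * X = 0 \<Longrightarrow> X = 0"
  obtains S where "mor S U U" "S * T = E (dm U)"
proof -
  let ?E = "E (dm U)"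
  note TD = morD[OF T]
  obtain S0 where S0: "T * S0 * T = T" using generalized_inverse[OF TD(1)] by blast
  define S where "S = ?E * S0 * ?E"
  have ES: "?E * S = S" "S * ?E = S" by (simp_all add: S_def mult.assoc) (simp flip: mult.assoc)
  have "T * S * T = T * ?E * S0 * (?E * T)" by (simp only: S_def mult.assoc)
  then have TST: "T * S * T = T" using TD S0 by simp
  have "S * T - ?E = 0"
    by (rule inj) (use ES TD TST in \<open>simp_all add: right_diff_distrib flip: mult.assoc\<close>)
  then have ST: "S * T = ?E" by simp
  have "?E - T * S = 0"
  proof (rule tr_idempotent[of "dm U"])
    have "T * S * (T * S) = T * S" using TST by (simp flip: mult.assoc)
    then show "(?E - T * S) * (?E - T * S) = ?E - T * S"
      using ES TD by (simp add: left_diff_distrib right_diff_distrib mult.assoc) (simp flip: mult.assoc)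
    show "tr (?E - T * S) = 0" using ST tr_mult_commute[of T S] by (simp add: tr_diff)
    show "?E * (?E - T * S) = ?E - T * S" using TD by (simp add: right_diff_distrib flip: mult.assoc)
    show "(?E - T * S) * ?E = ?E - T * S" using ES by (simp add: left_diff_distrib mult.assoc)
  qed
  then have TS: "T * S = ?E" by simp
  have comm: "S * X = X * S" if "T * X = X * T" "?E * X = X" "X * ?E = X" for X
  proof -
    have "S * X = S * X * (T * S)" using that TS by (simp add: mult.assoc)
    also have "\<dots> = S * (X * T) * S" by (simp add: mult.assoc)
    also have "\<dots> = S * T * X * S" unfolding that(1)[symmetric] by (simp add: mult.assoc)
    finally show ?thesis using ST that by simp
  qed
  have "mor S U U" unfolding mor_def
    using ES comm TD objD[OF U] by auto
  then show thesis using ST by (rule that)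
qed

text \<open>Uniserial submodules of maximal length split off. Let y^i be the last nonzero power. A
  generalized inverse Z of y^i compatible with G gives the G-stable complement Z y^i V of the kernel
  of y^i; an indecomposable G-summand W of it generates a copy of W \<otimes> M_(i+1), and the maps
  v to Z y^(i-j) v serve as coordinates for a retraction.\<close>

lemma uniserial_summand:
  assumes V: "obj V" and d: "0 < dm V"
  obtains W k N where "indec W" "0 < k" "k \<le> n" "obj N" "dsum V (tens W (Mk k)) N"
proof -
  note VD = objD[OF V]
  define k where "k = (LEAST k. ypow V k = 0)"
  have k0: "ypow V k = 0" unfolding k_def by (rule LeastI[of _ n]) (rule VD(6))
  have kn: "k \<le> n" unfolding k_def by (rule Least_le) (rule VD(6))
  have kpos: "0 < k" using k0 d by (cases k) auto
  define i where "i = k - 1"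
  have ik: "k = Suc i" using kpos by (simp add: i_def)
  define A where "A = ypow V i"
  have A0: "A \<noteq> 0" unfolding A_def using not_less_Least[of i "\<lambda>k. ypow V k = 0"] ik k_def by simp
  have zero: "ypow V j = 0" if "k \<le> j" for j
    using ypow_add[OF V, of k "j - k"] that k0 by simp
  have acA: "ac V h * A = smul (\<alpha> h ^ i) (A * ac V h)" if "h \<in> carrier G" for h
    using ac_ypow[OF V that] by (simp add: A_def)
  obtain Z0 where Z0: "A * Z0 * A = A" using generalized_inverse_ex[OF V, of i]
    unfolding generalized_inverse_of_def A_def by blast
  \<comment> \<open>An arbitrary generalized inverse is averaged with weights \<chi>^i, which
    balance the factor \<alpha>^i in the commutation of y^i with h. The average is again a
    generalized inverse.\<close>
  define Z where "Z = tw (\<lambda>h. \<chi> h ^ i) V V Z0"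
  have acZ: "ac V h * Z = smul (\<chi> h ^ i) (Z * ac V h)" if "h \<in> carrier G" for h
    unfolding Z_def by (rule tw_equivariant[OF V V that, symmetric]) (simp add: chi_mult power_mult_distrib)
  have EZ: "E (dm V) * Z = Z" "Z * E (dm V) = Z" unfolding Z_def using tw_E V by auto
  have ca: "\<chi> h ^ i * \<alpha> h ^ i = 1" "\<alpha> h ^ i * \<chi> h ^ i = 1" if "h \<in> carrier G" for h
    using alpha_chi[OF that] by (simp_all flip: power_mult_distrib)
  have "A * Z * A = avg (\<lambda>h. A)"
    unfolding Z_def tw_def avg_mult
  proof (rule avg_cong)
    fix h assume h: "h \<in> carrier G"
    have 1: "ac V (inv h) * A = smul (\<chi> h ^ i) (A * ac V (inv h))"
      using acA[of "inv h"] h by (simp add: alpha_inv)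
    have "A * smul (\<chi> h ^ i) (ac V (inv h) * Z0 * ac V h) * A =
        smul (\<chi> h ^ i) (A * ac V (inv h)) * Z0 * (ac V h * A)" by (simp add: mult.assoc)
    also have "\<dots> = smul (\<alpha> h ^ i) (ac V (inv h) * (A * Z0 * A) * ac V h)"
      unfolding 1[symmetric] acA[OF h] by (simp add: mult.assoc)
    also have "\<dots> = smul (\<alpha> h ^ i * \<chi> h ^ i) (A * (ac V (inv h) * ac V h))"
      unfolding Z0 1 by (simp add: mult.assoc)
    also have "\<dots> = A" using ac_inv[OF V h] ca[OF h] ypow_E[OF V] by (simp add: A_def)
    finally show "A * smul (\<chi> h ^ i) (ac V (inv h) * Z0 * ac V h) * A = A" .
  qed
  then have AZA: "A * Z * A = A" by (simp add: avg_const)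
  \<comment> \<open>Forgetting y turns V into a G-module, so that the idempotent Z y^i, which
    commutes with G only, can be split.\<close>
  define V0 where "V0 = V\<lparr>nl := 0\<rparr>"
  have V0: "pure V0"
  proof -
    obtain m where m: "n = Suc m" using n_ge_2 by (cases n) auto
    have "ypow V0 n = 0" unfolding m ypow_Suc by (simp add: V0_def)
    then show ?thesis using VD by (simp add: V0_def pure_def obj_def)
  qed
  define P where "P = Z * A"
  have P: "mor P V0 V0"
    unfolding mor_def
  proof (intro conjI ballI)
    show "E (dm V0) * P = P" "P * E (dm V0) = P" "P * nl V0 = nl V0 * P"
      using EZ ypow_E[OF V] by (simp_all add: V0_def P_def A_def mult.assoc) (simp flip: mult.assoc)
    fix h assume h: "h \<in> carrier G"
    have "ac V h * (Z * A) = smul (\<chi> h ^ i) (Z * (ac V h * A))"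
      using acZ[OF h] by (simp flip: mult.assoc)
    also have "\<dots> = Z * A * ac V h" using acA[OF h] ca[OF h] by (simp add: mult.assoc)
    finally show "P * ac V0 h = ac V0 h * P" by (simp add: V0_def P_def)
  qed
  have "P * P = Z * (A * Z * A)" by (simp only: P_def mult.assoc)
  then have PP: "P * P = P" by (simp add: AZA P_def)
  have P0: "P \<noteq> 0" using AZA A0 by (auto simp: P_def mult.assoc)
  obtain W0 B0 C0 where W0: "obj W0" "mor B0 W0 V0" "mor C0 V0 W0" "C0 * B0 = E (dm W0)" "B0 * C0 = P" "nl W0 = 0"
    using summand_obj[OF pure_obj[OF V0] P PP] V0 by (metis pure_def)
  have "dm W0 \<noteq> 0"
  proof
    assume "dm W0 = 0"
    then have "B0 = 0" using morD(2)[OF W0(2)] by simp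
    then show False using W0(5) P0 by simp
  qed
  then obtain W B1 C1 where W: "indec W" "mor B1 W W0" "mor C1 W0 W" "C1 * B1 = E (dm W)"
    using indec_summand[of W0] W0 by (auto simp: pure_def)
  have Wp: "pure W" and Wo: "obj W" using W(1) by (auto simp: indec_def pure_def)
  define B where "B = B0 * B1"
  define C where "C = C1 * C0"
  have mB: "mor B W V0" and mC: "mor C V0 W"
    using mor_comp[OF W(2) W0(2)] mor_comp[OF W0(3) W(3)] by (simp_all add: B_def C_def)
  have B: "E (dm V) * B = B" "B * E (dm W) = B" "\<And>h. h \<in> carrier G \<Longrightarrow> B * ac W h = ac V h * B"
    using morD[OF mB] by (simp_all add: V0_def)
  have C: "E (dm W) * C = C" "C * E (dm V) = C" "\<And>h. h \<in> carrier G \<Longrightarrow> C * ac V h = ac W h * C"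
    using morD[OF mC] by (simp_all add: V0_def)
  have "C * (Z * A * B) = C1 * (C0 * B0) * (C0 * B0) * B1"
    by (simp only: B_def C_def mult.assoc P_def[symmetric] W0(5)[symmetric])
  then have CZAB: "C * (Z * A * B) = E (dm W)" using W0(4) W(4) morD(2)[OF W(3)] by simp
  define w where "w = dm W"
  define U where "U = tens W (Mk k)"
  have Uo: "obj U" unfolding U_def by (rule obj_tens[OF Wo obj_Mk[OF kn]])
  have dU: "dm U = w * k" by (simp add: U_def w_def)
  have nU: "nl U = kr k k (E w) (shift_down k (Suc 0))"
    using Wp by (simp add: U_def pure_def w_def)
  have aU: "ac U h = kr k k (ac W h) (diag_pow k (\<alpha> h))" for h by (simp add: U_def)
  have yU: "ypow U j = kr k k (E w) (shift_down k j)" for j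
    using tens_v_pow[OF obj_Mk[OF kn], where d = w and i = j] by (simp add: ypow_def[of U] dU nU ypow_Mk)
  \<comment> \<open>\<open>J j\<close> and \<open>J' j\<close> are the projection of W \<otimes> M_k
    onto its layer j, identified with W, and the inclusion of that layer.\<close>
  define J where "J j = kr 1 k (E w) (munit 0 j)" for j
  define J' where "J' j = kr k 1 (E w) (munit j 0)" for j
  have Jn: "J j * nl U = (if j = 0 then 0 else J (j - 1))" if "j < k" for j
  proof -
    have "munit 0 j * shift_down k (Suc 0) = (if j = 0 then 0 else munit 0 (j - 1))"
      by (rule fmat_eqI) (use that in auto)
    then show ?thesis using that unfolding J_def nU by (subst kr_mult_E) auto
  qed
  have nJ': "nl U * J' j = (if Suc j < k then J' (Suc j) else 0)" for j
  proof -
    have "shift_down k (Suc 0) * munit j 0 = (if Suc j < k then munit (Suc j) 0 else 0)"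
      by (rule fmat_eqI) auto
    then show ?thesis unfolding J'_def nU by (subst kr_mult_E) auto
  qed
  have Ja: "J j * ac U h = smul (\<alpha> h ^ j) (ac W h * J j)" if "j < k" "h \<in> carrier G" for j h
  proof -
    have "munit 0 j * diag_pow k (\<alpha> h) = smul (\<alpha> h ^ j) (munit 0 j)"
      by (rule fmat_eqI) (use that in auto)
    moreover have "ac W h * J j = kr 1 k (ac W h) (munit 0 j)"
    proof -
      have "ac W h = kr 1 1 (ac W h) (E 1)" by (rule fmat_eqI) auto
      then have "ac W h * J j = kr 1 1 (ac W h) (E 1) * J j" by simp
      then show ?thesis using objD(8)[OF Wo] that unfolding J_def w_def by (simp add: kr_mult_E)
    qed
    ultimately show ?thesis using that objD(7)[OF Wo that(2)] unfolding aU
      by (simp add: J_def w_def kr_mult_E)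
  qed
  have aJ': "ac U h * J' j = smul (\<alpha> h ^ j) (J' j * ac W h)" if "j < k" "h \<in> carrier G" for j h
  proof -
    have dp: "diag_pow k (\<alpha> h) * E k = diag_pow k (\<alpha> h)" by (rule fmat_eqI) auto
    have "diag_pow k (\<alpha> h) * munit j 0 = smul (\<alpha> h ^ j) (munit j 0)"
      by (rule fmat_eqI) (use that in auto)
    moreover have "J' j * ac W h = kr k 1 (ac W h) (munit j 0)"
    proof -
      have "ac W h = kr 1 1 (ac W h) (E 1)" by (rule fmat_eqI) auto
      then have "J' j * ac W h = J' j * kr 1 1 (ac W h) (E 1)" by simp
      then show ?thesis using objD(7)[OF Wo] that unfolding J'_def w_def by (simp add: kr_mult_E)
    qed
    ultimately show ?thesis using that objD(8)[OF Wo that(2)] unfolding aU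
      by (simp add: J'_def w_def kr_mult_E dp)
  qed
  have EJ: "E w * J j = J j" "J j * E (w * k) = J j" "E (w * k) * J' j = J' j" "J' j * E w = J' j" if "j < k" for j
  proof -
    have "kr 1 1 (E w) (E 1) * J j = J j" "J' j * kr 1 1 (E w) (E 1) = J' j"
      unfolding J_def J'_def by (subst kr_mult_E; simp)+
    then show "E w * J j = J j" "J' j * E w = J' j" by simp_all
    have "J j * kr k k (E w) (E k) = J j" "kr k k (E w) (E k) * J' j = J' j"
      unfolding J_def J'_def by (subst kr_mult_E; use that in simp)+
    then show "J j * E (w * k) = J j" "E (w * k) * J' j = J' j" by simp_all
  qed
  \<comment> \<open>The layer j of W \<otimes> M_k is sent to y^j B W. In the other direction C Z
    y^(i-j) reads off layer j: composed with y^m B it vanishes for j < m and is the identity for j =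
    m.\<close>
  define \<iota> where "\<iota> = (\<Sum>j<k. ypow V j * B * J j)"
  define \<pi> where "\<pi> = (\<Sum>j<k. J' j * (C * Z * ypow V (i - j)))"
  have m\<iota>: "mor \<iota> U V"
    unfolding mor_def
  proof (intro conjI ballI)
    show "E (dm V) * \<iota> = \<iota>" "\<iota> * E (dm U) = \<iota>"
      using ypow_E[OF V] EJ
      by (auto simp: \<iota>_def dU sum_distrib_left sum_distrib_right mult.assoc intro!: sum.cong)
        (simp flip: mult.assoc)
    have "\<iota> * nl U = (\<Sum>j<k. if j = 0 then 0 else ypow V j * B * J (j - 1))"
      by (auto simp: \<iota>_def sum_distrib_right mult.assoc Jn intro!: sum.cong)
    also have "\<dots> = (\<Sum>j<k. ypow V (Suc j) * B * J (Suc j - 1))"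
      by (rule sum_shift_index) (simp add: k0)
    also have "\<dots> = nl V * \<iota>" by (simp add: \<iota>_def sum_distrib_left ypow_Suc mult.assoc)
    finally show "\<iota> * nl U = nl V * \<iota>" .
    fix h assume h: "h \<in> carrier G"
    have "ypow V j * B * J j * ac U h = ac V h * (ypow V j * B * J j)" if "j < k" for j
    proof -
      have "ypow V j * B * J j * ac U h = smul (\<alpha> h ^ j) (ypow V j * (B * ac W h) * J j)"
        using Ja[OF that h] by (simp add: mult.assoc)
      also have "\<dots> = smul (\<alpha> h ^ j) (ypow V j * ac V h) * B * J j"
        using B(3)[OF h] by (simp add: mult.assoc)
      also have "\<dots> = ac V h * ypow V j * B * J j" unfolding ac_ypow[OF V h] by simp
      finally show ?thesis by (simp only: mult.assoc)
    qed
    then show "\<iota> * ac U h = ac V h * \<iota>"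
      by (simp add: \<iota>_def sum_distrib_left sum_distrib_right)
  qed
  have m\<pi>: "mor \<pi> V U"
    unfolding mor_def
  proof (intro conjI ballI)
    show "E (dm U) * \<pi> = \<pi>"
      using EJ by (auto simp: \<pi>_def dU sum_distrib_left simp flip: mult.assoc intro!: sum.cong)
    show "\<pi> * E (dm V) = \<pi>"
      using ypow_E[OF V] by (simp add: \<pi>_def sum_distrib_right mult.assoc)
    have kj: "k - Suc j = i - j" for j by (simp add: ik)
    have "\<pi> * nl V = (\<Sum>j<k. J' j * (C * Z * ypow V (Suc (i - j))))"
      by (simp add: \<pi>_def sum_distrib_right mult.assoc ypow_Suc2[OF V])
    also have "\<dots> = (\<Sum>j<k. if j = 0 then 0 else J' j * (C * Z * ypow V (k - j)))"
      by (rule sum.cong) (auto simp: ik Suc_diff_le k0[unfolded ik])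
    also have "\<dots> = (\<Sum>j<k. if j = 0 then 0 else
        (\<lambda>j. if j < k then J' j * (C * Z * ypow V (k - j)) else 0) j)"
      by (rule sum.cong) auto
    also have "\<dots> = (\<Sum>j<k. if Suc j < k then J' (Suc j) * (C * Z * ypow V (k - Suc j)) else 0)"
      by (rule sum_shift_index) simp
    also have "\<dots> = nl U * \<pi>"
      by (auto simp: \<pi>_def sum_distrib_left nJ' kj simp flip: mult.assoc intro!: sum.cong)
    finally show "\<pi> * nl V = nl U * \<pi>" .
    fix h assume h: "h \<in> carrier G"
    have "ac U h * (J' j * (C * Z * ypow V (i - j))) = J' j * (C * Z * ypow V (i - j)) * ac V h" if "j < k" for j
    proof -
      have e: "\<alpha> h ^ j * (\<chi> h ^ i * \<alpha> h ^ (i - j)) = 1"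
        using that ca[OF h] by (simp add: ik flip: power_add mult.left_commute)
      have "ac U h * (J' j * (C * Z * ypow V (i - j))) = smul (\<alpha> h ^ j) (J' j * (ac W h * C) * Z * ypow V (i - j))"
        using aJ'[OF that h] by (simp flip: mult.assoc)
      also have "\<dots> = smul (\<alpha> h ^ j) (J' j * C * (ac V h * Z) * ypow V (i - j))"
        unfolding C(3)[OF h, symmetric] by (simp add: mult.assoc)
      also have "\<dots> = smul (\<alpha> h ^ j * \<chi> h ^ i) (J' j * C * Z * (ac V h * ypow V (i - j)))"
        unfolding acZ[OF h] by (simp add: mult.assoc)
      also have "\<dots> = smul (\<alpha> h ^ j * (\<chi> h ^ i * \<alpha> h ^ (i - j))) (J' j * C * Z * ypow V (i - j) * ac V h)"
        unfolding ac_ypow[OF V h] by (simp add: mult.assoc)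
      finally show ?thesis by (simp add: e mult.assoc)
    qed
    then show "\<pi> * ac V h = ac U h * \<pi>"
      by (simp add: \<pi>_def sum_distrib_left sum_distrib_right)
  qed
  define T where "T = \<pi> * \<iota>"
  have mT: "mor T U U" unfolding T_def by (rule mor_comp[OF m\<iota> m\<pi>])
  have top: "ypow U i = J' i * J 0"
  proof -
    have "shift_down k i = munit i 0" by (rule fmat_eqI) (auto simp: ik)
    then show ?thesis by (simp add: yU J_def J'_def kr_mult_E)
  qed
  \<comment> \<open>On the lowest layer y^i U all powers of y in the coordinate maps vanish except
    the one for j = i, and there C Z y^i B is the identity.\<close>
  have Ttop: "T * ypow U i = ypow U i"
  proof -
    have "munit 0 0 = E 1" by (rule fmat_eqI) auto
    then have JJ: "J j * J' i = (if j = i then E w else 0)" for j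
      unfolding J_def J'_def by (subst kr_mult_E') (auto simp: ik)
    have "\<iota> * J' i = (\<Sum>j<k. if j = i then ypow V j * B * E w else 0)"
      unfolding \<iota>_def sum_distrib_right by (rule sum.cong) (simp_all add: mult.assoc JJ)
    also have "\<dots> = A * B" using B(2) by (simp add: ik A_def w_def mult.assoc)
    finally have 1: "\<iota> * J' i = A * B" .
    have "ypow V (i - j) * (A * B) = (if j = i then A * B else 0)" if "j < k" for j
    proof (cases "j = i")
      case False
      then have "ypow V (i - j + i) = 0" using that ik by (intro zero) simp
      then show ?thesis using False by (simp add: A_def ypow_add[OF V] flip: mult.assoc)
    qed (use ypow_E[OF V] in \<open>simp add: A_def flip: mult.assoc\<close>)
    note YAB = this
    have "\<pi> * (A * B) = (\<Sum>j<k. if j = i then J' j * (C * Z * (A * B)) else 0)"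
      unfolding \<pi>_def sum_distrib_right by (rule sum.cong) (simp_all add: mult.assoc YAB)
    also have "\<dots> = J' i * (C * (Z * A * B))" by (simp add: ik mult.assoc)
    also have "\<dots> = J' i" using EJ(4)[of i] by (simp add: CZAB ik w_def)
    finally have "T * J' i = J' i" using 1 by (simp add: T_def mult.assoc)
    then show ?thesis unfolding top by (simp flip: mult.assoc)
  qed
  \<comment> \<open>The composite T is triangular with identities on the diagonal but need not be
    the identity, so \<pi> is corrected by its inverse. For injectivity, suppose T X = 0 and y^(m+1)
    X = 0: then y^m X lies in the kernel of y on U, which is y^i U, where T is the identity; yet T
    y^m X = y^m T X = 0.\<close>
  obtain S where S: "mor S U U" "S * T = E (dm U)"
  proof (rule injective_endo_invertible[OF Uo mT])
    fix X assume X: "E (dm U) * X = X" "T * X = 0"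
    have "ypow U 0 * X = 0"
    proof (rule finite_chain_zero[where k = k])
      show "ypow U k * X = 0" by (simp add: yU shift_down_eq_0)
      fix m assume "ypow U (Suc m) * X = 0"
      define R where "R = ypow U m * X"
      have nR: "nl U * R = 0" using \<open>ypow U (Suc m) * X = 0\<close> by (simp add: R_def ypow_Suc mult.assoc)
      \<comment> \<open>This writes a vector as a part that factors through y plus a part in the
        image of y^i, so the kernel of y on \<open>U\<close> lies in the image of y^i.\<close>
      have "E k = shift_up k 1 * shift_down k (Suc 0) + shift_down k i * shift_up k i"
        by (rule fmat_eqI) (auto simp: ik)
      then have "E (dm U) = kr k k (E w) (shift_up k 1) * nl U + ypow U i * kr k k (E w) (shift_up k i)"
      proof -
        assume e: "E k = shift_up k 1 * shift_down k (Suc 0) + shift_down k i * shift_up k i"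
        have "kr k k (E w) (shift_up k 1) * nl U = kr k k (E w) (shift_up k 1 * shift_down k (Suc 0))"
          "ypow U i * kr k k (E w) (shift_up k i) = kr k k (E w) (shift_down k i * shift_up k i)"
          unfolding nU yU by (subst kr_mult_E; simp)+
        moreover have "E (dm U) = kr k k (E w) (E k)" by (simp add: dU)
        ultimately show ?thesis by (simp only: e kr_add)
      qed
      moreover have "E (dm U) * R = R" using ypow_E[OF Uo] by (simp add: R_def flip: mult.assoc)
      ultimately have R: "R = ypow U i * (kr k k (E w) (shift_up k i) * R)"
        using nR by (metis (no_types, lifting) add.left_neutral distrib_right mult.assoc mult_zero_right)
      have "T * R = ypow U m * (T * X)" using mor_ypow[OF mT, of m] by (simp add: R_def flip: mult.assoc)
      then have "T * R = 0" using X by simp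
      moreover have "T * R = R" using R Ttop by (metis mult.assoc)
      ultimately show "ypow U m * X = 0" by (simp add: R_def)
    qed
    then show "X = 0" using X by simp
  qed blast
  have "mor (S * \<pi>) V U" by (rule mor_comp[OF m\<pi> S(1)])
  moreover have "S * \<pi> * \<iota> = E (dm U)" using S(2) by (simp add: T_def mult.assoc)
  ultimately obtain N where "obj N" "dsum V U N" using dsum_retract[OF V m\<iota>] by metis
  then show thesis using that[OF W(1) kpos kn] by (simp add: U_def)
qed

end

lift_definition tp :: "fmat \<Rightarrow> fmat" is "\<lambda>f i j. f j i" by auto

declare tp.rep_eq [simp]

lemma tp_mult: "tp (A * B) = tp B * tp A"
proof -
  obtain d where d: "\<And>i j. ent A i j \<noteq> 0 \<Longrightarrow> i < d \<and> j < d" "\<And>i j. ent B i j \<noteq> 0 \<Longrightarrow> i < d \<and> j < d"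
    using fmat_bound2 by blast
  have 1: "ent (A * B) i j = (\<Sum>l<d. ent A i l * ent B l j)" for i j
    by (rule ent_mult_row) (use d in blast)
  have 2: "ent (tp B * tp A) i j = (\<Sum>l<d. ent (tp B) i l * ent (tp A) l j)" for i j
    by (rule ent_mult_row) (use d in auto)
  show ?thesis by (rule fmat_eqI) (simp add: 1 2 mult.commute)
qed

lemma tp_E [simp]: "tp (E d) = E d" by (rule fmat_eqI) auto
lemma tr_tp: "tr (tp A) = tr A" by (simp add: tr_def)

context pointed_datum
begin

subsection \<open>Characters of the group\<close>

lemma tw_mor:
  assumes "pure V" "pure W"
  shows "mor (tw (\<lambda>_. 1) V W X) W V"
  unfolding mor_def using assms tw_E[of V W] tw_equivariant[of V W _ "\<lambda>_. 1"]
  by (auto simp: pure_def)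

lemma tw_1_fixed:
  assumes V: "obj V" and X: "mor X W V"
  shows "tw (\<lambda>_. 1) V W X = X"
proof -
  have "tw (\<lambda>_. 1) V W X = avg (\<lambda>h. X)"
    unfolding tw_def
  proof (rule avg_cong)
    fix h assume h: "h \<in> carrier G"
    have "ac V (inv h) * X * ac W h = ac V (inv h) * ac V h * X"
      using morD(3)[OF X h] by (simp add: mult.assoc)
    then show "smul 1 (ac V (inv h) * X * ac W h) = X" using ac_inv[OF V h] morD(1)[OF X] by simp
  qed
  then show ?thesis by (simp add: avg_const)
qed

text \<open>Averaging a generalized inverse of X gives a morphism Z with X Z X = X. Both Z X and X Z
  are then nonzero idempotent endomorphisms of indecomposables, hence identities.\<close>

lemma schur:
  assumes V: "indec V" and W: "indec W" and X: "mor X W V" "X \<noteq> 0"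
  shows "iso V W"
proof -
  have p: "pure V" "pure W" and o: "obj V" "obj W" using V W by (auto simp: indec_def pure_def)
  obtain Z0 where Z0: "X * Z0 * X = X" using generalized_inverse[OF morD(1)[OF X(1)]] by blast
  define Z where "Z = tw (\<lambda>_. 1) W V Z0"
  have mZ: "mor Z V W" unfolding Z_def by (rule tw_mor[OF p(2,1)])
  have "X * Z * X = avg (\<lambda>h. X)"
    unfolding Z_def tw_def avg_mult
  proof (rule avg_cong)
    fix h assume h: "h \<in> carrier G"
    have "X * smul 1 (ac W (inv h) * Z0 * ac V h) * X = X * ac W (inv h) * Z0 * (ac V h * X)"
      by (simp add: mult.assoc)
    also have "\<dots> = ac V (inv h) * X * Z0 * (X * ac W h)"
      unfolding morD(3)[OF X(1) h] morD(3)[OF X(1) inv_closed[OF h]] by simp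
    also have "\<dots> = ac V (inv h) * (X * Z0 * X) * ac W h" by (simp only: mult.assoc)
    also have "\<dots> = ac V (inv h) * ac V h * X" unfolding Z0 using morD(3)[OF X(1) h] by (simp add: mult.assoc)
    finally show "X * smul 1 (ac W (inv h) * Z0 * ac V h) * X = X"
      using ac_inv[OF o(1) h] morD(1)[OF X(1)] by simp
  qed
  then have XZX: "X * Z * X = X" by (simp add: avg_const)
  have "Z * X * (Z * X) = Z * (X * Z * X)" "X * Z * (X * Z) = X * Z * X * Z" by (simp_all only: mult.assoc)
  then have id: "Z * X * (Z * X) = Z * X" "X * Z * (X * Z) = X * Z" by (simp_all add: XZX)
  have "Z * X \<noteq> 0" "X * Z \<noteq> 0" using XZX X(2) by (metis mult.assoc mult_zero_left mult_zero_right)+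
  then have "Z * X = E (dm W)" "X * Z = E (dm V)"
    using V W id mor_comp[OF X(1) mZ] mor_comp[OF mZ X(1)] unfolding indec_def by blast+
  then show ?thesis unfolding iso_def using X(1) mZ by blast
qed

definition char_prod :: "'a obj \<Rightarrow> 'a obj \<Rightarrow> complex" where
  "char_prod V W = (\<Sum>h\<in>carrier G. gchar V (inv h) * gchar W h)"

text \<open>Every averaged matrix unit is an intertwiner and thus zero. Its entry at the position of
  the unit is the average of a product of diagonal entries; summing over all positions gives the
  product of characters.\<close>

lemma char_prod_eq_0:
  assumes V: "indec V" and W: "indec W" and niso: "\<not> iso V W"
  shows "char_prod V W = 0"
proof -
  have p: "pure V" "pure W" and o: "obj V" "obj W" using V W by (auto simp: indec_def pure_def)
  have z: "tw (\<lambda>_. 1) V W X = 0" for X using schur[OF V W tw_mor[OF p]] niso by blast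
  have "(\<Sum>h\<in>carrier G. ent (ac V (inv h)) i i * ent (ac W h) j j) = 0" for i j
  proof -
    have e: "ent (ac V (inv h) * munit i j * ac W h) i j = ent (ac V (inv h)) i i * ent (ac W h) j j" for h
      by (subst ent_mult_row[of _ _ "Suc j"]) (auto split: if_splits simp: if_distrib[of "\<lambda>x. x * _"] cong: if_cong)
    have "0 = ent (tw (\<lambda>_. 1) V W (munit i j)) i j" by (simp add: z)
    also have "\<dots> = 1 / of_nat (card (carrier G)) *
        (\<Sum>h\<in>carrier G. ent (ac V (inv h) * munit i j * ac W h) i j)"
      by (simp add: tw_def avg_def ent_sum)
    finally show ?thesis using card_G by (simp add: e)
  qed
  then have "(\<Sum>i<dm V. \<Sum>j<dm W. \<Sum>h\<in>carrier G. ent (ac V (inv h)) i i * ent (ac W h) j j) = 0" by simp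
  also have "(\<Sum>i<dm V. \<Sum>j<dm W. \<Sum>h\<in>carrier G. ent (ac V (inv h)) i i * ent (ac W h) j j) =
    (\<Sum>h\<in>carrier G. (\<Sum>i<dm V. ent (ac V (inv h)) i i) * (\<Sum>j<dm W. ent (ac W h) j j))"
  proof -
    let ?t = "\<lambda>h i j. ent (ac V (inv h)) i i * ent (ac W h) j j"
    have "(\<Sum>i<dm V. \<Sum>j<dm W. \<Sum>h\<in>carrier G. ?t h i j) = (\<Sum>i<dm V. \<Sum>h\<in>carrier G. \<Sum>j<dm W. ?t h i j)"
      by (rule sum.cong[OF refl], rule sum.swap)
    also have "\<dots> = (\<Sum>h\<in>carrier G. \<Sum>i<dm V. \<Sum>j<dm W. ?t h i j)" by (rule sum.swap)
    finally show ?thesis by (simp add: sum_product)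
  qed
  also have "\<dots> = char_prod V W"
    unfolding char_prod_def gchar_def
  proof (rule sum.cong[OF refl])
    fix h assume h: "h \<in> carrier G"
    then have "\<And>i j. ent (ac V (inv h)) i j \<noteq> 0 \<Longrightarrow> i < dm V" "\<And>i j. ent (ac W h) i j \<noteq> 0 \<Longrightarrow> i < dm W"
      using objD(7)[OF o(1), of "inv h"] objD(7)[OF o(2), of h] unfolding E_mult_eq_iff by auto
    then show "(\<Sum>i<dm V. ent (ac V (inv h)) i i) * (\<Sum>j<dm W. ent (ac W h) j j) = tr (ac V (inv h)) * tr (ac W h)"
      by (simp add: tr_bound[of _ "dm V"] tr_bound[of _ "dm W"])
  qed
  finally show ?thesis by simp
qed

text \<open>The matrix \<open>Q\<close> below is the averaging projection \<open>X \<mapsto> tw X\<close> written as a matrix on pairs of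
  indices; being a nonzero idempotent, it has nonzero trace.\<close>

lemma char_prod_self:
  assumes V: "indec V"
  shows "char_prod V V \<noteq> 0"
proof
  assume z: "char_prod V V = 0"
  have o: "obj V" and d: "0 < dm V" using V by (auto simp: indec_def pure_def)
  note VD = objD[OF o]
  let ?d = "dm V"
  define f where "f h = kr ?d ?d (ac V (inv h)) (tp (ac V h))" for h
  define Q where "Q = avg f"
  have tE: "E ?d * tp (ac V h) = tp (ac V h)" "tp (ac V h) * E ?d = tp (ac V h)" if "h \<in> carrier G" for h
    using VD(7,8)[OF that] by (simp_all flip: tp_mult[of _ "E ?d", simplified] tp_mult[of "E ?d", simplified])
  have ff: "f h * f k = f (k \<otimes> h)" if "h \<in> carrier G" "k \<in> carrier G" for h k
    using that VD(2)[of "inv h" "inv k"] VD(2)[of k h] tE by (simp add: f_def kr_mult_E inv_mult_group tp_mult)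
  have "f k * Q = Q" if k: "k \<in> carrier G" for k
  proof -
    have "f k * Q = avg (\<lambda>h. f (h \<otimes> k))" unfolding Q_def avg_mult by (rule avg_cong) (simp add: ff k)
    then show ?thesis using avg_shift[OF k] by (simp add: Q_def)
  qed
  then have "avg (\<lambda>h. f h * Q) = avg (\<lambda>h. Q)" by (intro avg_cong)
  then have QQ: "Q * Q = Q" by (simp add: avg_mult(2)[symmetric] avg_const Q_def[symmetric])
  have "tr Q = 1 / of_nat (card (carrier G)) * char_prod V V"
    unfolding Q_def avg_def char_prod_def tr_smul tr_sum f_def gchar_def
    using tE by (auto simp: tr_kr tr_tp)
  then have "tr Q = 0" by (simp add: z)
  moreover have "E (?d * ?d) * Q = Q" "Q * E (?d * ?d) = Q"
    unfolding Q_def avg_mult by (rule avg_cong; use tE VD in \<open>simp add: f_def kr_mult_E flip: kr_E\<close>)+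
  ultimately have Q0: "Q = 0" using QQ tr_idempotent by blast
  \<comment> \<open>The entries of \<open>Q\<close> are the matrix coefficients of the averaging
    operator, so \<open>Q = 0\<close> annihilates the average of each diagonal matrix unit. Their
    sum is the identity, which averaging fixes.\<close>
  have tw0: "tw (\<lambda>_. 1) V V (munit a a) = 0" if a: "a < ?d" for a
  proof (rule fmat_eqI)
    fix i j
    show "ent (tw (\<lambda>_. 1) V V (munit a a)) i j = ent 0 i j"
    proof (cases "j < ?d")
      case True
      have 1: "ent (ac V (inv h) * munit a a * ac V h) i j = ent (ac V (inv h)) i a * ent (ac V h) a j" for h
        by (subst ent_mult_row[of _ _ "Suc a"]) (auto split: if_splits simp: if_distrib[of "\<lambda>x. x * _"] cong: if_cong)
      have "0 = ent Q (i * ?d + j) (a * ?d + a)" by (simp add: Q0)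
      also have "\<dots> = 1 / of_nat (card (carrier G)) * (\<Sum>h\<in>carrier G. ent (ac V (inv h)) i a * ent (ac V h) a j)"
        using True a by (simp add: Q_def avg_def ent_sum f_def)
      finally show ?thesis by (simp add: tw_def avg_def ent_sum 1)
    next
      case False
      have "tw (\<lambda>_. 1) V V (munit a a) * E ?d = tw (\<lambda>_. 1) V V (munit a a)" using tw_E(2)[OF o o] .
      then show ?thesis using False unfolding mult_E_eq_iff by auto
    qed
  qed
  have Es: "E d = (\<Sum>a<d. munit a a)" for d by (induction d) (auto simp: E_Suc)
  have "E ?d = tw (\<lambda>_. 1) V V (E ?d)" using tw_1_fixed[OF o mor_E[OF o]] by simp
  also have "\<dots> = (\<Sum>a<?d. tw (\<lambda>_. 1) V V (munit a a))"
    unfolding tw_def avg_def Es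
    by (simp add: sum_distrib_left sum_distrib_right fm.scale_sum_right sum.swap[of _ "carrier G"])
  also have "\<dots> = 0" by (simp add: tw0)
  finally show False using d by simp
qed

definition irr_rep :: "'a obj \<Rightarrow> 'a obj" where
  "irr_rep W = (SOME W'. indec W' \<and> iso W W')"

definition Irr :: "'a obj set" where
  "Irr = irr_rep ` {W. indec W}"

lemma irr_rep: assumes "indec W" shows "indec (irr_rep W)" "iso W (irr_rep W)" "irr_rep W \<in> Irr"
proof -
  have "indec W \<and> iso W W" using assms iso_refl by (auto simp: indec_def pure_def)
  then have "indec (irr_rep W) \<and> iso W (irr_rep W)" unfolding irr_rep_def by (rule someI)
  then show "indec (irr_rep W)" "iso W (irr_rep W)" "irr_rep W \<in> Irr" using assms by (auto simp: Irr_def)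
qed

lemma Irr_indec: "W \<in> Irr \<Longrightarrow> indec W" and Irr_pure: "W \<in> Irr \<Longrightarrow> pure W" and Irr_obj: "W \<in> Irr \<Longrightarrow> obj W"
  using irr_rep(1) by (auto simp: Irr_def indec_def pure_def)

lemma Irr_iso_eq: assumes "V \<in> Irr" "W \<in> Irr" "iso V W" shows "V = W"
proof -
  obtain V0 W0 where 0: "indec V0" "V = irr_rep V0" "indec W0" "W = irr_rep W0" using assms by (auto simp: Irr_def)
  then have "iso V0 W0" using assms(3) irr_rep(2) iso_trans iso_sym by metis
  then have "iso V0 W' \<longleftrightarrow> iso W0 W'" for W' using iso_trans iso_sym by blast
  then show ?thesis by (simp add: 0 irr_rep_def)
qed

text \<open>Pairing the relation with the character of \<open>V\<close> leaves only the term of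
  \<open>V\<close>, whose product with itself is nonzero.\<close>

lemma Irr_independent:
  assumes "finite S" "S \<subseteq> Irr" "\<And>h. h \<in> carrier G \<Longrightarrow> (\<Sum>W\<in>S. c W * gchar W h) = 0" "V \<in> S"
  shows "c V = 0"
proof -
  have "0 = (\<Sum>h\<in>carrier G. gchar V (inv h) * (\<Sum>W\<in>S. c W * gchar W h))" using assms(3) by simp
  also have "\<dots> = (\<Sum>W\<in>S. c W * char_prod V W)"
    unfolding char_prod_def sum_distrib_left by (subst sum.swap) (simp add: mult.left_commute)
  also have "\<dots> = (\<Sum>W\<in>S. if W = V then c V * char_prod V V else 0)"
  proof (rule sum.cong[OF refl])
    fix W assume "W \<in> S"
    then show "c W * char_prod V W = (if W = V then c V * char_prod V V else 0)"
      using char_prod_eq_0[of V W] Irr_iso_eq[of V W] Irr_indec assms(2,4) by auto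
  qed
  also have "\<dots> = c V * char_prod V V" using assms(1,4) by simp
  finally show ?thesis using char_prod_self Irr_indec assms(2,4) by auto
qed

end

section \<open>Generalized Fibonacci polynomials\<close>

text \<open>Rescaled Chebyshev polynomials of the second kind: at a = b^2 and z = 2 b cos t the
  value is b^(k-1) sin(k t) / sin t whenever b and sin t are nonzero, see
  \<open>fib_cos\<close>.\<close>

fun fib :: "complex \<Rightarrow> nat \<Rightarrow> complex poly" where
  "fib a 0 = 0"
| "fib a (Suc 0) = 1"
| "fib a (Suc (Suc k)) = [:0, 1:] * fib a (Suc k) - Polynomial.smult a (fib a k)"

lemma fib_degree_aux:
  "degree (fib a (Suc k)) \<le> k \<and> coeff (fib a (Suc k)) k = 1 \<and> degree (fib a k) \<le> k - 1"
proof (induction k)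
  case (Suc k)
  have "degree (fib a k) < Suc k" using Suc by auto
  then have c: "coeff (fib a k) (Suc k) = 0" by (rule coeff_eq_0)
  have "degree ([:0, 1:] * fib a (Suc k)) \<le> degree [:0, 1::complex:] + degree (fib a (Suc k))"
    by (rule degree_mult_le)
  then have "degree ([:0, 1:] * fib a (Suc k)) \<le> Suc k" using Suc by simp
  moreover have "degree (Polynomial.smult a (fib a k)) \<le> Suc k"
    using Suc degree_smult_le[of a "fib a k"] by linarith
  ultimately have "degree (fib a (Suc (Suc k))) \<le> Suc k"
    by (simp only: fib.simps degree_diff_le)
  then show ?case using Suc c by simp
qed simp

lemma fib_degree: "degree (fib a (Suc k)) = k"
  using fib_degree_aux[of a k] le_degree[of "fib a (Suc k)" k] by auto

lemma fib_lead: "coeff (fib a (Suc k)) k = 1"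
  using fib_degree_aux by blast

lemma fib_independent:
  assumes "(\<Sum>k = 1..m. Polynomial.smult (c k) (fib a k)) = 0" "k \<in> {1..m}"
  shows "c k = 0"
  using assms
proof (induction m)
  case (Suc m)
  have "coeff (Polynomial.smult (c k) (fib a k)) m = 0" if k: "k \<in> {1..m}" for k
  proof -
    obtain i where "k = Suc i" using k by (cases k) auto
    then have "degree (fib a k) < m" using k fib_degree[of a i] by simp
    then show ?thesis by (simp add: coeff_eq_0)
  qed
  then have "(\<Sum>k = 1..m. coeff (Polynomial.smult (c k) (fib a k)) m) = 0" by (intro sum.neutral) blast
  moreover have "coeff (\<Sum>k = 1..Suc m. Polynomial.smult (c k) (fib a k)) m = 0" using Suc.prems by simp
  ultimately have c0: "c (Suc m) = 0" by (simp add: coeff_sum fib_lead)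
  then show ?case using Suc by (cases "k = Suc m") auto
qed simp

text \<open>The inclusion of \<complex>^e as the last coordinates of \<complex>^(d+e); its transpose
  is the projection.\<close>

lift_definition emb :: "nat \<Rightarrow> nat \<Rightarrow> fmat" is "\<lambda>d e i j. if i = d + j \<and> j < e then 1 else 0"
  subgoal for d e by (rule exI[of _ "d + e"]) auto
  done

declare emb.rep_eq [simp]

lemma emb_simps: "tp (emb d e) * emb d e = E e" "emb d e * E e = emb d e" "E (d + e) * emb d e = emb d e"
  "E e * tp (emb d e) = tp (emb d e)" "tp (emb d e) * E (d + e) = tp (emb d e)"
  "E d * emb d e = 0" "tp (emb d e) * E d = 0" "E d + emb d e * tp (emb d e) = E (d + e)"
proof -
  show "emb d e * E e = emb d e" "E (d + e) * emb d e = emb d e"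
    "E e * tp (emb d e) = tp (emb d e)" "tp (emb d e) * E (d + e) = tp (emb d e)"
    "E d * emb d e = 0" "tp (emb d e) * E d = 0"
    by (rule fmat_eqI; auto)+
  have 1: "ent (tp (emb d e) * X) i j = (\<Sum>l<d + e. ent (tp (emb d e)) i l * ent X l j)" for X i j
    by (rule ent_mult_row) (auto split: if_splits)
  have 2: "ent (X * tp (emb d e)) i j = (\<Sum>l<e. ent X i l * ent (tp (emb d e)) l j)" for X i j
    by (rule ent_mult_col) (auto split: if_splits)
  show "tp (emb d e) * emb d e = E e"
    by (rule fmat_eqI) (auto simp: 1 if_distrib[of "\<lambda>x. x * _"] sum.If_cases cong: if_cong)
  show "E d + emb d e * tp (emb d e) = E (d + e)"
  proof (rule fmat_eqI)
    fix i j
    have "(\<Sum>l<e. ent (emb d e) i l * ent (tp (emb d e)) l j) =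
      (\<Sum>l<e. if l = i - d then if d \<le> i \<and> i = j then 1 else 0 else 0)"
      by (rule sum.cong) auto
    then show "ent (E d + emb d e * tp (emb d e)) i j = ent (E (d + e)) i j" by (auto simp: 2)
  qed
qed

context pointed_datum
begin

subsection \<open>Complete invariants\<close>

definition osum :: "'a obj \<Rightarrow> 'a obj \<Rightarrow> 'a obj" where
  "osum V N = (let \<iota> = emb (dm V) (dm N) in \<lparr>dm = dm V + dm N,
     ac = (\<lambda>h. ac V h + \<iota> * ac N h * tp \<iota>), nl = nl V + \<iota> * nl N * tp \<iota>\<rparr>)"

lemma assoc_eq: "A * B = C \<Longrightarrow> A * (B * X) = C * (X :: fmat)"
  by (simp flip: mult.assoc)

lemma osum:
  assumes V: "obj V" and N: "obj N"
  shows "obj (osum V N)" "dsum (osum V N) V N"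
proof -
  let ?i = "emb (dm V) (dm N)" and ?S = "osum V N"
  note VD = objD[OF V] and ND = objD[OF N]
  note e = emb_simps[where d = "dm V" and e = "dm N"] and e' = emb_simps(1-7)[where d = "dm V" and e = "dm N", THEN assoc_eq]
  have s: "dm ?S = dm V + dm N" "ac ?S h = ac V h + ?i * ac N h * tp ?i" "nl ?S = nl V + ?i * nl N * tp ?i" for h
    by (simp_all add: osum_def Let_def)
  have V0: "X * ?i = 0" "X * (?i * Y) = 0" if "X * E (dm V) = X" for X Y
    using that e(6) by (metis mult.assoc mult_zero_left mult_zero_right)+
  have V1: "tp ?i * X = 0" "tp ?i * (X * Y) = 0" if "E (dm V) * X = X" for X Y
    using that e(7) by (metis mult.assoc mult_zero_left mult_zero_right)+
  have EV: "E (dm V + dm N) * X = X" if "E (dm V) * X = X" for X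
    using that by (metis E_mult_E min_add_distrib_left min.absorb2 le_add1 mult.assoc)
  have VE: "X * E (dm V + dm N) = X" if "X * E (dm V) = X" for X
    using that by (metis E_mult_E min.absorb1 le_add1 mult.assoc)
  have yp: "ypow ?S i = ypow V i + ?i * ypow N i * tp ?i" for i
  proof (induction i)
    case 0
    then show ?case using e by (simp add: s mult.assoc)
  next
    case (Suc i)
    have "ypow ?S (Suc i) = nl V * ypow V i + nl V * (?i * (ypow N i * tp ?i)) + (?i * (nl N * (tp ?i * ypow V i)) +
        ?i * (nl N * (tp ?i * (?i * (ypow N i * tp ?i)))))"
      by (simp only: ypow_Suc Suc s distrib_left distrib_right mult.assoc add_ac)
    then show ?case using V0[OF VD(4)] V1[OF ypow_E(1)[OF V]] e'(1) ypow_E(1)[OF N, THEN assoc_eq]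
      by (simp add: ypow_Suc mult.assoc)
  qed
  show "obj ?S"
    unfolding obj_def
  proof (intro conjI ballI)
    show "ac ?S \<one> = E (dm ?S)" using VD ND e by (simp add: s mult.assoc)
    show "E (dm ?S) * nl ?S = nl ?S" using VD EV e' by (simp add: s distrib_left mult.assoc)
    show "nl ?S * E (dm ?S) = nl ?S" using VD VE e by (simp add: s distrib_right mult.assoc)
    show "ypow ?S n = 0" using VD ND by (simp add: yp)
  next
    fix h assume h: "h \<in> carrier G"
    note z = V0[OF VD(4)] V0[OF VD(8)[OF h]] V1[OF VD(3)] V1[OF VD(7)[OF h]]
    show "ac ?S h * nl ?S = smul (\<alpha> h) (nl ?S * ac ?S h)"
      using z e' VD(5)[OF h] ND(5)[OF h] ND(5)[OF h, THEN assoc_eq] ND(3,7)[THEN assoc_eq] h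
      by (simp add: s distrib_left distrib_right mult.assoc fm.scale_right_distrib)
    fix k assume k: "k \<in> carrier G"
    note z = V0[OF VD(8)[OF h]] V1[OF VD(7)[OF k]]
    show "ac ?S (h \<otimes> k) = ac ?S h * ac ?S k"
      using z e' VD(2)[OF h k] ND(2)[OF h k] ND(7)[THEN assoc_eq] h k
      by (simp add: s distrib_left distrib_right mult.assoc)
  qed
  note ss = s distrib_left distrib_right mult.assoc min_def
  have "mor (E (dm V)) V ?S" unfolding mor_def using VD e by (simp add: ss)
  moreover have "mor (E (dm V)) ?S V" unfolding mor_def using VD e(6)[THEN assoc_eq] by (simp add: ss)
  moreover have "mor ?i N ?S" unfolding mor_def using V0 VD ND e by (simp add: ss)
  moreover have "mor (tp ?i) ?S N" unfolding mor_def
    by (simp add: ss V1[OF VD(3)] V1[OF VD(7)] e e' ND(3,7)[THEN assoc_eq])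
  ultimately have "mor (E (dm V)) V ?S" "mor (E (dm V)) ?S V" "mor ?i N ?S" "mor (tp ?i) ?S N" by blast+
  then show "dsum ?S V N"
    unfolding dsum_def using e
    by (intro exI[of _ "E (dm V)"] exI[of _ ?i] exI[of _ "tp ?i"] conjI) (simp_all add: s)
qed

lemma dsum_iso_left: assumes "iso V V'" "dsum V' N N'" shows "dsum V N N'"
proof -
  obtain f f' where f: "mor f V' V" "mor f' V V'" "f' * f = E (dm V')" "f * f' = E (dm V)"
    using assms(1) unfolding iso_def by blast
  obtain \<iota> \<pi> \<iota>' \<pi>' where m: "mor \<iota> N V'" "mor \<pi> V' N" "mor \<iota>' N' V'" "mor \<pi>' V' N'"
    and e: "\<pi> * \<iota> = E (dm N)" "\<pi>' * \<iota>' = E (dm N')" "\<iota> * \<pi> + \<iota>' * \<pi>' = E (dm V')"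
    using assms(2) unfolding dsum_def by blast
  show ?thesis unfolding dsum_def
  proof (intro exI conjI)
    show "mor (f * \<iota>) N V" "mor (\<pi> * f') V N" "mor (f * \<iota>') N' V" "mor (\<pi>' * f') V N'"
      using m f mor_comp by blast+
    show "\<pi> * f' * (f * \<iota>) = E (dm N)" "\<pi>' * f' * (f * \<iota>') = E (dm N')"
      using f(3)[THEN assoc_eq] morD(1)[OF m(1)] morD(1)[OF m(3)] e by (simp_all add: mult.assoc)
    have "f * \<iota> * (\<pi> * f') + f * \<iota>' * (\<pi>' * f') = f * (\<iota> * \<pi> + \<iota>' * \<pi>') * f'"
      by (simp add: distrib_left distrib_right mult.assoc)
    then show "f * \<iota> * (\<pi> * f') + f * \<iota>' * (\<pi>' * f') = E (dm V)" using e f morD(2)[OF f(1)] by simp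
  qed
qed

lemma dsum_iso_cong:
  assumes "dsum V A N" "dsum V' A N'" "iso N N'"
  shows "iso V V'"
proof -
  obtain \<iota> \<pi> \<iota>' \<pi>' where m: "mor \<iota> A V" "mor \<pi> V A" "mor \<iota>' N V" "mor \<pi>' V N"
    and e: "\<pi> * \<iota> = E (dm A)" "\<pi>' * \<iota>' = E (dm N)" "\<iota> * \<pi> + \<iota>' * \<pi>' = E (dm V)"
    using assms(1) unfolding dsum_def by blast
  obtain j p j' p' where m': "mor j A V'" "mor p V' A" "mor j' N' V'" "mor p' V' N'"
    and e': "p * j = E (dm A)" "p' * j' = E (dm N')" "j * p + j' * p' = E (dm V')"
    using assms(2) unfolding dsum_def by blast
  obtain f f' where f: "mor f N' N" "mor f' N N'" "f' * f = E (dm N')" "f * f' = E (dm N)"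
    using assms(3) unfolding iso_def by blast
  \<comment> \<open>The mixed products are not mentioned in \<open>dsum\<close>; they vanish because
    multiplying the resolution of the identity by one projection leaves no room for the other
    summand.\<close>
  have orth: "\<pi> * \<iota>' = 0 \<and> \<pi>' * \<iota> = 0"
    if m: "mor \<iota> A V" "mor \<pi> V A" "mor \<iota>' N V" "mor \<pi>' V N"
      and e: "\<pi> * \<iota> = E (dm A)" "\<pi>' * \<iota>' = E (dm N)" "\<iota> * \<pi> + \<iota>' * \<pi>' = E (dm V)"
    for \<iota> \<pi> \<iota>' \<pi>' A V N
  proof -
    have "\<pi> * E (dm V) = \<pi> * \<iota> * \<pi> + \<pi> * \<iota>' * \<pi>'" by (simp add: e(3)[symmetric] distrib_left mult.assoc)
    then have "\<pi> * \<iota>' * \<pi>' = 0" using morD[OF m(2)] e(1) by simp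
    then have "\<pi> * \<iota>' * (\<pi>' * \<iota>') = 0" by (simp flip: mult.assoc)
    moreover have "\<pi>' * E (dm V) = \<pi>' * \<iota> * \<pi> + \<pi>' * \<iota>' * \<pi>'" by (simp add: e(3)[symmetric] distrib_left mult.assoc)
    then have "\<pi>' * \<iota> * \<pi> = 0" using morD[OF m(4)] e(2) by simp
    then have "\<pi>' * \<iota> * (\<pi> * \<iota>) = 0" by (simp flip: mult.assoc)
    ultimately show ?thesis using e morD(2)[OF m(1)] morD(2)[OF m(3)] by (simp add: mult.assoc)
  qed
  note o = orth[OF m e] orth[OF m' e']
  define F where "F = \<iota> * p + \<iota>' * f * p'"
  define F' where "F' = j * \<pi> + j' * f' * \<pi>'"
  have "mor (\<iota> * p) V' V" "mor (\<iota>' * f * p') V' V" "mor (j * \<pi>) V V'" "mor (j' * f' * \<pi>') V V'"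
    using m m' f by (meson mor_comp)+
  then have FF: "mor F V' V" "mor F' V V'"
    unfolding F_def F'_def mor_def by (simp_all add: distrib_left distrib_right)
  have "F' * F = j * (\<pi> * \<iota>) * p + j * (\<pi> * \<iota>') * f * p' + (j' * f' * (\<pi>' * \<iota>) * p + j' * f' * (\<pi>' * \<iota>') * f * p')"
    unfolding F_def F'_def by (simp add: distrib_left distrib_right mult.assoc)
  also have "\<dots> = j * p + j' * (f' * f) * p'"
    using o e morD(2)[OF m'(1)] morD(2)[OF f(2)] by (simp add: mult.assoc)
  also have "\<dots> = E (dm V')" using e'(3) f(3) morD(2)[OF m'(3)] by simp
  finally have 1: "F' * F = E (dm V')" .
  have "F * F' = \<iota> * (p * j) * \<pi> + \<iota> * (p * j') * f' * \<pi>' + (\<iota>' * f * (p' * j) * \<pi> + \<iota>' * f * (p' * j') * f' * \<pi>')"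
    unfolding F_def F'_def by (simp add: distrib_left distrib_right mult.assoc)
  also have "\<dots> = \<iota> * \<pi> + \<iota>' * (f * f') * \<pi>'"
    using o e' morD(2)[OF m(1)] morD(2)[OF f(1)] by (simp add: mult.assoc)
  also have "\<dots> = E (dm V)" using e(3) f(4) morD(2)[OF m(3)] by simp
  finally show ?thesis unfolding iso_def using 1 FF by blast
qed

inductive decomp :: "'a obj \<Rightarrow> ('a obj \<times> nat) list \<Rightarrow> bool" where
  decomp_Nil: "obj V \<Longrightarrow> dm V = 0 \<Longrightarrow> decomp V []"
| decomp_Cons: "obj V \<Longrightarrow> W \<in> Irr \<Longrightarrow> 0 < k \<Longrightarrow> k \<le> n \<Longrightarrow> dsum V (tens W (Mk k)) N \<Longrightarrow> decomp N xs \<Longrightarrow>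
    decomp V ((W, k) # xs)"

lemma decomp_obj: "decomp V xs \<Longrightarrow> obj V"
  by (induction rule: decomp.induct) auto

lemma iso_dm: "iso V N \<Longrightarrow> dm V = dm N"
proof -
  assume "iso V N"
  then obtain \<iota> \<pi> where "\<pi> * \<iota> = E (dm N)" "\<iota> * \<pi> = E (dm V)" unfolding iso_def by blast
  then have "complex_of_nat (dm V) = of_nat (dm N)" using tr_mult_commute[of \<iota> \<pi>] by simp
  then show ?thesis by (simp only: of_nat_eq_iff)
qed

lemma dsum_iso_summand:
  assumes s: "dsum V N N'" and i: "iso N P" and o: "obj V" "obj P"
  obtains N'' where "obj N''" "dsum V P N''"
proof -
  obtain \<iota> \<pi> where m: "mor \<iota> N V" "mor \<pi> V N" and e: "\<pi> * \<iota> = E (dm N)"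
    using s unfolding dsum_def by blast
  obtain f f' where f: "mor f P N" "mor f' N P" "f' * f = E (dm P)"
    using i unfolding iso_def by blast
  have "f' * \<pi> * (\<iota> * f) = E (dm P)" using e[THEN assoc_eq] morD(1)[OF f(1)] f(3) by (simp add: mult.assoc)
  then show thesis using dsum_retract[OF o(1) mor_comp[OF f(1) m(1)] mor_comp[OF m(2) f(2)]] that by metis
qed

lemma decomp_exists: "obj V \<Longrightarrow> \<exists>xs. decomp V xs"
proof (induction "dm V" arbitrary: V rule: less_induct)
  case less
  show ?case
  proof (cases "dm V = 0")
    case False
    then obtain W k N where W: "indec W" "0 < k" "k \<le> n" "dsum V (tens W (Mk k)) N"
      using uniserial_summand[OF less.prems] by blast
    let ?W = "irr_rep W"
    note r = irr_rep[OF W(1)]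
    have "iso (tens W (Mk k)) (tens ?W (Mk k))" using iso_tens_left[OF obj_Mk[OF W(3)] r(2)] .
    then obtain N' where N': "obj N'" "dsum V (tens ?W (Mk k)) N'"
      using dsum_iso_summand[OF W(4)] less.prems obj_tens[OF Irr_obj[OF r(3)] obj_Mk[OF W(3)]] by metis
    have "0 < dm (tens ?W (Mk k))" using r(1) W(2) by (simp add: indec_def)
    then have "dm N' < dm V" using dsum_dm[OF N'(2)] by linarith
    then obtain xs where "decomp N' xs" using less.hyps N'(1) by blast
    then show ?thesis using decomp_Cons[OF less.prems r(3) W(2,3) N'(2)] by blast
  qed (use decomp_Nil less.prems in blast)
qed

text \<open>Every entry of the list splits off, not only its head. This allows a summand found in
  one module to be removed from another one.\<close>

lemma decomp_retract:
  assumes "decomp V xs" "(W, k) \<in> set xs"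
  shows "\<exists>\<iota> \<pi>. mor \<iota> (tens W (Mk k)) V \<and> mor \<pi> V (tens W (Mk k)) \<and> \<pi> * \<iota> = E (dm (tens W (Mk k)))"
  using assms
proof (induction rule: decomp.induct)
  case (decomp_Cons V W' k' N xs)
  show ?case
  proof (cases "(W, k) = (W', k')")
    case True
    then show ?thesis using decomp_Cons.hyps(5) unfolding dsum_def by blast
  next
    case False
    then obtain \<iota> \<pi> where 1: "mor \<iota> (tens W (Mk k)) N" "mor \<pi> N (tens W (Mk k))" "\<pi> * \<iota> = E (dm (tens W (Mk k)))"
      using decomp_Cons by auto
    obtain j p where 2: "mor j N V" "mor p V N" "p * j = E (dm N)"
      using decomp_Cons.hyps(5) unfolding dsum_def by blast
    have "\<pi> * p * (j * \<iota>) = E (dm (tens W (Mk k)))"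
      using 2(3)[THEN assoc_eq] 1 morD(1)[OF 1(1)] by (simp add: mult.assoc)
    then show ?thesis using mor_comp[OF 1(1) 2(1)] mor_comp[OF 2(2) 1(2)] by blast
  qed
qed simp

text \<open>On \<open>\<Oplus> W\<^sub>k \<otimes> M\<^sub>k\<close> the value of \<open>mult_char\<close> at \<open>k\<close> is the character of \<open>W\<^sub>k\<close>: the quotient
  \<open>y\<^sup>i V / y\<^sup>i\<^sup>+\<^sup>1 V\<close> is \<open>\<alpha>\<^sup>i\<close> times the sum of the \<open>W\<^sub>k\<close> with \<open>k > i\<close>.\<close>

definition trace_diff :: "(nat \<Rightarrow> 'a \<Rightarrow> complex) \<Rightarrow> nat \<Rightarrow> 'a \<Rightarrow> complex" where
  "trace_diff t k h = \<chi> h ^ (k - 1) * (t (k - 1) h - t k h) - \<chi> h ^ k * (t k h - t (Suc k) h)"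

definition mult_char :: "'a obj \<Rightarrow> nat \<Rightarrow> 'a \<Rightarrow> complex" where
  "mult_char V = trace_diff (image_trace V)"

lemma mult_char_linear:
  assumes "\<And>i. image_trace V i h = a * image_trace N i h + b * image_trace N' i h"
  shows "mult_char V k h = a * mult_char N k h + b * mult_char N' k h"
  by (simp add: mult_char_def trace_diff_def assms algebra_simps)

lemma mult_char_dsum:
  assumes "obj V" "obj N" "obj N'" "dsum V N N'" "h \<in> carrier G"
  shows "mult_char V k h = mult_char N k h + mult_char N' k h"
  using mult_char_linear[of V h 1 N 1 N'] image_trace_dsum[OF assms] by simp

lemma mult_char_zero: assumes "obj V" "dm V = 0" "h \<in> carrier G" shows "mult_char V k h = 0"
proof -
  have "ac V h = 0" using objD(7)[OF assms(1,3)] assms(2) by simp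
  then have "image_trace V i h = 0" for i by (simp add: image_trace_def)
  then show ?thesis by (simp add: mult_char_def trace_diff_def)
qed

lemma mult_char_tens_pure_left:
  "pure W \<Longrightarrow> obj V \<Longrightarrow> h \<in> carrier G \<Longrightarrow> mult_char (tens W V) k h = gchar W h * mult_char V k h"
  using mult_char_linear[of "tens W V" h "gchar W h" V 0 V] image_trace_tens_pure_left by simp

lemma mult_char_Mk:
  assumes "j \<le> n" "h \<in> carrier G" "0 < k"
  shows "mult_char (Mk j) k h = (if j = k then 1 else 0)"
proof -
  \<comment> \<open>Layer i of \<open>Mk j\<close> is one-dimensional with character \<alpha>^i for
    i < j and zero otherwise. After untwisting by \<chi>^i the layers form a step function of i, and
    \<open>trace_diff\<close> locates the step.\<close>
  have 1: "\<chi> h ^ i * (image_trace (Mk j) i h - image_trace (Mk j) (Suc i) h) = (if i < j then 1 else 0)" for i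
  proof (cases "i < j")
    case True
    have "image_trace (Mk j) i h = \<alpha> h ^ i + image_trace (Mk j) (Suc i) h"
      using assms True by (simp add: image_trace_Mk sum.atLeast_Suc_lessThan)
    then show ?thesis using True alpha_chi(2)[OF assms(2)] by (simp flip: power_mult_distrib)
  qed (use assms in \<open>simp add: image_trace_Mk\<close>)
  have "Suc (k - 1) = k" using assms by simp
  then show ?thesis using 1[of "k - 1"] 1[of k] by (auto simp: mult_char_def trace_diff_def)
qed

lemma mult_char_pure:
  assumes W: "pure W" and h: "h \<in> carrier G" and k: "0 < k"
  shows "mult_char W k h = (if k = 1 then gchar W h else 0)"
proof -
  have "generalized_inverse_of (ypow W (Suc i)) 0" for i using W by (simp add: generalized_inverse_of_def ypow_Suc pure_def)
  then have 1: "image_trace W (Suc i) h = 0" for i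
    using image_trace_eq[OF pure_obj[OF W] h, of "Suc i" 0] by simp
  then have 2: "image_trace W i h = (if i = 0 then gchar W h else 0)" for i
    using image_trace_0[OF pure_obj[OF W] h] by (cases i) auto
  show ?thesis using k by (auto simp: mult_char_def trace_diff_def 2)
qed

lemma mult_char_decomp:
  assumes "decomp V xs" "h \<in> carrier G" "0 < k" "k \<le> n" "finite S" "fst ` set xs \<subseteq> S"
  shows "mult_char V k h = (\<Sum>W\<in>S. of_nat (count_list xs (W, k)) * gchar W h)"
  using assms
proof (induction rule: decomp.induct)
  case (decomp_Cons V W j N xs)
  have "mult_char V k h = mult_char (tens W (Mk j)) k h + mult_char N k h"
    using decomp_Cons obj_tens Irr_obj obj_Mk decomp_obj by (intro mult_char_dsum) auto
  also have "mult_char (tens W (Mk j)) k h = (\<Sum>W'\<in>S. if W' = W then (if j = k then gchar W h else 0) else 0)"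
    using decomp_Cons Irr_pure obj_Mk by (simp add: mult_char_tens_pure_left mult_char_Mk)
  also have "mult_char N k h = (\<Sum>W\<in>S. of_nat (count_list xs (W, k)) * gchar W h)"
    using decomp_Cons by simp
  finally show ?case
    unfolding sum.distrib[symmetric] by - (erule trans, rule sum.cong, auto simp: algebra_simps)
qed (simp add: mult_char_zero)

lemma decomp_Irr: "decomp V xs \<Longrightarrow> set xs \<subseteq> Irr \<times> {1..n}"
  by (induction rule: decomp.induct) auto

lemma decomp_count:
  assumes "decomp V xs" "decomp V' xs'" "0 < k" "k \<le> n" "W \<in> Irr"
    and eq: "\<And>h. h \<in> carrier G \<Longrightarrow> mult_char V k h = mult_char V' k h"
  shows "count_list xs (W, k) = count_list xs' (W, k)"
proof -
  define S where "S = insert W (fst ` set xs \<union> fst ` set xs')"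
  have S: "finite S" "fst ` set xs \<subseteq> S" "fst ` set xs' \<subseteq> S" "S \<subseteq> Irr" "W \<in> S"
    using decomp_Irr[OF assms(1)] decomp_Irr[OF assms(2)] assms(5) by (auto simp: S_def)
  have "of_nat (count_list xs (W, k)) - of_nat (count_list xs' (W, k)) = (0 :: complex)"
  proof (rule Irr_independent[OF S(1,4) _ S(5), where c = "\<lambda>W. of_nat (count_list xs (W, k)) - of_nat (count_list xs' (W, k))"])
    fix h assume h: "h \<in> carrier G"
    show "(\<Sum>W\<in>S. (of_nat (count_list xs (W, k)) - of_nat (count_list xs' (W, k))) * gchar W h) = 0"
      using eq[OF h] mult_char_decomp[OF assms(1) h assms(3,4) S(1,2)] mult_char_decomp[OF assms(2) h assms(3,4) S(1,3)]
      by (simp add: left_diff_distrib sum_subtractf)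
  qed
  then have "complex_of_nat (count_list xs (W, k)) = of_nat (count_list xs' (W, k))" by simp
  then show ?thesis by (simp only: of_nat_eq_iff)
qed

text \<open>Equal characters force equal multiplicities, so the first summand in a decomposition of
  \<open>V\<close> also occurs in \<open>V'\<close>. It is split off from both, the complements have
  equal invariants by additivity, and induction gives an isomorphism of the complements.\<close>

theorem mult_char_complete:
  assumes "obj V" "obj V'"
    and "\<And>k h. 0 < k \<Longrightarrow> k \<le> n \<Longrightarrow> h \<in> carrier G \<Longrightarrow> mult_char V k h = mult_char V' k h"
  shows "iso V V'"
proof -
  obtain xs where "decomp V xs" using decomp_exists[OF assms(1)] by blast
  then show ?thesis using assms(2,3)
  proof (induction arbitrary: V' rule: decomp.induct)
    case (decomp_Nil V)
    obtain xs' where xs': "decomp V' xs'" using decomp_exists[OF decomp_Nil(3)] by blast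
    have "xs' = []"
    proof (rule ccontr)
      assume "xs' \<noteq> []"
      then obtain W k where Wk: "(W, k) \<in> set xs'" by (cases xs') auto
      then have "count_list [] (W, k) = count_list xs' (W, k)"
        using decomp_Irr[OF xs'] decomp_Nil
        by (intro decomp_count[OF decomp.decomp_Nil[of V] xs']) auto
      then show False using Wk by (simp add: count_list_0_iff)
    qed
    then have "dm V' = 0" using xs' by (auto elim: decomp.cases)
    then show ?case using decomp_Nil(2) unfolding iso_def mor_def
      by (intro exI[of _ 0]) simp
  next
    case (decomp_Cons V W k N xs)
    note D = decomp.decomp_Cons[OF decomp_Cons.hyps]
    obtain xs' where xs': "decomp V' xs'" using decomp_exists[OF decomp_Cons.prems(1)] by blast
    have "count_list ((W, k) # xs) (W, k) = count_list xs' (W, k)"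
      using decomp_Cons by (intro decomp_count[OF D xs']) auto
    then have "count_list xs' (W, k) \<noteq> 0" by simp
    then have "(W, k) \<in> set xs'" by (simp add: count_list_0_iff)
    then obtain N' where N': "obj N'" "dsum V' (tens W (Mk k)) N'"
      using decomp_retract[OF xs'] dsum_retract[OF decomp_Cons.prems(1)] by metis
    have o: "obj (tens W (Mk k))" "obj N"
      using decomp_Cons.hyps Irr_obj obj_Mk obj_tens decomp_obj by auto
    have "mult_char N j h = mult_char N' j h" if "0 < j" "j \<le> n" "h \<in> carrier G" for j h
      using decomp_Cons.prems(2)[OF that] mult_char_dsum[OF decomp_Cons.hyps(1) o decomp_Cons.hyps(5) that(3), of j]
        mult_char_dsum[OF decomp_Cons.prems(1) o(1) N' that(3), of j] by simp
    then have "iso N N'" using decomp_Cons.IH N'(1) by blast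
    then show ?case using dsum_iso_cong[OF decomp_Cons.hyps(5) N'(2)] by blast
  qed
qed

end

context pointed_datum
begin

subsection \<open>Multiplicativity of the invariant\<close>

text \<open>The factor \<open>z - (1 + a)\<close> expresses \<open>M\<^sub>2 \<otimes> M\<^sub>n = (1 + \<alpha>) M\<^sub>n\<close>.\<close>

definition modulus :: "complex \<Rightarrow> complex poly" where
  "modulus a = [:- (1 + a), 1:] * fib a n"

text \<open>The value 0 off \<open>carrier G\<close> makes equality of these functions the same as
  equality on the group, so the functions themselves can serve as invariants.\<close>

definition Phi :: "'a obj \<Rightarrow> 'a \<Rightarrow> complex poly" where
  "Phi V h = (if h \<in> carrier G then \<Sum>k = 1..n. Polynomial.smult (mult_char V k h) (fib (\<alpha> h) k) else 0)"

lemma Phi_eq: "h \<in> carrier G \<Longrightarrow> Phi V h = (\<Sum>k = 1..n. Polynomial.smult (mult_char V k h) (fib (\<alpha> h) k))"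
  by (simp add: Phi_def)

lemma degree_modulus: "degree (modulus a) = n" and modulus_nonzero: "modulus a \<noteq> 0"
proof -
  obtain m where m: "n = Suc m" using n_ge_2 by (cases n) auto
  have f: "fib a n \<noteq> 0" using fib_lead[of a m] by (auto simp: m)
  show "degree (modulus a) = n"
    unfolding modulus_def using f fib_degree[of a m] by (subst degree_mult_eq) (auto simp: m)
  then show "modulus a \<noteq> 0" using n_ge_2 by auto
qed

lemma degree_Phi: "degree (Phi V h) < n"
proof -
  obtain m where m: "n = Suc m" using n_ge_2 by (cases n) auto
  have "degree (Phi V h) \<le> m"
    unfolding Phi_def
  proof (cases "h \<in> carrier G")
    case True
    have "degree (Polynomial.smult (mult_char V k h) (fib (\<alpha> h) k)) \<le> m" if k: "k \<in> {1..n}" for k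
    proof -
      obtain i where "k = Suc i" using k by (cases k) auto
      then show ?thesis using fib_degree[of "\<alpha> h" i] k degree_smult_le[of "mult_char V k h" "fib (\<alpha> h) k"] m by simp
    qed
    then show "degree (if h \<in> carrier G then \<Sum>k = 1..n. Polynomial.smult (mult_char V k h) (fib (\<alpha> h) k) else 0) \<le> m"
      unfolding if_P[OF True] by (intro degree_sum_le) simp_all
  qed simp
  then show ?thesis using m by simp
qed

lemma Phi_mod: "Phi V h mod modulus (\<alpha> h) = Phi V h"
  using degree_Phi degree_modulus by (intro mod_poly_less) simp

lemma smult_sum_right: "Polynomial.smult c (\<Sum>x\<in>S. f x) = (\<Sum>x\<in>S. Polynomial.smult c (f x))"
  by (induction S rule: infinite_finite_induct) (simp_all add: smult_add_right)

lemma Phi_linear: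
  assumes "\<And>i. image_trace V i h = a * image_trace N i h + b * image_trace N' i h"
  shows "Phi V h = Polynomial.smult a (Phi N h) + Polynomial.smult b (Phi N' h)"
  using mult_char_linear[OF assms]
  by (simp add: Phi_def smult_add_left sum.distrib smult_sum_right mult.commute)

lemma Phi_dsum:
  assumes "obj V" "obj N" "obj N'" "dsum V N N'"
  shows "Phi V h = Phi N h + Phi N' h"
proof (cases "h \<in> carrier G")
  case True
  then show ?thesis using Phi_linear[of V h 1 N 1 N'] image_trace_dsum[OF assms] by simp
qed (simp add: Phi_def)

lemma Phi_zero: "obj V \<Longrightarrow> dm V = 0 \<Longrightarrow> Phi V h = 0"
  using mult_char_zero by (simp add: Phi_def)

lemma Phi_tens_pure_left:
  "pure W \<Longrightarrow> obj V \<Longrightarrow> h \<in> carrier G \<Longrightarrow> Phi (tens W V) h = Polynomial.smult (gchar W h) (Phi V h)"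
  using Phi_linear[of "tens W V" h "gchar W h" V 0 V] image_trace_tens_pure_left by simp

lemma Phi_tens_pure_right:
  "pure W \<Longrightarrow> obj V \<Longrightarrow> h \<in> carrier G \<Longrightarrow> Phi (tens V W) h = Polynomial.smult (gchar W h) (Phi V h)"
  using Phi_linear[of "tens V W" h "gchar W h" V 0 V] image_trace_tens_pure_right by simp

lemma Phi_Mk: assumes "k \<le> n" "h \<in> carrier G" shows "Phi (Mk k) h = fib (\<alpha> h) k"
proof -
  have "Phi (Mk k) h = (\<Sum>j = 1..n. if j = k then fib (\<alpha> h) k else 0)"
    unfolding Phi_eq[OF assms(2)] using assms by (intro sum.cong) (auto simp: mult_char_Mk)
  then show ?thesis using assms by (cases k) auto
qed

lemma Phi_pure: assumes "pure W" "h \<in> carrier G" shows "Phi W h = [:gchar W h:]"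
proof -
  have "Phi W h = (\<Sum>j = 1..n. if j = 1 then [:gchar W h:] else 0)"
    unfolding Phi_eq[OF assms(2)] using assms by (intro sum.cong) (auto simp: mult_char_pure)
  then show ?thesis using n_ge_2 by simp
qed

lemma Phi_complete:
  assumes "obj V" "obj V'" "\<And>h. h \<in> carrier G \<Longrightarrow> Phi V h = Phi V' h"
  shows "iso V V'"
proof (rule mult_char_complete[OF assms(1,2)])
  fix k h assume k: "0 < k" "k \<le> n" and h: "h \<in> carrier G"
  have "(\<Sum>k = 1..n. Polynomial.smult (mult_char V k h - mult_char V' k h) (fib (\<alpha> h) k)) = 0"
    using assms(3)[OF h] by (simp add: Phi_eq[OF h] smult_diff_left sum_subtractf)
  then have "mult_char V k h - mult_char V' k h = 0" by (rule fib_independent) (use k in auto)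
  then show "mult_char V k h = mult_char V' k h" by simp
qed

text \<open>Regarding an isomorphism as a splitting with zero complement makes invariance under
  isomorphism a case of additivity.\<close>

lemma iso_dsum: assumes "iso V V'" "obj V" "obj V'" shows "dsum V V' (Mk 0)"
proof -
  obtain \<iota> \<pi> where "mor \<iota> V' V" "mor \<pi> V V'" "\<pi> * \<iota> = E (dm V')" "\<iota> * \<pi> = E (dm V)"
    using assms(1) unfolding iso_def by blast
  moreover have "mor 0 (Mk 0) V" "mor 0 V (Mk 0)" by (simp_all add: mor_def)
  ultimately show ?thesis unfolding dsum_def
    by (intro exI[of _ \<iota>] exI[of _ \<pi>] exI[of _ 0] conjI) simp_all
qed

lemma Phi_iso: assumes "iso V V'" "obj V" "obj V'" shows "Phi V h = Phi V' h"
  using Phi_dsum[OF assms(2,3) obj_Mk iso_dsum[OF assms]] Phi_zero[OF obj_Mk] by simp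

text \<open>The left factor ranges over all modules, so the property passes to tensor products by
  associativity and to a summand whose complement already has it.\<close>

definition multiplicative :: "'a obj \<Rightarrow> bool" where
  "multiplicative N \<longleftrightarrow> obj N \<and> (\<forall>M. obj M \<longrightarrow> (\<forall>h\<in>carrier G.
     Phi (tens M N) h = (Phi M h * Phi N h) mod modulus (\<alpha> h)))"

lemma multiplicativeD:
  "multiplicative N \<Longrightarrow> obj M \<Longrightarrow> h \<in> carrier G \<Longrightarrow> Phi (tens M N) h = (Phi M h * Phi N h) mod modulus (\<alpha> h)"
  by (simp add: multiplicative_def)

lemma multiplicative_pure: assumes "pure W" shows "multiplicative W"
  using assms Phi_mod by (auto simp: multiplicative_def pure_obj Phi_tens_pure_right Phi_pure mod_smult_left)

lemma multiplicative_tens: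
  assumes N: "multiplicative N" and N': "multiplicative N'"
  shows "multiplicative (tens N N')"
proof -
  have o: "obj N" "obj N'" using assms by (auto simp: multiplicative_def)
  have "Phi (tens M (tens N N')) h = (Phi M h * Phi (tens N N') h) mod modulus (\<alpha> h)"
    if M: "obj M" and h: "h \<in> carrier G" for M h
  proof -
    have "Phi (tens M (tens N N')) h = (Phi M h * Phi N h mod modulus (\<alpha> h) * Phi N' h) mod modulus (\<alpha> h)"
      using multiplicativeD[OF N' obj_tens[OF M o(1)] h] multiplicativeD[OF N M h] by (simp add: tens_assoc)
    also have "\<dots> = (Phi M h * (Phi N h * Phi N' h mod modulus (\<alpha> h))) mod modulus (\<alpha> h)"
      by (simp add: mod_simps mult.assoc)
    finally show ?thesis using multiplicativeD[OF N' o(1) h] by simp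
  qed
  then show ?thesis using obj_tens o by (simp add: multiplicative_def)
qed

text \<open>Both sides are additive in \<open>M\<close>, and a pure left factor only scales them by
  its character; a decomposition of \<open>M\<close> thus reduces the claim to the uniserial
  modules.\<close>

lemma Phi_tens_eqI:
  assumes "decomp M xs" and N: "obj N" and h: "h \<in> carrier G"
    and base: "\<And>k. 0 < k \<Longrightarrow> k \<le> n \<Longrightarrow> Phi (tens (Mk k) N) h = (fib (\<alpha> h) k * f) mod modulus (\<alpha> h)"
  shows "Phi (tens M N) h = (Phi M h * f) mod modulus (\<alpha> h)"
  using assms(1)
proof (induction rule: decomp.induct)
  case (decomp_Nil V)
  then show ?case using Phi_zero[of V h] Phi_zero[OF obj_tens[OF _ N], of V h] by simp
next
  case (decomp_Cons V W k N' xs)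
  have o: "obj N'" "obj W" "pure W" "obj (Mk k)" "obj (tens W (Mk k))"
    using decomp_Cons decomp_obj Irr_obj Irr_pure obj_Mk obj_tens by auto
  have "Phi (tens V N) h = Phi (tens (tens W (Mk k)) N) h + Phi (tens N' N) h"
    by (rule Phi_dsum) (use o decomp_Cons.hyps N in \<open>auto intro: obj_tens dsum_tens_left\<close>)
  also have "Phi (tens (tens W (Mk k)) N) h = Polynomial.smult (gchar W h) (Phi (tens (Mk k) N) h)"
    unfolding tens_assoc by (rule Phi_tens_pure_left) (use o N h obj_tens in auto)
  also have "\<dots> = (Phi (tens W (Mk k)) h * f) mod modulus (\<alpha> h)"
    using decomp_Cons.hyps o h by (simp add: base Phi_tens_pure_left Phi_Mk mod_smult_left)
  finally show ?case
    using Phi_dsum[OF decomp_Cons.hyps(1) o(5) o(1) decomp_Cons.hyps(5), of h] decomp_Cons.IH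
    by (simp add: distrib_right poly_mod_add_left)
qed

lemma pure_alpha: "pure (one_obj \<alpha>)"
  by (rule pure_one_obj) (simp_all add: alpha_mult)

lemma Phi_Mk_M2:
  assumes "0 < k" "k \<le> n" "h \<in> carrier G"
  shows "Phi (tens (Mk k) (Mk 2)) h = (fib (\<alpha> h) k * [:0, 1:]) mod modulus (\<alpha> h)"
proof (cases "k = n")
  case True
  have "[:0, 1:] * fib (\<alpha> h) n = modulus (\<alpha> h) + Polynomial.smult (1 + \<alpha> h) (fib (\<alpha> h) n)"
    by (simp add: modulus_def smult_add_left[symmetric])
  then have "(fib (\<alpha> h) k * [:0, 1:]) mod modulus (\<alpha> h) = Polynomial.smult (1 + \<alpha> h) (fib (\<alpha> h) n) mod modulus (\<alpha> h)"
    using True by (simp add: mult.commute)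
  also have "\<dots> = Polynomial.smult (1 + \<alpha> h) (fib (\<alpha> h) n)"
    using Phi_mod[of "Mk n" h] assms by (simp add: Phi_Mk mod_smult_left)
  finally show ?thesis
    using Phi_linear[of "tens (Mk n) (Mk 2)" h "1 + \<alpha> h" "Mk n" 0 "Mk n"] image_trace_Mn_M2[OF assms(3)] True assms
    by (simp add: Phi_Mk)
next
  case False
  then have k: "k < n" using assms by simp
  obtain j where j: "k = Suc j" using assms by (cases k) auto
  have "Phi (tens (Mk k) (Mk 2)) h = fib (\<alpha> h) (Suc k) + Polynomial.smult (\<alpha> h) (fib (\<alpha> h) (k - 1))"
    using Phi_linear[of "tens (Mk k) (Mk 2)" h 1 "Mk (Suc k)" "\<alpha> h" "Mk (k - 1)"]
      image_trace_Mk_M2_less[OF assms(1) k assms(3)] assms k by (simp add: Phi_Mk)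
  then have e: "Phi (tens (Mk k) (Mk 2)) h = fib (\<alpha> h) k * [:0, 1:]" by (simp add: j)
  show ?thesis using Phi_mod[of "tens (Mk k) (Mk 2)" h] unfolding e by simp
qed

lemma multiplicative_M2: "multiplicative (Mk 2)"
proof -
  have "fib (\<alpha> h) 2 = [:0, 1:]" for h by (simp add: numeral_2_eq_2)
  then have "Phi (Mk 2) h = [:0, 1:]" if "h \<in> carrier G" for h using n_ge_2 that by (simp add: Phi_Mk)
  then show ?thesis
    unfolding multiplicative_def using obj_Mk n_ge_2 Phi_Mk_M2 Phi_tens_eqI decomp_exists by metis
qed

text \<open>The module and the external sum of the claimed summands have equal invariants, hence are
  isomorphic; no inclusion or projection is written down.\<close>

lemma dsum_Mk_M2:
  assumes k: "0 < k" "k < n"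
  shows "dsum (tens (Mk k) (Mk 2)) (Mk (Suc k)) (tens (one_obj \<alpha>) (Mk (k - 1)))"
proof -
  let ?N = "Mk (Suc k)" and ?N' = "tens (one_obj \<alpha>) (Mk (k - 1))"
  have o: "obj (tens (Mk k) (Mk 2))" "obj ?N" "obj ?N'"
    using k n_ge_2 obj_tens obj_Mk pure_obj[OF pure_alpha] by auto
  have "iso (tens (Mk k) (Mk 2)) (osum ?N ?N')"
  proof (rule Phi_complete[OF o(1) osum(1)[OF o(2,3)]])
    fix h assume h: "h \<in> carrier G"
    have "Phi (osum ?N ?N') h = Phi ?N h + Polynomial.smult (\<alpha> h) (Phi (Mk (k - 1)) h)"
      using Phi_dsum[OF osum(1)[OF o(2,3)] o(2,3) osum(2)[OF o(2,3)]] Phi_tens_pure_left[OF pure_alpha obj_Mk h] k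
      by simp
    then show "Phi (tens (Mk k) (Mk 2)) h = Phi (osum ?N ?N') h"
      using Phi_linear[of "tens (Mk k) (Mk 2)" h 1 "Mk (Suc k)" "\<alpha> h" "Mk (k - 1)"]
        image_trace_Mk_M2_less[OF k h] by simp
  qed
  then show ?thesis using dsum_iso_left osum(2)[OF o(2,3)] by blast
qed

text \<open>With k = j + 1, the module \<open>Mk k\<close> is a summand of
  \<open>tens (Mk j) (Mk 2)\<close> with complement the twist of \<open>Mk (j - 1)\<close> by
  \<alpha>. Both the product and the complement are multiplicative by induction, and the formula for
  \<open>Mk k\<close> is their difference.\<close>

lemma multiplicative_Mk: "k \<le> n \<Longrightarrow> multiplicative (Mk k)"
proof (induction k rule: less_induct)
  case (less k)
  consider "k = 0" | "k = 1" | j where "k = Suc j" "0 < j" by (cases k) auto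
  then show ?case
  proof cases
    case 1
    then show ?thesis using Phi_zero[OF obj_tens] Phi_zero[OF obj_Mk] obj_Mk by (simp add: multiplicative_def)
  next
    case 2
    have "pure (Mk 1)" using obj_Mk[of 1] n_ge_2 by (simp add: pure_def shift_down_eq_0)
    then show ?thesis using multiplicative_pure 2 by simp
  next
    case 3
    have j: "0 < j" "j < n" and mj: "multiplicative (Mk j)" "multiplicative (Mk (j - 1))"
      using 3 less by auto
    let ?A = "one_obj \<alpha>"
    have mA: "multiplicative (tens ?A (Mk (j - 1)))"
      using multiplicative_tens multiplicative_pure[OF pure_alpha] mj by blast
    have mM: "multiplicative (tens (Mk j) (Mk 2))" using multiplicative_tens mj multiplicative_M2 by blast
    have o: "obj (Mk k)" "obj (tens ?A (Mk (j - 1)))" "obj (tens (Mk j) (Mk 2))"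
      using less.prems obj_Mk mA mM by (auto simp: multiplicative_def)
    note d = dsum_Mk_M2[OF j]
    have "Phi (tens M (Mk k)) h = (Phi M h * Phi (Mk k) h) mod modulus (\<alpha> h)"
      if M: "obj M" and h: "h \<in> carrier G" for M h
    proof -
      have "Phi (tens M (tens (Mk j) (Mk 2))) h = Phi (tens M (Mk k)) h + Phi (tens M (tens ?A (Mk (j - 1)))) h"
        by (rule Phi_dsum) (use o M obj_tens dsum_tens_right[OF M d] 3 in auto)
      then have "Phi (tens M (Mk k)) h = (Phi M h * Phi (tens (Mk j) (Mk 2)) h) mod modulus (\<alpha> h) -
          (Phi M h * Phi (tens ?A (Mk (j - 1))) h) mod modulus (\<alpha> h)"
        using multiplicativeD[OF mM M h] multiplicativeD[OF mA M h] by simp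
      also have "\<dots> = (Phi M h * (Phi (tens (Mk j) (Mk 2)) h - Phi (tens ?A (Mk (j - 1))) h)) mod modulus (\<alpha> h)"
        by (simp add: right_diff_distrib poly_mod_diff_left)
      also have "Phi (tens (Mk j) (Mk 2)) h - Phi (tens ?A (Mk (j - 1))) h = Phi (Mk k) h"
        using Phi_dsum[OF o(3) _ o(2) d, of h] o(1) 3 by simp
      finally show ?thesis .
    qed
    then show ?thesis using o(1) by (simp add: multiplicative_def)
  qed
qed

theorem Phi_tens:
  assumes M: "obj M" and N: "obj N" and h: "h \<in> carrier G"
  shows "Phi (tens M N) h = (Phi M h * Phi N h) mod modulus (\<alpha> h)"
proof -
  obtain xs where "decomp N xs" using decomp_exists[OF N] by blast
  then show ?thesis
  proof (induction rule: decomp.induct)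
    case (decomp_Nil V)
    then show ?case using Phi_zero[of V h] Phi_zero[OF obj_tens[OF M], of V h] by simp
  next
    case (decomp_Cons V W k N' xs)
    have m: "multiplicative (tens W (Mk k))"
      using decomp_Cons by (intro multiplicative_tens multiplicative_pure multiplicative_Mk Irr_pure)
    then have o: "obj N'" "obj (tens W (Mk k))"
      using decomp_Cons decomp_obj by (auto simp: multiplicative_def)
    have "Phi (tens M V) h = Phi (tens M (tens W (Mk k))) h + Phi (tens M N') h"
      by (rule Phi_dsum) (use o M decomp_Cons.hyps in \<open>auto intro: obj_tens dsum_tens_right\<close>)
    then show ?case
      using multiplicativeD[OF m M h] decomp_Cons.IH Phi_dsum[OF decomp_Cons.hyps(1) o(2,1) decomp_Cons.hyps(5), of h]
      by (simp add: distrib_left poly_mod_add_left)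
  qed
qed

end

section \<open>Quotients by the kernel of an additive map\<close>

lemma group_add_monoid_class:
  fixes F :: "'f::ab_group_add ring"
  assumes F: "zero F = 0" "add F = (+)" "0 \<in> carrier F"
    and cl: "\<And>x y. x \<in> carrier F \<Longrightarrow> y \<in> carrier F \<Longrightarrow> x + y \<in> carrier F" "\<And>x. x \<in> carrier F \<Longrightarrow> - x \<in> carrier F"
  shows "comm_group (add_monoid F)" "x \<in> carrier F \<Longrightarrow> inv\<^bsub>add_monoid F\<^esub> x = - x"
proof -
  show g: "comm_group (add_monoid F)"
    by (rule comm_groupI) (use F cl in \<open>auto simp: add.assoc add.commute intro!: bexI[of _ "- _"]\<close>)
  then interpret g: comm_group "add_monoid F" .
  show "inv\<^bsub>add_monoid F\<^esub> x = - x" if "x \<in> carrier F"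
    by (rule g.inv_equality) (use F cl that in auto)
qed

lemma generate_additive:
  fixes F :: "'f::ab_group_add ring"
  assumes F: "zero F = 0" "add F = (+)" "0 \<in> carrier F"
    and cl: "\<And>x y. x \<in> carrier F \<Longrightarrow> y \<in> carrier F \<Longrightarrow> x + y \<in> carrier F" "\<And>x. x \<in> carrier F \<Longrightarrow> - x \<in> carrier F"
    and S: "S \<subseteq> carrier F"
  shows "0 \<in> generate (add_monoid F) S"
    "x \<in> generate (add_monoid F) S \<Longrightarrow> y \<in> generate (add_monoid F) S \<Longrightarrow> x + y \<in> generate (add_monoid F) S"
    "x \<in> generate (add_monoid F) S \<Longrightarrow> - x \<in> generate (add_monoid F) S"
    "x \<in> generate (add_monoid F) S \<Longrightarrow> x \<in> carrier F"
proof -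
  show 0: "0 \<in> generate (add_monoid F) S" using generate.one[of "add_monoid F" S] F by simp
  show 1: "x \<in> generate (add_monoid F) S \<Longrightarrow> y \<in> generate (add_monoid F) S \<Longrightarrow> x + y \<in> generate (add_monoid F) S" for x y
    using generate.eng[of x "add_monoid F" S y] F by simp
  have inv: "inv\<^bsub>add_monoid F\<^esub> x = - x" if "x \<in> S" for x
    by (rule group_add_monoid_class(2)[OF F cl]) (use that S in auto)
  have "x \<in> carrier F \<and> - x \<in> generate (add_monoid F) S" if "x \<in> generate (add_monoid F) S"
    using that
  proof (induction rule: generate.induct)
    case (incl h)
    then show ?case using S generate.inv[OF incl, where G = "add_monoid F"] inv[OF incl] by auto
  next
    case (inv h)
    then show ?case using S generate.incl[OF inv, where G = "add_monoid F"] \<open>\<And>x. x \<in> S \<Longrightarrow> inv\<^bsub>add_monoid F\<^esub> x = - x\<close> cl(2) by auto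
  next
    case (eng x y)
    then show ?case using 1[of "- x" "- y"] cl(1) F by simp
  qed (use F 0 in simp)
  then show "x \<in> generate (add_monoid F) S \<Longrightarrow> - x \<in> generate (add_monoid F) S"
    "x \<in> generate (add_monoid F) S \<Longrightarrow> x \<in> carrier F" by blast+
qed

lemma generate_additive_zero:
  fixes F :: "'f::ab_group_add ring" and \<theta> :: "'f \<Rightarrow> 't::ab_group_add"
  assumes F: "zero F = 0" "add F = (+)" "0 \<in> carrier F"
    and cl: "\<And>x y. x \<in> carrier F \<Longrightarrow> y \<in> carrier F \<Longrightarrow> x + y \<in> carrier F" "\<And>x. x \<in> carrier F \<Longrightarrow> - x \<in> carrier F"
    and S: "S \<subseteq> carrier F"
    and \<theta>: "\<And>x y. \<theta> (x + y) = \<theta> x + \<theta> y" "\<And>x. x \<in> S \<Longrightarrow> \<theta> x = 0"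
  shows "x \<in> generate (add_monoid F) S \<Longrightarrow> \<theta> x = 0"
proof (induction rule: generate.induct)
  have \<theta>0: "\<theta> 0 = 0" using \<theta>(1)[of 0 0] by simp
  {
    case one
    show ?case using F \<theta>0 by simp
  next
    case (incl h)
    then show ?case by (rule \<theta>(2))
  next
    case (inv h)
    have "inv\<^bsub>add_monoid F\<^esub> h = - h"
      by (rule group_add_monoid_class(2)[OF F cl]) (use inv S in auto)
    then show ?case using \<theta>(1)[of h "- h"] \<theta>(2)[OF inv] \<theta>0 by simp
  next
    case (eng x y)
    then show ?case using F \<theta>(1) by simp
  }
qed

text \<open>The ring laws of the quotient are to be pulled back from the target along the injective
  induced map \<open>\<Theta>\<close>; therefore only closure of \<open>F\<close> and compatibility
  of \<open>\<theta>\<close> with its operations are assumed.\<close>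

locale additive_kernel =
  fixes F :: "'f::ab_group_add ring" and I :: "'f set" and \<theta> :: "'f \<Rightarrow> 't::ab_group_add"
    and mul :: "'t \<Rightarrow> 't \<Rightarrow> 't"
  assumes F: "zero F = 0" "add F = (+)" "0 \<in> carrier F"
    and cl: "\<And>x y. x \<in> carrier F \<Longrightarrow> y \<in> carrier F \<Longrightarrow> x + y \<in> carrier F" "\<And>x. x \<in> carrier F \<Longrightarrow> - x \<in> carrier F"
    and mult_cl: "\<And>x y. x \<in> carrier F \<Longrightarrow> y \<in> carrier F \<Longrightarrow> x \<otimes>\<^bsub>F\<^esub> y \<in> carrier F"
    and one_cl: "\<one>\<^bsub>F\<^esub> \<in> carrier F"
    and th_add: "\<And>x y. x \<in> carrier F \<Longrightarrow> y \<in> carrier F \<Longrightarrow> \<theta> (x + y) = \<theta> x + \<theta> y"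
    and th_mult: "\<And>x y. x \<in> carrier F \<Longrightarrow> y \<in> carrier F \<Longrightarrow> \<theta> (x \<otimes>\<^bsub>F\<^esub> y) = mul (\<theta> x) (\<theta> y)"
    and I: "I = {x \<in> carrier F. \<theta> x = 0}"
begin

lemma th_0: "\<theta> 0 = 0" using th_add[OF F(3) F(3)] by simp

lemma th_minus: "x \<in> carrier F \<Longrightarrow> \<theta> (- x) = - \<theta> x"
  using th_add[of x "- x"] cl(2)[of x] th_0 by (simp add: eq_neg_iff_add_eq_0 add.commute)

lemma cl_diff: "x \<in> carrier F \<Longrightarrow> y \<in> carrier F \<Longrightarrow> x - y \<in> carrier F"
  using cl(1)[of x "- y"] cl(2)[of y] by simp

lemma th_diff: "x \<in> carrier F \<Longrightarrow> y \<in> carrier F \<Longrightarrow> \<theta> (x - y) = \<theta> x - \<theta> y"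
  using th_add[of x "- y"] cl(2)[of y] th_minus[of y] by simp

lemma coset_eq: assumes "x \<in> carrier F" shows "I +>\<^bsub>F\<^esub> x = {z \<in> carrier F. \<theta> z = \<theta> x}"
proof -
  have "z \<in> (\<Union>i\<in>I. {i + x})" if "z \<in> carrier F" "\<theta> z = \<theta> x" for z
  proof -
    have "z - x \<in> I" using that assms by (simp add: I cl_diff th_diff)
    moreover have "z = z - x + x" by simp
    ultimately show ?thesis by blast
  qed
  moreover have "z \<in> carrier F \<and> \<theta> z = \<theta> x" if "z \<in> (\<Union>i\<in>I. {i + x})" for z
    using that assms cl(1) th_add by (auto simp: I)
  ultimately show ?thesis unfolding a_r_coset_def' F by blast
qed

lemma coset_eq_iff: "x \<in> carrier F \<Longrightarrow> y \<in> carrier F \<Longrightarrow> I +>\<^bsub>F\<^esub> x = I +>\<^bsub>F\<^esub> y \<longleftrightarrow> \<theta> x = \<theta> y"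
  by (auto simp: coset_eq)

lemma quot_carrier: "carrier (F Quot I) = (\<lambda>x. I +>\<^bsub>F\<^esub> x) ` carrier F"
  by (auto simp: FactRing_def A_RCOSETS_def')

lemma quot_one: "\<one>\<^bsub>F Quot I\<^esub> = I +>\<^bsub>F\<^esub> \<one>\<^bsub>F\<^esub>" by (simp add: FactRing_def)

lemma quot_zero: "\<zero>\<^bsub>F Quot I\<^esub> = I +>\<^bsub>F\<^esub> 0"
  by (simp add: FactRing_def coset_eq F th_0) (simp add: I)

lemma quot_add:
  assumes "x \<in> carrier F" "y \<in> carrier F"
  shows "(I +>\<^bsub>F\<^esub> x) \<oplus>\<^bsub>F Quot I\<^esub> (I +>\<^bsub>F\<^esub> y) = I +>\<^bsub>F\<^esub> (x + y)"
proof -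
  have "\<exists>a b. z = a + b \<and> a \<in> carrier F \<and> b \<in> carrier F \<and> \<theta> a = \<theta> x \<and> \<theta> b = \<theta> y"
    if "z \<in> carrier F" "\<theta> z = \<theta> x + \<theta> y" for z
    by (rule exI[of _ "z - y"], rule exI[of _ y]) (use that assms in \<open>simp add: cl_diff th_diff\<close>)
  then have 1: "{z \<in> carrier F. \<theta> z = \<theta> x + \<theta> y} \<subseteq>
      (\<Union>a\<in>{z \<in> carrier F. \<theta> z = \<theta> x}. \<Union>b\<in>{z \<in> carrier F. \<theta> z = \<theta> y}. {a + b})" by blast
  have 2: "(\<Union>a\<in>{z \<in> carrier F. \<theta> z = \<theta> x}. \<Union>b\<in>{z \<in> carrier F. \<theta> z = \<theta> y}. {a + b}) \<subseteq>
      {z \<in> carrier F. \<theta> z = \<theta> x + \<theta> y}"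
    using cl(1) th_add by auto
  show ?thesis using 1 2 assms
    by (simp add: FactRing_def set_add_defs F coset_eq cl(1) th_add subset_antisym)
qed

lemma quot_mult:
  assumes "x \<in> carrier F" "y \<in> carrier F"
  shows "(I +>\<^bsub>F\<^esub> x) \<otimes>\<^bsub>F Quot I\<^esub> (I +>\<^bsub>F\<^esub> y) = I +>\<^bsub>F\<^esub> (x \<otimes>\<^bsub>F\<^esub> y)"
proof -
  have "I +>\<^bsub>F\<^esub> (a \<otimes>\<^bsub>F\<^esub> b) = I +>\<^bsub>F\<^esub> (x \<otimes>\<^bsub>F\<^esub> y)"
    if "a \<in> I +>\<^bsub>F\<^esub> x" "b \<in> I +>\<^bsub>F\<^esub> y" for a b
    using that assms by (simp add: coset_eq mult_cl th_mult)
  then have "(\<Union>a\<in>I +>\<^bsub>F\<^esub> x. \<Union>b\<in>I +>\<^bsub>F\<^esub> y. I +>\<^bsub>F\<^esub> (a \<otimes>\<^bsub>F\<^esub> b)) =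
      (\<Union>a\<in>I +>\<^bsub>F\<^esub> x. \<Union>b\<in>I +>\<^bsub>F\<^esub> y. I +>\<^bsub>F\<^esub> (x \<otimes>\<^bsub>F\<^esub> y))" by (intro SUP_cong refl)
  also have "\<dots> = I +>\<^bsub>F\<^esub> (x \<otimes>\<^bsub>F\<^esub> y)"
  proof -
    have "x \<in> I +>\<^bsub>F\<^esub> x" "y \<in> I +>\<^bsub>F\<^esub> y" using assms by (simp_all add: coset_eq)
    then have "I +>\<^bsub>F\<^esub> x \<noteq> {}" "I +>\<^bsub>F\<^esub> y \<noteq> {}" by blast+
    then show ?thesis by simp
  qed
  finally show ?thesis by (simp add: FactRing_def rcoset_mult_def)
qed

definition "\<Theta> S = \<theta> (SOME x. x \<in> S)"

lemma Theta: "x \<in> carrier F \<Longrightarrow> \<Theta> (I +>\<^bsub>F\<^esub> x) = \<theta> x"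
proof -
  assume x: "x \<in> carrier F"
  then have "x \<in> I +>\<^bsub>F\<^esub> x" by (simp add: coset_eq)
  then have "(SOME z. z \<in> I +>\<^bsub>F\<^esub> x) \<in> I +>\<^bsub>F\<^esub> x" by (rule someI)
  then show ?thesis using x by (simp add: \<Theta>_def coset_eq)
qed

lemma Theta_hom:
  "S \<in> carrier (F Quot I) \<Longrightarrow> S' \<in> carrier (F Quot I) \<Longrightarrow> \<Theta> (S \<oplus>\<^bsub>F Quot I\<^esub> S') = \<Theta> S + \<Theta> S'"
  "S \<in> carrier (F Quot I) \<Longrightarrow> S' \<in> carrier (F Quot I) \<Longrightarrow> \<Theta> (S \<otimes>\<^bsub>F Quot I\<^esub> S') = mul (\<Theta> S) (\<Theta> S')"
  "\<Theta> \<zero>\<^bsub>F Quot I\<^esub> = 0" "\<Theta> \<one>\<^bsub>F Quot I\<^esub> = \<theta> \<one>\<^bsub>F\<^esub>"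
  "S \<in> carrier (F Quot I) \<Longrightarrow> S' \<in> carrier (F Quot I) \<Longrightarrow> S \<oplus>\<^bsub>F Quot I\<^esub> S' \<in> carrier (F Quot I)"
  "S \<in> carrier (F Quot I) \<Longrightarrow> S' \<in> carrier (F Quot I) \<Longrightarrow> S \<otimes>\<^bsub>F Quot I\<^esub> S' \<in> carrier (F Quot I)"
  "\<zero>\<^bsub>F Quot I\<^esub> \<in> carrier (F Quot I)" "\<one>\<^bsub>F Quot I\<^esub> \<in> carrier (F Quot I)"
proof -
  show "\<Theta> \<zero>\<^bsub>F Quot I\<^esub> = 0" "\<Theta> \<one>\<^bsub>F Quot I\<^esub> = \<theta> \<one>\<^bsub>F\<^esub>"
    by (simp_all add: quot_zero quot_one Theta F(3) one_cl th_0)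
  show "\<zero>\<^bsub>F Quot I\<^esub> \<in> carrier (F Quot I)" "\<one>\<^bsub>F Quot I\<^esub> \<in> carrier (F Quot I)"
    unfolding quot_zero quot_one quot_carrier using F(3) one_cl by blast+
  assume "S \<in> carrier (F Quot I)" "S' \<in> carrier (F Quot I)"
  then obtain x y where x: "x \<in> carrier F" "S = I +>\<^bsub>F\<^esub> x" and y: "y \<in> carrier F" "S' = I +>\<^bsub>F\<^esub> y"
    unfolding quot_carrier by blast
  note xy = x(1) y(1)
  show "\<Theta> (S \<oplus>\<^bsub>F Quot I\<^esub> S') = \<Theta> S + \<Theta> S'" "\<Theta> (S \<otimes>\<^bsub>F Quot I\<^esub> S') = mul (\<Theta> S) (\<Theta> S')"
    unfolding x(2) y(2) quot_add[OF xy] quot_mult[OF xy]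
    by (simp_all add: Theta xy cl(1) mult_cl th_add th_mult)
  show "S \<oplus>\<^bsub>F Quot I\<^esub> S' \<in> carrier (F Quot I)" "S \<otimes>\<^bsub>F Quot I\<^esub> S' \<in> carrier (F Quot I)"
    unfolding x(2) y(2) quot_add[OF xy] quot_mult[OF xy] quot_carrier
    using cl(1)[OF xy] mult_cl[OF xy] by blast+
qed

lemma Theta_inj: "inj_on \<Theta> (carrier (F Quot I))"
proof (rule inj_onI)
  fix S S' assume "S \<in> carrier (F Quot I)" "S' \<in> carrier (F Quot I)" and eq: "\<Theta> S = \<Theta> S'"
  then obtain x y where "x \<in> carrier F" "S = I +>\<^bsub>F\<^esub> x" "y \<in> carrier F" "S' = I +>\<^bsub>F\<^esub> y"
    unfolding quot_carrier by blast
  then show "S = S'" using eq by (simp add: Theta coset_eq_iff)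
qed

lemma Theta_image: "\<Theta> ` carrier (F Quot I) = \<theta> ` carrier F"
  by (simp add: quot_carrier image_image Theta cong: image_cong)

end

section \<open>Free modules\<close>

definition pm_sum :: "('x \<Rightarrow> 'r \<Rightarrow> 'z) \<Rightarrow> ('x \<Rightarrow>\<^sub>0 'r::zero) \<Rightarrow> 'z::comm_monoid_add" where
  "pm_sum \<phi> f = (\<Sum>x\<in>keys f. \<phi> x (lookup f x))"

lemma pm_sum_superset:
  assumes "\<And>x. \<phi> x 0 = 0" "finite S" "keys f \<subseteq> S"
  shows "pm_sum \<phi> f = (\<Sum>x\<in>S. \<phi> x (lookup f x))"
  unfolding pm_sum_def by (rule sum.mono_neutral_left) (use assms in \<open>auto simp: in_keys_iff\<close>)

lemma pm_sum_add:
  fixes f f' :: "'x \<Rightarrow>\<^sub>0 'r::ab_group_add"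
  assumes "\<And>x. \<phi> x 0 = 0" "\<And>x a b. \<phi> x (a + b) = \<phi> x a + \<phi> x b"
  shows "pm_sum \<phi> (f + f') = pm_sum \<phi> f + pm_sum \<phi> f'"
proof -
  let ?S = "keys f \<union> keys f'"
  have S: "pm_sum \<phi> k = (\<Sum>x\<in>?S. \<phi> x (lookup k x))" if "keys k \<subseteq> ?S" for k
    by (rule pm_sum_superset) (use assms(1) that in auto)
  show ?thesis
    by (simp add: S keys_add lookup_add assms(2) sum.distrib)
qed

lemma pm_sum_single: "\<phi> x 0 = 0 \<Longrightarrow> pm_sum \<phi> (single x a) = \<phi> x a"
  by (cases "a = 0") (auto simp: pm_sum_def)

lemma pm_sum_0 [simp]: "pm_sum \<phi> 0 = 0" by (simp add: pm_sum_def)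

lemma pm_sum_cong: "(\<And>x. x \<in> keys f \<Longrightarrow> \<phi> x (lookup f x) = \<psi> x (lookup f x)) \<Longrightarrow> pm_sum \<phi> f = pm_sum \<psi> f"
  by (simp add: pm_sum_def)

lemma pm_sum_id: "pm_sum (\<lambda>x a. single x a) f = (f :: 'x \<Rightarrow>\<^sub>0 'r::ab_group_add)"
proof (rule poly_mapping_eqI)
  fix y
  have "lookup (pm_sum (\<lambda>x a. single x a) f) y = (\<Sum>x\<in>keys f. if x = y then lookup f y else 0)"
    unfolding pm_sum_def lookup_sum by (intro sum.cong) (auto simp: lookup_single when_def)
  also have "\<dots> = lookup f y" by (simp add: in_keys_iff)
  finally show "lookup (pm_sum (\<lambda>x a. single x a) f) y = lookup f y" .
qed

lemma pm_induct [consumes 1, case_names zero single add]: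
  fixes f :: "'x \<Rightarrow>\<^sub>0 'r::ab_group_add"
  assumes "keys f \<subseteq> B" "P 0" "\<And>x a. x \<in> B \<Longrightarrow> P (single x a)"
    "\<And>f f'. keys f \<subseteq> B \<Longrightarrow> keys f' \<subseteq> B \<Longrightarrow> P f \<Longrightarrow> P f' \<Longrightarrow> P (f + f')"
  shows "P f"
proof -
  have "keys (\<Sum>x\<in>S. single x (lookup f x)) \<subseteq> B \<and> P (\<Sum>x\<in>S. single x (lookup f x))" if "finite S" "S \<subseteq> B" for S
    using that
  proof (induction S)
    case (insert x S)
    have "keys (single x (lookup f x)) \<subseteq> B" using insert by (cases "lookup f x = 0") auto
    then show ?case using insert assms(3,4) keys_add[of "single x (lookup f x)" "\<Sum>x\<in>S. single x (lookup f x)"] by auto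
  qed (simp add: assms(2))
  from this[of "keys f"] show ?thesis using assms(1) pm_sum_id[of f] by (simp add: pm_sum_def)
qed

lemma structure_ring_simps:
  "carrier (structure_ring B \<beta> w) = {f. keys f \<subseteq> B}" "mult (structure_ring B \<beta> w) = bilin_ext \<beta>"
  "one (structure_ring B \<beta> w) = w" "zero (structure_ring B \<beta> w) = 0" "add (structure_ring B \<beta> w) = (+)"
  by (simp_all add: structure_ring_def)

lemma structure_ring_closed:
  "f \<in> carrier (structure_ring B \<beta> w) \<Longrightarrow> f' \<in> carrier (structure_ring B \<beta> w) \<Longrightarrow>
    f + f' \<in> carrier (structure_ring B \<beta> w)"
  "f \<in> carrier (structure_ring B \<beta> w) \<Longrightarrow> - f \<in> carrier (structure_ring B \<beta> w)"
  "0 \<in> carrier (structure_ring B \<beta> w)"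
  using keys_add[of f f'] by (auto simp: structure_ring_simps)

lemma scale_add: "scale (a + b) z = scale a z + scale b z" "scale a (z + z') = scale a z + scale a z'"
  by (rule poly_mapping_eqI; simp add: lookup_add algebra_simps)+

lemma bilin_ext_add_left: "bilin_ext \<beta> (f + f') k = bilin_ext \<beta> f k + bilin_ext \<beta> f' k"
proof -
  let ?\<phi> = "\<lambda>x c. \<Sum>y\<in>keys k. scale (c * lookup k y) (\<beta> x y)"
  have eq: "bilin_ext \<beta> f k = pm_sum ?\<phi> f" for f by (simp add: bilin_ext_def pm_sum_def)
  show ?thesis unfolding eq by (intro pm_sum_add) (simp_all add: distrib_right sum.distrib scale_add)
qed

lemma bilin_ext_swap: "bilin_ext \<beta> f k = bilin_ext (\<lambda>x y. \<beta> y x) k f"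
  unfolding bilin_ext_def by (subst sum.swap) (simp add: mult.commute)

lemma bilin_ext_add_right: "bilin_ext \<beta> f (k + k') = bilin_ext \<beta> f k + bilin_ext \<beta> f k'"
  by (subst (1 2 3) bilin_ext_swap) (rule bilin_ext_add_left)

lemma bilin_ext_0 [simp]: "bilin_ext \<beta> 0 k = 0" "bilin_ext \<beta> f 0 = 0"
  by (simp_all add: bilin_ext_def)

lemma keys_scale: "keys (scale c f) \<subseteq> keys f"
  by (auto simp: in_keys_iff)

lemma keys_sum_subset: "(\<And>x. x \<in> S \<Longrightarrow> keys (f x) \<subseteq> B) \<Longrightarrow> keys (\<Sum>x\<in>S. f x) \<subseteq> B"
proof (induction S rule: infinite_finite_induct)
  case (insert x S)
  then show ?case using keys_add[of "f x" "sum f S"] by auto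
qed simp_all

lemma bilin_ext_closed:
  assumes "\<And>x y. x \<in> B \<Longrightarrow> y \<in> B \<Longrightarrow> keys (\<beta> x y) \<subseteq> B'" "keys f \<subseteq> B" "keys k \<subseteq> B"
  shows "keys (bilin_ext \<beta> f k) \<subseteq> B'"
  unfolding bilin_ext_def
proof (intro keys_sum_subset)
  fix x y assume "x \<in> keys f" "y \<in> keys k"
  then have "keys (\<beta> x y) \<subseteq> B'" using assms by blast
  then show "keys (scale (lookup f x * lookup k y) (\<beta> x y)) \<subseteq> B'" using keys_scale by (rule subset_trans[rotated])
qed

text \<open>Extends a product rule from basis elements to all of them. The target product
  \<open>mul\<close> is kept abstract so that the lemma applies to matrix products, Kronecker
  products and the products of invariants alike.\<close>

lemma bilin_ext_induct:
  fixes \<psi> :: "('c \<Rightarrow>\<^sub>0 'r::comm_ring_1) \<Rightarrow> 't::ab_group_add"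
    and mul :: "'u::ab_group_add \<Rightarrow> 'v::ab_group_add \<Rightarrow> 't"
  assumes "keys f \<subseteq> B" "keys k \<subseteq> B'"
    and \<psi>: "\<And>x y. \<psi> (x + y) = \<psi> x + \<psi> y"
    and m: "\<And>x y z. mul (x + y) z = mul x z + mul y z" "\<And>x y z. mul z (x + y) = mul z x + mul z y"
    and \<phi>: "\<And>x y. \<phi> (x + y) = \<phi> x + \<phi> y" "\<And>x y. \<phi>' (x + y) = \<phi>' x + \<phi>' y"
    and base: "\<And>x y a b. x \<in> B \<Longrightarrow> y \<in> B' \<Longrightarrow> \<psi> (scale (a * b) (\<beta> x y)) = mul (\<phi> (single x a)) (\<phi>' (single y b))"
  shows "\<psi> (bilin_ext \<beta> f k) = mul (\<phi> f) (\<phi>' k)"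
  using assms(1)
proof (induction rule: pm_induct)
  have \<phi>0: "\<phi> 0 = 0" "\<phi>' 0 = 0" "\<psi> 0 = 0" using \<phi>[of 0 0] \<psi>[of 0 0] by simp_all
  have m0: "mul 0 z = 0" for z using m(1)[of 0 0 z] by simp
  case zero
  show ?case by (simp add: \<phi>0 m0)
next
  have \<phi>0: "\<phi>' 0 = 0" "\<psi> 0 = 0" using \<phi>(2)[of 0 0] \<psi>[of 0 0] by simp_all
  have m0: "mul z 0 = 0" for z using m(2)[of z 0 0] by simp
  case (single x a)
  show ?case using assms(2)
  proof (induction rule: pm_induct)
    case zero
    show ?case by (simp add: \<phi>0 m0)
  next
    case (single y b)
    then show ?case using base \<open>x \<in> B\<close> by (simp add: bilin_ext_single)
  qed (simp add: bilin_ext_add_right \<psi> \<phi> m)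
qed (simp add: bilin_ext_add_left \<psi> \<phi> m)

section \<open>Green rings with a complete additive invariant\<close>

text \<open>What is needed to compute a Green ring from its presentation: a complete invariant,
  additive and multiplicative, with values in a complex vector space; a family \<open>rp\<close>
  whose invariants are linearly independent; and the splitting of a member of the family from any
  nonzero module, stated for invariants only. It is instantiated for H and for the group
  algebra.\<close>

locale green_invariant = vector_space sc for sc :: "complex \<Rightarrow> 't::ab_group_add \<Rightarrow> 't" +
  fixes A :: "'b hopf_algebra" and \<Phi> :: "'b rep \<Rightarrow> 't" and mul :: "'t \<Rightarrow> 't \<Rightarrow> 't" and u :: 't
    and Bs :: "'i set" and rp :: "'i \<Rightarrow> 'b rep"
  assumes mul_add: "mul (x + y) z = mul x z + mul y z" and mul_sc: "mul (sc c x) y = sc c (mul x y)"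
    and mul_comm: "mul x y = mul y x" and mul_assoc: "mul (mul x y) z = mul x (mul y z)"
    and fd_one: "fd_module A (one_dim_rep (counit A))"
    and fd_sum: "fd_module A M \<Longrightarrow> fd_module A N \<Longrightarrow> fd_module A (rep_sum M N)"
    and fd_tensor: "fd_module A M \<Longrightarrow> fd_module A N \<Longrightarrow> fd_module A (rep_tensor A M N)"
    and Phi_iso: "fd_module A M \<Longrightarrow> fd_module A N \<Longrightarrow>
      module_iso (alg A) (as_module M) (as_module N) \<longleftrightarrow> \<Phi> M = \<Phi> N"
    and Phi_sum: "fd_module A M \<Longrightarrow> fd_module A N \<Longrightarrow> \<Phi> (rep_sum M N) = \<Phi> M + \<Phi> N"
    and Phi_tensor: "fd_module A M \<Longrightarrow> fd_module A N \<Longrightarrow> \<Phi> (rep_tensor A M N) = mul (\<Phi> M) (\<Phi> N)"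
    and Phi_one: "\<Phi> (one_dim_rep (counit A)) = u"
    and mul_u: "fd_module A M \<Longrightarrow> mul u (\<Phi> M) = \<Phi> M"
    and fd_rp: "b \<in> Bs \<Longrightarrow> fd_module A (rp b)"
    and indep: "finite S \<Longrightarrow> S \<subseteq> Bs \<Longrightarrow> (\<Sum>b\<in>S. sc (cf b) (\<Phi> (rp b))) = 0 \<Longrightarrow> b \<in> S \<Longrightarrow> cf b = 0"
    and dec0: "fd_module A M \<Longrightarrow> fst M = 0 \<Longrightarrow> \<Phi> M = 0"
    and dec: "fd_module A M \<Longrightarrow> fst M \<noteq> 0 \<Longrightarrow>
      \<exists>b\<in>Bs. \<exists>N. fd_module A N \<and> fst N < fst M \<and> \<Phi> M = \<Phi> (rp b) + \<Phi> N"
begin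

lemma mul_0 [simp]: "mul 0 x = 0" "mul x 0 = 0"
  using mul_add[of 0 0 x] mul_comm[of x 0] by simp_all

lemma mul_add2: "mul z (x + y) = mul z x + mul z y" using mul_add mul_comm by metis

lemma mul_sc2: "mul x (sc c y) = sc c (mul x y)" using mul_sc mul_comm by metis

abbreviation "cls \<equiv> iso_class A"
abbreviation "X \<equiv> carrier (iso_class_monoid A)"
abbreviation "F \<equiv> green_free A"
abbreviation "r \<equiv> green_ring A"
abbreviation "R \<equiv> complex_green_ring A"

lemma cls_eq: "fd_module A M \<Longrightarrow> cls M = {N. fd_module A N \<and> \<Phi> N = \<Phi> M}"
  unfolding iso_class_def using Phi_iso[of M] by (intro Collect_cong) metis

lemma X_eq: "X = {cls M | M. fd_module A M}"
  by (simp add: iso_class_monoid_def)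

lemma cls_in_X [simp]: "fd_module A M \<Longrightarrow> cls M \<in> X"
  unfolding X_eq by blast

definition "\<phi> Y = \<Phi> (SOME M. M \<in> Y)"

lemma phi_cls [simp]: assumes "fd_module A M" shows "\<phi> (cls M) = \<Phi> M"
proof -
  have "M \<in> cls M" using assms by (simp add: cls_eq)
  then have "(SOME N. N \<in> cls M) \<in> cls M" by (rule someI)
  then show ?thesis using assms by (simp add: \<phi>_def cls_eq)
qed

lemma cls_eq_iff: "fd_module A M \<Longrightarrow> fd_module A N \<Longrightarrow> cls M = cls N \<longleftrightarrow> \<Phi> M = \<Phi> N"
  by (auto simp: cls_eq)

lemma X_mult:
  assumes "fd_module A M" "fd_module A N"
  shows "cls M \<otimes>\<^bsub>iso_class_monoid A\<^esub> cls N = cls (rep_tensor A M N)"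
proof -
  have "cls (rep_tensor A M' N') = cls (rep_tensor A M N)" if "M' \<in> cls M" "N' \<in> cls N" for M' N'
    using that assms by (simp add: cls_eq fd_tensor Phi_tensor)
  then have "(\<Union>M'\<in>cls M. \<Union>N'\<in>cls N. cls (rep_tensor A M' N')) = (\<Union>M'\<in>cls M. \<Union>N'\<in>cls N. cls (rep_tensor A M N))"
    by (intro SUP_cong refl)
  moreover have "M \<in> cls M" "N \<in> cls N" using assms by (simp_all add: cls_eq)
  then have "cls M \<noteq> {}" "cls N \<noteq> {}" by blast+
  ultimately show ?thesis by (simp add: iso_class_monoid_def)
qed

lemma X_closed: "x \<in> X \<Longrightarrow> y \<in> X \<Longrightarrow> x \<otimes>\<^bsub>iso_class_monoid A\<^esub> y \<in> X"
  unfolding X_eq using X_mult fd_tensor by blast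

lemma phi_mult: "x \<in> X \<Longrightarrow> y \<in> X \<Longrightarrow> \<phi> (x \<otimes>\<^bsub>iso_class_monoid A\<^esub> y) = mul (\<phi> x) (\<phi> y)"
proof -
  assume "x \<in> X" "y \<in> X"
  then obtain M N where MN: "fd_module A M" "x = cls M" "fd_module A N" "y = cls N" unfolding X_eq by blast
  show ?thesis using X_mult[OF MN(1,3)] MN fd_tensor[OF MN(1,3)] by (simp add: Phi_tensor)
qed

lemma X_one: "\<one>\<^bsub>iso_class_monoid A\<^esub> = cls (one_dim_rep (counit A))"
  by (simp add: iso_class_monoid_def)

definition th1 :: "('b rep set \<Rightarrow>\<^sub>0 int) \<Rightarrow> 't" where
  "th1 = pm_sum (\<lambda>x m. sc (of_int m) (\<phi> x))"

lemma th1_add: "th1 (f + f') = th1 f + th1 f'"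
  unfolding th1_def by (rule pm_sum_add) (simp_all add: scale_left_distrib)

lemma th1_diff: "th1 (f - f') = th1 f - th1 f'"
  using th1_add[of "f - f'" f'] by simp

lemma th1_single [simp]: "th1 (single x m) = sc (of_int m) (\<phi> x)"
  unfolding th1_def by (rule pm_sum_single) simp

lemma F_simps: "carrier F = {f. keys f \<subseteq> X}" "zero F = 0" "add F = (+)" "one F = single (cls (one_dim_rep (counit A))) 1"
  by (simp_all add: green_free_def monoid_ring_def structure_ring_simps X_one)

lemma monoid_ring_mult: "f \<otimes>\<^bsub>monoid_ring Mo\<^esub> k = bilin_ext (\<lambda>x y. single (x \<otimes>\<^bsub>Mo\<^esub> y) 1) f k"
  by (simp add: monoid_ring_def structure_ring_simps)

lemma th1_mult:
  assumes "f \<in> carrier F" "k \<in> carrier F"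
  shows "th1 (f \<otimes>\<^bsub>F\<^esub> k) = mul (th1 f) (th1 k)"
  unfolding green_free_def monoid_ring_mult
  by (rule bilin_ext_induct[where B = X and B' = X])
    (use assms in \<open>auto simp: F_simps th1_add mul_add mul_add2 scale_single phi_mult mul_sc mul_sc2\<close>)

definition emb1 :: "('i \<Rightarrow>\<^sub>0 int) \<Rightarrow> ('b rep set \<Rightarrow>\<^sub>0 int)" where
  "emb1 = pm_sum (\<lambda>b m. single (cls (rp b)) m)"

lemma emb1_add: "emb1 (m + m') = emb1 m + emb1 m'"
  unfolding emb1_def by (rule pm_sum_add) (simp_all add: single_add)

lemma emb1_single [simp]: "emb1 (single b m) = single (cls (rp b)) m"
  unfolding emb1_def by (rule pm_sum_single) simp

lemma emb1_0 [simp]: "emb1 0 = 0" by (simp add: emb1_def)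

lemma emb1_uminus: "emb1 (- m) = - emb1 m"
  using emb1_add[of m "- m"] by (simp add: eq_neg_iff_add_eq_0 add.commute)

lemma single_in_F: "fd_module A M \<Longrightarrow> single (cls M) m \<in> carrier F"
  by (auto simp: F_simps)

lemma emb1_F: "keys m \<subseteq> Bs \<Longrightarrow> emb1 m \<in> carrier F"
proof (induction rule: pm_induct)
  case (single b m)
  then show ?case using single_in_F fd_rp by simp
next
  case (add f f')
  then show ?case using keys_add[of "emb1 f" "emb1 f'"] by (auto simp: emb1_add F_simps)
qed (simp add: F_simps)

lemma th1_emb1: "keys m \<subseteq> Bs \<Longrightarrow> th1 (emb1 m) = pm_sum (\<lambda>b c. sc (of_int c) (\<Phi> (rp b))) m"
proof (induction rule: pm_induct)
  case (single b m)
  then show ?case by (simp add: fd_rp pm_sum_single)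
next
  case (add f f')
  have "pm_sum (\<lambda>b c. sc (of_int c) (\<Phi> (rp b))) (f + f') =
      pm_sum (\<lambda>b c. sc (of_int c) (\<Phi> (rp b))) f + pm_sum (\<lambda>b c. sc (of_int c) (\<Phi> (rp b))) f'"
    by (rule pm_sum_add) (simp_all add: scale_left_distrib)
  then show ?case using add by (simp add: emb1_add th1_add)
qed (simp add: th1_def)

abbreviation "Rel1 \<equiv> green_relations A"

definition "gens1 = {single (cls (rep_sum M N)) (1::int) - single (cls M) 1 - single (cls N) 1
    | M N. fd_module A M \<and> fd_module A N}"

lemma Rel1_def: "Rel1 = generate (add_monoid F) gens1"
  by (simp add: green_relations_def gens1_def)

lemma Rel1_gen: "fd_module A M \<Longrightarrow> fd_module A N \<Longrightarrow>
    single (cls (rep_sum M N)) 1 - single (cls M) 1 - single (cls N) 1 \<in> Rel1"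
  unfolding Rel1_def gens1_def by (rule generate.incl) blast

lemma F_closed: "f \<in> carrier F \<Longrightarrow> f' \<in> carrier F \<Longrightarrow> f + f' \<in> carrier F" "f \<in> carrier F \<Longrightarrow> - f \<in> carrier F"
  "0 \<in> carrier F"
  unfolding green_free_def monoid_ring_def by (rule structure_ring_closed; assumption?)+

lemma gens1_F: "gens1 \<subseteq> carrier F"
proof
  fix f assume "f \<in> gens1"
  then obtain M N where MN: "fd_module A M" "fd_module A N"
    and f: "f = single (cls (rep_sum M N)) 1 - single (cls M) 1 - single (cls N) 1"
    unfolding gens1_def by blast
  have "single (cls (rep_sum M N)) 1 + - single (cls M) 1 + - single (cls N) 1 \<in> carrier F"
    using MN by (intro F_closed single_in_F fd_sum)
  then show "f \<in> carrier F" by (simp add: f)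
qed

lemma gens1_th1: "f \<in> gens1 \<Longrightarrow> th1 f = 0"
proof -
  assume "f \<in> gens1"
  then obtain M N where MN: "fd_module A M" "fd_module A N"
    and f: "f = single (cls (rep_sum M N)) 1 - single (cls M) 1 - single (cls N) 1"
    unfolding gens1_def by blast
  then show ?thesis using fd_sum[OF MN] by (simp add: th1_diff Phi_sum)
qed

lemma Rel1_0: "0 \<in> Rel1" and Rel1_add: "f \<in> Rel1 \<Longrightarrow> f' \<in> Rel1 \<Longrightarrow> f + f' \<in> Rel1"
  unfolding Rel1_def
  using generate_additive(1,2)[OF F_simps(2,3) F_closed(3,1,2) gens1_F] by blast+

lemma Rel1_sub: "f \<in> Rel1 \<Longrightarrow> f \<in> carrier F \<and> th1 f = 0 \<and> - f \<in> Rel1"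
  unfolding Rel1_def
  using generate_additive(3,4)[OF F_simps(2,3) F_closed(3,1,2) gens1_F]
    generate_additive_zero[OF F_simps(2,3) F_closed(3,1,2) gens1_F th1_add gens1_th1] by blast

text \<open>Splitting off members of \<open>rp\<close> one at a time, by induction on the dimension,
  brings a generator into the normal form \<open>emb1 m\<close> modulo the relations.\<close>

lemma single_mod_Rel1:
  "fd_module A M \<Longrightarrow> \<exists>m. keys m \<subseteq> Bs \<and> single (cls M) 1 - emb1 m \<in> Rel1"
proof (induction "fst M" arbitrary: M rule: less_induct)
  case less
  show ?case
  proof (cases "fst M = 0")
    case True
    then have "\<Phi> M = 0" using dec0 less.prems by blast
    \<comment> \<open>For a module of invariant zero the sum with itself is isomorphic to it, so the
      defining relation for the pair collapses to minus the class of \<open>M\<close>.\<close>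
    then have "cls (rep_sum M M) = cls M"
      using less.prems by (simp add: cls_eq_iff fd_sum Phi_sum)
    then have "- single (cls M) 1 \<in> Rel1" using Rel1_gen[OF less.prems less.prems] by simp
    then have "single (cls M) 1 \<in> Rel1" using Rel1_sub[of "- single (cls M) 1"] by simp
    then show ?thesis by (intro exI[of _ 0]) simp
  next
    case False
    then obtain b N where b: "b \<in> Bs" and N: "fd_module A N" "fst N < fst M" "\<Phi> M = \<Phi> (rp b) + \<Phi> N"
      using dec[OF less.prems] by blast
    obtain m where m: "keys m \<subseteq> Bs" "single (cls N) 1 - emb1 m \<in> Rel1" using less.hyps[OF N(2,1)] by blast
    have "cls M = cls (rep_sum (rp b) N)"
      using less.prems N fd_rp[OF b] by (simp add: cls_eq_iff fd_sum Phi_sum)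
    then have "single (cls M) 1 - single (cls (rp b)) 1 - single (cls N) 1 \<in> Rel1"
      using Rel1_gen[OF fd_rp[OF b] N(1)] by simp
    from Rel1_add[OF this m(2)] have "single (cls M) 1 - emb1 (single b 1 + m) \<in> Rel1"
      by (simp add: emb1_add algebra_simps)
    moreover have "keys (single b (1::int) + m) \<subseteq> Bs" using keys_add[of "single b (1::int)" m] b m by auto
    ultimately show ?thesis by blast
  qed
qed

lemma F_mod_Rel1: "f \<in> carrier F \<Longrightarrow> \<exists>m. keys m \<subseteq> Bs \<and> f - emb1 m \<in> Rel1"
proof -
  assume "f \<in> carrier F"
  then have "keys f \<subseteq> X" by (simp add: F_simps)
  have sub: "\<exists>m. keys m \<subseteq> Bs \<and> f + f' - emb1 m \<in> Rel1"
    if ex: "\<exists>m. keys m \<subseteq> Bs \<and> f - emb1 m \<in> Rel1" "\<exists>m. keys m \<subseteq> Bs \<and> f' - emb1 m \<in> Rel1" for f f'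
  proof -
    obtain m m' where m: "keys m \<subseteq> Bs" "f - emb1 m \<in> Rel1" "keys m' \<subseteq> Bs" "f' - emb1 m' \<in> Rel1" using ex by blast
    have "f + f' - emb1 (m + m') \<in> Rel1" using Rel1_add[OF m(2,4)] by (simp add: emb1_add algebra_simps)
    then show ?thesis using keys_add[of m m'] m by blast
  qed
  have uminus: "\<exists>m. keys m \<subseteq> Bs \<and> - f - emb1 m \<in> Rel1"
    if ex: "\<exists>m. keys m \<subseteq> Bs \<and> f - emb1 m \<in> Rel1" for f
  proof -
    obtain m where m: "keys m \<subseteq> Bs" "f - emb1 m \<in> Rel1" using ex by blast
    then have "- f - emb1 (- m) \<in> Rel1" using Rel1_sub[OF m(2)] by (simp add: emb1_uminus)
    then show ?thesis using m(1) by (intro exI[of _ "- m"]) simp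
  qed
  have zero: "\<exists>m. keys m \<subseteq> Bs \<and> 0 - emb1 m \<in> Rel1" using Rel1_0 by (intro exI[of _ 0]) simp
  show ?thesis using \<open>keys f \<subseteq> X\<close>
  proof (induction rule: pm_induct)
    case (single x a)
    then obtain M where M: "fd_module A M" "x = cls M" unfolding X_eq by blast
    have n: "\<exists>m. keys m \<subseteq> Bs \<and> single x (int k) - emb1 m \<in> Rel1" for k
    proof (induction k)
      case (Suc k)
      have "single x (int (Suc k)) = single x 1 + single x (int k)" by (simp flip: single_add)
      then show ?case using sub[OF _ Suc] single_mod_Rel1[OF M(1)] M(2) by simp
    qed (simp add: zero[simplified])
    show ?case
    proof (cases a rule: int_cases)
      case (nonneg k)
      then show ?thesis using n by simp
    next
      case (neg k)
      then have "single x a = - single x (int (Suc k))" by (simp only: single_uminus)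
      then show ?thesis using uminus[OF n[of "Suc k"]] by simp
    qed
  qed (use zero sub in auto)
qed

text \<open>The relations lie in the kernel by additivity of the invariant. Conversely, an element
  of the kernel is congruent to a normal form that is also in the kernel, and independence makes all
  its coefficients zero.\<close>

lemma Rel1_eq: "Rel1 = {f \<in> carrier F. th1 f = 0}"
proof (intro equalityI subsetI)
  fix f assume f: "f \<in> {f \<in> carrier F. th1 f = 0}"
  then obtain m where m: "keys m \<subseteq> Bs" "f - emb1 m \<in> Rel1" using F_mod_Rel1 by blast
  then have "th1 (emb1 m) = 0" using Rel1_sub[OF m(2)] f by (simp add: th1_diff)
  then have "(\<Sum>b\<in>keys m. sc (of_int (lookup m b)) (\<Phi> (rp b))) = 0"
    by (simp add: th1_emb1[OF m(1)] pm_sum_def)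
  then have "complex_of_int (lookup m b) = 0" if "b \<in> keys m" for b
    by (intro indep[of "keys m" "\<lambda>b. of_int (lookup m b)"]) (use m(1) that in auto)
  then have "m = 0" by (intro poly_mapping_eqI) (metis in_keys_iff lookup_zero of_int_eq_0_iff)
  then show "f \<in> Rel1" using m(2) by simp
qed (use Rel1_sub in auto)

sublocale G1: additive_kernel F Rel1 th1 mul
proof
  fix x y assume x: "x \<in> carrier F" "y \<in> carrier F"
  show "x \<otimes>\<^bsub>F\<^esub> y \<in> carrier F"
  proof -
    have "keys (bilin_ext (\<lambda>x y. single (x \<otimes>\<^bsub>iso_class_monoid A\<^esub> y) (1::int)) x y) \<subseteq> X"
      by (rule bilin_ext_closed[where B = X]) (use x X_closed in \<open>auto simp: F_simps\<close>)
    then show ?thesis by (simp add: F_simps) (simp add: green_free_def monoid_ring_mult)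
  qed
  show "th1 (x \<otimes>\<^bsub>F\<^esub> y) = mul (th1 x) (th1 y)" using th1_mult x by blast
  show "x + y \<in> carrier F" "- x \<in> carrier F" using F_closed x by blast+
qed (use F_simps F_closed fd_one Rel1_eq th1_add in \<open>auto simp: single_in_F\<close>)

end

section \<open>The complexified Green ring\<close>

context green_invariant
begin

abbreviation "\<Theta>\<^sub>1 \<equiv> G1.\<Theta>"
abbreviation "CF \<equiv> complex_free r"
abbreviation "Rel2 \<equiv> complex_relations r"

lemma r_eq: "r = F Quot Rel1" by (simp add: green_ring_def)

lemmas Theta1_hom = G1.Theta_hom[folded r_eq]

lemma CF_simps: "carrier CF = {f. keys f \<subseteq> carrier r}" "zero CF = 0" "add CF = (+)" "one CF = single \<one>\<^bsub>r\<^esub> 1"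
  by (simp_all add: complex_free_def monoid_ring_def structure_ring_simps)

definition th2 :: "(('b rep set \<Rightarrow>\<^sub>0 int) set \<Rightarrow>\<^sub>0 complex) \<Rightarrow> 't" where
  "th2 = pm_sum (\<lambda>x c. sc c (\<Theta>\<^sub>1 x))"

lemma th2_add: "th2 (f + f') = th2 f + th2 f'"
  unfolding th2_def by (rule pm_sum_add) (simp_all add: scale_left_distrib)

lemma th2_diff: "th2 (f - f') = th2 f - th2 f'"
  using th2_add[of "f - f'" f'] by simp

lemma th2_single [simp]: "th2 (single x c) = sc c (\<Theta>\<^sub>1 x)"
  unfolding th2_def by (rule pm_sum_single) simp

lemma th2_mult:
  assumes "f \<in> carrier CF" "k \<in> carrier CF"
  shows "th2 (f \<otimes>\<^bsub>CF\<^esub> k) = mul (th2 f) (th2 k)"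
  unfolding complex_free_def monoid_ring_mult
  by (rule bilin_ext_induct[where B = "carrier r" and B' = "carrier r" and mul = mul and \<phi> = th2 and \<phi>' = th2])
    (use assms in \<open>auto simp: CF_simps th2_add mul_add mul_add2 scale_single Theta1_hom mul_sc mul_sc2\<close>)

lemma CF_closed: "f \<in> carrier CF \<Longrightarrow> f' \<in> carrier CF \<Longrightarrow> f + f' \<in> carrier CF" "f \<in> carrier CF \<Longrightarrow> - f \<in> carrier CF"
  "0 \<in> carrier CF"
  unfolding complex_free_def monoid_ring_def by (rule structure_ring_closed; assumption?)+

lemma single_in_CF: "x \<in> carrier r \<Longrightarrow> single x c \<in> carrier CF"
  by (auto simp: CF_simps)

definition "gens2 = {single (x \<oplus>\<^bsub>r\<^esub> y) (c::complex) - single x c - single y c | x y c. x \<in> carrier r \<and> y \<in> carrier r}"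

lemma Rel2_def: "Rel2 = generate (add_monoid CF) gens2"
  by (simp add: complex_relations_def gens2_def)

lemma Rel2_gen: "x \<in> carrier r \<Longrightarrow> y \<in> carrier r \<Longrightarrow> single (x \<oplus>\<^bsub>r\<^esub> y) c - single x c - single y c \<in> Rel2"
  unfolding Rel2_def gens2_def by (rule generate.incl) blast

lemma gens2_CF: "gens2 \<subseteq> carrier CF"
proof
  fix f assume "f \<in> gens2"
  then obtain x y c where xy: "x \<in> carrier r" "y \<in> carrier r"
    and f: "f = single (x \<oplus>\<^bsub>r\<^esub> y) c - single x c - single y c" unfolding gens2_def by blast
  have "single (x \<oplus>\<^bsub>r\<^esub> y) c + - single x c + - single y c \<in> carrier CF"
    using xy by (intro CF_closed single_in_CF) (simp_all add: Theta1_hom)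
  then show "f \<in> carrier CF" by (simp add: f)
qed

lemma gens2_th2: "f \<in> gens2 \<Longrightarrow> th2 f = 0"
proof -
  assume "f \<in> gens2"
  then obtain x y c where xy: "x \<in> carrier r" "y \<in> carrier r"
    and f: "f = single (x \<oplus>\<^bsub>r\<^esub> y) c - single x c - single y c" unfolding gens2_def by blast
  then show ?thesis by (simp add: th2_diff Theta1_hom scale_right_distrib)
qed

lemma Rel2_0: "0 \<in> Rel2" and Rel2_add: "f \<in> Rel2 \<Longrightarrow> f' \<in> Rel2 \<Longrightarrow> f + f' \<in> Rel2"
  and Rel2_uminus: "f \<in> Rel2 \<Longrightarrow> - f \<in> Rel2"
  unfolding Rel2_def
  using generate_additive(1-3)[OF CF_simps(2,3) CF_closed(3,1,2) gens2_CF] by blast+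

lemma Rel2_sub: "f \<in> Rel2 \<Longrightarrow> f \<in> carrier CF \<and> th2 f = 0"
  unfolding Rel2_def
  using generate_additive(4)[OF CF_simps(2,3) CF_closed(3,1,2) gens2_CF]
    generate_additive_zero[OF CF_simps(2,3) CF_closed(3,1,2) gens2_CF th2_add gens2_th2] by blast

abbreviation "gc f \<equiv> Rel1 +>\<^bsub>F\<^esub> f"

lemma green_class_eq: "green_class A M = gc (single (cls M) 1)"
  by (simp add: green_class_def)

lemma gc_r: "f \<in> carrier F \<Longrightarrow> gc f \<in> carrier r"
  by (auto simp: r_eq G1.quot_carrier)

lemma gc_add: "f \<in> carrier F \<Longrightarrow> f' \<in> carrier F \<Longrightarrow> gc f \<oplus>\<^bsub>r\<^esub> gc f' = gc (f + f')"
  by (simp add: r_eq G1.quot_add)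

definition emb2 :: "('i \<Rightarrow>\<^sub>0 complex) \<Rightarrow> (('b rep set \<Rightarrow>\<^sub>0 int) set \<Rightarrow>\<^sub>0 complex)" where
  "emb2 = pm_sum (\<lambda>b c. single (green_class A (rp b)) c)"

lemma emb2_add: "emb2 (m + m') = emb2 m + emb2 m'"
  unfolding emb2_def by (rule pm_sum_add) (simp_all add: single_add)

lemma emb2_single [simp]: "emb2 (single b c) = single (green_class A (rp b)) c"
  unfolding emb2_def by (rule pm_sum_single) simp

lemma emb2_0 [simp]: "emb2 0 = 0" by (simp add: emb2_def)

lemma emb2_uminus: "emb2 (- m) = - emb2 m"
  using emb2_add[of m "- m"] by (simp add: eq_neg_iff_add_eq_0 add.commute)

lemma th2_emb2: "keys m \<subseteq> Bs \<Longrightarrow> th2 (emb2 m) = pm_sum (\<lambda>b c. sc c (\<Phi> (rp b))) m"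
proof (induction rule: pm_induct)
  case (single b m)
  then show ?case using single_in_F[OF fd_rp] fd_rp by (simp add: pm_sum_single green_class_eq G1.Theta)
next
  case (add f f')
  have "pm_sum (\<lambda>b c. sc c (\<Phi> (rp b))) (f + f') =
      pm_sum (\<lambda>b c. sc c (\<Phi> (rp b))) f + pm_sum (\<lambda>b c. sc c (\<Phi> (rp b))) f'"
    by (rule pm_sum_add) (simp_all add: scale_left_distrib)
  then show ?case using add by (simp add: emb2_add th2_add)
qed (simp add: th2_def)

definition red2 :: "(('b rep set \<Rightarrow>\<^sub>0 int) set \<Rightarrow>\<^sub>0 complex) \<Rightarrow> bool" where
  "red2 f \<longleftrightarrow> (\<exists>m. keys m \<subseteq> Bs \<and> f - emb2 m \<in> Rel2)"

lemma red2_add: assumes "red2 f" "red2 f'" shows "red2 (f + f')"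
proof -
  obtain m m' where m: "keys m \<subseteq> Bs" "f - emb2 m \<in> Rel2" "keys m' \<subseteq> Bs" "f' - emb2 m' \<in> Rel2"
    using assms unfolding red2_def by blast
  have "f + f' - emb2 (m + m') \<in> Rel2" using Rel2_add[OF m(2,4)] by (simp add: emb2_add algebra_simps)
  then show ?thesis unfolding red2_def using keys_add[of m m'] m by blast
qed

lemma red2_uminus: assumes "red2 f" shows "red2 (- f)"
proof -
  obtain m where m: "keys m \<subseteq> Bs" "f - emb2 m \<in> Rel2" using assms unfolding red2_def by blast
  then have "- f - emb2 (- m) \<in> Rel2" using Rel2_uminus[OF m(2)] by (simp add: emb2_uminus)
  then show ?thesis unfolding red2_def using m(1) by (intro exI[of _ "- m"]) simp
qed

lemma red2_Rel2: "f \<in> Rel2 \<Longrightarrow> red2 f"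
  unfolding red2_def by (intro exI[of _ 0]) simp

lemma red2_gc_add:
  assumes "f \<in> carrier F" "f' \<in> carrier F" "\<And>c. red2 (single (gc f) c)" "\<And>c. red2 (single (gc f') c)"
  shows "red2 (single (gc (f + f')) c)"
proof -
  have "red2 (single (gc (f + f')) c - single (gc f) c - single (gc f') c)"
    using Rel2_gen[OF gc_r[OF assms(1)] gc_r[OF assms(2)], of c] by (intro red2_Rel2) (simp add: gc_add assms)
  from red2_add[OF red2_add[OF this assms(3)[of c]] assms(4)[of c]] show ?thesis by simp
qed

lemma red2_zero: "red2 (single (gc 0) c)"
proof -
  have "- single (gc 0) c \<in> Rel2"
    using Rel2_gen[OF gc_r[OF F_closed(3)] gc_r[OF F_closed(3)], of c] by (simp add: gc_add F_closed)
  then have "single (gc 0) c \<in> Rel2" using Rel2_uminus by fastforce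
  then show ?thesis by (rule red2_Rel2)
qed

lemma red2_gc_uminus:
  assumes "f \<in> carrier F" "\<And>c. red2 (single (gc f) c)"
  shows "red2 (single (gc (- f)) c)"
proof -
  have "red2 (single (gc 0) c - single (gc f) c - single (gc (- f)) c)"
    using Rel2_gen[OF gc_r[OF assms(1)] gc_r[OF F_closed(2)[OF assms(1)]], of c]
    by (intro red2_Rel2) (simp add: gc_add F_closed assms)
  then have "red2 (- (single (gc 0) c - single (gc f) c - single (gc (- f)) c))" by (rule red2_uminus)
  from red2_add[OF this red2_add[OF red2_zero[of c] red2_uminus[OF assms(2)[of c]]]]
  show ?thesis by simp
qed

lemma red2_emb1: "keys m \<subseteq> Bs \<Longrightarrow> red2 (single (gc (emb1 m)) c)"
proof (induction arbitrary: c rule: pm_induct)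
  case zero
  then show ?case by (simp add: red2_zero)
next
  case (single b a)
  have inF: "single (cls (rp b)) i \<in> carrier F" for i using single_in_F fd_rp single by blast
  have n: "red2 (single (gc (single (cls (rp b)) (int k))) c)" for k c
  proof (induction k arbitrary: c)
    case (Suc k)
    have "single (gc (single (cls (rp b)) 1)) c - emb2 (single b c) \<in> Rel2" for c
      using Rel2_0 by (simp add: green_class_eq)
    then have "red2 (single (gc (single (cls (rp b)) 1)) c)" for c
      unfolding red2_def using single by (intro exI[of _ "single b c"]) auto
    then have "red2 (single (gc (single (cls (rp b)) 1 + single (cls (rp b)) (int k))) c)"
      by (intro red2_gc_add inF Suc)
    then show ?case by (simp flip: single_add)
  qed (simp add: red2_zero)
  show ?case
  proof (cases a rule: int_cases)
    case (nonneg k)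
    then show ?thesis using n by simp
  next
    case (neg k)
    then have a: "single (cls (rp b)) a = - single (cls (rp b)) (int (Suc k))" by (simp only: single_uminus)
    show ?thesis unfolding emb1_single a by (rule red2_gc_uminus[OF inF n])
  qed
next
  case (add f f')
  then show ?case unfolding emb1_add by (intro red2_gc_add emb1_F)
qed

lemma red2_single: assumes "x \<in> carrier r" shows "red2 (single x c)"
proof -
  obtain f where f: "f \<in> carrier F" "x = gc f" using assms by (auto simp: r_eq G1.quot_carrier)
  obtain m where m: "keys m \<subseteq> Bs" "f - emb1 m \<in> Rel1" using F_mod_Rel1[OF f(1)] by blast
  have "x = gc (emb1 m)"
    using f m Rel1_sub[OF m(2)] emb1_F[OF m(1)] by (simp add: G1.coset_eq_iff th1_diff)
  then show ?thesis using red2_emb1[OF m(1)] by simp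
qed

lemma red2_CF: "f \<in> carrier CF \<Longrightarrow> red2 f"
proof -
  assume "f \<in> carrier CF"
  then have "keys f \<subseteq> carrier r" by (simp add: CF_simps)
  then show ?thesis
    by (induction rule: pm_induct) (use red2_Rel2 Rel2_0 red2_single red2_add in auto)
qed

text \<open>The same normal form argument as in \<open>Rel1_eq\<close>, now with complex
  coefficients: this is where independence over \<complex> rather than over the integers is
  used.\<close>

lemma Rel2_eq: "Rel2 = {f \<in> carrier CF. th2 f = 0}"
proof (intro equalityI subsetI)
  fix f assume f: "f \<in> {f \<in> carrier CF. th2 f = 0}"
  then obtain m where m: "keys m \<subseteq> Bs" "f - emb2 m \<in> Rel2" using red2_CF unfolding red2_def by blast
  then have "th2 (emb2 m) = 0" using Rel2_sub[OF m(2)] f by (simp add: th2_diff)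
  then have "(\<Sum>b\<in>keys m. sc (lookup m b) (\<Phi> (rp b))) = 0"
    by (simp add: th2_emb2[OF m(1)] pm_sum_def)
  then have "lookup m b = 0" if "b \<in> keys m" for b
    by (intro indep[of "keys m" "lookup m"]) (use m(1) that in auto)
  then have "m = 0" by (intro poly_mapping_eqI) (metis in_keys_iff lookup_zero)
  then show "f \<in> Rel2" using m(2) by simp
qed (use Rel2_sub in auto)

lemma r_closed: "x \<in> carrier r \<Longrightarrow> y \<in> carrier r \<Longrightarrow> x \<otimes>\<^bsub>r\<^esub> y \<in> carrier r" "\<one>\<^bsub>r\<^esub> \<in> carrier r"
  by (simp_all add: Theta1_hom)

sublocale G2: additive_kernel CF Rel2 th2 mul
proof
  fix x y assume x: "x \<in> carrier CF" "y \<in> carrier CF"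
  show "x \<otimes>\<^bsub>CF\<^esub> y \<in> carrier CF"
  proof -
    have "keys (bilin_ext (\<lambda>x y. single (x \<otimes>\<^bsub>r\<^esub> y) (1::complex)) x y) \<subseteq> carrier r"
      by (rule bilin_ext_closed[where B = "carrier r"]) (use x r_closed in \<open>auto simp: CF_simps\<close>)
    then show ?thesis by (simp add: CF_simps) (simp add: complex_free_def monoid_ring_mult)
  qed
  show "th2 (x \<otimes>\<^bsub>CF\<^esub> y) = mul (th2 x) (th2 y)" using th2_mult x by blast
  show "x + y \<in> carrier CF" "- x \<in> carrier CF" using CF_closed x by blast+
qed (use CF_simps CF_closed r_closed Rel2_eq th2_add in \<open>auto simp: single_in_CF\<close>)

lemma R_eq: "R = CF Quot Rel2" by (simp add: complex_green_ring_def complexification_def)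

abbreviation "\<Theta> \<equiv> G2.\<Theta>"

lemma Theta_one1: "\<Theta>\<^sub>1 \<one>\<^bsub>r\<^esub> = u"
  using G1.Theta_hom(4) fd_one Phi_one by (simp add: r_eq F_simps)

lemma Theta_green_class: "fd_module A M \<Longrightarrow> \<Theta>\<^sub>1 (green_class A M) = \<Phi> M"
  using single_in_F by (simp add: green_class_eq G1.Theta)

lemma green_class_r: "fd_module A M \<Longrightarrow> green_class A M \<in> carrier r"
  using single_in_F by (simp add: green_class_eq gc_r)

lemma complex_tensor_closed: "x \<in> carrier r \<Longrightarrow> complex_tensor r c x \<in> carrier R"
  using single_in_CF by (auto simp: R_eq G2.quot_carrier complex_tensor_def)

lemma Theta_complex_tensor: "x \<in> carrier r \<Longrightarrow> \<Theta> (complex_tensor r c x) = sc c (\<Theta>\<^sub>1 x)"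
  using single_in_CF by (simp add: complex_tensor_def G2.Theta)

lemmas Theta_hom = G2.Theta_hom[folded R_eq]
lemmas Theta_inj = G2.Theta_inj[folded R_eq]

lemma Theta_one: "\<Theta> \<one>\<^bsub>R\<^esub> = u"
  using Theta_hom(4) by (simp add: CF_simps Theta_one1)

lemma Theta_image: "\<Theta> ` carrier R = span (\<Phi> ` rp ` Bs)"
proof (intro equalityI subsetI)
  fix t assume "t \<in> \<Theta> ` carrier R"
  then obtain f where f: "f \<in> carrier CF" "t = th2 f" unfolding R_eq G2.Theta_image by blast
  then obtain m where m: "keys m \<subseteq> Bs" "f - emb2 m \<in> Rel2" using red2_CF unfolding red2_def by blast
  then have "t = th2 (emb2 m)" using Rel2_sub[OF m(2)] f by (simp add: th2_diff)
  also have "\<dots> = (\<Sum>b\<in>keys m. sc (lookup m b) (\<Phi> (rp b)))" by (simp add: th2_emb2[OF m(1)] pm_sum_def)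
  also have "\<dots> \<in> span (\<Phi> ` rp ` Bs)" using m(1) by (intro span_sum span_scale span_base) auto
  finally show "t \<in> span (\<Phi> ` rp ` Bs)" .
next
  fix t assume "t \<in> span (\<Phi> ` rp ` Bs)"
  then show "t \<in> \<Theta> ` carrier R"
  proof (induction rule: span_induct_alt)
    case base
    show ?case using Theta_hom(3,7) by (metis imageI)
  next
    case (step c x y)
    then obtain b z where b: "b \<in> Bs" "x = \<Phi> (rp b)" and z: "z \<in> carrier R" "y = \<Theta> z" by auto
    let ?w = "complex_tensor r c (green_class A (rp b))"
    have w: "?w \<in> carrier R" "\<Theta> ?w = sc c x"
      using complex_tensor_closed green_class_r fd_rp[OF b(1)] b(2)
      by (simp_all add: Theta_complex_tensor Theta_green_class)
    then have "\<Theta> (?w \<oplus>\<^bsub>R\<^esub> z) = sc c x + y" using z by (simp add: Theta_hom)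
    then show ?case using Theta_hom(5)[OF w(1) z(1)] by (metis imageI)
  qed
qed

lemma Phi_in_span: assumes "fd_module A M" shows "\<Phi> M \<in> span (\<Phi> ` rp ` Bs)"
proof -
  have "\<Theta> (complex_tensor r 1 (green_class A M)) = \<Phi> M"
    using assms green_class_r by (simp add: Theta_complex_tensor Theta_green_class)
  then show ?thesis using complex_tensor_closed[OF green_class_r[OF assms], of 1] Theta_image by (metis imageI)
qed

lemma mul_u_span: "t \<in> span (\<Phi> ` rp ` Bs) \<Longrightarrow> mul u t = t"
  by (induction rule: span_induct_alt) (auto simp: mul_add2 mul_sc2 mul_u fd_rp)

text \<open>The map \<open>\<Theta>\<close> is injective and respects both operations, so each law
  is checked on invariants, where \<open>mul\<close> is commutative, associative and
  bilinear.\<close>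

lemma cring_R: "cring R"
proof -
  have e: "x = y" if "x \<in> carrier R" "y \<in> carrier R" "\<Theta> x = \<Theta> y" for x y
    using Theta_inj that by (auto dest: inj_onD)
  have u: "mul u (\<Theta> x) = \<Theta> x" if "x \<in> carrier R" for x
    using mul_u_span Theta_image that by blast
  note th = Theta_hom(1,2,3,5-8) Theta_one
  show ?thesis
  proof (rule cringI)
    show "abelian_group R"
    proof (rule abelian_groupI)
      fix x assume x: "x \<in> carrier R"
      \<comment> \<open>The additive inverse of x is the product of x with the scalar -1 of the
        complexification.\<close>
      let ?w = "complex_tensor r (-1) \<one>\<^bsub>r\<^esub>"
      have w: "?w \<in> carrier R" "\<Theta> ?w = - u"
        using r_closed complex_tensor_closed by (simp_all add: Theta_complex_tensor Theta_one1)
      have "mul (- u) (\<Theta> x) = - \<Theta> x" using mul_sc[of "-1" u "\<Theta> x"] u[OF x] by simp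
      then have "(?w \<otimes>\<^bsub>R\<^esub> x) \<oplus>\<^bsub>R\<^esub> x = \<zero>\<^bsub>R\<^esub>" using x w by (intro e) (simp_all add: th)
      then show "\<exists>y\<in>carrier R. y \<oplus>\<^bsub>R\<^esub> x = \<zero>\<^bsub>R\<^esub>" using th(5)[OF w(1) x] by blast
    qed (rule e; simp add: th add_ac | simp add: th)+
    show "comm_monoid R"
    proof (rule comm_monoidI)
      fix x y assume "x \<in> carrier R" "y \<in> carrier R"
      then show "x \<otimes>\<^bsub>R\<^esub> y = y \<otimes>\<^bsub>R\<^esub> x" by (intro e) (simp_all add: th mul_comm[of "\<Theta> x"])
    qed (rule e; simp add: th u mul_assoc | simp add: th)+
  qed (rule e; simp add: th mul_add)
qed

end

section \<open>Complex dimension from coordinates\<close>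

lemma finsum_coordinate:
  assumes V: "abelian_group V" and fin: "finite S"
    and f: "\<And>x. x \<in> S \<Longrightarrow> f x \<in> carrier V"
    and \<phi>: "\<And>x y. x \<in> carrier V \<Longrightarrow> y \<in> carrier V \<Longrightarrow> \<phi> (x \<oplus>\<^bsub>V\<^esub> y) = \<phi> x + (\<phi> y :: complex)"
  shows "\<phi> (finsum V f S) = (\<Sum>x\<in>S. \<phi> (f x))"
proof -
  interpret abelian_group V by (rule V)
  have \<phi>0: "\<phi> \<zero>\<^bsub>V\<^esub> = 0" using \<phi>[of "\<zero>\<^bsub>V\<^esub>" "\<zero>\<^bsub>V\<^esub>"] by simp
  show ?thesis using fin f
  proof (induction S)
    case (insert x S)
    then have "finsum V f (insert x S) = f x \<oplus>\<^bsub>V\<^esub> finsum V f S" by (intro finsum_insert) auto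
    moreover have "finsum V f S \<in> carrier V" using insert by (intro finsum_closed) auto
    ultimately show ?case using insert by (simp add: \<phi>)
  qed (simp add: \<phi>0)
qed

text \<open>The functionals \<open>\<phi> i\<close> embed \<open>V\<close> into coordinate space, so
  the vector space axioms are checked coordinatewise; the vectors supplied by \<open>surj\<close>
  form the dual basis.\<close>

lemma has_complex_dimI:
  fixes V :: "(complex, 'v) module" and \<phi> :: "'i \<Rightarrow> 'v \<Rightarrow> complex"
  assumes V: "abelian_group V"
    and sm: "\<And>c x. x \<in> carrier V \<Longrightarrow> c \<odot>\<^bsub>V\<^esub> x \<in> carrier V"
    and I: "finite I"
    and add: "\<And>i x y. i \<in> I \<Longrightarrow> x \<in> carrier V \<Longrightarrow> y \<in> carrier V \<Longrightarrow> \<phi> i (x \<oplus>\<^bsub>V\<^esub> y) = \<phi> i x + \<phi> i y"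
    and hom: "\<And>i c x. i \<in> I \<Longrightarrow> x \<in> carrier V \<Longrightarrow> \<phi> i (c \<odot>\<^bsub>V\<^esub> x) = c * \<phi> i x"
    and inj: "\<And>x. x \<in> carrier V \<Longrightarrow> (\<And>i. i \<in> I \<Longrightarrow> \<phi> i x = 0) \<Longrightarrow> x = \<zero>\<^bsub>V\<^esub>"
    and surj: "\<And>i. i \<in> I \<Longrightarrow> \<exists>e\<in>carrier V. \<forall>j\<in>I. \<phi> j e = (if j = i then 1 else 0)"
  shows "has_complex_dim V (card I)"
proof -
  interpret abelian_group V by (rule V)
  have \<phi>0: "\<phi> i \<zero>\<^bsub>V\<^esub> = 0" if "i \<in> I" for i using add[OF that, of "\<zero>\<^bsub>V\<^esub>" "\<zero>\<^bsub>V\<^esub>"] by simp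
  have \<phi>m: "\<phi> i (\<ominus>\<^bsub>V\<^esub> x) = - \<phi> i x" if "i \<in> I" "x \<in> carrier V" for i x
    using add[OF that(1), of x "\<ominus>\<^bsub>V\<^esub> x"] that \<phi>0 by (simp add: r_neg eq_neg_iff_add_eq_0 add.commute)
  have eqI: "x = y" if xy: "x \<in> carrier V" "y \<in> carrier V" "\<And>i. i \<in> I \<Longrightarrow> \<phi> i x = \<phi> i y" for x y
  proof -
    have "x \<oplus>\<^bsub>V\<^esub> \<ominus>\<^bsub>V\<^esub> y = \<zero>\<^bsub>V\<^esub>" by (rule inj) (use xy in \<open>simp_all add: add \<phi>m\<close>)
    then have "\<ominus>\<^bsub>V\<^esub> (\<ominus>\<^bsub>V\<^esub> y) = x" using xy by (intro minus_equality) auto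
    then show ?thesis using xy by simp
  qed
  have vs: "vectorspace class_ring V"
  proof (intro vectorspace.intro module.intro module_axioms.intro class_field V)
    show "cring (class_ring :: complex ring)"
      by (rule domain.axioms(1)[OF field.axioms(1)[OF class_field]])
  qed (auto intro!: eqI simp: sm add hom algebra_simps)
  interpret vectorspace "class_ring :: complex ring" V by (rule vs)
  obtain e where e: "\<And>i. i \<in> I \<Longrightarrow> e i \<in> carrier V" "\<And>i j. i \<in> I \<Longrightarrow> j \<in> I \<Longrightarrow> \<phi> j (e i) = (if j = i then 1 else 0)"
    using surj by metis
  have inj_e: "inj_on e I"
    by (rule inj_onI) (metis e(2) zero_neq_one)
  define B where "B = e ` I"
  have B: "finite B" "B \<subseteq> carrier V" "card B = card I"
    using I e(1) inj_e by (auto simp: B_def card_image)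
  have lc: "\<phi> j (lincomb a A) = (\<Sum>i | i \<in> I \<and> e i \<in> A. a (e i) * \<phi> j (e i))"
    if A: "A \<subseteq> B" and j: "j \<in> I" for a A j
  proof -
    have "finite A" "A \<subseteq> carrier V" using A B by (auto intro: finite_subset)
    then have "\<phi> j (lincomb a A) = (\<Sum>v\<in>A. \<phi> j (a v \<odot>\<^bsub>V\<^esub> v))"
      unfolding lincomb_def by (intro finsum_coordinate V) (auto simp: sm add j)
    also have "\<dots> = (\<Sum>v\<in>A. a v * \<phi> j v)"
      using \<open>A \<subseteq> carrier V\<close> by (intro sum.cong) (auto simp: hom j)
    also have "\<dots> = (\<Sum>v\<in>e ` {i \<in> I. e i \<in> A}. a v * \<phi> j v)"
      using A by (intro sum.cong) (auto simp: B_def)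
    also have "\<dots> = (\<Sum>i | i \<in> I \<and> e i \<in> A. a (e i) * \<phi> j (e i))"
      by (subst sum.reindex) (use inj_e in \<open>auto intro: inj_on_subset\<close>)
    finally show ?thesis .
  qed
  have lc': "\<phi> j (lincomb a A) = (if e j \<in> A then a (e j) else 0)" if A: "A \<subseteq> B" and j: "j \<in> I" for a A j
  proof -
    have "\<phi> j (lincomb a A) = (\<Sum>i | i \<in> I \<and> e i \<in> A. if i = j then a (e j) else 0)"
      unfolding lc[OF that] using j e(2) by (intro sum.cong) auto
    then show ?thesis using I j by simp
  qed
  have "lin_indpt B"
  proof
    assume "lin_dep B"
    then obtain A a v where A: "finite A" "A \<subseteq> B" "lincomb a A = \<zero>\<^bsub>V\<^esub>" "v \<in> A" "a v \<noteq> 0"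
      unfolding lin_dep_def by auto
    then obtain j where j: "j \<in> I" "v = e j" by (auto simp: B_def)
    have "\<phi> j (lincomb a A) = a v" using lc'[OF A(2) j(1)] j A(4) by simp
    then show False using A(3,5) \<phi>0[OF j(1)] by simp
  qed
  moreover have gen: "gen_set B"
  proof -
    have "x \<in> span B" if x: "x \<in> carrier V" for x
    proof -
      define a where "a v = \<phi> (inv_into I e v) x" for v
      have "lincomb a B = x"
      proof (rule eqI)
        show "lincomb a B \<in> carrier V" using B by (intro lincomb_closed) auto
        fix j assume j: "j \<in> I"
        then show "\<phi> j (lincomb a B) = \<phi> j x" using lc'[of B j a] inj_e by (simp add: a_def B_def)
      qed (rule x)
      then show ?thesis unfolding span_def using B(1) by (auto intro!: exI[of _ a] exI[of _ B])
    qed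
    moreover have "span B \<subseteq> carrier V" using B(2) by (rule span_is_subset2)
    ultimately show ?thesis by blast
  qed
  ultimately have "basis B" using B by (simp add: basis_def)
  then have "dim = card I" using dim_basis[OF B(1)] B by simp
  moreover have "fin_dim" unfolding fin_dim_def using B gen by blast
  ultimately show ?thesis using vs by (simp add: has_complex_dim_def)
qed

section \<open>Commutative algebras with finitely many complex points\<close>

lemma left_module_submoduleI:
  assumes M: "left_module R M" and U: "U \<subseteq> carrier M" "U \<noteq> {}"
    and add: "\<And>x y. x \<in> U \<Longrightarrow> y \<in> U \<Longrightarrow> x \<oplus>\<^bsub>M\<^esub> y \<in> U"
    and sm: "\<And>a x. a \<in> carrier R \<Longrightarrow> x \<in> U \<Longrightarrow> a \<odot>\<^bsub>M\<^esub> x \<in> U"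
  shows "Module.submodule U R M"
proof -
  interpret left_module R M by (rule M)
  have z: "\<zero>\<^bsub>R\<^esub> \<odot>\<^bsub>M\<^esub> x = \<zero>\<^bsub>M\<^esub>" if "x \<in> carrier M" for x
    using lm_smult_l_distr[of "\<zero>\<^bsub>R\<^esub>" "\<zero>\<^bsub>R\<^esub>" x] that lm_smult_closed[of "\<zero>\<^bsub>R\<^esub>" x]
    by (metis M.add.l_cancel_one' R.zero_closed R.l_zero)
  have neg: "\<ominus>\<^bsub>M\<^esub> x = (\<ominus>\<^bsub>R\<^esub> \<one>\<^bsub>R\<^esub>) \<odot>\<^bsub>M\<^esub> x" if x: "x \<in> carrier M" for x
  proof (rule M.minus_equality)
    have "(\<ominus>\<^bsub>R\<^esub> \<one>\<^bsub>R\<^esub>) \<odot>\<^bsub>M\<^esub> x \<oplus>\<^bsub>M\<^esub> \<one>\<^bsub>R\<^esub> \<odot>\<^bsub>M\<^esub> x = \<zero>\<^bsub>M\<^esub>"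
      using x z by (simp flip: lm_smult_l_distr add: R.l_neg)
    then show "(\<ominus>\<^bsub>R\<^esub> \<one>\<^bsub>R\<^esub>) \<odot>\<^bsub>M\<^esub> x \<oplus>\<^bsub>M\<^esub> x = \<zero>\<^bsub>M\<^esub>" using x by (simp add: lm_smult_one)
  qed (use x lm_smult_closed in auto)
  show ?thesis
  proof (intro Module.submodule.intro Module.submodule_axioms.intro group.subgroupI)
    show "group (add_monoid M)" by (rule M.a_group)
    fix x assume "x \<in> U"
    then have "(\<ominus>\<^bsub>R\<^esub> \<one>\<^bsub>R\<^esub>) \<odot>\<^bsub>M\<^esub> x \<in> U" by (intro sm) auto
    then show "inv\<^bsub>add_monoid M\<^esub> x \<in> U" using neg[of x] U(1) \<open>x \<in> U\<close> by (auto simp: a_inv_def)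
  qed (use U add sm in auto)
qed

lemma submoduleD:
  assumes "Module.submodule U R M"
  shows "U \<subseteq> carrier M" "\<zero>\<^bsub>M\<^esub> \<in> U" "x \<in> U \<Longrightarrow> y \<in> U \<Longrightarrow> x \<oplus>\<^bsub>M\<^esub> y \<in> U"
    "a \<in> carrier R \<Longrightarrow> x \<in> U \<Longrightarrow> a \<odot>\<^bsub>M\<^esub> x \<in> U"
proof -
  have sg: "subgroup U (add_monoid M)" using assms by (simp add: Module.submodule_def)
  show "U \<subseteq> carrier M" "\<zero>\<^bsub>M\<^esub> \<in> U" using subgroup.subset[OF sg] subgroup.one_closed[OF sg] by auto
  show "x \<in> U \<Longrightarrow> y \<in> U \<Longrightarrow> x \<oplus>\<^bsub>M\<^esub> y \<in> U" using subgroup.m_closed[OF sg] by auto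
  show "a \<in> carrier R \<Longrightarrow> x \<in> U \<Longrightarrow> a \<odot>\<^bsub>M\<^esub> x \<in> U"
    using assms by (simp add: Module.submodule_def Module.submodule_axioms_def)
qed

text \<open>The set \<open>L\<close> lists the points, with values \<open>lam\<close>, and
  \<open>\<iota>\<close> embeds the scalars. The condition \<open>nil\<close> says that elements
  vanishing at all points are nilpotent; it plays the part of a finiteness condition and is verified
  directly for both Green rings.\<close>

locale pointed_algebra = cring R for R :: "'a ring" (structure) +
  fixes \<iota> :: "complex \<Rightarrow> 'a" and L :: "'l set" and lam :: "'l \<Rightarrow> 'a \<Rightarrow> complex"
  assumes fin_L: "finite L"
    and \<iota>_closed [simp]: "\<iota> c \<in> carrier R" and \<iota>_add: "\<iota> (c + d) = \<iota> c \<oplus> \<iota> d"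
    and \<iota>_mult: "\<iota> (c * d) = \<iota> c \<otimes> \<iota> d" and \<iota>_one: "\<iota> 1 = \<one>"
    and lam_add: "l \<in> L \<Longrightarrow> x \<in> carrier R \<Longrightarrow> y \<in> carrier R \<Longrightarrow> lam l (x \<oplus> y) = lam l x + lam l y"
    and lam_mult: "l \<in> L \<Longrightarrow> x \<in> carrier R \<Longrightarrow> y \<in> carrier R \<Longrightarrow> lam l (x \<otimes> y) = lam l x * lam l y"
    and lam_\<iota>: "l \<in> L \<Longrightarrow> lam l (\<iota> c) = c"
    and lam_separate: "l \<in> L \<Longrightarrow> l' \<in> L \<Longrightarrow> l \<noteq> l' \<Longrightarrow> \<exists>x\<in>carrier R. lam l x \<noteq> lam l' x"
    and nil: "x \<in> carrier R \<Longrightarrow> (\<And>l. l \<in> L \<Longrightarrow> lam l x = 0) \<Longrightarrow> \<exists>k::nat. x [^] k = \<zero>"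
begin

lemma lam_zero: "l \<in> L \<Longrightarrow> lam l \<zero> = 0" using lam_add[of l \<zero> \<zero>] by simp
lemma lam_one: "l \<in> L \<Longrightarrow> lam l \<one> = 1" using lam_\<iota>[of l 1] by (simp add: \<iota>_one)
lemma lam_minus: "l \<in> L \<Longrightarrow> x \<in> carrier R \<Longrightarrow> lam l (\<ominus> x) = - lam l x"
  using lam_add[of l x "\<ominus> x"] lam_zero by (simp add: r_neg eq_neg_iff_add_eq_0 add.commute)

lemma R_ring: "ring R" by (rule ring_axioms)

definition acts :: "'l \<Rightarrow> ('a, 'v) module \<Rightarrow> bool" where
  "acts l M \<longleftrightarrow> (\<forall>x\<in>carrier R. \<forall>m\<in>carrier M. x \<odot>\<^bsub>M\<^esub> m = \<iota> (lam l x) \<odot>\<^bsub>M\<^esub> m)"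

lemma actsD: "acts l M \<Longrightarrow> x \<in> carrier R \<Longrightarrow> m \<in> carrier M \<Longrightarrow> x \<odot>\<^bsub>M\<^esub> m = \<iota> (lam l x) \<odot>\<^bsub>M\<^esub> m"
  by (simp only: acts_def)

lemma sub_add: "x \<in> carrier R \<Longrightarrow> y \<in> carrier R \<Longrightarrow> (x \<oplus> \<ominus> y) \<oplus> y = x"
  by (simp add: a_assoc l_neg)

text \<open>If no point annihilated \<open>M\<close>, a product of elements of the kernels would be nilpotent and act
  injectively.\<close>

lemma simple_acts:
  fixes M :: "('a, 'v) module"
  assumes M: "simple_module R M"
  shows "\<exists>l\<in>L. acts l M"
proof -
  interpret left_module R M using M by (simp add: simple_module_def)
  have LM: "left_module R M" using M by (simp add: simple_module_def)
  have sm0: "x \<odot>\<^bsub>M\<^esub> \<zero>\<^bsub>M\<^esub> = \<zero>\<^bsub>M\<^esub>" if "x \<in> carrier R" for x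
    using lm_smult_r_distr[of x "\<zero>\<^bsub>M\<^esub>" "\<zero>\<^bsub>M\<^esub>"] that lm_smult_closed[of x "\<zero>\<^bsub>M\<^esub>"]
      M.add.l_cancel_one'[of "x \<odot>\<^bsub>M\<^esub> \<zero>\<^bsub>M\<^esub>" "x \<odot>\<^bsub>M\<^esub> \<zero>\<^bsub>M\<^esub>"] by simp
  have sm0': "\<zero> \<odot>\<^bsub>M\<^esub> m = \<zero>\<^bsub>M\<^esub>" if "m \<in> carrier M" for m
    using lm_smult_l_distr[of \<zero> \<zero> m] that lm_smult_closed[of \<zero> m]
      M.add.l_cancel_one'[of "\<zero> \<odot>\<^bsub>M\<^esub> m" "\<zero> \<odot>\<^bsub>M\<^esub> m"] add.l_one[OF add.one_closed] add.one_closed by simp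
  have dich: "(\<forall>m\<in>carrier M. x \<odot>\<^bsub>M\<^esub> m = \<zero>\<^bsub>M\<^esub>) \<or> (\<forall>m\<in>carrier M. x \<odot>\<^bsub>M\<^esub> m = \<zero>\<^bsub>M\<^esub> \<longrightarrow> m = \<zero>\<^bsub>M\<^esub>)"
    if x: "x \<in> carrier R" for x
  proof -
    let ?U = "{m \<in> carrier M. x \<odot>\<^bsub>M\<^esub> m = \<zero>\<^bsub>M\<^esub>}"
    have "Module.submodule ?U R M"
    proof (rule left_module_submoduleI[OF LM])
      show "?U \<noteq> {}" using sm0[OF x] by blast
      fix y m assume y: "y \<in> carrier R" and m: "m \<in> ?U"
      have "x \<odot>\<^bsub>M\<^esub> (y \<odot>\<^bsub>M\<^esub> m) = y \<odot>\<^bsub>M\<^esub> (x \<odot>\<^bsub>M\<^esub> m)"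
        using x y m lm_smult_assoc[of x y m] lm_smult_assoc[of y x m] m_comm[of x y] by simp
      then show "y \<odot>\<^bsub>M\<^esub> m \<in> ?U" using y m sm0 lm_smult_closed by simp
    qed (auto simp: lm_smult_r_distr x)
    then have "?U = {\<zero>\<^bsub>M\<^esub>} \<or> ?U = carrier M" using M by (simp add: simple_module_def)
    then show ?thesis by blast
  qed
  have ex: "\<exists>l\<in>L. \<forall>x\<in>carrier R. lam l x = 0 \<longrightarrow> (\<forall>m\<in>carrier M. x \<odot>\<^bsub>M\<^esub> m = \<zero>\<^bsub>M\<^esub>)"
  proof (rule ccontr)
    assume no: "\<not> ?thesis"
    have "\<exists>x\<in>carrier R. (\<forall>l\<in>S. lam l x = 0) \<and> (\<forall>m\<in>carrier M. x \<odot>\<^bsub>M\<^esub> m = \<zero>\<^bsub>M\<^esub> \<longrightarrow> m = \<zero>\<^bsub>M\<^esub>)"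
      if "finite S" "S \<subseteq> L" for S
      using that
    proof (induction S)
      case empty
      show ?case by (rule bexI[of _ \<one>]) (auto simp: lm_smult_one)
    next
      case (insert l S)
      then obtain x where x: "x \<in> carrier R" "\<forall>l\<in>S. lam l x = 0"
        "\<forall>m\<in>carrier M. x \<odot>\<^bsub>M\<^esub> m = \<zero>\<^bsub>M\<^esub> \<longrightarrow> m = \<zero>\<^bsub>M\<^esub>" by blast
      obtain y where y: "y \<in> carrier R" "lam l y = 0" "\<forall>m\<in>carrier M. y \<odot>\<^bsub>M\<^esub> m = \<zero>\<^bsub>M\<^esub> \<longrightarrow> m = \<zero>\<^bsub>M\<^esub>"
      proof -
        have "\<exists>y\<in>carrier R. lam l y = 0 \<and> \<not> (\<forall>m\<in>carrier M. y \<odot>\<^bsub>M\<^esub> m = \<zero>\<^bsub>M\<^esub>)" using no insert.prems by blast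
        then obtain y where y: "y \<in> carrier R" "lam l y = 0" "\<not> (\<forall>m\<in>carrier M. y \<odot>\<^bsub>M\<^esub> m = \<zero>\<^bsub>M\<^esub>)" by (elim bexE conjE)
        show thesis using dich[OF y(1)] y(3) by (intro that[OF y(1,2)]) simp
      qed
      show ?case
      proof (rule bexI[of _ "x \<otimes> y"], intro conjI ballI impI)
        show "lam l' (x \<otimes> y) = 0" if "l' \<in> insert l S" for l'
        proof -
          have "lam l' (x \<otimes> y) = lam l' x * lam l' y" using that insert.prems x(1) y(1) by (intro lam_mult) auto
          then show ?thesis using that x(2) y(2) by auto
        qed
        fix m assume m: "m \<in> carrier M" "x \<otimes> y \<odot>\<^bsub>M\<^esub> m = \<zero>\<^bsub>M\<^esub>"
        then have "x \<odot>\<^bsub>M\<^esub> (y \<odot>\<^bsub>M\<^esub> m) = \<zero>\<^bsub>M\<^esub>" using lm_smult_assoc[OF x(1) y(1)] by simp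
        then have "y \<odot>\<^bsub>M\<^esub> m = \<zero>\<^bsub>M\<^esub>" using x(3) lm_smult_closed[OF y(1) m(1)] by blast
        then show "m = \<zero>\<^bsub>M\<^esub>" using y(3) m(1) by blast
      qed (use x(1) y(1) in simp)
    qed
    then obtain x where x: "x \<in> carrier R" "\<forall>l\<in>L. lam l x = 0"
      "\<forall>m\<in>carrier M. x \<odot>\<^bsub>M\<^esub> m = \<zero>\<^bsub>M\<^esub> \<longrightarrow> m = \<zero>\<^bsub>M\<^esub>" using fin_L by blast
    obtain k :: nat where k: "x [^] k = \<zero>" using nil x by blast
    have inj: "x [^] j \<odot>\<^bsub>M\<^esub> m = \<zero>\<^bsub>M\<^esub> \<Longrightarrow> m = \<zero>\<^bsub>M\<^esub>" if "m \<in> carrier M" for j :: nat and m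
      using that
    proof (induction j arbitrary: m)
      case 0
      then show ?case by (simp add: lm_smult_one)
    next
      case (Suc j)
      have "x [^] j \<odot>\<^bsub>M\<^esub> (x \<odot>\<^bsub>M\<^esub> m) = \<zero>\<^bsub>M\<^esub>" using Suc.prems x by (simp add: lm_smult_assoc)
      then have "x \<odot>\<^bsub>M\<^esub> m = \<zero>\<^bsub>M\<^esub>" using Suc.IH[of "x \<odot>\<^bsub>M\<^esub> m"] x Suc.prems(2) lm_smult_closed by blast
      then show ?case using x Suc.prems by blast
    qed
    have "m = \<zero>\<^bsub>M\<^esub>" if "m \<in> carrier M" for m using inj[OF that, of k] k sm0'[OF that] by simp
    then have "carrier M = {\<zero>\<^bsub>M\<^esub>}" using M.zero_closed by blast
    then show False using M by (simp add: simple_module_def)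
  qed
  then obtain l where l: "l \<in> L" "\<And>x m. x \<in> carrier R \<Longrightarrow> lam l x = 0 \<Longrightarrow> m \<in> carrier M \<Longrightarrow> x \<odot>\<^bsub>M\<^esub> m = \<zero>\<^bsub>M\<^esub>"
    by blast
  have "x \<odot>\<^bsub>M\<^esub> m = \<iota> (lam l x) \<odot>\<^bsub>M\<^esub> m" if x: "x \<in> carrier R" and m: "m \<in> carrier M" for x m
  proof -
    let ?y = "x \<oplus> \<ominus> \<iota> (lam l x)"
    have "?y \<odot>\<^bsub>M\<^esub> m = \<zero>\<^bsub>M\<^esub>" by (rule l(2)) (use l(1) x m in \<open>simp_all add: lam_add lam_minus lam_\<iota>\<close>)
    moreover have "?y \<oplus> \<iota> (lam l x) = x" using x \<iota>_closed by (rule sub_add)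
    then have "x \<odot>\<^bsub>M\<^esub> m = ?y \<odot>\<^bsub>M\<^esub> m \<oplus>\<^bsub>M\<^esub> \<iota> (lam l x) \<odot>\<^bsub>M\<^esub> m"
      using lm_smult_l_distr[of ?y "\<iota> (lam l x)" m] x m by simp
    ultimately show ?thesis using m by (simp add: lm_smult_closed)
  qed
  then show ?thesis using l(1) unfolding acts_def by blast
qed

text \<open>Since the ring acts through a point, hence by scalars, every complex line is a
  submodule; a simple module is therefore a single line.\<close>

lemma simple_line:
  assumes M: "simple_module R M" and v: "v \<in> carrier M" "v \<noteq> \<zero>\<^bsub>M\<^esub>"
  shows "carrier M = (\<lambda>c. \<iota> c \<odot>\<^bsub>M\<^esub> v) ` UNIV" "inj (\<lambda>c. \<iota> c \<odot>\<^bsub>M\<^esub> v)"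
proof -
  interpret left_module R M using M by (simp add: simple_module_def)
  have LM: "left_module R M" using M by (simp add: simple_module_def)
  obtain l where l: "l \<in> L" "acts l M" using simple_acts[OF M] by blast
  let ?U = "(\<lambda>c. \<iota> c \<odot>\<^bsub>M\<^esub> v) ` UNIV"
  have "Module.submodule ?U R M"
  proof (rule left_module_submoduleI[OF LM])
    show "?U \<subseteq> carrier M" using lm_smult_closed v by auto
    fix x y assume "x \<in> ?U" "y \<in> ?U"
    then show "x \<oplus>\<^bsub>M\<^esub> y \<in> ?U" using v by (auto simp flip: lm_smult_l_distr \<iota>_add)
  next
    fix a x assume a: "a \<in> carrier R" and "x \<in> ?U"
    then obtain c where c: "x = \<iota> c \<odot>\<^bsub>M\<^esub> v" by blast
    then have "a \<odot>\<^bsub>M\<^esub> x = (a \<otimes> \<iota> c) \<odot>\<^bsub>M\<^esub> v" using a v by (simp add: lm_smult_assoc)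
    also have "\<dots> = \<iota> (lam l (a \<otimes> \<iota> c)) \<odot>\<^bsub>M\<^esub> v" by (rule actsD[OF l(2)]) (use a v in auto)
    finally show "a \<odot>\<^bsub>M\<^esub> x \<in> ?U" by blast
  qed auto
  moreover have "v \<in> ?U" using lm_smult_one[OF v(1)] by (metis \<iota>_one rangeI)
  ultimately show "carrier M = ?U" using M v(2) unfolding simple_module_def by blast
  show "inj (\<lambda>c. \<iota> c \<odot>\<^bsub>M\<^esub> v)"
  proof (rule injI, rule ccontr)
    fix c d assume eq: "\<iota> c \<odot>\<^bsub>M\<^esub> v = \<iota> d \<odot>\<^bsub>M\<^esub> v" and ne: "c \<noteq> d"
    have "\<iota> c \<odot>\<^bsub>M\<^esub> v = \<iota> (c - d) \<odot>\<^bsub>M\<^esub> v \<oplus>\<^bsub>M\<^esub> \<iota> d \<odot>\<^bsub>M\<^esub> v"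
      using v by (simp flip: lm_smult_l_distr \<iota>_add)
    then have z: "\<iota> (c - d) \<odot>\<^bsub>M\<^esub> v = \<zero>\<^bsub>M\<^esub>"
      using eq M.add.r_cancel_one[of "\<iota> d \<odot>\<^bsub>M\<^esub> v" "\<iota> (c - d) \<odot>\<^bsub>M\<^esub> v"] v lm_smult_closed by simp
    have "v = \<iota> (1 / (c - d)) \<odot>\<^bsub>M\<^esub> (\<iota> (c - d) \<odot>\<^bsub>M\<^esub> v)"
      using ne v lm_smult_one by (simp flip: lm_smult_assoc \<iota>_mult) (simp add: \<iota>_one lm_smult_one)
    also have "\<dots> = \<zero>\<^bsub>M\<^esub>"
      unfolding z using lm_smult_r_distr[of "\<iota> (1 / (c - d))" "\<zero>\<^bsub>M\<^esub>" "\<zero>\<^bsub>M\<^esub>"]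
        lm_smult_closed[of "\<iota> (1 / (c - d))" "\<zero>\<^bsub>M\<^esub>"]
      by (metis M.add.l_cancel_one' M.zero_closed M.l_zero \<iota>_closed)
    finally show False using v(2) by simp
  qed
qed

lemma simple_nonzero: assumes M: "simple_module R M" obtains v where "v \<in> carrier M" "v \<noteq> \<zero>\<^bsub>M\<^esub>"
proof -
  interpret left_module R M using M by (simp add: simple_module_def)
  show thesis using M M.zero_closed that unfolding simple_module_def by blast
qed

lemma acts_unique:
  assumes M: "simple_module R M" and l: "l \<in> L" "acts l M" "l' \<in> L" "acts l' M"
  shows "l = l'"
proof (rule ccontr)
  assume "l \<noteq> l'"
  then obtain x where x: "x \<in> carrier R" "lam l x \<noteq> lam l' x" using lam_separate l by blast
  obtain v where v: "v \<in> carrier M" "v \<noteq> \<zero>\<^bsub>M\<^esub>" using simple_nonzero[OF M] by blast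
  have "\<iota> (lam l x) \<odot>\<^bsub>M\<^esub> v = \<iota> (lam l' x) \<odot>\<^bsub>M\<^esub> v" using l x v unfolding acts_def by metis
  then show False using simple_line(2)[OF M v] x(2) by (auto dest: injD)
qed

lemma iso_iff_acts:
  assumes M: "simple_module R M" and N: "simple_module R N" and l: "l \<in> L" "acts l M" and l': "l' \<in> L" "acts l' N"
  shows "module_iso R M N \<longleftrightarrow> l = l'"
proof
  interpret M: left_module R M using M by (simp add: simple_module_def)
  interpret N: left_module R N using N by (simp add: simple_module_def)
  {
    assume "module_iso R M N"
    then obtain f where f: "bij_betw f (carrier M) (carrier N)"
      "\<And>a x. a \<in> carrier R \<Longrightarrow> x \<in> carrier M \<Longrightarrow> f (a \<odot>\<^bsub>M\<^esub> x) = a \<odot>\<^bsub>N\<^esub> f x"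
      unfolding module_iso_def by blast
    have "acts l N" unfolding acts_def
    proof (intro ballI)
      fix x m assume x: "x \<in> carrier R" and m: "m \<in> carrier N"
      then obtain m0 where m0: "m0 \<in> carrier M" "m = f m0" using f(1) by (auto simp: bij_betw_def)
      have "f (x \<odot>\<^bsub>M\<^esub> m0) = f (\<iota> (lam l x) \<odot>\<^bsub>M\<^esub> m0)" using actsD[OF l(2) x m0(1)] by (rule arg_cong)
      then show "x \<odot>\<^bsub>N\<^esub> m = \<iota> (lam l x) \<odot>\<^bsub>N\<^esub> m" using f(2) x m0 by simp
    qed
    then show "l = l'" using acts_unique[OF N] l l' by blast
  }
  assume ll: "l = l'"
  obtain v where v: "v \<in> carrier M" "v \<noteq> \<zero>\<^bsub>M\<^esub>" using simple_nonzero[OF M] by blast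
  obtain w where w: "w \<in> carrier N" "w \<noteq> \<zero>\<^bsub>N\<^esub>" using simple_nonzero[OF N] by blast
  note sv = simple_line[OF M v] and sw = simple_line[OF N w]
  define f where "f x = \<iota> (inv_into UNIV (\<lambda>c. \<iota> c \<odot>\<^bsub>M\<^esub> v) x) \<odot>\<^bsub>N\<^esub> w" for x
  have f: "f (\<iota> c \<odot>\<^bsub>M\<^esub> v) = \<iota> c \<odot>\<^bsub>N\<^esub> w" for c
    unfolding f_def using inv_f_f[OF sv(2), of c] by simp
  show "module_iso R M N" unfolding module_iso_def
  proof (intro exI[of _ f] conjI ballI)
    show "bij_betw f (carrier M) (carrier N)"
      unfolding bij_betw_def sv(1) sw(1) using sw(2) by (auto simp: f image_image intro!: inj_onI dest: injD)
    fix x assume "x \<in> carrier M"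
    then obtain c where x: "x = \<iota> c \<odot>\<^bsub>M\<^esub> v" unfolding sv(1) by blast
    {
      fix y assume "y \<in> carrier M"
      then obtain d where y: "y = \<iota> d \<odot>\<^bsub>M\<^esub> v" unfolding sv(1) by blast
      show "f (x \<oplus>\<^bsub>M\<^esub> y) = f x \<oplus>\<^bsub>N\<^esub> f y"
        using v w by (simp add: x y f flip: M.lm_smult_l_distr N.lm_smult_l_distr \<iota>_add)
    next
      fix a assume a: "a \<in> carrier R"
      have "a \<odot>\<^bsub>M\<^esub> x = (a \<otimes> \<iota> c) \<odot>\<^bsub>M\<^esub> v" "a \<odot>\<^bsub>N\<^esub> f x = (a \<otimes> \<iota> c) \<odot>\<^bsub>N\<^esub> w"
        using a v w by (simp_all add: x f M.lm_smult_assoc N.lm_smult_assoc)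
      then have "a \<odot>\<^bsub>M\<^esub> x = \<iota> (lam l (a \<otimes> \<iota> c)) \<odot>\<^bsub>M\<^esub> v" "a \<odot>\<^bsub>N\<^esub> f x = \<iota> (lam l (a \<otimes> \<iota> c)) \<odot>\<^bsub>N\<^esub> w"
        using actsD[OF l(2), of "a \<otimes> \<iota> c" v] actsD[OF l'(2), of "a \<otimes> \<iota> c" w] ll a v w by simp_all
      then show "f (a \<odot>\<^bsub>M\<^esub> x) = a \<odot>\<^bsub>N\<^esub> f x" by (simp add: f)
    }
  qed
qed

text \<open>The complex numbers, with the ring acting through the point, are simple;
  \<open>simple_module_universe\<close> moves them into the type over which classes are
  taken.\<close>

lemma simple_exists:
  assumes l: "l \<in> L"
  shows "\<exists>M :: ('a, 'a set) module. simple_module R M \<and> acts l M"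
proof -
  define C :: "('a, complex) module" where "C = \<lparr>carrier = UNIV, mult = undefined, one = undefined,
    zero = 0, add = (+), smult = (\<lambda>x c. lam l x * c)\<rparr>"
  have C: "carrier C = UNIV" "zero C = 0" "add C = (+)" "x \<odot>\<^bsub>C\<^esub> c = lam l x * c" for x c by (simp_all add: C_def)
  have "abelian_group C"
    by (rule abelian_groupI) (auto simp: C add.assoc intro: exI[of _ "- _"])
  then have LM: "left_module R C"
    by (intro left_module.intro left_module_axioms.intro R_ring)
      (auto simp: C lam_add lam_mult lam_one l algebra_simps)
  have S: "simple_module R C"
    unfolding simple_module_def
  proof (intro conjI LM allI impI)
    show "carrier C \<noteq> {\<zero>\<^bsub>C\<^esub>}" by (metis C(1,2) UNIV_I singletonD zero_neq_one)
    fix U assume U: "Module.submodule U R C"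
    note UD = submoduleD[OF U]
    show "U = {\<zero>\<^bsub>C\<^esub>} \<or> U = carrier C"
    proof (cases "U = {0}")
      case False
      then obtain u where u: "u \<in> U" "u \<noteq> 0" using UD(2) C(2) by auto
      have "c \<in> U" for c using UD(4)[of "\<iota> (c / u)" u] u l by (simp add: C lam_\<iota>)
      then show ?thesis by (auto simp: C)
    qed (simp add: C)
  qed
  obtain N :: "('a, 'a set) module" where N: "simple_module R N" "module_iso R C N"
    using simple_module_universe[OF S] by blast
  have aC: "acts l C" by (simp add: acts_def C lam_\<iota> l)
  obtain l' where l': "l' \<in> L" "acts l' N" using simple_acts[OF N(1)] by blast
  then have "l = l'" using iso_iff_acts[OF S N(1) l aC l'] N(2) by blast
  then show ?thesis using N(1) l' by blast
qed

definition points_class :: "'l \<Rightarrow> ('a, 'a set) module set" where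
  "points_class l = {M. simple_module R M \<and> acts l M}"

theorem simple_classes_points: "bij_betw points_class L (simple_classes R)"
proof -
  let ?rel = "{(M, N). simple_module R M \<and> simple_module R N \<and> module_iso R M N} ::
      (('a, 'a set) module \<times> ('a, 'a set) module) set"
  have cls: "?rel `` {M} = points_class l" if "simple_module R M" "l \<in> L" "acts l M" for M l
  proof -
    have "module_iso R M N \<longleftrightarrow> acts l N" if N: "simple_module R N" for N :: "('a, 'a set) module"
    proof -
      obtain l' where l': "l' \<in> L" "acts l' N" using simple_acts[OF N] by blast
      show ?thesis
        using iso_iff_acts[OF \<open>simple_module R M\<close> N \<open>l \<in> L\<close> \<open>acts l M\<close> l'] acts_unique[OF N l' \<open>l \<in> L\<close>] l' by blast
    qed
    then show ?thesis using that by (auto simp: points_class_def)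
  qed
  have "simple_classes R = points_class ` L"
  proof (intro equalityI subsetI)
    fix Y assume "Y \<in> simple_classes R"
    then obtain M where M: "simple_module R M" "Y = ?rel `` {M}" unfolding simple_classes_def by (auto elim: quotientE)
    obtain l where l: "l \<in> L" "acts l M" using simple_acts[OF M(1)] by blast
    show "Y \<in> points_class ` L" unfolding M(2) cls[OF M(1) l] using l(1) by (rule imageI)
  next
    fix Y assume "Y \<in> points_class ` L"
    then obtain l where l: "l \<in> L" "Y = points_class l" by blast
    obtain M :: "('a, 'a set) module" where M: "simple_module R M" "acts l M" using simple_exists[OF l(1)] by blast
    show "Y \<in> simple_classes R" unfolding simple_classes_def l(2) cls[OF M(1) l(1) M(2), symmetric]
      using M(1) by (intro quotientI) simp
  qed
  moreover have "inj_on points_class L"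
  proof (rule inj_onI)
    fix l l' assume l: "l \<in> L" "l' \<in> L" and eq: "points_class l = points_class l'"
    obtain M :: "('a, 'a set) module" where M: "simple_module R M" "acts l M" using simple_exists[OF l(1)] by blast
    then have "acts l' M" using eq by (auto simp: points_class_def)
    then show "l = l'" using acts_unique[OF M(1) l(1) M(2) l(2)] by blast
  qed
  ultimately show ?thesis by (simp add: bij_betw_def)
qed

text \<open>The kernel of each point is a maximal left ideal, which bounds the radical from above.
  If x vanishes at all points and lies outside a maximal ideal I, then 1 = i + a x with i in I and a
  x nilpotent, which puts 1 into I.\<close>

theorem jacobson_radical_points: "jacobson_radical R = {x \<in> carrier R. \<forall>l\<in>L. lam l x = 0}"
proof -
  let ?M = "regular_module R"
  have rm: "carrier ?M = carrier R" "zero ?M = \<zero>" "add ?M = add R" "smult ?M = mult R"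
    by (simp_all add: regular_module_def)
  have "abelian_group ?M"
    by (rule abelian_groupI) (auto simp: rm a_ac intro!: bexI[of _ "\<ominus> _"] l_neg)
  then have LM: "left_module R ?M"
    by (intro left_module.intro left_module_axioms.intro R_ring) (auto simp: rm l_distr r_distr m_assoc)
  show ?thesis
  proof (intro equalityI subsetI)
    fix x assume x: "x \<in> jacobson_radical R"
    then have xR: "x \<in> carrier R" by (simp add: jacobson_radical_def)
    have "lam l x = 0" if l: "l \<in> L" for l
    proof -
      let ?I = "{x \<in> carrier R. lam l x = 0}"
      have I: "Module.submodule ?I R ?M"
        by (rule left_module_submoduleI[OF LM]) (use l lam_zero in \<open>auto simp: rm lam_add lam_mult\<close>)
      have one: "\<one> \<notin> ?I" using lam_one[OF l] by simp
      have "maximal_left_ideal R ?I"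
        unfolding maximal_left_ideal_def
      proof (intro conjI I allI impI)
        show "?I \<noteq> carrier R" using one by blast
        fix K assume K: "Module.submodule K R ?M" and IK: "?I \<subseteq> K"
        note KD = submoduleD[OF K, unfolded rm]
        show "K = ?I \<or> K = carrier R"
        proof (cases "K = ?I")
          case False
          then obtain y where y: "y \<in> K" "lam l y \<noteq> 0" "y \<in> carrier R" using IK KD(1) by blast
          have z: "z \<in> K" if z: "z \<in> carrier R" for z
          proof -
            let ?w = "\<iota> (lam l z / lam l y) \<otimes> y"
            have w: "?w \<in> K" using KD(4) y by simp
            have wR: "?w \<in> carrier R" using y by simp
            have "z \<oplus> \<ominus> ?w \<in> ?I" using z wR y l by (simp add: lam_add lam_minus lam_mult lam_\<iota>)
            then have "(z \<oplus> \<ominus> ?w) \<oplus> ?w \<in> K" using KD(3) w IK by blast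
            moreover have "(z \<oplus> \<ominus> ?w) \<oplus> ?w = z" using z wR by (simp add: a_assoc l_neg)
            ultimately show ?thesis by simp
          qed
          then show ?thesis using KD(1) by blast
        qed simp
      qed
      then show ?thesis using x by (auto simp: jacobson_radical_def)
    qed
    then show "x \<in> {x \<in> carrier R. \<forall>l\<in>L. lam l x = 0}" using xR by blast
  next
    fix x assume x: "x \<in> {x \<in> carrier R. \<forall>l\<in>L. lam l x = 0}"
    have "x \<in> I" if I: "maximal_left_ideal R I" for I
    proof (rule ccontr)
      assume xI: "x \<notin> I"
      have sI: "Module.submodule I R ?M" and neI: "I \<noteq> carrier R" using I by (auto simp: maximal_left_ideal_def)
      note ID = submoduleD[OF sI, unfolded rm]
      let ?K = "{i \<oplus> a \<otimes> x | i a. i \<in> I \<and> a \<in> carrier R}"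
      have "Module.submodule ?K R ?M"
      proof (rule left_module_submoduleI[OF LM])
        show "?K \<subseteq> carrier ?M" using ID(1) x by (auto simp: rm)
        show "?K \<noteq> {}" using ID(2) by blast
        fix y z assume "y \<in> ?K" "z \<in> ?K"
        then obtain i a j b where y: "y = i \<oplus> a \<otimes> x" "i \<in> I" "a \<in> carrier R" and z: "z = j \<oplus> b \<otimes> x" "j \<in> I" "b \<in> carrier R"
          by blast
        have "i \<in> carrier R" "j \<in> carrier R" "x \<in> carrier R" using y z ID(1) x by auto
        then have "y \<oplus> z = (i \<oplus> j) \<oplus> (a \<oplus> b) \<otimes> x" using y z by (simp add: a_ac l_distr)
        then show "y \<oplus>\<^bsub>?M\<^esub> z \<in> ?K" using ID(3)[OF y(2) z(2)] y z by (auto simp: rm)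
      next
        fix c y assume c: "c \<in> carrier R" and "y \<in> ?K"
        then obtain i a where y: "y = i \<oplus> a \<otimes> x" "i \<in> I" "a \<in> carrier R" by blast
        have "i \<in> carrier R" "x \<in> carrier R" using y ID(1) x by auto
        then have "c \<otimes> y = (c \<otimes> i) \<oplus> (c \<otimes> a) \<otimes> x" using y c by (simp add: r_distr m_assoc)
        then show "c \<odot>\<^bsub>?M\<^esub> y \<in> ?K" using ID(4)[OF c y(2)] y c by (auto simp: rm)
      qed
      moreover have "I \<subseteq> ?K"
      proof
        fix i assume i: "i \<in> I"
        then have "i = i \<oplus> \<zero> \<otimes> x" using ID(1) x by auto
        then show "i \<in> ?K" using i by blast
      qed
      moreover have "x \<in> ?K"
      proof -
        have "x = \<zero> \<oplus> \<one> \<otimes> x" using x by simp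
        then show ?thesis using ID(2) by blast
      qed
      ultimately have "?K = carrier R" using I xI unfolding maximal_left_ideal_def by blast
      then obtain i a where ia: "\<one> = i \<oplus> a \<otimes> x" "i \<in> I" "a \<in> carrier R" using one_closed by blast
      have iR: "i \<in> carrier R" using ia ID(1) by blast
      let ?y = "a \<otimes> x"
      have y: "?y \<in> carrier R" using ia x by simp
      obtain k :: nat where k: "?y [^] k = \<zero>" using nil[OF y] x ia by (auto simp: lam_mult)
      \<comment> \<open>Rewriting the last factor 1 in y^j 1 as i + y moves one more power of y to
        the right, modulo I; at a vanishing power only an element of I is left.\<close>
      have "\<exists>i\<in>I. \<one> = i \<oplus> ?y [^] j" for j :: nat
      proof (induction j)
        case 0
        show ?case using ID(2) by (intro bexI[of _ \<zero>]) simp_all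
      next
        case (Suc j)
        then obtain i' where i': "i' \<in> I" "\<one> = i' \<oplus> ?y [^] j" by blast
        have iR': "i' \<in> carrier R" using i' ID(1) by blast
        have "\<one> = i' \<oplus> ?y [^] j \<otimes> \<one>" unfolding r_one[OF nat_pow_closed[OF y]] by (rule i'(2))
        also have "\<dots> = i' \<oplus> ?y [^] j \<otimes> (i \<oplus> ?y)"
          by (rule arg_cong[OF ia(1), where f = "\<lambda>t. i' \<oplus> ?y [^] j \<otimes> t"])
        also have "\<dots> = (i' \<oplus> ?y [^] j \<otimes> i) \<oplus> ?y [^] Suc j" using y iR iR' by (simp add: r_distr a_assoc)
        finally show ?case using ID(3)[OF i'(1) ID(4)[OF _ ia(2)]] y by blast
      qed
      then obtain i' where "i' \<in> I" "\<one> = i' \<oplus> ?y [^] k" by blast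
      then have "\<one> \<in> I" using k ID(1) by auto
      then have "x \<in> I" if "x \<in> carrier R" for x using ID(4)[OF that \<open>\<one> \<in> I\<close>] that by simp
      then have "I = carrier R" using ID(1) by blast
      then show False using neI by simp
    qed
    then show "x \<in> jacobson_radical R" using x by (simp add: jacobson_radical_def)
  qed
qed

end

section \<open>Representations by matrices\<close>

definition bhat :: "('b \<Rightarrow> fmat) \<Rightarrow> ('b \<Rightarrow>\<^sub>0 complex) \<Rightarrow> fmat" where
  "bhat \<beta> = pm_sum (\<lambda>b c. smul c (\<beta> b))"

lemma bhat_add: "bhat \<beta> (a + a') = bhat \<beta> a + bhat \<beta> a'"
  unfolding bhat_def by (rule pm_sum_add) (simp_all add: fm.scale_left_distrib)

lemma bhat_single [simp]: "bhat \<beta> (single b c) = smul c (\<beta> b)"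
  unfolding bhat_def by (rule pm_sum_single) simp

lemma bhat_0 [simp]: "bhat \<beta> 0 = 0" by (simp add: bhat_def)

lemma scale_eq_pm: "bhat \<beta> (scale c a) = smul c (bhat \<beta> a)"
proof -
  have "keys a \<subseteq> UNIV" by simp
  then show ?thesis
    by (induction rule: pm_induct) (simp_all add: scale_single scale_add bhat_add fm.scale_right_distrib)
qed

lemma bhat_cong: "keys a \<subseteq> B \<Longrightarrow> (\<And>b. b \<in> B \<Longrightarrow> \<beta> b = \<gamma> b) \<Longrightarrow> bhat \<beta> a = bhat \<gamma> a"
  unfolding bhat_def by (rule pm_sum_cong) auto

lemma bhat_linear:
  assumes "keys a \<subseteq> B" "\<And>x y. f (x + y) = f x + f y" "\<And>c x. f (smul c x) = smul c (f x)"
  shows "f (bhat \<beta> a) = bhat (\<lambda>b. f (\<beta> b)) a"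
  using assms(1)
proof (induction rule: pm_induct)
  have "f 0 = 0" using assms(2)[of 0 0] by simp
  case zero
  then show ?case using \<open>f 0 = 0\<close> by simp
qed (simp_all add: bhat_add assms)

lemma bhat_bilin:
  assumes "keys a \<subseteq> B" "keys a' \<subseteq> B" "\<And>b c. b \<in> B \<Longrightarrow> c \<in> B \<Longrightarrow> bhat \<beta> (m b c) = \<beta> b * \<beta> c"
  shows "bhat \<beta> (bilin_ext m a a') = bhat \<beta> a * bhat \<beta> a'"
  by (rule bilin_ext_induct[where mul = "(*)", OF assms(1,2)])
    (simp_all add: bhat_add distrib_left distrib_right scale_eq_pm assms(3) mult.commute)

lemma alg_simps: "carrier (alg A) = {a. keys a \<subseteq> basis A}" "mult (alg A) = bilin_ext (bmult A)"
  "one (alg A) = unity A" "zero (alg A) = 0" "add (alg A) = (+)"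
  by (simp_all add: alg_def structure_ring_simps)

locale based =
  fixes A :: "('b, 'k) based_algebra_scheme"
  assumes unity_keys: "keys (unity A) \<subseteq> basis A"
    and bmult_keys: "b \<in> basis A \<Longrightarrow> c \<in> basis A \<Longrightarrow> keys (bmult A b c) \<subseteq> basis A"
begin

definition repr :: "nat \<Rightarrow> ('b \<Rightarrow> fmat) \<Rightarrow> bool" where
  "repr d \<beta> \<longleftrightarrow> (\<forall>b\<in>basis A. E d * \<beta> b = \<beta> b \<and> \<beta> b * E d = \<beta> b) \<and> bhat \<beta> (unity A) = E d \<and>
     (\<forall>b\<in>basis A. \<forall>c\<in>basis A. bhat \<beta> (bmult A b c) = \<beta> b * \<beta> c)"

definition mats :: "'b rep \<Rightarrow> 'b \<Rightarrow> fmat" where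
  "mats M b = tf (snd M (single b 1))"

lemma repr_bhat_E:
  assumes "repr d \<beta>" "keys a \<subseteq> basis A"
  shows "E d * bhat \<beta> a = bhat \<beta> a" "bhat \<beta> a * E d = bhat \<beta> a"
proof -
  have "E d * bhat \<beta> a = bhat (\<lambda>b. E d * \<beta> b) a" "bhat \<beta> a * E d = bhat (\<lambda>b. \<beta> b * E d) a"
    using bhat_linear[OF assms(2), of "\<lambda>x. E d * x" \<beta>] bhat_linear[OF assms(2), of "\<lambda>x. x * E d" \<beta>]
    by (simp_all add: distrib_left distrib_right)
  then show "E d * bhat \<beta> a = bhat \<beta> a" "bhat \<beta> a * E d = bhat \<beta> a"
    using assms by (auto simp: repr_def intro: bhat_cong)
qed

lemma bmult_closed: "keys a \<subseteq> basis A \<Longrightarrow> keys a' \<subseteq> basis A \<Longrightarrow> keys (bilin_ext (bmult A) a a') \<subseteq> basis A"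
  by (rule bilin_ext_closed) (use bmult_keys in auto)

lemma fd_moduleI:
  assumes r: "repr d \<beta>" and \<rho>: "\<And>a :: 'b \<Rightarrow>\<^sub>0 complex. keys a \<subseteq> basis A \<Longrightarrow> \<rho> a \<in> carrier_mat d d \<and> tf (\<rho> a) = bhat \<beta> a"
  shows "fd_module A (d, \<rho>)"
proof -
  have eqI: "P = Q" if "P \<in> carrier_mat d d" "Q \<in> carrier_mat d d" "tf P = tf Q" for P Q
    using tf_inj that by blast
  note c = \<rho>[THEN conjunct1] and t = \<rho>[THEN conjunct2]
  show ?thesis
    unfolding fd_module_def prod.case alg_simps mem_Collect_eq
  proof (intro conjI allI ballI, unfold mem_Collect_eq)
    show "\<rho> (unity A) = 1\<^sub>m d"
      using r unity_keys c by (intro eqI) (auto simp: t repr_def)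
    fix a :: "'b \<Rightarrow>\<^sub>0 complex" assume a: "keys a \<subseteq> basis A"
    show "\<rho> a \<in> carrier_mat d d" using c a .
    {
      fix k
      have "keys (scale k a) \<subseteq> basis A" by (rule subset_trans[OF keys_scale a])
      then show "\<rho> (scale k a) = k \<cdot>\<^sub>m \<rho> a"
        using c a by (intro eqI) (auto simp: t tf_smult scale_eq_pm)
    next
      fix a' :: "'b \<Rightarrow>\<^sub>0 complex" assume a': "keys a' \<subseteq> basis A"
      show "\<rho> (bilin_ext (bmult A) a a') = \<rho> a * \<rho> a'"
      proof (rule eqI)
        have "tf (\<rho> a * \<rho> a') = tf (\<rho> a) * tf (\<rho> a')" using c[OF a] c[OF a'] by (rule tf_mult)
        also have "\<dots> = bhat \<beta> (bilin_ext (bmult A) a a')"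
          using bhat_bilin[OF a a', of \<beta> "bmult A"] r by (simp add: t a a' repr_def)
        finally show "tf (\<rho> (bilin_ext (bmult A) a a')) = tf (\<rho> a * \<rho> a')"
          using t[OF bmult_closed[OF a a']] by simp
      qed (use c[OF a] c[OF a'] c[OF bmult_closed[OF a a']] in auto)
      have "keys (a + a') \<subseteq> basis A" using keys_add[of a a'] a a' by blast
      then show "\<rho> (a + a') = \<rho> a + \<rho> a'"
        using c[OF a] c[OF a'] c by (intro eqI) (auto simp: t tf_add[OF c[OF a] c[OF a']] a a' bhat_add)
    }
  qed
qed

lemma fd_moduleD:
  assumes "fd_module A M"
  shows "keys a \<subseteq> basis A \<Longrightarrow> snd M a \<in> carrier_mat (fst M) (fst M)"
    "keys a \<subseteq> basis A \<Longrightarrow> tf (snd M a) = bhat (mats M) a"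
    "repr (fst M) (mats M)"
proof -
  obtain d \<rho> where M: "M = (d, \<rho>)" by (cases M)
  have F: "\<And>a :: 'b \<Rightarrow>\<^sub>0 complex. keys a \<subseteq> basis A \<Longrightarrow> \<rho> a \<in> carrier_mat d d" "\<rho> (unity A) = 1\<^sub>m d"
    "\<And>a b. keys a \<subseteq> basis A \<Longrightarrow> keys b \<subseteq> basis A \<Longrightarrow> \<rho> (bilin_ext (bmult A) a b) = \<rho> a * \<rho> b"
    "\<And>a b. keys a \<subseteq> basis A \<Longrightarrow> keys b \<subseteq> basis A \<Longrightarrow> \<rho> (a + b) = \<rho> a + \<rho> b"
    "\<And>c a. keys a \<subseteq> basis A \<Longrightarrow> \<rho> (scale c a) = c \<cdot>\<^sub>m \<rho> a"
    using assms unfolding M fd_module_def prod.case alg_simps mem_Collect_eq by blast+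
  have t: "tf (\<rho> a) = bhat (mats M) a" if "keys a \<subseteq> basis A" for a
    using that
  proof (induction rule: pm_induct)
    case zero
    have "\<rho> (scale 0 0) = 0 \<cdot>\<^sub>m \<rho> 0" by (rule F(5)) simp
    then have "\<rho> 0 = 0 \<cdot>\<^sub>m \<rho> 0" by (simp only: scale_zero)
    then have "tf (\<rho> 0) = 0" by (metis tf_smult fm.scale_zero_left)
    then show ?case by simp
  next
    case (single x a)
    then have "\<rho> (scale a (single x 1)) = a \<cdot>\<^sub>m \<rho> (single x 1)" by (intro F(5)) simp
    then show ?case by (simp add: scale_single tf_smult mats_def M)
  next
    case (add f f')
    then show ?case by (simp add: F tf_add[OF F(1) F(1)] bhat_add)
  qed
  show "keys a \<subseteq> basis A \<Longrightarrow> snd M a \<in> carrier_mat (fst M) (fst M)"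
    "keys a \<subseteq> basis A \<Longrightarrow> tf (snd M a) = bhat (mats M) a" using F t by (simp_all add: M)
  show "repr (fst M) (mats M)"
    unfolding repr_def
  proof (intro conjI ballI)
    show "bhat (mats M) (unity A) = E (fst M)" using t[OF unity_keys] F(2) by (simp add: M)
    fix b assume b: "b \<in> basis A"
    have kb: "keys (single b (1::complex)) \<subseteq> basis A" using b by simp
    show "E (fst M) * mats M b = mats M b" "mats M b * E (fst M) = mats M b"
      using tf_E[OF F(1)[OF kb]] by (simp_all add: M mats_def)
    fix c assume c: "c \<in> basis A"
    have kc: "keys (single c (1::complex)) \<subseteq> basis A" using c by simp
    have "tf (\<rho> (bilin_ext (bmult A) (single b 1) (single c 1))) = mats M b * mats M c"
      unfolding F(3)[OF kb kc] tf_mult[OF F(1)[OF kb] F(1)[OF kc]] by (simp add: mats_def M)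
    also have "bilin_ext (bmult A) (single b 1) (single c 1) = bmult A b c"
      by (rule poly_mapping_eqI) (simp add: bilin_ext_single)
    finally show "bhat (mats M) (bmult A b c) = mats M b * mats M c" using t bmult_keys[OF b c] by simp
  qed
qed

definition rep_of :: "nat \<Rightarrow> ('b \<Rightarrow> fmat) \<Rightarrow> 'b rep" where
  "rep_of d \<beta> = (d, \<lambda>a. of_f d d (bhat \<beta> a))"

lemma rep_of:
  assumes "repr d \<beta>"
  shows "fd_module A (rep_of d \<beta>)" "fst (rep_of d \<beta>) = d" "b \<in> basis A \<Longrightarrow> mats (rep_of d \<beta>) b = \<beta> b"
proof -
  have t: "tf (of_f d d (bhat \<beta> a)) = bhat \<beta> a" if "keys a \<subseteq> basis A" for a
    using repr_bhat_E[OF assms that] by simp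
  show "fd_module A (rep_of d \<beta>)" unfolding rep_of_def by (rule fd_moduleI[OF assms]) (simp add: t del: tf_of_f)
  show "fst (rep_of d \<beta>) = d" by (simp add: rep_of_def)
  show "b \<in> basis A \<Longrightarrow> mats (rep_of d \<beta>) b = \<beta> b" using t[of "single b 1"] by (simp add: mats_def rep_of_def del: tf_of_f)
qed

definition intertwines :: "fmat \<Rightarrow> nat \<Rightarrow> ('b \<Rightarrow> fmat) \<Rightarrow> nat \<Rightarrow> ('b \<Rightarrow> fmat) \<Rightarrow> bool" where
  "intertwines X d \<beta> e \<gamma> \<longleftrightarrow> E e * X = X \<and> X * E d = X \<and> (\<forall>b\<in>basis A. X * \<beta> b = \<gamma> b * X)"

lemma (in -) mat_vec_unit:
  "(P :: complex mat) \<in> carrier_mat e d \<Longrightarrow> j < d \<Longrightarrow> P *\<^sub>v unit_vec d j = col P j"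
  by (rule eq_vecI) (auto simp: scalar_prod_right_unit[where v = "row P _" and n = d])

lemma (in -) linear_map_matrix:
  assumes f: "\<And>v. v \<in> carrier_vec d \<Longrightarrow> f v \<in> carrier_vec e"
    and add: "\<And>v w. v \<in> carrier_vec d \<Longrightarrow> w \<in> carrier_vec d \<Longrightarrow> f (v + w) = f v + f w"
    and sm: "\<And>c v. v \<in> carrier_vec d \<Longrightarrow> f (c \<cdot>\<^sub>v v) = (c :: complex) \<cdot>\<^sub>v f v"
  obtains P where "P \<in> carrier_mat e d" "\<And>v. v \<in> carrier_vec d \<Longrightarrow> f v = P *\<^sub>v v"
proof -
  define P where "P = mat e d (\<lambda>(i, j). f (unit_vec d j) $ i)"
  have P: "P \<in> carrier_mat e d" by (simp add: P_def)
  have colP: "col P j = f (unit_vec d j)" if "j < d" for j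
    by (rule eq_vecI) (use that f[of "unit_vec d j"] in \<open>auto simp: P_def\<close>)
  have "f v = P *\<^sub>v v" if v: "v \<in> carrier_vec d" for v
  proof -
    define w where "w k = vec d (\<lambda>i. if i < k then v $ i else 0)" for k
    have w: "w k \<in> carrier_vec d" for k by (simp add: w_def)
    have "k \<le> d \<Longrightarrow> f (w k) = P *\<^sub>v w k" for k
    proof (induction k)
      case 0
      have z: "0 \<cdot>\<^sub>v x = 0\<^sub>v e" if "x \<in> carrier_vec e" for x :: "complex vec" and e
        using that by auto
      have w0: "w 0 = 0\<^sub>v d" by (rule eq_vecI) (auto simp: w_def)
      have "f (0 \<cdot>\<^sub>v w 0) = 0\<^sub>v e" using sm[OF w, of 0 0] z f[OF w] by metis
      then have "f (w 0) = 0\<^sub>v e" using z[OF w, of 0] w0 by metis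
      moreover have "P *\<^sub>v w 0 = 0\<^sub>v e" unfolding w0 by (rule eq_vecI) (use P in auto)
      ultimately show ?case by simp
    next
      case (Suc k)
      have e: "w (Suc k) = w k + v $ k \<cdot>\<^sub>v unit_vec d k"
        using Suc.prems by (intro eq_vecI) (auto simp: w_def unit_vec_def less_Suc_eq)
      have "f (w (Suc k)) = f (w k) + v $ k \<cdot>\<^sub>v f (unit_vec d k)"
        unfolding e using w by (simp add: add sm)
      also have "\<dots> = P *\<^sub>v w k + v $ k \<cdot>\<^sub>v (P *\<^sub>v unit_vec d k)"
        using Suc colP[of k] mat_vec_unit[OF P, of k] by simp
      also have "\<dots> = P *\<^sub>v w (Suc k)"
        unfolding e using w P by (simp add: mult_add_distrib_mat_vec[OF P] mult_mat_vec[OF P])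
      finally show ?case .
    qed
    from this[of d] have "f (w d) = P *\<^sub>v w d" by simp
    moreover have "w d = v" using v by (intro eq_vecI) (auto simp: w_def)
    ultimately show ?thesis by simp
  qed
  then show thesis using P that by blast
qed

lemma (in -) mat_eq_vecI:
  assumes "P \<in> carrier_mat e d" "Q \<in> carrier_mat e d" "\<And>v. v \<in> carrier_vec d \<Longrightarrow> P *\<^sub>v v = Q *\<^sub>v (v :: complex vec)"
  shows "P = Q"
proof (rule eq_matI)
  fix i j assume ij: "i < dim_row Q" "j < dim_col Q"
  then have "col P j = col Q j" using assms mat_vec_unit[of P e d j] mat_vec_unit[of Q e d j] by auto
  then show "P $$ (i, j) = Q $$ (i, j)" using assms ij by (metis carrier_matD index_col)
qed (use assms in auto)

lemma (in -) as_module_simps: "carrier (as_module M) = carrier_vec (fst M)" "add (as_module M) = (+)"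
  "a \<odot>\<^bsub>as_module M\<^esub> v = snd M a *\<^sub>v v" "zero (as_module M) = 0\<^sub>v (fst M)"
  by (cases M; simp add: as_module_def)+

text \<open>Complex linearity is not part of \<open>module_iso\<close>. It follows because scalars
  act through the multiples of the unity, with which the map commutes.\<close>

lemma module_map_matrix:
  assumes M: "fd_module A M" and N: "fd_module A N"
    and f: "\<And>v. v \<in> carrier_vec (fst M) \<Longrightarrow> f v \<in> carrier_vec (fst N)"
    and add: "\<And>v w. v \<in> carrier_vec (fst M) \<Longrightarrow> w \<in> carrier_vec (fst M) \<Longrightarrow> f (v + w) = f v + f w"
    and sm: "\<And>a v. keys a \<subseteq> basis A \<Longrightarrow> v \<in> carrier_vec (fst M) \<Longrightarrow> f (snd M a *\<^sub>v v) = snd N a *\<^sub>v f v"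
  obtains P where "P \<in> carrier_mat (fst N) (fst M)" "\<And>v. v \<in> carrier_vec (fst M) \<Longrightarrow> f v = P *\<^sub>v v"
    "\<And>a. keys a \<subseteq> basis A \<Longrightarrow> P * snd M a = snd N a * P"
proof -
  have sc: "snd K (scale c (unity A)) *\<^sub>v v = c \<cdot>\<^sub>v v" if "fd_module A K" "v \<in> carrier_vec (fst K)" for K c v
  proof -
    have "snd K (scale c (unity A)) = c \<cdot>\<^sub>m 1\<^sub>m (fst K)"
      using that(1) unity_keys by (cases K) (auto simp: fd_module_def alg_simps)
    then show ?thesis using that(2) by (auto intro!: eq_vecI simp: scalar_prod_def)
      (simp add: scalar_prod_def sum.remove)
  qed
  have k: "keys (scale c (unity A)) \<subseteq> basis A" for c by (rule subset_trans[OF keys_scale unity_keys])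
  have "f (c \<cdot>\<^sub>v v) = c \<cdot>\<^sub>v f v" if "v \<in> carrier_vec (fst M)" for c v
    using sm[OF k that, of c] sc[OF M that] sc[OF N f[OF that]] by simp
  from linear_map_matrix[of "fst M" f "fst N", OF f add this]
  obtain P where P: "P \<in> carrier_mat (fst N) (fst M)" "\<And>v. v \<in> carrier_vec (fst M) \<Longrightarrow> f v = P *\<^sub>v v"
    by blast
  have "P * snd M a = snd N a * P" if a: "keys a \<subseteq> basis A" for a
  proof (rule mat_eq_vecI)
    note Ma = fd_moduleD(1)[OF M a] and Na = fd_moduleD(1)[OF N a]
    show "P * snd M a \<in> carrier_mat (fst N) (fst M)" "snd N a * P \<in> carrier_mat (fst N) (fst M)" using P(1) Ma Na by auto
    fix v :: "complex vec" assume v: "v \<in> carrier_vec (fst M)"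
    have "P *\<^sub>v (snd M a *\<^sub>v v) = snd N a *\<^sub>v (P *\<^sub>v v)"
      using sm[OF a v] P(2)[OF v] P(2)[of "snd M a *\<^sub>v v"] Ma v by simp
    then show "P * snd M a *\<^sub>v v = snd N a * P *\<^sub>v v"
      using assoc_mult_mat_vec[OF P(1) Ma v] assoc_mult_mat_vec[OF Na P(1) v] by simp
  qed
  then show thesis using that P by blast
qed

lemma module_iso_iff:
  assumes M: "fd_module A M" and N: "fd_module A N"
  shows "module_iso (alg A) (as_module M) (as_module N) \<longleftrightarrow>
    (\<exists>X X'. intertwines X (fst M) (mats M) (fst N) (mats N) \<and> intertwines X' (fst N) (mats N) (fst M) (mats M) \<and>
      X' * X = E (fst M) \<and> X * X' = E (fst N))"
proof
  assume "module_iso (alg A) (as_module M) (as_module N)"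
  then obtain f where f: "bij_betw f (carrier_vec (fst M)) (carrier_vec (fst N))"
    "\<And>v w. v \<in> carrier_vec (fst M) \<Longrightarrow> w \<in> carrier_vec (fst M) \<Longrightarrow> f (v + w) = f v + f w"
    "\<And>a v. keys a \<subseteq> basis A \<Longrightarrow> v \<in> carrier_vec (fst M) \<Longrightarrow> f (snd M a *\<^sub>v v) = snd N a *\<^sub>v f v"
    unfolding module_iso_def as_module_simps alg_simps mem_Collect_eq by blast
  define f' where "f' = inv_into (carrier_vec (fst M)) f"
  have f': "f' (f v) = v" if "v \<in> carrier_vec (fst M)" for v
    using f(1) that unfolding f'_def bij_betw_def by simp
  have ff': "f (f' w) = w" and f'c: "f' w \<in> carrier_vec (fst M)" if "w \<in> carrier_vec (fst N)" for w
    using f(1) that unfolding f'_def bij_betw_def by (auto intro: f_inv_into_f inv_into_into)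
  have fc: "f v \<in> carrier_vec (fst N)" if "v \<in> carrier_vec (fst M)" for v
    using f(1) that unfolding bij_betw_def by blast
  obtain P where P: "P \<in> carrier_mat (fst N) (fst M)" "\<And>v. v \<in> carrier_vec (fst M) \<Longrightarrow> f v = P *\<^sub>v v"
    "\<And>a. keys a \<subseteq> basis A \<Longrightarrow> P * snd M a = snd N a * P"
    using module_map_matrix[OF M N fc f(2,3)] by metis
  have add': "f' (v + w) = f' v + f' w" if "v \<in> carrier_vec (fst N)" "w \<in> carrier_vec (fst N)" for v w
  proof -
    have "v + w = f (f' v + f' w)" using that f(2) f'c ff' by simp
    then show ?thesis using f' f'c that by simp
  qed
  have sm': "f' (snd N a *\<^sub>v v) = snd M a *\<^sub>v f' v" if "keys a \<subseteq> basis A" "v \<in> carrier_vec (fst N)" for a v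
  proof -
    have "snd N a *\<^sub>v v = f (snd M a *\<^sub>v f' v)" using that f(3) f'c ff' by simp
    moreover have "snd M a *\<^sub>v f' v \<in> carrier_vec (fst M)" using fd_moduleD(1)[OF M that(1)] f'c[OF that(2)] by simp
    ultimately show ?thesis using f' by simp
  qed
  obtain Q where Q: "Q \<in> carrier_mat (fst M) (fst N)" "\<And>v. v \<in> carrier_vec (fst N) \<Longrightarrow> f' v = Q *\<^sub>v v"
    "\<And>a. keys a \<subseteq> basis A \<Longrightarrow> Q * snd N a = snd M a * Q"
    using module_map_matrix[OF N M f'c add' sm'] by metis
  have QP: "Q * P = 1\<^sub>m (fst M)"
  proof (rule mat_eq_vecI)
    fix v :: "complex vec" assume v: "v \<in> carrier_vec (fst M)"
    show "Q * P *\<^sub>v v = 1\<^sub>m (fst M) *\<^sub>v v"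
      using assoc_mult_mat_vec[OF Q(1) P(1) v] P(2)[OF v] Q(2)[OF fc[OF v]] f'[OF v] v by simp
  qed (use P Q in auto)
  have PQ: "P * Q = 1\<^sub>m (fst N)"
  proof (rule mat_eq_vecI)
    fix v :: "complex vec" assume v: "v \<in> carrier_vec (fst N)"
    show "P * Q *\<^sub>v v = 1\<^sub>m (fst N) *\<^sub>v v"
      using assoc_mult_mat_vec[OF P(1) Q(1) v] Q(2)[OF v] P(2)[OF f'c[OF v]] ff'[OF v] v by simp
  qed (use P Q in auto)
  have k1: "keys (single b (1::complex)) \<subseteq> basis A" if "b \<in> basis A" for b using that by simp
  have "intertwines (tf P) (fst M) (mats M) (fst N) (mats N)" "intertwines (tf Q) (fst N) (mats N) (fst M) (mats M)"
    unfolding intertwines_def mats_def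
    using tf_E[OF P(1)] tf_E[OF Q(1)] arg_cong[OF P(3)[OF k1], of _ tf] arg_cong[OF Q(3)[OF k1], of _ tf]
      tf_mult[OF P(1) fd_moduleD(1)[OF M k1]] tf_mult[OF fd_moduleD(1)[OF N k1] P(1)]
      tf_mult[OF Q(1) fd_moduleD(1)[OF N k1]] tf_mult[OF fd_moduleD(1)[OF M k1] Q(1)] by simp_all
  moreover have "tf Q * tf P = E (fst M)" "tf P * tf Q = E (fst N)"
    using arg_cong[OF QP, of tf] arg_cong[OF PQ, of tf] tf_mult[OF Q(1) P(1)] tf_mult[OF P(1) Q(1)] by simp_all
  ultimately show "\<exists>X X'. intertwines X (fst M) (mats M) (fst N) (mats N) \<and> intertwines X' (fst N) (mats N) (fst M) (mats M) \<and>
      X' * X = E (fst M) \<and> X * X' = E (fst N)" by blast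
next
  assume "\<exists>X X'. intertwines X (fst M) (mats M) (fst N) (mats N) \<and> intertwines X' (fst N) (mats N) (fst M) (mats M) \<and>
      X' * X = E (fst M) \<and> X * X' = E (fst N)"
  then obtain X X' where X: "intertwines X (fst M) (mats M) (fst N) (mats N)"
    "intertwines X' (fst N) (mats N) (fst M) (mats M)" "X' * X = E (fst M)" "X * X' = E (fst N)" by blast
  define P Q where "P = of_f (fst N) (fst M) X" and "Q = of_f (fst M) (fst N) X'"
  have c: "P \<in> carrier_mat (fst N) (fst M)" "Q \<in> carrier_mat (fst M) (fst N)" by (simp_all add: P_def Q_def)
  have t: "tf P = X" "tf Q = X'" using X by (simp_all add: P_def Q_def intertwines_def)
  have QP: "Q * P = 1\<^sub>m (fst M)" and PQ: "P * Q = 1\<^sub>m (fst N)"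
    using c X(3,4) t by (auto intro!: tf_inj[of "Q * P" _ "fst M" "fst M"] tf_inj[of "P * Q" _ "fst N" "fst N"]
        simp: tf_mult[OF c(2,1)] tf_mult[OF c])
  have PM: "P * snd M a = snd N a * P" if a: "keys a \<subseteq> basis A" for a
  proof -
    note Ma = fd_moduleD(1)[OF M a] and Na = fd_moduleD(1)[OF N a]
    have "X * bhat (mats M) a = bhat (\<lambda>b. X * mats M b) a" "bhat (mats N) a * X = bhat (\<lambda>b. mats N b * X) a"
      using bhat_linear[OF a, of "\<lambda>x. X * x"] bhat_linear[OF a, of "\<lambda>x. x * X"] by (simp_all add: distrib_left distrib_right)
    moreover have "bhat (\<lambda>b. X * mats M b) a = bhat (\<lambda>b. mats N b * X) a"
      by (rule bhat_cong[OF a]) (use X(1) in \<open>simp add: intertwines_def\<close>)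
    ultimately have "tf (P * snd M a) = tf (snd N a * P)"
      using tf_mult[OF c(1) Ma] tf_mult[OF Na c(1)] fd_moduleD(2)[OF M a] fd_moduleD(2)[OF N a] t by simp
    then show ?thesis using c Ma Na by (intro tf_inj[of _ _ "fst N" "fst M"]) auto
  qed
  let ?f = "\<lambda>v. P *\<^sub>v v"
  have "bij_betw ?f (carrier_vec (fst M)) (carrier_vec (fst N))"
  proof (rule bij_betw_byWitness[where f' = "\<lambda>v. Q *\<^sub>v v"])
    show "\<forall>a\<in>carrier_vec (fst M). Q *\<^sub>v (P *\<^sub>v a) = a"
      using assoc_mult_mat_vec[OF c(2,1)] QP by (metis one_mult_mat_vec)
    show "\<forall>a\<in>carrier_vec (fst N). P *\<^sub>v (Q *\<^sub>v a) = a"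
      using assoc_mult_mat_vec[OF c] PQ by (metis one_mult_mat_vec)
  qed (use c in \<open>auto intro!: mult_mat_vec_carrier\<close>)
  moreover have "P *\<^sub>v (snd M a *\<^sub>v v) = snd N a *\<^sub>v (P *\<^sub>v v)" if "keys a \<subseteq> basis A" "v \<in> carrier_vec (fst M)" for a v
    using PM[OF that(1)] assoc_mult_mat_vec[OF c(1) fd_moduleD(1)[OF M that(1)] that(2)]
      assoc_mult_mat_vec[OF fd_moduleD(1)[OF N that(1)] c(1) that(2)] by simp
  ultimately show "module_iso (alg A) (as_module M) (as_module N)"
    unfolding module_iso_def as_module_simps alg_simps mem_Collect_eq
    using mult_add_distrib_mat_vec[OF c(1)] by (intro exI[of _ ?f]) blast
qed

lemma rep_sum:
  assumes M: "fd_module A M" and N: "fd_module A N"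
  shows "fd_module A (rep_sum M N)" "fst (rep_sum M N) = fst M + fst N"
    "b \<in> basis A \<Longrightarrow> mats (rep_sum M N) b =
      mats M b + emb (fst M) (fst N) * mats N b * tp (emb (fst M) (fst N))"
proof -
  let ?d = "fst M" and ?e = "fst N" and ?i = "emb (fst M) (fst N)"
  let ?\<rho> = "\<lambda>a. four_block_mat (snd M a) (0\<^sub>m ?d ?e) (0\<^sub>m ?e ?d) (snd N a)"
  have rs: "rep_sum M N = (?d + ?e, ?\<rho>)" by (cases M; cases N; simp add: rep_sum_def)
  show f: "fst (rep_sum M N) = ?d + ?e" by (simp add: rs)
  have ent_i: "ent (?i * X * tp ?i) i j = (if ?d \<le> i \<and> ?d \<le> j \<and> i < ?d + ?e \<and> j < ?d + ?e then ent X (i - ?d) (j - ?d) else 0)"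
    for X i j
  proof -
    have 1: "ent (?i * X) i l = (if ?d \<le> i \<and> i < ?d + ?e then ent X (i - ?d) l else 0)" for l
    proof -
      have "ent (?i * X) i l = (\<Sum>k<?e. ent ?i i k * ent X k l)" by (rule ent_mult_row) (auto split: if_splits)
      also have "\<dots> = (\<Sum>k<?e. if k = i - ?d then if ?d \<le> i then ent X k l else 0 else 0)" by (rule sum.cong) auto
      finally show ?thesis by auto
    qed
    have "ent (?i * X * tp ?i) i j = (\<Sum>k<?e. ent (?i * X) i k * ent (tp ?i) k j)" by (rule ent_mult_col) (auto split: if_splits)
    also have "\<dots> = (\<Sum>k<?e. if k = j - ?d then if ?d \<le> j then ent (?i * X) i k else 0 else 0)" by (rule sum.cong) auto
    finally show ?thesis by (auto simp: 1)
  qed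
  have t: "?\<rho> a \<in> carrier_mat (?d + ?e) (?d + ?e) \<and> tf (?\<rho> a) = tf (snd M a) + ?i * tf (snd N a) * tp ?i"
    if a: "keys a \<subseteq> basis A" for a
  proof (intro conjI)
    note Ma = fd_moduleD(1)[OF M a] and Na = fd_moduleD(1)[OF N a]
    show "?\<rho> a \<in> carrier_mat (?d + ?e) (?d + ?e)" using Ma Na by simp
    show "tf (?\<rho> a) = tf (snd M a) + ?i * tf (snd N a) * tp ?i"
      by (rule fmat_eqI) (use Ma Na in \<open>auto simp: ent_i\<close>)
  qed
  define \<beta> where "\<beta> b = mats M b + ?i * mats N b * tp ?i" for b
  have bh: "bhat \<beta> a = bhat (mats M) a + ?i * bhat (mats N) a * tp ?i" if "keys a \<subseteq> basis A" for a
    using that by (induction rule: pm_induct) (simp_all add: bhat_add \<beta>_def fm.scale_right_distrib algebra_simps)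
  note MD = fd_moduleD(3)[OF M, unfolded repr_def] and ND = fd_moduleD(3)[OF N, unfolded repr_def]
  note em = emb_simps[where d = ?d and e = ?e]
  have z: "X * ?i = 0" if "X * E ?d = X" for X using that em(6) by (metis mult.assoc mult_zero_right)
  have z': "tp ?i * X = 0" if "E ?d * X = X" for X using that em(7) by (metis mult.assoc mult_zero_left)
  have "repr (?d + ?e) \<beta>"
    unfolding repr_def
  proof (intro conjI ballI)
    show "bhat \<beta> (unity A) = E (?d + ?e)" using MD ND em by (simp add: bh unity_keys)
    fix b assume b: "b \<in> basis A"
    have "E (?d + ?e) * mats M b = E (?d + ?e) * (E ?d * mats M b)" "mats M b * E (?d + ?e) = mats M b * E ?d * E (?d + ?e)"
      using MD b by simp_all
    moreover have "E (?d + ?e) * (E ?d * X) = E ?d * X" "X * E ?d * E (?d + ?e) = X * E ?d" for X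
      by (simp_all flip: mult.assoc) (simp add: mult.assoc)
    ultimately have "E (?d + ?e) * mats M b = mats M b" "mats M b * E (?d + ?e) = mats M b"
      using MD b by metis+
    then show "E (?d + ?e) * \<beta> b = \<beta> b" "\<beta> b * E (?d + ?e) = \<beta> b"
      using em by (simp_all add: \<beta>_def distrib_left distrib_right mult.assoc) (simp flip: mult.assoc)
    fix c assume c: "c \<in> basis A"
    have "\<beta> b * \<beta> c = mats M b * mats M c + (mats M b * ?i) * (mats N c * tp ?i) + (?i * mats N b * (tp ?i * mats M c) +
        ?i * mats N b * (tp ?i * ?i) * mats N c * tp ?i)"
      by (simp add: \<beta>_def distrib_left distrib_right mult.assoc)
    also have "\<dots> = mats M b * mats M c + ?i * (mats N b * mats N c) * tp ?i"
      using MD ND b c z[of "mats M b"] z'[of "mats M c"] em by (simp add: mult.assoc)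
    finally show "bhat \<beta> (bmult A b c) = \<beta> b * \<beta> c" using MD ND b c by (simp add: bh bmult_keys)
  qed
  then show "fd_module A (rep_sum M N)"
    unfolding rs by (rule fd_moduleI) (use t fd_moduleD(2)[OF M] fd_moduleD(2)[OF N] in \<open>simp add: bh\<close>)
  show "b \<in> basis A \<Longrightarrow> mats (rep_sum M N) b = mats M b + ?i * mats N b * tp ?i"
    using t[of "single b 1"] by (simp add: mats_def rs)
qed

end

lemma bhat_tensor_elt:
  "bhat (\<lambda>(b, c). kr r s (\<beta> b) (\<gamma> c)) (tensor_elt p p') = kr r s (bhat \<beta> p) (bhat \<gamma> p')"
  unfolding tensor_elt_def
  by (rule bilin_ext_induct[where mul = "kr r s" and B = UNIV and B' = UNIV])
    (simp_all add: bhat_add kr_add scale_single mult.commute)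

text \<open>The tensor product of two representations represents the tensor square, so a coproduct
  that is defined by multiplication there can be evaluated factor by factor.\<close>

lemma bhat_tensor_square:
  assumes s: "keys s \<subseteq> basis A \<times> basis A" and t: "keys t \<subseteq> basis A \<times> basis A"
    and \<beta>: "\<And>b c. b \<in> basis A \<Longrightarrow> c \<in> basis A \<Longrightarrow> bhat \<beta> (bmult A b c) = \<beta> b * \<beta> c"
    and \<gamma>: "\<And>b c. b \<in> basis A \<Longrightarrow> c \<in> basis A \<Longrightarrow> bhat \<gamma> (bmult A b c) = \<gamma> b * \<gamma> c"
      "\<And>b. b \<in> basis A \<Longrightarrow> \<gamma> b * E e = \<gamma> b"
  shows "bhat (\<lambda>(b, c). kr e e (\<beta> b) (\<gamma> c)) (s \<otimes>\<^bsub>alg (tensor_square A)\<^esub> t) =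
    bhat (\<lambda>(b, c). kr e e (\<beta> b) (\<gamma> c)) s * bhat (\<lambda>(b, c). kr e e (\<beta> b) (\<gamma> c)) t"
  unfolding alg_simps
proof (rule bhat_bilin[OF s t])
  fix x y assume "x \<in> basis A \<times> basis A" "y \<in> basis A \<times> basis A"
  then obtain b c b' c' where "x = (b, c)" "y = (b', c')" "b \<in> basis A" "c \<in> basis A" "b' \<in> basis A" "c' \<in> basis A"
    by blast
  then show "bhat (\<lambda>(b, c). kr e e (\<beta> b) (\<gamma> c)) (bmult (tensor_square A) x y) =
      (case x of (b, c) \<Rightarrow> kr e e (\<beta> b) (\<gamma> c)) * (case y of (b, c) \<Rightarrow> kr e e (\<beta> b) (\<gamma> c))"
    by (simp add: tensor_square_def bhat_tensor_elt \<beta> \<gamma> kr_mult_E)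
qed

lemma keys_lin_ext: "(\<And>b. b \<in> B \<Longrightarrow> keys (\<beta> b) \<subseteq> B') \<Longrightarrow> keys a \<subseteq> B \<Longrightarrow> keys (lin_ext \<beta> a) \<subseteq> B'"
  unfolding lin_ext_def by (intro keys_sum_subset subset_trans[OF keys_scale]) auto

lemma lin_ext_pm: "lin_ext \<beta> a = pm_sum (\<lambda>b c. scale c (\<beta> b)) a"
  by (simp add: lin_ext_def pm_sum_def)

lemma bhat_lin_ext: "bhat \<kappa> (lin_ext \<beta> a) = bhat (\<lambda>b. bhat \<kappa> (\<beta> b)) a"
proof -
  have "keys a \<subseteq> UNIV" by simp
  then show ?thesis
    by (induction rule: pm_induct)
      (simp_all add: lin_ext_pm pm_sum_add pm_sum_single scale_add bhat_add scale_eq_pm)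
qed

lemma ent_bhat: "ent (bhat \<beta> a) i j = (\<Sum>b\<in>keys a. lookup a b * ent (\<beta> b) i j)"
proof -
  have "ent (sum f S) i j = (\<Sum>x\<in>S. ent (f x) i j)" for f :: "'a \<Rightarrow> fmat" and S
    by (induction S rule: infinite_finite_induct) auto
  then show ?thesis by (simp add: bhat_def pm_sum_def)
qed

text \<open>The numbering i * e + j of the tensor basis in \<open>rep_tensor\<close> is the one of
  \<open>kr\<close>, so the matrix is the Kronecker product extended linearly over the
  coproduct.\<close>

lemma (in based) rep_tensor_matrix:
  fixes A' :: "'b hopf_algebra"
  assumes A': "basis A' = basis A" and M: "fd_module A M" and N: "fd_module A N"
    and co: "\<And>b. b \<in> basis A \<Longrightarrow> keys (comult A' b) \<subseteq> basis A \<times> basis A" and a: "keys a \<subseteq> basis A"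
  shows "snd (rep_tensor A' M N) a \<in> carrier_mat (fst M * fst N) (fst M * fst N) \<and>
    tf (snd (rep_tensor A' M N) a) =
      bhat (\<lambda>b. bhat (\<lambda>(b, c). kr (fst N) (fst N) (mats M b) (mats N c)) (comult A' b)) a"
proof -
  let ?d = "fst M" and ?e = "fst N"
  let ?\<kappa> = "\<lambda>(b, c). kr ?e ?e (mats M b) (mats N c)" and ?L = "lin_ext (comult A') a"
  define T where "T = mat (?d * ?e) (?d * ?e) (\<lambda>(i, j).
       \<Sum>(b, c)\<in>keys ?L. lookup ?L (b, c) *
       snd M (single b 1) $$ (i div ?e, j div ?e) * snd N (single c 1) $$ (i mod ?e, j mod ?e))"
  have T: "snd (rep_tensor A' M N) a = T" by (cases M; cases N; simp add: rep_tensor_def T_def)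
  have L: "keys ?L \<subseteq> basis A \<times> basis A" by (rule keys_lin_ext[OF co a])
  have k: "ent (kr ?e ?e (mats M b) (mats N c)) i j = (if i < ?d * ?e \<and> j < ?d * ?e then
      snd M (single b 1) $$ (i div ?e, j div ?e) * snd N (single c 1) $$ (i mod ?e, j mod ?e) else 0)"
    if "(b, c) \<in> keys ?L" for b c i j
  proof -
    have bc: "keys (single b (1::complex)) \<subseteq> basis A" "keys (single c (1::complex)) \<subseteq> basis A" using that L by auto
    note Mb = fd_moduleD(1)[OF M bc(1)] and Nc = fd_moduleD(1)[OF N bc(2)]
    have "i < ?d * ?e \<longleftrightarrow> i div ?e < ?d" "i mod ?e < ?e" if "?e \<noteq> 0" for i
      using that by (simp_all add: div_less_iff_less_mult)
    then show ?thesis using Mb Nc by (cases "?e = 0") (auto simp: mats_def)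
  qed
  have "tf T = bhat ?\<kappa> ?L"
  proof (rule fmat_eqI)
    fix i j
    have "ent (bhat ?\<kappa> ?L) i j = (\<Sum>(b, c)\<in>keys ?L. lookup ?L (b, c) * ent (kr ?e ?e (mats M b) (mats N c)) i j)"
      by (simp add: ent_bhat case_prod_beta del: kr.rep_eq)
    also have "\<dots> = (\<Sum>(b, c)\<in>keys ?L. lookup ?L (b, c) * (if i < ?d * ?e \<and> j < ?d * ?e then
      snd M (single b 1) $$ (i div ?e, j div ?e) * snd N (single c 1) $$ (i mod ?e, j mod ?e) else 0))"
      by (rule sum.cong) (auto simp only: k case_prod_conv)
    also have "\<dots> = ent (tf T) i j"
      by (auto simp: T_def case_prod_beta mult.assoc intro!: sum.cong)
    finally show "ent (tf T) i j = ent (bhat ?\<kappa> ?L) i j" by (rule sym)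
  qed
  then show ?thesis by (simp add: T bhat_lin_ext) (simp add: T_def)
qed

lemma (in based) rep_tensor:
  fixes A' :: "'b hopf_algebra"
  assumes A': "basis A' = basis A" and M: "fd_module A M" and N: "fd_module A N"
    and co: "\<And>b. b \<in> basis A \<Longrightarrow> keys (comult A' b) \<subseteq> basis A \<times> basis A"
    and r: "repr (fst M * fst N) \<beta>"
    and \<beta>: "\<And>b. b \<in> basis A \<Longrightarrow> bhat (\<lambda>(b, c). kr (fst N) (fst N) (mats M b) (mats N c)) (comult A' b) = \<beta> b"
  shows "fd_module A (rep_tensor A' M N)" "fst (rep_tensor A' M N) = fst M * fst N"
    "b \<in> basis A \<Longrightarrow> mats (rep_tensor A' M N) b = \<beta> b"
proof -
  let ?T = "rep_tensor A' M N"
  have t: "snd ?T a \<in> carrier_mat (fst M * fst N) (fst M * fst N) \<and> tf (snd ?T a) = bhat \<beta> a"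
    if "keys a \<subseteq> basis A" for a
    using rep_tensor_matrix[OF A' M N co that] bhat_cong[OF that \<beta>] by simp
  show f: "fst ?T = fst M * fst N" by (cases M; cases N; simp add: rep_tensor_def)
  have "?T = (fst M * fst N, snd ?T)" using f by (metis prod.collapse)
  then show "fd_module A ?T" using fd_moduleI[OF r t] by metis
  show "b \<in> basis A \<Longrightarrow> mats ?T b = \<beta> b" using t[of "single b 1"] by (simp add: mats_def)
qed

lemma (in based) one_dim_rep:
  assumes r: "repr 1 (\<lambda>b. smul (\<epsilon> b) (E 1))"
  shows "fd_module A (one_dim_rep \<epsilon>)" "fst (one_dim_rep \<epsilon>) = 1"
    "b \<in> basis A \<Longrightarrow> mats (one_dim_rep \<epsilon>) b = smul (\<epsilon> b) (E 1)"
proof -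
  have t: "snd (one_dim_rep \<epsilon>) a \<in> carrier_mat 1 1 \<and> tf (snd (one_dim_rep \<epsilon>) a) = bhat (\<lambda>b. smul (\<epsilon> b) (E 1)) a" for a
    by (auto simp: one_dim_rep_def ent_bhat sum_distrib_right mult.assoc intro!: fmat_eqI)
  show "fst (one_dim_rep \<epsilon>) = 1" by (simp add: one_dim_rep_def)
  have "one_dim_rep \<epsilon> = (1, snd (one_dim_rep \<epsilon>))" by (simp add: one_dim_rep_def)
  then show "fd_module A (one_dim_rep \<epsilon>)" using fd_moduleI[OF r t] by metis
  show "b \<in> basis A \<Longrightarrow> mats (one_dim_rep \<epsilon>) b = smul (\<epsilon> b) (E 1)" using t[of "single b 1"] by (simp add: mats_def)
qed

section \<open>Modules over the Hopf algebras of a group datum\<close>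

lemma keys_tensor_elt:
  assumes "keys p \<subseteq> B" "keys p' \<subseteq> B'" shows "keys (tensor_elt p p') \<subseteq> B \<times> B'"
  unfolding tensor_elt_def bilin_ext_def
  by (intro keys_sum_subset subset_trans[OF keys_scale]) (use assms in auto)

lemma based_tensor_square: "based A \<Longrightarrow> based (tensor_square A)"
  unfolding based_def by (auto simp: tensor_square_def dest!: subsetD[OF keys_tensor_elt, rotated 2])

lemma (in based) repr_cong: "repr d \<beta> \<Longrightarrow> (\<And>b. b \<in> basis A \<Longrightarrow> \<beta> b = \<gamma> b) \<Longrightarrow> repr d \<gamma>"
  unfolding repr_def using bhat_cong[OF unity_keys, of \<beta> \<gamma>] bhat_cong[OF bmult_keys, of _ _ \<beta> \<gamma>] by simp

context pointed_datum
begin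

text \<open>Two records for the same module may differ off \<open>carrier G\<close>. They need not
  be equal, but the identity matrix is an isomorphism between them.\<close>

lemma obj_cong:
  assumes V: "obj V" and e: "dm N = dm V" "\<And>h. h \<in> carrier G \<Longrightarrow> ac N h = ac V h" "nl N = nl V"
  shows "obj N" "Phi N = Phi V"
proof -
  show N: "obj N" using V unfolding obj_def by (simp add: e ypow_def)
  have m: "mor (E (dm V)) V N" "mor (E (dm V)) N V" unfolding mor_def using objD[OF V] by (simp_all add: e)
  have "iso N V" unfolding iso_def using m e by fastforce
  then show "Phi N = Phi V" using Phi_iso V N by blast
qed

abbreviation "H \<equiv> H_hopf G \<chi> g"
abbreviation "CG \<equiv> group_hopf G"

lemma H_simps: "basis H = {..<n} \<times> carrier G" "unity H = single (0, \<one>) 1"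
  "bmult H (i, h) (j, k) = (if i + j < n then single (i + j, h \<otimes> k) (\<alpha> h ^ j) else 0)"
  "counit H (i, h) = (if i = 0 then 1 else 0)"
  by (simp_all add: H_hopf_def H_algebra_def Let_def based_algebra.defs n_def \<alpha>_def)

lemma alg_H: "alg (H_algebra G \<chi> g) = alg H" "tensor_square (H_algebra G \<chi> g) = tensor_square H"
  by (simp_all add: alg_def tensor_square_def H_hopf_def Let_def based_algebra.defs)

lemma comult_H: "comult H (i, h) =
    (tensor_elt (H_y G) (H_grp g) + tensor_elt (unity H) (H_y G)) [^]\<^bsub>alg (tensor_square H)\<^esub> i
       \<otimes>\<^bsub>alg (tensor_square H)\<^esub> tensor_elt (H_grp h) (H_grp h)"
  unfolding alg_simps(3)[symmetric] by (subst H_hopf_def) (simp add: alg_H Let_def based_algebra.defs)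

sublocale H: based H
proof
  show "keys (unity H) \<subseteq> basis H" using n_ge_2 by (simp add: H_simps)
  fix b c assume "b \<in> basis H" "c \<in> basis H"
  then show "keys (bmult H b c) \<subseteq> basis H" by (cases b; cases c) (auto simp: H_simps)
qed

sublocale H2: based "tensor_square H" by (rule based_tensor_square) unfold_locales

definition beta :: "'a obj \<Rightarrow> nat \<times> 'a \<Rightarrow> fmat" where
  "beta V = (\<lambda>(i, h). ypow V i * ac V h)"

lemma repr_beta: assumes V: "obj V" shows "H.repr (dm V) (beta V)"
  unfolding H.repr_def
proof (intro conjI ballI)
  note VD = objD[OF V]
  show "bhat (beta V) (unity H) = E (dm V)" by (simp add: H_simps beta_def VD)
  fix b assume "b \<in> basis H"
  then obtain i h where b: "b = (i, h)" "i < n" "h \<in> carrier G" by (auto simp: H_simps)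
  show "E (dm V) * beta V b = beta V b" "beta V b * E (dm V) = beta V b"
    using b VD ypow_E[OF V] by (simp_all add: beta_def mult.assoc) (simp flip: mult.assoc)
  fix c assume "c \<in> basis H"
  then obtain j k where c: "c = (j, k)" "j < n" "k \<in> carrier G" by (auto simp: H_simps)
  have "beta V b * beta V c = ypow V i * (ac V h * ypow V j) * ac V k"
    by (simp add: b c beta_def mult.assoc)
  also have "\<dots> = smul (\<alpha> h ^ j) (ypow V (i + j) * ac V (h \<otimes> k))"
    using b c VD by (simp add: ac_ypow[OF V] ypow_add[OF V] mult.assoc)
  also have "\<dots> = bhat (beta V) (bmult H b c)"
    using ypow_big[OF V, of "i + j"] by (auto simp: b c H_simps beta_def)
  finally show "bhat (beta V) (bmult H b c) = beta V b * beta V c" by (rule sym)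
qed

definition obj_of :: "(nat \<times> 'a) rep \<Rightarrow> 'a obj" where
  "obj_of M = \<lparr>dm = fst M, ac = (\<lambda>h. H.mats M (0, h)), nl = H.mats M (1, \<one>)\<rparr>"

lemma obj_of_simps [simp]: "dm (obj_of M) = fst M" "ac (obj_of M) h = H.mats M (0, h)"
  "nl (obj_of M) = H.mats M (1, \<one>)"
  by (simp_all add: obj_of_def)

lemma obj_obj_of:
  assumes M: "fd_module H M"
  shows "obj (obj_of M)" "b \<in> basis H \<Longrightarrow> H.mats M b = beta (obj_of M) b"
proof -
  let ?m = "H.mats M" and ?V = "obj_of M"
  have u: "?m (0, \<one>) = E (fst M)"
    and e: "\<And>i h. i < n \<Longrightarrow> h \<in> carrier G \<Longrightarrow> E (fst M) * ?m (i, h) = ?m (i, h) \<and> ?m (i, h) * E (fst M) = ?m (i, h)"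
    and m: "\<And>i h j k. i < n \<Longrightarrow> h \<in> carrier G \<Longrightarrow> j < n \<Longrightarrow> k \<in> carrier G \<Longrightarrow>
      ?m (i, h) * ?m (j, k) = (if i + j < n then smul (\<alpha> h ^ j) (?m (i + j, h \<otimes> k)) else 0)"
  proof -
    note r = H.fd_moduleD(3)[OF M, unfolded H.repr_def]
    show "?m (0, \<one>) = E (fst M)" using r by (simp add: H_simps)
    show "E (fst M) * ?m (i, h) = ?m (i, h) \<and> ?m (i, h) * E (fst M) = ?m (i, h)"
      if "i < n" "h \<in> carrier G" for i h
      using r that by (simp add: H_simps)
    show "?m (i, h) * ?m (j, k) = (if i + j < n then smul (\<alpha> h ^ j) (?m (i + j, h \<otimes> k)) else 0)"
      if "i < n" "h \<in> carrier G" "j < n" "k \<in> carrier G" for i h j k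
    proof -
      have "(i, h) \<in> basis H" "(j, k) \<in> basis H" using that by (simp_all add: H_simps)
      then have "?m (i, h) * ?m (j, k) = bhat ?m (bmult H (i, h) (j, k))" using r by simp
      then show ?thesis by (simp add: H_simps)
    qed
  qed
  have n0: "0 < n" "Suc 0 < n" using n_ge_2 by auto
  have y: "ypow ?V i = (if i < n then ?m (i, \<one>) else 0)" for i
    by (induction i) (use n0 m[of "Suc 0" \<one>] in \<open>auto simp: u ypow_Suc\<close>)
  show "obj ?V"
    unfolding obj_def using n0 u e m by (auto simp: y)
  show "?m b = beta ?V b" if bH: "b \<in> basis H"
  proof -
    obtain i h where b: "b = (i, h)" "i < n" "h \<in> carrier G" using bH by (auto simp: H_simps)
    then show ?thesis using m[of i \<one> 0 h] n0 by (simp add: beta_def y)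
  qed
qed

lemma module_iso_H:
  assumes M: "fd_module H M" and N: "fd_module H N"
  shows "module_iso (alg H) (as_module M) (as_module N) \<longleftrightarrow> iso (obj_of N) (obj_of M)"
proof -
  have n0: "0 < n" "1 < n" using n_ge_2 by auto
  have *: "H.intertwines X (fst M) (H.mats M) (fst N) (H.mats N) \<longleftrightarrow> mor X (obj_of M) (obj_of N)"
    if M: "fd_module H M" and N: "fd_module H N" for X M N
  proof
    assume "H.intertwines X (fst M) (H.mats M) (fst N) (H.mats N)"
    then show "mor X (obj_of M) (obj_of N)"
      using n0 unfolding H.intertwines_def mor_def by (auto simp: H_simps)
  next
    assume X: "mor X (obj_of M) (obj_of N)"
    have "X * H.mats M b = H.mats N b * X" if b: "b \<in> basis H" for b
    proof -
      obtain i h where ih: "b = (i, h)" "h \<in> carrier G" using b by (auto simp: H_simps)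
      have "X * (ypow (obj_of M) i * ac (obj_of M) h) = ypow (obj_of N) i * (ac (obj_of N) h * X)"
        using mor_ypow[OF X, of i] morD(3)[OF X ih(2)] by (metis mult.assoc)
      then show ?thesis
        using obj_obj_of(2)[OF M b] obj_obj_of(2)[OF N b] by (simp add: ih beta_def mult.assoc)
    qed
    then show "H.intertwines X (fst M) (H.mats M) (fst N) (H.mats N)"
      using morD[OF X] unfolding H.intertwines_def by simp
  qed
  show ?thesis
    unfolding H.module_iso_iff[OF M N] iso_def using *[OF M N] *[OF N M] by auto
qed

definition rep_obj :: "'a obj \<Rightarrow> (nat \<times> 'a) rep" where
  "rep_obj V = H.rep_of (dm V) (beta V)"

lemma rep_obj:
  assumes V: "obj V"
  shows "fd_module H (rep_obj V)" "Phi (obj_of (rep_obj V)) = Phi V" "fst (rep_obj V) = dm V"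
proof -
  note r = H.rep_of[OF repr_beta[OF V], folded rep_obj_def]
  show "fd_module H (rep_obj V)" "fst (rep_obj V) = dm V" by (fact r)+
  show "Phi (obj_of (rep_obj V)) = Phi V"
    using n_ge_2 objD[OF V] r(2,3) by (intro obj_cong[OF V]) (simp_all add: H_simps beta_def ypow_Suc)
qed

lemma Phi_rep_sum:
  assumes M: "fd_module H M" and N: "fd_module H N"
  shows "Phi (obj_of (rep_sum M N)) h = Phi (obj_of M) h + Phi (obj_of N) h"
proof -
  note o = osum[OF obj_obj_of(1)[OF M] obj_obj_of(1)[OF N]]
  have "Phi (obj_of (rep_sum M N)) = Phi (osum (obj_of M) (obj_of N))"
    using n_ge_2 H.rep_sum(2,3)[OF M N] by (intro obj_cong[OF o(1)]) (simp_all add: H_simps osum_def Let_def)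
  then show ?thesis using Phi_dsum[OF o(1) obj_obj_of(1)[OF M] obj_obj_of(1)[OF N] o(2)] by simp
qed

text \<open>The coproduct is defined through powers of \<Delta>(y) in the tensor square. Support and
  matrix of these powers are tracked together along the recursion, since the matrix of a product can
  be evaluated only for factors supported on the basis.\<close>

lemma rep_tensor_H:
  assumes M: "fd_module H M" and N: "fd_module H N"
  shows "fd_module H (rep_tensor H M N)"
    "h \<in> carrier G \<Longrightarrow> Phi (obj_of (rep_tensor H M N)) h = (Phi (obj_of M) h * Phi (obj_of N) h) mod modulus (\<alpha> h)"
proof -
  let ?V = "obj_of M" and ?W = "obj_of N" and ?T = "alg (tensor_square H)"
  let ?K = "bhat (\<lambda>(b, c). kr (fst N) (fst N) (H.mats M b) (H.mats N c))"
  let ?B = "basis H \<times> basis H" and ?y = "tensor_elt (H_y G) (H_grp g) + tensor_elt (unity H) (H_y G)"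
  note oV = obj_obj_of(1)[OF M] and oW = obj_obj_of(1)[OF N]
  note VW = obj_tens[OF oV oW]
  have n0: "0 < n" "Suc 0 < n" using n_ge_2 by auto
  have B2: "basis (tensor_square H) = ?B" by (simp add: tensor_square_def)
  have ky: "keys (H_y G) \<subseteq> basis H" and kg: "h \<in> carrier G \<Longrightarrow> keys (H_grp h) \<subseteq> basis H" for h
    using n0 by (simp_all add: H_y_def H_grp_def H_simps)
  have k1: "keys ?y \<subseteq> ?B"
    using keys_add[of "tensor_elt (H_y G) (H_grp g)" "tensor_elt (unity H) (H_y G)"]
      keys_tensor_elt[OF ky kg[OF g_closed]] keys_tensor_elt[OF H.unity_keys ky] by blast
  have mk: "?K (s \<otimes>\<^bsub>?T\<^esub> t) = ?K s * ?K t" if "keys s \<subseteq> ?B" "keys t \<subseteq> ?B" for s t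
    using that H.fd_moduleD(3)[OF M] H.fd_moduleD(3)[OF N] unfolding H.repr_def
    by (intro bhat_tensor_square) auto
  have mc: "keys (s \<otimes>\<^bsub>?T\<^esub> t) \<subseteq> ?B" if "keys s \<subseteq> ?B" "keys t \<subseteq> ?B" for s t
    using H2.bmult_closed[unfolded B2, OF that] by (simp add: alg_simps)
  have Ky: "?K ?y = nl (tens ?V ?W)"
    using objD(1)[OF oV] by (simp add: bhat_add bhat_tensor_elt H_y_def H_grp_def H_simps del: kr.rep_eq)
  have p: "keys (?y [^]\<^bsub>?T\<^esub> i) \<subseteq> ?B \<and> ?K (?y [^]\<^bsub>?T\<^esub> i) = ypow (tens ?V ?W) i" for i :: nat
  proof (induction i)
    case 0
    have "?y [^]\<^bsub>?T\<^esub> (0::nat) = tensor_elt (unity H) (unity H)"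
      by (simp add: nat_pow_def alg_simps) (simp add: tensor_square_def)
    then show ?case
      using keys_tensor_elt[OF H.unity_keys H.unity_keys] objD(1)[OF oV] objD(1)[OF oW]
      by (simp add: bhat_tensor_elt) (simp add: H_simps)
  next
    case (Suc i)
    have "?y [^]\<^bsub>?T\<^esub> Suc i = ?y [^]\<^bsub>?T\<^esub> i \<otimes>\<^bsub>?T\<^esub> ?y" by (simp add: nat_pow_def)
    then show ?case using Suc mk[OF _ k1] mc[OF _ k1] Ky ypow_Suc2[OF VW, of i] by simp
  qed
  have kh: "keys (tensor_elt (H_grp h) (H_grp h)) \<subseteq> ?B" if "h \<in> carrier G" for h
    using keys_tensor_elt[OF kg[OF that] kg[OF that]] .
  have co: "keys (comult H b) \<subseteq> ?B" "?K (comult H b) = beta (tens ?V ?W) b" if bH: "b \<in> basis H" for b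
  proof -
    obtain i h where b: "b = (i, h)" "h \<in> carrier G" using bH by (auto simp: H_simps)
    show "keys (comult H b) \<subseteq> ?B" using mc p[of i] kh[OF b(2)] by (simp add: b(1) comult_H)
    show "?K (comult H b) = beta (tens ?V ?W) b"
      using mk p[of i] kh[OF b(2)] by (simp add: b(1) comult_H beta_def bhat_tensor_elt) (simp add: H_grp_def)
  qed
  have r: "H.repr (fst M * fst N) (beta (tens ?V ?W))" using repr_beta[OF VW] by simp
  note t = H.rep_tensor[OF refl M N co(1) r co(2)]
  show "fd_module H (rep_tensor H M N)" by (rule t(1))
  have "Phi (obj_of (rep_tensor H M N)) = Phi (tens ?V ?W)"
    using n0 t(2,3) objD(8)[OF VW one_closed] objD(1,4)[OF VW] objD(7)[OF VW]
    by (intro obj_cong[OF VW]) (simp_all add: H_simps beta_def ypow_Suc del: tens_simps(2,3))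
  then show "h \<in> carrier G \<Longrightarrow> Phi (obj_of (rep_tensor H M N)) h = (Phi ?V h * Phi ?W h) mod modulus (\<alpha> h)"
    using Phi_tens[OF oV oW] by simp
qed

lemma one_dim_rep_H:
  shows "fd_module H (one_dim_rep (counit H))"
    "h \<in> carrier G \<Longrightarrow> Phi (obj_of (one_dim_rep (counit H))) h = 1"
proof -
  let ?O = "one_obj (\<lambda>_. 1)"
  have p: "pure ?O" by (rule pure_one_obj) auto
  note o = pure_obj[OF p]
  have b: "beta ?O b = smul (counit H b) (E 1)" if "b \<in> basis H" for b
    using that by (cases b; cases "fst b") (auto simp: H_simps beta_def one_obj_def ypow_Suc)
  have r: "H.repr 1 (\<lambda>b. smul (counit H b) (E 1))"
    using H.repr_cong[OF repr_beta[OF o] b] by (simp add: one_obj_def)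
  note t = H.one_dim_rep[OF r]
  show "fd_module H (one_dim_rep (counit H))" by (rule t(1))
  have "Phi (obj_of (one_dim_rep (counit H))) = Phi ?O"
    using n_ge_2 t(2,3) by (intro obj_cong[OF o]) (simp_all add: H_simps one_obj_def)
  then show "h \<in> carrier G \<Longrightarrow> Phi (obj_of (one_dim_rep (counit H))) h = 1"
    using Phi_pure[OF p] gchar_one_obj[of "\<lambda>_. 1"] by (simp add: one_pCons)
qed

end

section \<open>Modules over the group algebra\<close>

lemma (in based) intertwines_bhat:
  assumes X: "intertwines X d \<beta> e \<gamma>" and a: "keys a \<subseteq> basis A"
  shows "X * bhat \<beta> a = bhat \<gamma> a * X"
proof -
  have "X * bhat \<beta> a = bhat (\<lambda>b. X * \<beta> b) a" "bhat \<gamma> a * X = bhat (\<lambda>b. \<gamma> b * X) a"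
    using bhat_linear[OF a, of "\<lambda>x. X * x"] bhat_linear[OF a, of "\<lambda>x. x * X"] by (simp_all add: distrib_left distrib_right)
  moreover have "bhat (\<lambda>b. X * \<beta> b) a = bhat (\<lambda>b. \<gamma> b * X) a"
    by (rule bhat_cong[OF a]) (use X in \<open>simp add: intertwines_def\<close>)
  ultimately show ?thesis by simp
qed

lemma (in based) left_module_as_module:
  assumes R: "ring (alg A)" and M: "fd_module A M"
  shows "left_module (alg A) (as_module M)"
proof -
  have ab: "abelian_group (as_module M)"
    by (rule abelian_groupI) (auto simp: as_module_simps comm_add_vec intro!: bexI[of _ "- _"])
  have F: "snd M (unity A) = 1\<^sub>m (fst M)"
    "\<And>a b. keys a \<subseteq> basis A \<Longrightarrow> keys b \<subseteq> basis A \<Longrightarrow> snd M (bilin_ext (bmult A) a b) = snd M a * snd M b"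
    "\<And>a b. keys a \<subseteq> basis A \<Longrightarrow> keys b \<subseteq> basis A \<Longrightarrow> snd M (a + b) = snd M a + snd M b"
    using M by (cases M; auto simp: fd_module_def alg_simps)+
  show ?thesis
    by (intro left_module.intro left_module_axioms.intro R ab)
      (use fd_moduleD(1)[OF M] in \<open>auto simp: as_module_simps alg_simps F mult_add_distrib_mat_vec[of _ "fst M" "fst M"]
        add_mult_distrib_mat_vec[of _ "fst M" "fst M"] assoc_mult_mat_vec[of _ "fst M" "fst M" _ "fst M"]
        intro!: mult_mat_vec_carrier[of _ "fst M" "fst M"]\<close>)
qed

text \<open>A vector as a matrix supported in column 0, the form in which
  \<open>subspace_basis\<close> handles subspaces.\<close>

definition cv :: "complex vec \<Rightarrow> fmat" where
  "cv v = tf (mat (dim_vec v) 1 (\<lambda>(i, _). v $ i))"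

lemma ent_cv: "ent (cv v) i j = (if i < dim_vec v \<and> j = 0 then v $ i else 0)"
  by (simp add: cv_def)

lemma cv_E: "v \<in> carrier_vec d \<Longrightarrow> E d * cv v = cv v" "cv v * E 1 = cv v"
  by (rule fmat_eqI; auto simp: ent_cv)+

lemma cv_add: "v \<in> carrier_vec d \<Longrightarrow> w \<in> carrier_vec d \<Longrightarrow> cv (v + w) = cv v + cv w"
  by (rule fmat_eqI) (auto simp: ent_cv)

lemma cv_inj: "v \<in> carrier_vec d \<Longrightarrow> w \<in> carrier_vec d \<Longrightarrow> cv v = cv w \<Longrightarrow> v = w"
proof (rule eq_vecI)
  fix i assume "v \<in> carrier_vec d" "w \<in> carrier_vec d" "cv v = cv w" "i < dim_vec w"
  then show "v $ i = w $ i" using ent_cv[of v i 0] ent_cv[of w i 0] by simp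
qed auto

lemma cv_0 [simp]: "cv (0\<^sub>v d) = 0" by (rule fmat_eqI) (simp add: ent_cv)

lemma cv_surj:
  assumes "E d * X = X" "X * E 1 = X" shows "\<exists>w\<in>carrier_vec d. X = cv w"
proof (rule bexI[of _ "vec d (\<lambda>i. ent X i 0)"], rule fmat_eqI)
  fix i j
  have "ent X i j \<noteq> 0 \<Longrightarrow> i < d \<and> j < 1" using assms E_mult_eq_iff mult_E_eq_iff by metis
  then show "ent X i j = ent (cv (vec d (\<lambda>i. ent X i 0))) i j" by (cases "ent X i j = 0") (auto simp: ent_cv)
qed simp

lemma cv_mult: assumes "P \<in> carrier_mat e d" "v \<in> carrier_vec d" shows "cv (P *\<^sub>v v) = tf P * cv v"
proof -
  let ?m = "mat d 1 (\<lambda>(i, _). v $ i)"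
  have c: "col ?m 0 = v" by (rule eq_vecI) (use assms in auto)
  have "mat e 1 (\<lambda>(i, _). (P *\<^sub>v v) $ i) = P * ?m"
  proof (rule eq_matI)
    fix i j assume "i < dim_row (P * ?m)" "j < dim_col (P * ?m)"
    then show "mat e 1 (\<lambda>(i, _). (P *\<^sub>v v) $ i) $$ (i, j) = (P * ?m) $$ (i, j)"
      using assms c by (auto simp del: col_mat)
  qed (use assms in auto)
  then show ?thesis using tf_mult[OF assms(1), of ?m 1] assms by (simp add: cv_def)
qed

context pointed_datum
begin

lemma C_simps: "basis CG = carrier G" "unity CG = single \<one> 1" "bmult CG h k = single (h \<otimes> k) 1"
  "comult CG h = single (h, h) 1" "counit CG h = 1"
  by (simp_all add: group_hopf_def)

sublocale C: based CG
  by unfold_locales (auto simp: C_simps)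

text \<open>Simple modules are by definition modules over a ring, so the ring laws of the group
  algebra have to be verified; each is trilinear or linear and reduces to basis elements.\<close>

lemma ring_CG: "ring (alg CG)"
proof -
  let ?m = "bilin_ext (bmult CG)"
  have sc: "scale c (single x d) = single x (c * d)" for c d :: complex and x :: 'a by (rule scale_single)
  have as: "?m (?m f k) l = ?m f (?m k l)"
    if "keys f \<subseteq> carrier G" "keys k \<subseteq> carrier G" "keys l \<subseteq> carrier G" for f k l
    using that(1)
  proof (induction rule: pm_induct)
    case (single x a)
    note x = single
    show ?case using that(2)
    proof (induction rule: pm_induct)
      case (single y b)
      note y = single
      show ?case using that(3)
        by (induction rule: pm_induct)
          (use x y in \<open>simp_all add: bilin_ext_single C_simps sc m_assoc mult.assoc bilin_ext_add_right\<close>)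
    qed (simp_all add: bilin_ext_add_left bilin_ext_add_right)
  qed (simp_all add: bilin_ext_add_left)
  have un: "?m (single \<one> 1) f = f \<and> ?m f (single \<one> 1) = f" if "keys f \<subseteq> carrier G" for f
    using that by (induction rule: pm_induct)
      (simp_all add: bilin_ext_single C_simps sc bilin_ext_add_left bilin_ext_add_right)
  have neg: "\<exists>y\<in>carrier (alg CG). y \<oplus>\<^bsub>alg CG\<^esub> x = \<zero>\<^bsub>alg CG\<^esub>" if "x \<in> carrier (alg CG)" for x
    using that by (intro bexI[of _ "- x"]) (auto simp: alg_simps)
  have cl: "keys (x + y) \<subseteq> carrier G" if "keys x \<subseteq> carrier G" "keys y \<subseteq> carrier G" for x y :: "'a \<Rightarrow>\<^sub>0 complex"
    using that keys_add[of x y] by blast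
  show ?thesis
  proof (rule ringI)
    show "abelian_group (alg CG)"
      by (rule abelian_groupI) (use neg cl in \<open>simp_all add: alg_simps add_ac C_simps\<close>)
    show "Group.monoid (alg CG)"
      by (rule monoidI) (use C.bmult_closed as un in \<open>simp_all add: alg_simps C_simps(1,2)\<close>)
  qed (simp_all add: alg_simps bilin_ext_add_left bilin_ext_add_right)
qed

definition gobj_of :: "'a rep \<Rightarrow> 'a obj" where
  "gobj_of M = \<lparr>dm = fst M, ac = C.mats M, nl = 0\<rparr>"

lemma gobj_of_simps [simp]: "dm (gobj_of M) = fst M" "ac (gobj_of M) = C.mats M" "nl (gobj_of M) = 0"
  by (simp_all add: gobj_of_def)

lemma repr_pure: assumes W: "pure W" shows "C.repr (dm W) (ac W)"
  using objD[OF pure_obj[OF W]] unfolding C.repr_def by (simp add: C_simps)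

lemma pure_gobj_of: assumes M: "fd_module CG M" shows "pure (gobj_of M)"
proof -
  obtain m where m: "n = Suc m" using n_ge_2 by (cases n) auto
  show ?thesis
    using C.fd_moduleD(3)[OF M] unfolding C.repr_def pure_def obj_def by (simp add: C_simps m ypow_Suc)
qed

lemma intertwines_C:
  "C.intertwines X (fst M) (C.mats M) (fst N) (C.mats N) \<longleftrightarrow> mor X (gobj_of M) (gobj_of N)"
  unfolding C.intertwines_def mor_def by (simp add: C_simps)

lemma module_iso_C:
  assumes M: "fd_module CG M" and N: "fd_module CG N"
  shows "module_iso (alg CG) (as_module M) (as_module N) \<longleftrightarrow> iso (gobj_of N) (gobj_of M)"
  unfolding C.module_iso_iff[OF M N] iso_def intertwines_C by auto

definition rep_gobj :: "'a obj \<Rightarrow> 'a rep" where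
  "rep_gobj V = C.rep_of (dm V) (ac V)"

lemma pure_cong_iso:
  assumes V: "pure V" and e: "dm N = dm V" "\<And>h. h \<in> carrier G \<Longrightarrow> ac N h = ac V h" "nl N = 0"
  shows "iso N V" "Phi N = Phi V"
proof -
  have "obj V" "nl N = nl V" using V e by (simp_all add: pure_def)
  note o = obj_cong[OF this(1) e(1,2) this(2)]
  show "Phi N = Phi V" by (rule o(2))
  then show "iso N V" using Phi_complete[OF o(1) pure_obj[OF V]] by simp
qed

lemma rep_gobj:
  assumes W: "pure W"
  shows "fd_module CG (rep_gobj W)" "iso (gobj_of (rep_gobj W)) W" "Phi (gobj_of (rep_gobj W)) = Phi W"
    "fst (rep_gobj W) = dm W"
proof -
  note r = C.rep_of[OF repr_pure[OF W], folded rep_gobj_def]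
  show "fd_module CG (rep_gobj W)" "fst (rep_gobj W) = dm W" by (fact r)+
  show "iso (gobj_of (rep_gobj W)) W" "Phi (gobj_of (rep_gobj W)) = Phi W"
    using r(2,3) by (intro pure_cong_iso[OF W]; simp add: C_simps)+
qed

lemma Phi_rep_sum_C:
  assumes M: "fd_module CG M" and N: "fd_module CG N"
  shows "Phi (gobj_of (rep_sum M N)) h = Phi (gobj_of M) h + Phi (gobj_of N) h"
proof -
  note oM = pure_obj[OF pure_gobj_of[OF M]] and oN = pure_obj[OF pure_gobj_of[OF N]]
  note o = osum[OF oM oN]
  have "Phi (gobj_of (rep_sum M N)) = Phi (osum (gobj_of M) (gobj_of N))"
    using C.rep_sum(2,3)[OF M N] by (intro obj_cong[OF o(1)]) (simp_all add: C_simps osum_def Let_def)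
  then show ?thesis using Phi_dsum[OF o(1) oM oN o(2)] by simp
qed

lemma rep_tensor_C:
  assumes M: "fd_module CG M" and N: "fd_module CG N"
  shows "fd_module CG (rep_tensor CG M N)"
    "h \<in> carrier G \<Longrightarrow> Phi (gobj_of (rep_tensor CG M N)) h =
      (Phi (gobj_of M) h * Phi (gobj_of N) h) mod modulus (\<alpha> h)"
proof -
  let ?V = "gobj_of M" and ?W = "gobj_of N"
  note oM = pure_obj[OF pure_gobj_of[OF M]] and oN = pure_obj[OF pure_gobj_of[OF N]]
  note VW = obj_tens[OF oM oN]
  have p: "pure (tens ?V ?W)" using VW by (simp add: pure_def)
  have r: "C.repr (fst M * fst N) (ac (tens ?V ?W))" using repr_pure[OF p] by (simp del: tens_simps(2))
  have co: "keys (comult CG b) \<subseteq> basis CG \<times> basis CG"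
    "bhat (\<lambda>(b, c). kr (fst N) (fst N) (C.mats M b) (C.mats N c)) (comult CG b) = ac (tens ?V ?W) b"
    if "b \<in> basis CG" for b
    using that by (simp_all add: C_simps)
  note t = C.rep_tensor[OF refl M N co(1) r co(2)]
  show "fd_module CG (rep_tensor CG M N)" by (rule t(1))
  have "Phi (gobj_of (rep_tensor CG M N)) = Phi (tens ?V ?W)"
    using t(2,3) by (intro pure_cong_iso[OF p]) (simp_all add: C_simps)
  then show "h \<in> carrier G \<Longrightarrow> Phi (gobj_of (rep_tensor CG M N)) h = (Phi ?V h * Phi ?W h) mod modulus (\<alpha> h)"
    using Phi_tens[OF oM oN] by simp
qed

lemma one_dim_rep_C:
  assumes "\<epsilon> \<one> = 1" "\<And>h k. h \<in> carrier G \<Longrightarrow> k \<in> carrier G \<Longrightarrow> \<epsilon> (h \<otimes> k) = \<epsilon> h * \<epsilon> k"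
  shows "fd_module CG (one_dim_rep \<epsilon>)"
    "h \<in> carrier G \<Longrightarrow> Phi (gobj_of (one_dim_rep \<epsilon>)) h = [:\<epsilon> h:]"
proof -
  let ?O = "one_obj \<epsilon>"
  have p: "pure ?O" by (rule pure_one_obj) (use assms in auto)
  have r: "C.repr 1 (\<lambda>b. smul (\<epsilon> b) (E 1))" using repr_pure[OF p] by (simp add: one_obj_def)
  note t = C.one_dim_rep[OF r]
  show "fd_module CG (one_dim_rep \<epsilon>)" by (rule t(1))
  have "Phi (gobj_of (one_dim_rep \<epsilon>)) = Phi ?O"
    using t(2,3) by (intro pure_cong_iso[OF p]) (simp_all add: C_simps one_obj_def)
  then show "h \<in> carrier G \<Longrightarrow> Phi (gobj_of (one_dim_rep \<epsilon>)) h = [:\<epsilon> h:]"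
    using Phi_pure[OF p] gchar_one_obj[of \<epsilon>] by simp
qed

text \<open>The fixed vectors of an equivariant idempotent form a submodule, namely its image; if
  this is zero or everything, so is the idempotent.\<close>

lemma simple_indec:
  assumes M: "fd_module CG M" and S: "simple_module (alg CG) (as_module M)"
  shows "indec (gobj_of M)"
  unfolding indec_def
proof (intro conjI allI impI pure_gobj_of[OF M])
  let ?d = "fst M"
  show "0 < dm (gobj_of M)"
  proof (rule ccontr)
    assume "\<not> 0 < dm (gobj_of M)"
    then have "carrier (as_module M) = {0\<^sub>v 0}" by (auto simp: as_module_simps)
    then show False using S \<open>\<not> 0 < dm (gobj_of M)\<close> by (simp add: simple_module_def as_module_simps)
  qed
  fix P assume P: "mor P (gobj_of M) (gobj_of M) \<and> P * P = P"
  have Pd: "E ?d * P = P" "P * E ?d = P" using P morD(1,2) by fastforce+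
  define U where "U = {v \<in> carrier_vec ?d. P * cv v = cv v}"
  have act: "P * tf (snd M a) = tf (snd M a) * P" if "keys a \<subseteq> carrier G" for a
    using C.intertwines_bhat[of P ?d "C.mats M" ?d "C.mats M" a] P intertwines_C[of P M M] that
      C.fd_moduleD(2)[OF M, of a] by (simp add: C_simps)
  have "Module.submodule U (alg CG) (as_module M)"
  proof (rule left_module_submoduleI[OF C.left_module_as_module[OF ring_CG M]])
    show "U \<subseteq> carrier (as_module M)" by (auto simp: U_def as_module_simps)
    have "0\<^sub>v ?d \<in> U" by (simp add: U_def)
    then show "U \<noteq> {}" by blast
    show "x \<oplus>\<^bsub>as_module M\<^esub> y \<in> U" if "x \<in> U" "y \<in> U" for x y
      using that cv_add[of x ?d y] by (auto simp: U_def as_module_simps distrib_left)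
    fix a x assume a: "a \<in> carrier (alg CG)" and x: "x \<in> U"
    then have ka: "keys a \<subseteq> carrier G" by (simp add: alg_simps C_simps)
    have Ma: "snd M a \<in> carrier_mat ?d ?d" using C.fd_moduleD(1)[OF M, of a] ka by (simp add: C_simps)
    have xc: "x \<in> carrier_vec ?d" "P * cv x = cv x" using x by (auto simp: U_def)
    have "P * (tf (snd M a) * cv x) = tf (snd M a) * cv x"
      using act[OF ka] xc(2) by (metis mult.assoc)
    then show "a \<odot>\<^bsub>as_module M\<^esub> x \<in> U"
      using Ma xc cv_mult[OF Ma xc(1)] by (simp add: U_def as_module_simps)
  qed
  then have "U = {0\<^sub>v ?d} \<or> U = carrier_vec ?d" using S by (simp add: simple_module_def as_module_simps)
  then show "P = 0 \<or> P = E (dm (gobj_of M))"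
  proof
    assume U: "U = {0\<^sub>v ?d}"
    have "P = 0"
    proof (rule fmat_eq_colsI)
      fix j
      have "\<exists>w\<in>carrier_vec ?d. P * munit j 0 = cv w"
        by (rule cv_surj) (use Pd in \<open>simp_all add: mult.assoc flip: mult.assoc[of "E ?d"]\<close>)
      then obtain w where w: "w \<in> carrier_vec ?d" "P * munit j 0 = cv w" by blast
      have "P * cv w = cv w" unfolding w(2)[symmetric] using P by (simp flip: mult.assoc)
      then have "w \<in> U" using w(1) by (simp add: U_def)
      then have "w = 0\<^sub>v ?d" using U by blast
      then show "P * munit j 0 = 0 * munit j 0" using w(2) by simp
    qed
    then show ?thesis ..
  next
    assume U: "U = carrier_vec ?d"
    have "P = E ?d"
    proof (rule fmat_eq_colsI)
      fix j
      have "\<exists>w\<in>carrier_vec ?d. E ?d * munit j 0 = cv w"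
        by (rule cv_surj) (simp_all add: mult.assoc)
      then obtain w where w: "w \<in> carrier_vec ?d" "E ?d * munit j 0 = cv w" by blast
      then have "w \<in> U" using U by blast
      then have "P * (E ?d * munit j 0) = E ?d * munit j 0" unfolding U_def w(2) by simp
      then show "P * munit j 0 = E ?d * munit j 0" using Pd by (metis mult.assoc)
    qed
    then show ?thesis by simp
  qed
qed

lemma avg_closed:
  assumes "\<And>h. h \<in> carrier G \<Longrightarrow> f h \<in> U" "0 \<in> U" "\<And>X Y. X \<in> U \<Longrightarrow> Y \<in> U \<Longrightarrow> X + Y \<in> U"
    "\<And>c X. X \<in> U \<Longrightarrow> smul c X \<in> U"
  shows "avg f \<in> U"
proof -
  have "(\<Sum>h\<in>S. f h) \<in> U" if "S \<subseteq> carrier G" for S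
    using that by (induction S rule: infinite_finite_induct) (auto intro: assms)
  then show ?thesis unfolding avg_def using assms(4) by blast
qed

text \<open>Maschke's argument: a projection onto a submodule is averaged into an equivariant
  idempotent with the same image, which must be zero or the identity.\<close>

lemma indec_simple:
  assumes M: "fd_module CG M" and I: "indec (gobj_of M)"
  shows "simple_module (alg CG) (as_module M)"
  unfolding simple_module_def
proof (intro conjI allI impI)
  let ?d = "fst M" and ?V = "gobj_of M"
  note p = pure_gobj_of[OF M]
  note VD = objD[OF pure_obj[OF p]]
  show "left_module (alg CG) (as_module M)" by (rule C.left_module_as_module[OF ring_CG M])
  show "carrier (as_module M) \<noteq> {\<zero>\<^bsub>as_module M\<^esub>}"
  proof
    assume "carrier (as_module M) = {\<zero>\<^bsub>as_module M\<^esub>}"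
    then have "(carrier_vec ?d :: complex vec set) = {0\<^sub>v ?d}" by (simp only: as_module_simps)
    then have "unit_vec ?d 0 = (0\<^sub>v ?d :: complex vec)" using unit_vec_carrier[of ?d 0] by blast
    then show False using I unit_vec_nonzero[of 0 ?d] by (simp add: indec_def)
  qed
  fix U assume "Module.submodule U (alg CG) (as_module M)"
  note U = submoduleD[OF this, unfolded as_module_simps alg_simps mem_Collect_eq]
  define Uf where "Uf = cv ` U"
  have Uc: "u \<in> carrier_vec ?d" if "u \<in> U" for u using U(1) that by blast
  have zero: "0 \<in> Uf" unfolding Uf_def using U(2) cv_0 by (metis imageI)
  have add: "X + Y \<in> Uf" if XY: "X \<in> Uf" "Y \<in> Uf" for X Y
  proof -
    obtain u v where uv: "u \<in> U" "v \<in> U" "X = cv u" "Y = cv v" using XY unfolding Uf_def by blast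
    have "X + Y = cv (u + v)" using cv_add[OF Uc Uc] uv by simp
    then show ?thesis unfolding Uf_def using U(3) uv by blast
  qed
  have act: "tf (snd M a) * X \<in> Uf" if aX: "keys a \<subseteq> carrier G" "X \<in> Uf" for a X
  proof -
    obtain u where u: "u \<in> U" "X = cv u" using aX unfolding Uf_def by blast
    have ka: "keys a \<subseteq> basis CG" using aX by (simp add: C_simps)
    have "tf (snd M a) * X = cv (snd M a *\<^sub>v u)" using cv_mult[OF C.fd_moduleD(1)[OF M ka] Uc[OF u(1)]] u by simp
    then show ?thesis unfolding Uf_def using U(4) u(1) ka by blast
  qed
  have ac: "ac ?V h * X \<in> Uf" if "h \<in> carrier G" "X \<in> Uf" for h X
    using act[of "single h 1" X] that by (simp add: C.mats_def)
  have Ud: "E ?d * X = X" "X * E 1 = X" if "X \<in> Uf" for X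
    using that cv_E Uc unfolding Uf_def by auto
  have sm: "smul c X \<in> Uf" if "X \<in> Uf" for c X
  proof -
    have "tf (snd M (single \<one> c)) = smul c (E ?d)"
      using C.fd_moduleD(2)[OF M, of "single \<one> c"] VD(1) by (simp add: C_simps)
    then show ?thesis using act[of "single \<one> c" X] that Ud by simp
  qed
  obtain e B D where BD: "E ?d * B = B" "B * E e = B" "E e * D = D" "D * E ?d = D" "D * B = E e"
    "\<And>X. X \<in> Uf \<Longrightarrow> B * (D * X) = X" "\<And>X. X * E 1 = X \<Longrightarrow> B * X \<in> Uf"
    by (rule subspace_basis[of Uf ?d]) (rule zero | erule (1) add | erule sm | erule Ud | (rule that; assumption))+
  \<comment> \<open>\<open>B * D\<close> projects onto the submodule. Its average still fixes the
    submodule and still takes values in it, both because the submodule is stable under G.\<close>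
  let ?T = "tw (\<lambda>_. 1) ?V ?V (B * D)"
  have T: "?T * X = avg (\<lambda>h. ac ?V (inv h) * (B * (D * (ac ?V h * X))))" for X
    by (simp add: tw_def avg_mult mult.assoc)
  have fix_U: "?T * X = X" if X: "X \<in> Uf" for X
  proof -
    have "?T * X = avg (\<lambda>h. X)"
      unfolding T
    proof (rule avg_cong)
      fix h assume h: "h \<in> carrier G"
      have "ac ?V (inv h) * (ac ?V h * X) = E ?d * X"
        using ac_inv(2)[OF pure_obj[OF p] h] by (simp flip: mult.assoc)
      then show "ac ?V (inv h) * (B * (D * (ac ?V h * X))) = X"
        using BD(6)[OF ac[OF h X]] Ud[OF X] by simp
    qed
    then show ?thesis by (simp add: avg_const)
  qed
  have T_U: "?T * X \<in> Uf" if X: "X * E 1 = X" for X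
    unfolding T
  proof (rule avg_closed[OF _ zero add sm])
    fix h assume h: "h \<in> carrier G"
    have "B * (D * (ac ?V h * X)) \<in> Uf" by (rule BD(7)) (simp add: mult.assoc X[simplified])
    then show "ac ?V (inv h) * (B * (D * (ac ?V h * X))) \<in> Uf" using ac h by blast
  qed
  have "?T * ?T = ?T"
  proof (rule fmat_eq_colsI)
    fix j
    have "?T * munit j 0 \<in> Uf" by (rule T_U) simp
    then show "?T * ?T * munit j 0 = ?T * munit j 0" using fix_U by (simp add: mult.assoc)
  qed
  then consider "?T = 0" | "?T = E ?d" using I tw_mor[OF p p] unfolding indec_def by auto
  then have "U = {0\<^sub>v ?d} \<or> U = carrier_vec ?d"
  proof cases
    case 1
    have "u = 0\<^sub>v ?d" if u: "u \<in> U" for u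
    proof -
      have "cv u \<in> Uf" using u by (simp add: Uf_def)
      then have "cv u = cv (0\<^sub>v ?d)" using fix_U[of "cv u"] 1 by simp
      then show ?thesis using cv_inj[OF Uc[OF u]] by simp
    qed
    then show ?thesis using U(2) by blast
  next
    case 2
    have "v \<in> U" if v: "v \<in> carrier_vec ?d" for v
    proof -
      have "cv v \<in> Uf" using T_U[OF cv_E(2), of v] cv_E(1)[OF v] 2 by simp
      then obtain u where "u \<in> U" "cv v = cv u" unfolding Uf_def by blast
      then show ?thesis using cv_inj[OF v Uc] by blast
    qed
    then show ?thesis using U(1) by blast
  qed
  then show "U = {\<zero>\<^bsub>as_module M\<^esub>} \<or> U = carrier (as_module M)" by (simp add: as_module_simps)
qed

lemma iso_indec: assumes "iso V W" "indec W" "pure V" shows "indec V"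
proof -
  obtain \<iota> \<pi> where m: "mor \<iota> W V" "mor \<pi> V W" and e: "\<pi> * \<iota> = E (dm W)" "\<iota> * \<pi> = E (dm V)"
    using assms(1) unfolding iso_def by blast
  show ?thesis
    unfolding indec_def
  proof (intro conjI allI impI)
    show "pure V" "0 < dm V" using assms iso_dm[OF assms(1)] by (auto simp: indec_def)
    fix P assume P: "mor P V V \<and> P * P = P"
    have "mor (\<pi> * (P * \<iota>)) W W" using mor_comp[OF mor_comp[OF m(1)] m(2)] P by blast
    then have "mor (\<pi> * P * \<iota>) W W" by (simp only: mult.assoc)
    moreover have "\<pi> * P * \<iota> * (\<pi> * P * \<iota>) = \<pi> * P * (\<iota> * \<pi>) * P * \<iota>" by (simp add: mult.assoc)
    then have "\<pi> * P * \<iota> * (\<pi> * P * \<iota>) = \<pi> * (P * E (dm V) * P) * \<iota>" unfolding e by (simp add: mult.assoc)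
    then have "\<pi> * P * \<iota> * (\<pi> * P * \<iota>) = \<pi> * P * \<iota>" using P morD(2)[of P V V] by simp
    ultimately have "\<pi> * P * \<iota> = 0 \<or> \<pi> * P * \<iota> = E (dm W)" using assms(2) by (simp add: indec_def)
    moreover have "\<iota> * (\<pi> * P * \<iota>) * \<pi> = E (dm V) * P * E (dm V)" unfolding e(2)[symmetric] by (simp add: mult.assoc)
    then have "\<iota> * (\<pi> * P * \<iota>) * \<pi> = P" using P morD(1,2)[of P V V] by simp
    moreover have "\<iota> * E (dm W) * \<pi> = E (dm V)" using morD(2)[OF m(1)] e by simp
    ultimately show "P = 0 \<or> P = E (dm V)" by auto
  qed
qed

lemma num_simple_reps: "num_simple_reps G = card Irr"
proof -
  let ?f = "\<lambda>W. iso_class CG (rep_gobj W)"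
  have cls: "iso_class CG M = {N. fd_module CG N \<and> iso (gobj_of N) (gobj_of M)}" if "fd_module CG M" for M
    unfolding iso_class_def using module_iso_C[OF that] by blast
  have "bij_betw ?f Irr {iso_class CG M | M. fd_module CG M \<and> simple_module (alg CG) (as_module M)}"
  proof (rule bij_betwI')
    fix V W assume V: "V \<in> Irr" and W: "W \<in> Irr"
    note rV = rep_gobj[OF Irr_pure[OF V]] and rW = rep_gobj[OF Irr_pure[OF W]]
    show "?f V = ?f W \<longleftrightarrow> V = W"
    proof
      assume "?f V = ?f W"
      then have "rep_gobj V \<in> {N. fd_module CG N \<and> iso (gobj_of N) (gobj_of (rep_gobj W))}"
        using cls[OF rV(1)] cls[OF rW(1)] rV(1) iso_refl[OF pure_obj[OF pure_gobj_of[OF rV(1)]]] by blast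
      then have "iso V W" using rV(2) rW(2) iso_trans iso_sym by blast
      then show "V = W" by (rule Irr_iso_eq[OF V W])
    qed simp
  next
    fix W assume W: "W \<in> Irr"
    note r = rep_gobj[OF Irr_pure[OF W]]
    have "indec (gobj_of (rep_gobj W))" by (rule iso_indec[OF r(2) Irr_indec[OF W] pure_gobj_of[OF r(1)]])
    then show "?f W \<in> {iso_class CG M | M. fd_module CG M \<and> simple_module (alg CG) (as_module M)}"
      using indec_simple[OF r(1)] r(1) by blast
  next
    fix Y assume "Y \<in> {iso_class CG M | M. fd_module CG M \<and> simple_module (alg CG) (as_module M)}"
    then obtain M where M: "Y = iso_class CG M" "fd_module CG M" "simple_module (alg CG) (as_module M)" by blast
    note i = irr_rep[OF simple_indec[OF M(2,3)]]
    note r = rep_gobj[OF Irr_pure[OF i(3)]]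
    have "iso (gobj_of M) (gobj_of (rep_gobj (irr_rep (gobj_of M))))" using i(2) r(2) iso_trans iso_sym by blast
    then have "Y = ?f (irr_rep (gobj_of M))"
      unfolding M(1) cls[OF M(2)] cls[OF r(1)] using iso_trans iso_sym by blast
    then show "\<exists>W\<in>Irr. Y = ?f W" using i(3) by blast
  qed
  from bij_betw_same_card[OF this] show ?thesis unfolding num_simple_reps_def by (rule sym)
qed

end

section \<open>Roots of the generalized Fibonacci polynomials\<close>

lemma fib_sum: "poly (fib a k) (1 + a) = (\<Sum>i<k. a ^ i)"
proof -
  have "poly (fib a k) (1 + a) = (\<Sum>i<k. a ^ i) \<and> poly (fib a (Suc k)) (1 + a) = (\<Sum>i<Suc k. a ^ i)"
  proof (induction k)
    case (Suc k)
    have "(1 + a) * (\<Sum>i<Suc k. a ^ i) - a * (\<Sum>i<k. a ^ i) = (\<Sum>i<Suc (Suc k). a ^ i)"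
      by (simp add: algebra_simps sum_distrib_left)
    then show ?case using Suc by simp
  qed simp
  then show ?thesis ..
qed

lemma fib_sum_eq_0: "0 < k \<Longrightarrow> poly (fib a k) (1 + a) = 0 \<longleftrightarrow> a ^ k = 1 \<and> a \<noteq> 1"
  unfolding fib_sum using geometric_sum[of a k] by (cases "a = 1") auto

lemma fib_cos:
  fixes b :: complex and t :: real
  shows "b * poly (fib (b\<^sup>2) k) (2 * b * of_real (cos t)) * of_real (sin t) = b ^ k * of_real (sin (k * t))"
proof -
  have "sin (real (Suc (Suc k)) * t) = 2 * cos t * sin (real (Suc k) * t) - sin (k * t)" for k
  proof -
    have "sin (real (Suc k) * t + t) + sin (real (Suc k) * t - t) = 2 * cos t * sin (real (Suc k) * t)"
      by (simp add: sin_add sin_diff)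
    moreover have "real (Suc k) * t + t = real (Suc (Suc k)) * t" "real (Suc k) * t - t = k * t"
      by (simp_all add: algebra_simps)
    ultimately show ?thesis by simp
  qed
  note rec = this
  have "b * poly (fib (b\<^sup>2) k) (2 * b * of_real (cos t)) * of_real (sin t) = b ^ k * of_real (sin (k * t)) \<and>
    b * poly (fib (b\<^sup>2) (Suc k)) (2 * b * of_real (cos t)) * of_real (sin t) = b ^ Suc k * of_real (sin (Suc k * t))"
  proof (induction k)
    case (Suc k)
    let ?p = "\<lambda>k. poly (fib (b\<^sup>2) k) (2 * b * of_real (cos t))"
    have "b * ?p (Suc (Suc k)) * of_real (sin t) =
        2 * b * of_real (cos t) * (b * ?p (Suc k) * of_real (sin t)) - b\<^sup>2 * (b * ?p k * of_real (sin t))"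
      by (simp add: algebra_simps)
    also have "\<dots> = 2 * b * of_real (cos t) * (b ^ Suc k * of_real (sin (Suc k * t))) - b\<^sup>2 * (b ^ k * of_real (sin (k * t)))"
      using Suc.IH by simp
    also have "\<dots> = b ^ Suc (Suc k) * of_real (sin (real (Suc (Suc k)) * t))"
      unfolding rec by (simp add: algebra_simps power2_eq_square)
    finally show ?case using Suc by simp
  qed simp
  then show ?thesis ..
qed

text \<open>With b a square root of a, the m distinct roots are 2 b cos(j pi / (m + 1)) for j = 1,
  ..., m; they exhaust the degree.\<close>

lemma fib_roots:
  assumes "a \<noteq> 0"
  shows "card {z. poly (fib a (Suc m)) z = 0} = m"
proof -
  let ?Z = "{z. poly (fib a (Suc m)) z = 0}" and ?n = "Suc m"
  have f0: "fib a ?n \<noteq> 0" using fib_lead[of a m] by auto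
  define b where "b = csqrt a"
  have b: "b\<^sup>2 = a" "b \<noteq> 0" using assms by (auto simp: b_def)
  define t where "t j = real j * pi / real ?n" for j
  have t: "0 < t j" "t j < pi" if "j \<in> {1..m}" for j
    using that mult_strict_right_mono[of "real j" "real ?n" pi] by (auto simp: t_def divide_less_eq mult.commute)
  have "(\<lambda>j. 2 * b * of_real (cos (t j))) ` {1..m} \<subseteq> ?Z"
  proof safe
    fix j assume j: "j \<in> {1..m}"
    have "real ?n * t j = real j * pi" by (simp add: t_def)
    then have "sin (real ?n * t j) = 0" by (simp only: sin_npi)
    then have "b * poly (fib a ?n) (2 * b * of_real (cos (t j))) * of_real (sin (t j)) = 0"
      using fib_cos[of b ?n "t j"] b by simp
    moreover have "sin (t j) \<noteq> 0" using sin_gt_zero[OF t[OF j]] by simp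
    ultimately show "poly (fib a ?n) (2 * b * of_real (cos (t j))) = 0" using b by simp
  qed
  moreover have "inj_on (\<lambda>j. 2 * b * of_real (cos (t j)) :: complex) {1..m}"
  proof (rule inj_onI)
    fix i j assume ij: "i \<in> {1..m}" "j \<in> {1..m}"
      and "2 * b * of_real (cos (t i)) = (2 * b * of_real (cos (t j)) :: complex)"
    then have "cos (t i) = cos (t j)" using b by simp
    then have "t i = t j" using cos_inj_pi[of "t i" "t j"] t[OF ij(1)] t[OF ij(2)] by simp
    then show "i = j" by (simp add: t_def)
  qed
  ultimately have "card {1..m} \<le> card ?Z"
    using poly_roots_finite[OF f0] by (metis card_image card_mono)
  moreover have "card ?Z \<le> m" using card_poly_roots_bound[OF f0] by (simp add: fib_degree)
  ultimately show ?thesis by simp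
qed

text \<open>The polynomial has as many distinct roots as its degree, so a nonzero remainder
  vanishing at all of them would have too many.\<close>

lemma fib_dvd:
  assumes a: "a \<noteq> 0" and f: "\<And>z. poly (fib a (Suc m)) z = 0 \<Longrightarrow> poly f z = 0"
  shows "fib a (Suc m) dvd f"
proof (rule ccontr)
  let ?r = "f mod fib a (Suc m)"
  assume "\<not> fib a (Suc m) dvd f"
  then have r0: "?r \<noteq> 0" by (simp add: mod_eq_0_iff_dvd)
  have f0: "fib a (Suc m) \<noteq> 0" using fib_lead[of a m] by auto
  have m: "m \<noteq> 0"
  proof
    assume "m = 0"
    then have "fib a (Suc m) = 1" by simp
    then show False using r0 by simp
  qed
  have "degree ?r < m" using degree_mod_less[OF f0, of f] r0 by (simp add: fib_degree)
  moreover have "poly ?r z = 0" if "poly (fib a (Suc m)) z = 0" for z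
  proof -
    have "f = fib a (Suc m) * (f div fib a (Suc m)) + ?r" by simp
    then have "poly f z = poly (fib a (Suc m)) z * poly (f div fib a (Suc m)) z + poly ?r z"
      by (metis poly_add poly_mult)
    then show ?thesis using that f by simp
  qed
  then have "card {z. poly (fib a (Suc m)) z = 0} \<le> card {z. poly ?r z = 0}"
    by (intro card_mono poly_roots_finite[OF r0]) auto
  ultimately show False using card_poly_roots_bound[OF r0] fib_roots[OF a, of m] by simp
qed

context pointed_datum
begin

lemma modulus_root: "poly (modulus a) z = 0 \<longleftrightarrow> z = 1 + a \<or> poly (fib a n) z = 0"
proof -
  have "poly [:- (1 + a), 1:] z = z - (1 + a)" by simp
  then show ?thesis unfolding modulus_def poly_mult mult_eq_0_iff by (simp only: right_minus_eq)
qed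

lemma n_Suc: "n = Suc (n - 1)" using n_ge_2 by simp

lemma modulus_roots:
  assumes "a \<noteq> 0"
  shows "card {z. poly (modulus a) z = 0} = (if a ^ n = 1 \<and> a \<noteq> 1 then n - 1 else n)"
    "finite {z. poly (modulus a) z = 0}"
proof -
  let ?Z = "{z. poly (fib a n) z = 0}"
  have e: "{z. poly (modulus a) z = 0} = insert (1 + a) ?Z" by (auto simp: modulus_root)
  have f0: "fib a n \<noteq> 0" using fib_lead[of a "n - 1"] n_Suc by auto
  have c: "card ?Z = n - 1" using fib_roots[OF assms, of "n - 1"] n_Suc by simp
  show "card {z. poly (modulus a) z = 0} = (if a ^ n = 1 \<and> a \<noteq> 1 then n - 1 else n)"
    using fib_sum_eq_0[of n a] n_ge_2 c poly_roots_finite[OF f0] unfolding e by (auto simp: card_insert_if)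
  show "finite {z. poly (modulus a) z = 0}" unfolding e using poly_roots_finite[OF f0] by simp
qed

text \<open>By simplicity of the roots f is a multiple of F_n, constant for degree reasons. Its
  value at the further root 1 + a kills the constant unless a is exceptional. The linear factor and
  F_n both divide f, so the modulus divides f^2; this will give nilpotency.\<close>

lemma vanishing_on_roots:
  assumes "a \<noteq> 0" "degree f < n" "\<And>z. poly (modulus a) z = 0 \<Longrightarrow> poly f z = 0"
  shows "f = Polynomial.smult (coeff f (n - 1)) (fib a n)" "\<not> (a ^ n = 1 \<and> a \<noteq> 1) \<Longrightarrow> f = 0"
    "modulus a dvd f * f"
proof -
  have f: "fib a n dvd f" using fib_dvd[OF assms(1), of "n - 1" f] assms(3) n_Suc by (simp add: modulus_root)
  then obtain p where p: "f = fib a n * p" by auto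
  have deg: "degree (fib a n) = n - 1" using fib_degree[of a "n - 1"] n_Suc by simp
  have "degree p = 0"
  proof (cases "p = 0")
    case False
    have "fib a n \<noteq> 0" using fib_lead[of a "n - 1"] n_Suc by auto
    then show ?thesis using assms(2) False by (simp add: p degree_mult_eq deg)
  qed simp
  then obtain c where c: "p = [:c:]" by (rule degree_eq_zeroE)
  have "coeff (fib a n) (n - 1) = 1" using fib_lead[of a "n - 1"] n_Suc by metis
  then have "coeff f (n - 1) = c" by (simp add: p c)
  moreover have "f = Polynomial.smult c (fib a n)" by (simp add: p c)
  ultimately show fc: "f = Polynomial.smult (coeff f (n - 1)) (fib a n)" by metis
  show "f = 0" if "\<not> (a ^ n = 1 \<and> a \<noteq> 1)"
  proof -
    have "poly f (1 + a) = 0" by (rule assms(3)) (simp add: modulus_root)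
    then have "coeff f (n - 1) = 0" using fib_sum_eq_0[of n a] that n_ge_2
      by (subst (asm) fc) auto
    then show ?thesis by (subst fc) simp
  qed
  have "poly f (1 + a) = 0" by (rule assms(3)) (simp add: modulus_root)
  then have "[:- (1 + a), 1:] dvd f" by (simp only: poly_eq_0_iff_dvd)
  then show "modulus a dvd f * f" unfolding modulus_def using f by (rule mult_dvd_mono)
qed

section \<open>The Green rings as rings of functions\<close>

definition psc :: "complex \<Rightarrow> ('a \<Rightarrow> complex poly) \<Rightarrow> 'a \<Rightarrow> complex poly" where
  "psc c f = (\<lambda>h. Polynomial.smult c (f h))"

definition pmul :: "('a \<Rightarrow> complex poly) \<Rightarrow> ('a \<Rightarrow> complex poly) \<Rightarrow> 'a \<Rightarrow> complex poly" where
  "pmul f k = (\<lambda>h. (f h * k h) mod modulus (\<alpha> h))"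

definition pone :: "'a \<Rightarrow> complex poly" where
  "pone = (\<lambda>h. if h \<in> carrier G then 1 else 0)"

lemma Phi_off: "h \<notin> carrier G \<Longrightarrow> Phi V h = 0" by (simp add: Phi_def)

lemma psc_vector_space: "vector_space psc"
  by unfold_locales (simp_all add: psc_def fun_eq_iff smult_add_right smult_add_left)

lemma pmul_props: "pmul (x + y) z = pmul x z + pmul y z" "pmul (psc c x) y = psc c (pmul x y)"
  "pmul x y = pmul y x" "pmul (pmul x y) z = pmul x (pmul y z)"
proof -
  show "pmul (x + y) z = pmul x z + pmul y z" "pmul (psc c x) y = psc c (pmul x y)"
    by (simp_all add: pmul_def psc_def fun_eq_iff distrib_right poly_mod_add_left mod_smult_left)
  show "pmul x y = pmul y x" by (simp add: pmul_def mult.commute)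
  show "pmul (pmul x y) z = pmul x (pmul y z)"
    by (simp add: pmul_def fun_eq_iff mod_mult_left_eq mod_mult_right_eq mult.assoc)
qed

lemma pmul_pone: "pmul pone (Phi V) = Phi V"
  using Phi_mod[of V] Phi_off[of _ V] by (auto simp: pmul_def pone_def fun_eq_iff)

lemma sum_fun_apply: "(\<Sum>x\<in>S. f x) h = (\<Sum>x\<in>S. (f x h :: complex poly))"
  by (induction S rule: infinite_finite_induct) auto

lemma Phi_tens_Irr:
  "W \<in> Irr \<Longrightarrow> k \<le> n \<Longrightarrow> h \<in> carrier G \<Longrightarrow>
    Phi (tens W (Mk k)) h = Polynomial.smult (gchar W h) (fib (\<alpha> h) k)"
  by (simp add: Phi_tens_pure_left[OF Irr_pure obj_Mk] Phi_Mk)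

text \<open>At each h the polynomials \<open>fib\<close> of different index are independent, which
  leaves for every k a relation among irreducible characters.\<close>

lemma Irr_Mk_independent:
  assumes S: "finite S" "S \<subseteq> Irr \<times> {1..n}" and z: "(\<Sum>(W, k)\<in>S. psc (cf (W, k)) (Phi (tens W (Mk k)))) = 0"
    and b: "b \<in> S"
  shows "cf b = 0"
proof -
  define c where "c W k = (if (W, k) \<in> S then cf (W, k) else 0)" for W k
  let ?S = "fst ` S"
  have sub: "S \<subseteq> ?S \<times> {1..n}" using S(2) by force
  have Irr_S: "?S \<subseteq> Irr" using S(2) by auto
  have "(\<Sum>W\<in>?S. c W k * gchar W h) = 0" if k: "k \<in> {1..n}" and h: "h \<in> carrier G" for k h
  proof -
    have "0 = (\<Sum>(W, k)\<in>S. psc (cf (W, k)) (Phi (tens W (Mk k)))) h" using z by simp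
    also have "\<dots> = (\<Sum>(W, k)\<in>S. Polynomial.smult (c W k * gchar W h) (fib (\<alpha> h) k))"
      unfolding sum_fun_apply
    proof (rule sum.cong[OF refl])
      fix x assume x: "x \<in> S"
      then obtain W k where "x = (W, k)" "W \<in> Irr" "k \<le> n" using S(2) by auto
      then show "(case x of (W, k) \<Rightarrow> psc (cf (W, k)) (Phi (tens W (Mk k)))) h =
          (case x of (W, k) \<Rightarrow> Polynomial.smult (c W k * gchar W h) (fib (\<alpha> h) k))"
        using x h by (simp add: psc_def Phi_tens_Irr c_def)
    qed
    also have "\<dots> = (\<Sum>(W, k)\<in>?S \<times> {1..n}. Polynomial.smult (c W k * gchar W h) (fib (\<alpha> h) k))"
      by (rule sum.mono_neutral_left) (use S(1) sub in \<open>auto simp: c_def\<close>)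
    also have "\<dots> = (\<Sum>k = 1..n. Polynomial.smult (\<Sum>W\<in>?S. c W k * gchar W h) (fib (\<alpha> h) k))"
      by (subst sum.cartesian_product[symmetric], subst sum.swap) (simp add: smult_sum)
    finally show ?thesis using fib_independent[of "\<lambda>k. \<Sum>W\<in>?S. c W k * gchar W h" "\<alpha> h" n k] k by simp
  qed
  note indep = this
  obtain W k where Wk: "b = (W, k)" by (cases b)
  then have W: "W \<in> ?S" and k: "k \<in> {1..n}" using b sub by force+
  have "c W k = 0" by (rule Irr_independent[OF finite_imageI[OF S(1)] Irr_S indep[OF k] W])
  then show ?thesis using b by (simp add: Wk c_def)
qed

end

context pointed_datum
begin

sublocale GH: green_invariant psc H "\<lambda>M. Phi (obj_of M)" pmul pone "Irr \<times> {1..n}" "\<lambda>(W, k). rep_obj (tens W (Mk k))"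
proof (rule green_invariant.intro[OF psc_vector_space], unfold_locales)
  have oWk: "obj (tens W (Mk k))" if "W \<in> Irr" "k \<in> {1..n}" for W k
    using that Irr_obj obj_Mk obj_tens by simp
  fix M N
  show "fd_module H (one_dim_rep (counit H))" by (rule one_dim_rep_H)
  show "Phi (obj_of (one_dim_rep (counit H))) = pone"
    using one_dim_rep_H(2) Phi_off by (auto simp: pone_def fun_eq_iff)
  show "pmul pone (Phi (obj_of M)) = Phi (obj_of M)" by (rule pmul_pone)
  show "fd_module H (case b of (W, k) \<Rightarrow> rep_obj (tens W (Mk k)))" if "b \<in> Irr \<times> {1..n}" for b
    using that rep_obj(1)[OF oWk] by auto
  show "cf b = 0" if S: "finite S" "S \<subseteq> Irr \<times> {1..n}"
    "(\<Sum>b\<in>S. psc (cf b) (Phi (obj_of (case b of (W, k) \<Rightarrow> rep_obj (tens W (Mk k)))))) = 0" "b \<in> S" for S cf b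
  proof (rule Irr_Mk_independent[OF S(1,2) _ S(4)])
    have "(\<Sum>(W, k)\<in>S. psc (cf (W, k)) (Phi (tens W (Mk k)))) =
      (\<Sum>b\<in>S. psc (cf b) (Phi (obj_of (case b of (W, k) \<Rightarrow> rep_obj (tens W (Mk k))))))"
    proof (rule sum.cong[OF refl])
      fix x assume "x \<in> S"
      then obtain W k where "x = (W, k)" "W \<in> Irr" "k \<in> {1..n}" using S(2) by auto
      then show "(case x of (W, k) \<Rightarrow> psc (cf (W, k)) (Phi (tens W (Mk k)))) =
          psc (cf x) (Phi (obj_of (case x of (W, k) \<Rightarrow> rep_obj (tens W (Mk k)))))"
        using rep_obj(2)[OF oWk] by simp
    qed
    then show "(\<Sum>(W, k)\<in>S. psc (cf (W, k)) (Phi (tens W (Mk k)))) = 0" using S(3) by simp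
  qed
  assume M: "fd_module H M"
  note oM = obj_obj_of(1)[OF M]
  show "Phi (obj_of M) = 0" if "fst M = 0" using Phi_zero[OF oM] that by (simp add: fun_eq_iff)
  show "\<exists>b\<in>Irr \<times> {1..n}. \<exists>N. fd_module H N \<and> fst N < fst M \<and>
      Phi (obj_of M) = Phi (obj_of (case b of (W, k) \<Rightarrow> rep_obj (tens W (Mk k)))) + Phi (obj_of N)" if M0: "fst M \<noteq> 0"
  proof -
    obtain W k V where W: "indec W" "0 < k" "k \<le> n" "obj V" "dsum (obj_of M) (tens W (Mk k)) V"
      using uniserial_summand[OF oM] M0 unfolding obj_of_simps by blast
    note i = irr_rep[OF W(1)]
    have k: "k \<in> {1..n}" using W by auto
    have oW: "obj W" "obj (tens W (Mk k))" using W obj_Mk obj_tens by (auto simp: indec_def pure_def)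
    have "dm W * k + dm V = fst M" using dsum_dm[OF W(5)] by simp
    moreover have "0 < dm W * k" using W(1,2) by (simp add: indec_def)
    ultimately have "dm V < fst M" by linarith
    moreover have "Phi (obj_of M) = Phi (obj_of (rep_obj (tens (irr_rep W) (Mk k)))) + Phi (obj_of (rep_obj V))"
      using Phi_dsum[OF oM oW(2) W(4,5)] Phi_iso[OF iso_tens_left[OF obj_Mk[OF W(3)] i(2)] oW(2) oWk[OF i(3) k]]
      by (simp add: rep_obj W(4) oWk[OF i(3) k] fun_eq_iff)
    ultimately show ?thesis using i(3) k rep_obj(1,3)[OF W(4)]
      by (intro bexI[of _ "(irr_rep W, k)"] exI[of _ "rep_obj V"] conjI) auto
  qed
  assume N: "fd_module H N"
  note oN = obj_obj_of(1)[OF N]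
  show "fd_module H (rep_sum M N)" by (rule H.rep_sum[OF M N])
  show "fd_module H (rep_tensor H M N)" by (rule rep_tensor_H[OF M N])
  show "Phi (obj_of (rep_sum M N)) = Phi (obj_of M) + Phi (obj_of N)"
    using Phi_rep_sum[OF M N] by (simp add: fun_eq_iff)
  show "Phi (obj_of (rep_tensor H M N)) = pmul (Phi (obj_of M)) (Phi (obj_of N))"
  proof (rule ext)
    fix h show "Phi (obj_of (rep_tensor H M N)) h = pmul (Phi (obj_of M)) (Phi (obj_of N)) h"
      by (cases "h \<in> carrier G") (simp_all add: pmul_def rep_tensor_H(2)[OF M N] Phi_off)
  qed
  show "module_iso (alg H) (as_module M) (as_module N) \<longleftrightarrow> Phi (obj_of M) = Phi (obj_of N)"
    unfolding module_iso_H[OF M N] using Phi_iso[OF _ oN oM] Phi_complete[OF oN oM] by auto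
qed (rule pmul_props)+

text \<open>A module of the group algebra is treated as a module with y = 0. Its invariant is the
  constant polynomial with value the character, so the same product \<open>pmul\<close> is here the
  pointwise product of characters.\<close>

sublocale GC: green_invariant psc CG "\<lambda>M. Phi (gobj_of M)" pmul pone Irr rep_gobj
proof (rule green_invariant.intro[OF psc_vector_space], unfold_locales)
  have one: "counit CG = (\<lambda>_. 1)" by (simp add: group_hopf_def)
  fix M N
  show "fd_module CG (one_dim_rep (counit CG))" unfolding one by (rule one_dim_rep_C) auto
  show "Phi (gobj_of (one_dim_rep (counit CG))) = pone"
    using one_dim_rep_C(2)[of "\<lambda>_. 1"] Phi_off by (auto simp: pone_def fun_eq_iff one one_pCons)
  show "pmul pone (Phi (gobj_of M)) = Phi (gobj_of M)" by (rule pmul_pone)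
  show "fd_module CG (rep_gobj b)" if "b \<in> Irr" for b using rep_gobj(1)[OF Irr_pure[OF that]] .
  show "cf b = 0" if S: "finite S" "S \<subseteq> Irr"
    "(\<Sum>b\<in>S. psc (cf b) (Phi (gobj_of (rep_gobj b)))) = 0" "b \<in> S" for S cf b
  proof (rule Irr_independent[OF S(1,2) _ S(4)])
    fix h assume h: "h \<in> carrier G"
    have "0 = coeff ((\<Sum>b\<in>S. psc (cf b) (Phi (gobj_of (rep_gobj b)))) h) 0" using S(3) by simp
    also have "\<dots> = (\<Sum>W\<in>S. cf W * gchar W h)"
      unfolding sum_fun_apply coeff_sum
    proof (rule sum.cong[OF refl])
      fix W assume "W \<in> S"
      then have "pure W" using S(2) Irr_pure by blast
      then show "coeff (psc (cf W) (Phi (gobj_of (rep_gobj W))) h) 0 = cf W * gchar W h"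
        by (simp add: psc_def rep_gobj Phi_pure h)
    qed
    finally show "(\<Sum>W\<in>S. cf W * gchar W h) = 0" by simp
  qed
  assume M: "fd_module CG M"
  note pM = pure_gobj_of[OF M]
  note oM = pure_obj[OF pM]
  show "Phi (gobj_of M) = 0" if "fst M = 0" using Phi_zero[OF oM] that by (simp add: fun_eq_iff)
  show "\<exists>b\<in>Irr. \<exists>N. fd_module CG N \<and> fst N < fst M \<and>
      Phi (gobj_of M) = Phi (gobj_of (rep_gobj b)) + Phi (gobj_of N)" if M0: "fst M \<noteq> 0"
  proof -
    obtain W \<iota> \<pi> where W: "indec W" "mor \<iota> W (gobj_of M)" "mor \<pi> (gobj_of M) W" "\<pi> * \<iota> = E (dm W)"
      using indec_summand[OF pM] M0 unfolding gobj_of_simps by blast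
    obtain V where V: "obj V" "dsum (gobj_of M) W V" "nl V = 0" using dsum_retract[OF oM W(2-4)] by auto
    note i = irr_rep[OF W(1)]
    have pV: "pure V" using V by (simp add: pure_def)
    have oW: "obj W" using W by (auto simp: indec_def pure_def)
    have "dm W + dm V = fst M" using dsum_dm[OF V(2)] by simp
    then have "dm V < fst M" using W(1) by (auto simp: indec_def)
    moreover have "Phi (gobj_of M) = Phi (gobj_of (rep_gobj (irr_rep W))) + Phi (gobj_of (rep_gobj V))"
      using Phi_dsum[OF oM oW V(1,2)] Phi_iso[OF i(2) oW Irr_obj[OF i(3)]]
      by (simp add: rep_gobj pV Irr_pure[OF i(3)] fun_eq_iff)
    ultimately show ?thesis using i(3) rep_gobj(1,4)[OF pV] by (intro bexI[of _ "irr_rep W"] exI[of _ "rep_gobj V"] conjI) auto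
  qed
  assume N: "fd_module CG N"
  note oN = pure_obj[OF pure_gobj_of[OF N]]
  show "fd_module CG (rep_sum M N)" by (rule C.rep_sum[OF M N])
  show "fd_module CG (rep_tensor CG M N)" by (rule rep_tensor_C[OF M N])
  show "Phi (gobj_of (rep_sum M N)) = Phi (gobj_of M) + Phi (gobj_of N)"
    using Phi_rep_sum_C[OF M N] by (simp add: fun_eq_iff)
  show "Phi (gobj_of (rep_tensor CG M N)) = pmul (Phi (gobj_of M)) (Phi (gobj_of N))"
  proof (rule ext)
    fix h show "Phi (gobj_of (rep_tensor CG M N)) h = pmul (Phi (gobj_of M)) (Phi (gobj_of N)) h"
      by (cases "h \<in> carrier G") (simp_all add: pmul_def rep_tensor_C(2)[OF M N] Phi_off)
  qed
  show "module_iso (alg CG) (as_module M) (as_module N) \<longleftrightarrow> Phi (gobj_of M) = Phi (gobj_of N)"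
    unfolding module_iso_C[OF M N] using Phi_iso[OF _ oN oM] Phi_complete[OF oN oM] by auto
qed (rule pmul_props)+

end

context green_invariant
begin

abbreviation "unit_map c \<equiv> complex_tensor r c \<one>\<^bsub>r\<^esub>"

lemma unit_map: "unit_map c \<in> carrier R" "\<Theta> (unit_map c) = sc c u"
  "unit_map (c + d) = unit_map c \<oplus>\<^bsub>R\<^esub> unit_map d" "unit_map (c * d) = unit_map c \<otimes>\<^bsub>R\<^esub> unit_map d"
  "unit_map 1 = \<one>\<^bsub>R\<^esub>"
proof -
  have inj: "x = y" if "x \<in> carrier R" "y \<in> carrier R" "\<Theta> x = \<Theta> y" for x y
    using Theta_inj that by (auto dest: inj_onD)
  show c: "unit_map c \<in> carrier R" and T: "\<Theta> (unit_map c) = sc c u" for c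
    using r_closed complex_tensor_closed by (simp_all add: Theta_complex_tensor Theta_one1)
  have uu: "mul u u = u" using mul_u[OF fd_one] by (simp add: Phi_one)
  show "unit_map (c + d) = unit_map c \<oplus>\<^bsub>R\<^esub> unit_map d" "unit_map (c * d) = unit_map c \<otimes>\<^bsub>R\<^esub> unit_map d"
    "unit_map 1 = \<one>\<^bsub>R\<^esub>"
    by (rule inj; simp add: c T Theta_hom(1-3,5-8) Theta_one scale_left_distrib mul_sc mul_sc2 uu)+
qed

end

context pointed_datum
begin

subsection \<open>Joint level sets of the characters\<close>

definition ceq :: "'a \<Rightarrow> 'a \<Rightarrow> bool" where
  "ceq h h' \<longleftrightarrow> (\<forall>W\<in>Irr. gchar W h = gchar W h')"

definition crep :: "'a \<Rightarrow> 'a" where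
  "crep h = (SOME h'. h' \<in> carrier G \<and> ceq h h')"

text \<open>Representatives of the level sets; they are the points of \<open>R(\<complex>G)\<close>.\<close>

definition "Cl = crep ` carrier G"

lemma crep: assumes "h \<in> carrier G" shows "crep h \<in> carrier G" "ceq h (crep h)" "crep h \<in> Cl"
proof -
  have "h \<in> carrier G \<and> ceq h h" using assms by (simp add: ceq_def)
  then have "crep h \<in> carrier G \<and> ceq h (crep h)" unfolding crep_def by (rule someI)
  then show "crep h \<in> carrier G" "ceq h (crep h)" "crep h \<in> Cl" using assms by (simp_all add: Cl_def)
qed

lemma Cl: "Cl \<subseteq> carrier G" "finite Cl"
  using crep(1) finite_carrier by (auto simp: Cl_def)

lemma Cl_eq: assumes "h \<in> Cl" "h' \<in> Cl" "ceq h h'" shows "h = h'"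
proof -
  obtain a b where ab: "a \<in> carrier G" "b \<in> carrier G" "h = crep a" "h' = crep b" using assms by (auto simp: Cl_def)
  have "ceq a k = ceq b k" for k using crep(2)[OF ab(1)] crep(2)[OF ab(2)] assms(3) by (auto simp: ab ceq_def)
  then show ?thesis by (simp add: ab crep_def)
qed

definition "TG = GC.\<Theta> ` carrier GC.R"

lemma TG_span: "TG = GH.span (Phi ` Irr)"
proof -
  have "(\<lambda>M. Phi (gobj_of M)) ` rep_gobj ` Irr = Phi ` Irr"
    unfolding image_image by (rule image_cong) (simp_all add: rep_gobj Irr_pure)
  then show ?thesis unfolding TG_def GC.Theta_image by simp
qed

lemma Phi_Irr: "W \<in> Irr \<Longrightarrow> h \<in> carrier G \<Longrightarrow> Phi W h = [:gchar W h:]"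
  by (rule Phi_pure[OF Irr_pure])

lemma TG_props:
  assumes "f \<in> TG"
  shows "h \<notin> carrier G \<Longrightarrow> f h = 0" "h \<in> carrier G \<Longrightarrow> f h = [:coeff (f h) 0:]"
    "h \<in> carrier G \<Longrightarrow> h' \<in> carrier G \<Longrightarrow> ceq h h' \<Longrightarrow> f h = f h'"
proof -
  have "(\<forall>h. h \<notin> carrier G \<longrightarrow> f h = 0) \<and> (\<forall>h\<in>carrier G. f h = [:coeff (f h) 0:]) \<and>
      (\<forall>h\<in>carrier G. \<forall>h'\<in>carrier G. ceq h h' \<longrightarrow> f h = f h')"
    using assms unfolding TG_span
  proof (induction rule: GH.span_induct_alt)
    case (step c x y)
    then obtain W where W: "W \<in> Irr" "x = Phi W" by blast
    have "(psc c x + y) h = [:coeff ((psc c x + y) h) 0:]" if "h \<in> carrier G" for h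
    proof -
      have "y h = [:coeff (y h) 0:]" using step(2) that by simp
      then obtain b where "y h = [:b:]" ..
      then show ?thesis using that W by (simp add: psc_def Phi_Irr)
    qed
    moreover have "(psc c x + y) h = (psc c x + y) h'" if "h \<in> carrier G" "h' \<in> carrier G" "ceq h h'" for h h'
      using step that W by (simp add: psc_def Phi_Irr) (simp add: ceq_def)
    ultimately show ?case using step W Phi_off by (simp add: psc_def)
  qed simp
  then show "h \<notin> carrier G \<Longrightarrow> f h = 0" "h \<in> carrier G \<Longrightarrow> f h = [:coeff (f h) 0:]"
    "h \<in> carrier G \<Longrightarrow> h' \<in> carrier G \<Longrightarrow> ceq h h' \<Longrightarrow> f h = f h'" by blast+
qed

lemma TG_closed: "f \<in> TG \<Longrightarrow> k \<in> TG \<Longrightarrow> f + k \<in> TG" "f \<in> TG \<Longrightarrow> psc c f \<in> TG" "0 \<in> TG" "pone \<in> TG"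
  "f \<in> TG \<Longrightarrow> k \<in> TG \<Longrightarrow> pmul f k \<in> TG" "f \<in> TG \<Longrightarrow> k \<in> TG \<Longrightarrow> f - k \<in> TG" "W \<in> Irr \<Longrightarrow> Phi W \<in> TG"
proof -
  show "pone \<in> TG" unfolding TG_def using GC.Theta_one GC.Theta_hom(8) by (metis imageI)
  show "pmul f k \<in> TG" if "f \<in> TG" "k \<in> TG"
  proof -
    obtain x y where xy: "x \<in> carrier GC.R" "y \<in> carrier GC.R" "f = GC.\<Theta> x" "k = GC.\<Theta> y"
      using \<open>f \<in> TG\<close> \<open>k \<in> TG\<close> unfolding TG_def by blast
    show ?thesis unfolding TG_def xy(3,4) GC.Theta_hom(2)[OF xy(1,2), symmetric] using GC.Theta_hom(6)[OF xy(1,2)] by blast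
  qed
qed (auto simp: TG_span intro: GH.span_add GH.span_scale GH.span_zero GH.span_diff GH.span_base)

lemma TG_eqI:
  assumes "f \<in> TG" "k \<in> TG" "\<And>h. h \<in> Cl \<Longrightarrow> f h = k h"
  shows "f = k"
proof (rule ext)
  fix h show "f h = k h"
    using assms(3)[of "crep h"] crep[of h] TG_props(1,3)[OF assms(1), of h] TG_props(1,3)[OF assms(2), of h]
    by (cases "h \<in> carrier G") metis+
qed

lemma mod_modulus_const: "[:c:] mod modulus a = [:c:]"
  using degree_modulus[of a] n_ge_2 by (intro mod_poly_less) simp

lemma one_mod_modulus: "1 mod modulus a = (1 :: complex poly)"
  using mod_modulus_const[of 1] by (simp only: one_pCons)

text \<open>Two level sets are separated by some irreducible character, which an affine change
  normalizes to the values 1 and 0; the indicator is the product over all other level sets.\<close>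

lemma indicator_TG:
  assumes h: "h \<in> Cl"
  shows "\<exists>e\<in>TG. \<forall>h'\<in>Cl. e h' = (if h' = h then 1 else 0)"
proof -
  have hG: "x \<in> carrier G" if "x \<in> Cl" for x using that Cl by blast
  have sep: "\<exists>f\<in>TG. f h = 1 \<and> f h' = 0" if h': "h' \<in> Cl" "h' \<noteq> h" for h'
  proof -
    obtain W where W: "W \<in> Irr" "gchar W h \<noteq> gchar W h'" using Cl_eq[OF h h'(1)] h'(2) by (auto simp: ceq_def)
    define f where "f = psc (1 / (gchar W h - gchar W h')) (Phi W - psc (gchar W h') pone)"
    have "f \<in> TG" unfolding f_def using W by (intro TG_closed)
    moreover have "f h = 1" "f h' = 0"
      using W hG[OF h] hG[OF h'(1)] by (simp_all add: f_def psc_def pone_def Phi_Irr one_pCons)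
    ultimately show ?thesis by blast
  qed
  have "\<exists>f\<in>TG. f h = 1 \<and> (\<forall>h'\<in>S. f h' = 0)" if "finite S" "S \<subseteq> Cl - {h}" for S
    using that
  proof (induction S)
    case empty
    show ?case using TG_closed(4) hG[OF h] by (intro bexI[of _ pone]) (auto simp: pone_def)
  next
    case (insert h' S)
    then obtain f where f: "f \<in> TG" "f h = 1" "\<forall>h'\<in>S. f h' = 0" by blast
    obtain k where k: "k \<in> TG" "k h = 1" "k h' = 0" using sep[of h'] insert.prems by auto
    have "pmul f k h = 1" using f k by (simp add: pmul_def one_mod_modulus)
    moreover have "\<forall>x\<in>insert h' S. pmul f k x = 0" using f k by (auto simp: pmul_def)
    ultimately show ?case using TG_closed(5)[OF f(1) k(1)] by blast
  qed
  from this[of "Cl - {h}"] obtain f where "f \<in> TG" "f h = 1" "\<forall>h'\<in>Cl - {h}. f h' = 0" using Cl(2) by auto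
  then show ?thesis by (intro bexI[of _ f]) auto
qed

definition "ind h = (SOME e. e \<in> TG \<and> (\<forall>h'\<in>Cl. e h' = (if h' = h then 1 else 0)))"

lemma ind: assumes "h \<in> Cl" shows "ind h \<in> TG" "h' \<in> Cl \<Longrightarrow> ind h h' = (if h' = h then 1 else 0)"
proof -
  have "\<exists>e. e \<in> TG \<and> (\<forall>h'\<in>Cl. e h' = (if h' = h then 1 else 0))" using indicator_TG[OF assms] by blast
  then have "ind h \<in> TG \<and> (\<forall>h'\<in>Cl. ind h h' = (if h' = h then 1 else 0))" unfolding ind_def by (rule someI_ex)
  then show "ind h \<in> TG" "h' \<in> Cl \<Longrightarrow> ind h h' = (if h' = h then 1 else 0)" by blast+
qed

lemma inj_Phi_Irr: "inj_on Phi Irr"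
proof (rule inj_onI)
  fix V W assume "V \<in> Irr" "W \<in> Irr" "Phi V = Phi W"
  then show "V = W" using Irr_iso_eq Phi_complete[of V W] Irr_obj by metis
qed

text \<open>The invariants of the irreducible modules and the indicators of the level sets are both
  independent and span the same space \<open>TG\<close>.\<close>

lemma card_Irr: "card Irr = card Cl"
proof -
  have i1: "GH.independent (Phi ` Irr)"
    unfolding GH.independent_explicit_module
  proof (intro allI impI)
    fix t u v assume t: "finite t" "t \<subseteq> Phi ` Irr" "(\<Sum>v\<in>t. psc (u v) v) = 0" "v \<in> t"
    obtain S where S: "S \<subseteq> Irr" "t = Phi ` S" using t(2) unfolding subset_image_iff by metis
    have injS: "inj_on Phi S" using inj_on_subset[OF inj_Phi_Irr S(1)] .
    have fS: "finite S" using t(1) finite_imageD[OF _ injS] S(2) by simp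
    obtain W where W: "W \<in> S" "v = Phi W" using t(4) S(2) by blast
    have "(\<Sum>W\<in>S. psc (u (Phi W)) (Phi (gobj_of (rep_gobj W)))) = (\<Sum>W\<in>S. psc (u (Phi W)) (Phi W))"
      using S(1) Irr_pure by (intro sum.cong) (auto simp: rep_gobj)
    also have "\<dots> = 0" using t(3) sum.reindex[OF injS, of "\<lambda>v. psc (u v) v"] S(2) by (simp add: o_def)
    finally show "u v = 0" using GC.indep[OF fS S(1), of "\<lambda>W. u (Phi W)" W] W by simp
  qed
  have inj: "inj_on ind Cl"
  proof (rule inj_onI)
    fix h h' assume h: "h \<in> Cl" "h' \<in> Cl" "ind h = ind h'"
    have "ind h h = 1" "ind h' h = (if h = h' then 1 else 0)" using ind(2)[OF h(1) h(1)] ind(2)[OF h(2) h(1)] by simp_all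
    then show "h = h'" using h(3) by (simp split: if_splits)
  qed
  have sum_ind: "(\<Sum>h\<in>Cl. psc (c h) (ind h)) h' = [:c h':]" if "h' \<in> Cl" for c h'
  proof -
    have "(\<Sum>h\<in>Cl. psc (c h) (ind h)) h' = (\<Sum>h\<in>Cl. if h = h' then [:c h':] else 0)"
      unfolding sum_fun_apply by (rule sum.cong) (auto simp: psc_def ind that)
    then show ?thesis using that Cl(2) by simp
  qed
  have "GH.independent (ind ` Cl)"
  proof -
    have "u v = 0" if uv: "(\<Sum>v\<in>ind ` Cl. psc (u v) v) = 0" "v \<in> ind ` Cl" for u v
    proof -
      obtain h where h: "h \<in> Cl" "v = ind h" using uv(2) by blast
      have "(\<Sum>h\<in>Cl. psc (u (ind h)) (ind h)) h = 0" using uv(1) sum.reindex[OF inj, of "\<lambda>v. psc (u v) v"] by (simp add: o_def)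
      then show ?thesis using sum_ind[OF h(1), of "\<lambda>h. u (ind h)"] h(2) by simp
    qed
    then show ?thesis unfolding GH.dependent_finite[OF finite_imageI[OF Cl(2)]] by blast
  qed
  note i2 = this
  have "f \<in> GH.span (ind ` Cl)" if f: "f \<in> TG" for f
  proof -
    have "f = (\<Sum>h\<in>Cl. psc (coeff (f h) 0) (ind h))"
    proof (rule TG_eqI[OF f])
      show "(\<Sum>h\<in>Cl. psc (coeff (f h) 0) (ind h)) \<in> TG"
        unfolding TG_span by (intro GH.span_sum GH.span_scale) (use ind(1) in \<open>simp add: TG_span\<close>)
      fix h assume h: "h \<in> Cl"
      then show "f h = (\<Sum>h\<in>Cl. psc (coeff (f h) 0) (ind h)) h"
        using sum_ind[OF h, of "\<lambda>h. coeff (f h) 0"] TG_props(2)[OF f, of h] Cl(1) by auto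
    qed
    also have "\<dots> \<in> GH.span (ind ` Cl)" by (intro GH.span_sum GH.span_scale GH.span_base) blast
    finally show ?thesis .
  qed
  then have s1: "Phi ` Irr \<subseteq> GH.span (ind ` Cl)" using TG_closed(7) by blast
  have s2: "ind ` Cl \<subseteq> GH.span (Phi ` Irr)" using ind(1) unfolding TG_span by blast
  have f: "finite (Phi ` Irr)" and le: "card (Phi ` Irr) \<le> card (ind ` Cl)"
    using GH.independent_span_bound[OF finite_imageI[OF Cl(2)] i1 s1] by blast+
  have "card (ind ` Cl) \<le> card (Phi ` Irr)" using GH.independent_span_bound[OF f i2 s2] by blast
  then show ?thesis using le card_image[OF inj] card_image[OF inj_Phi_Irr] by simp
qed

lemma element_a_point:
  shows "GC.\<Theta>\<^sub>1 (element_a G \<chi>) \<in> TG" "h \<in> carrier G \<Longrightarrow> GC.\<Theta>\<^sub>1 (element_a G \<chi>) h = [:\<alpha> h:]"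
    "element_a G \<chi> \<in> carrier GC.r"
proof -
  have e: "(\<lambda>h. inverse (\<chi> h)) = \<alpha>" by (simp add: \<alpha>_def fun_eq_iff)
  have fd: "fd_module CG (one_dim_rep \<alpha>)" by (rule one_dim_rep_C) (simp_all add: alpha_mult)
  have a: "element_a G \<chi> = green_class CG (one_dim_rep \<alpha>)" by (simp add: element_a_def e)
  show "element_a G \<chi> \<in> carrier GC.r" unfolding a by (rule GC.green_class_r[OF fd])
  have T: "GC.\<Theta>\<^sub>1 (element_a G \<chi>) = Phi (gobj_of (one_dim_rep \<alpha>))" unfolding a by (rule GC.Theta_green_class[OF fd])
  show "GC.\<Theta>\<^sub>1 (element_a G \<chi>) \<in> TG" unfolding T TG_def GC.Theta_image by (rule GC.Phi_in_span[OF fd])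
  show "h \<in> carrier G \<Longrightarrow> GC.\<Theta>\<^sub>1 (element_a G \<chi>) h = [:\<alpha> h:]"
    unfolding T by (rule one_dim_rep_C(2)) (simp_all add: alpha_mult)
qed

text \<open>The function \<alpha> is the character of a one-dimensional module, hence a combination
  of irreducible characters. So the modulus depends on the level set only.\<close>

lemma alpha_ceq: "h \<in> carrier G \<Longrightarrow> h' \<in> carrier G \<Longrightarrow> ceq h h' \<Longrightarrow> \<alpha> h = \<alpha> h'"
  using TG_props(3)[OF element_a_point(1), of h h'] element_a_point(2)[of h] element_a_point(2)[of h'] by simp

sublocale RC: pointed_algebra GC.R GC.unit_map Cl "\<lambda>h x. coeff (GC.\<Theta> x h) 0"
proof (rule pointed_algebra.intro[OF GC.cring_R], unfold_locales)
  have hG: "x \<in> carrier G" if "x \<in> Cl" for x using that Cl by blast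
  have T: "GC.\<Theta> x \<in> TG" if "x \<in> carrier GC.R" for x using that by (simp add: TG_def)
  show "finite Cl" by (rule Cl)
  show "GC.unit_map c \<in> carrier GC.R" "GC.unit_map (c + d) = GC.unit_map c \<oplus>\<^bsub>GC.R\<^esub> GC.unit_map d"
    "GC.unit_map (c * d) = GC.unit_map c \<otimes>\<^bsub>GC.R\<^esub> GC.unit_map d" "GC.unit_map 1 = \<one>\<^bsub>GC.R\<^esub>" for c d
    by (rule GC.unit_map)+
  fix h assume h: "h \<in> Cl"
  show "coeff (GC.\<Theta> (GC.unit_map c) h) 0 = c" for c
    using hG[OF h] by (simp add: GC.unit_map psc_def pone_def)
  show "\<exists>x\<in>carrier GC.R. coeff (GC.\<Theta> x h) 0 \<noteq> coeff (GC.\<Theta> x h') 0" if h': "h' \<in> Cl" "h \<noteq> h'" for h'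
  proof -
    obtain x where "x \<in> carrier GC.R" "GC.\<Theta> x = ind h" using ind(1)[OF h] unfolding TG_def by force
    then show ?thesis using ind(2)[OF h h] ind(2)[OF h h'(1)] h'(2) by (intro bexI[of _ x]) auto
  qed
  fix x y assume x: "x \<in> carrier GC.R" and y: "y \<in> carrier GC.R"
  show "coeff (GC.\<Theta> (x \<oplus>\<^bsub>GC.R\<^esub> y) h) 0 = coeff (GC.\<Theta> x h) 0 + coeff (GC.\<Theta> y h) 0"
    using GC.Theta_hom(1)[OF x y] by simp
  show "coeff (GC.\<Theta> (x \<otimes>\<^bsub>GC.R\<^esub> y) h) 0 = coeff (GC.\<Theta> x h) 0 * coeff (GC.\<Theta> y h) 0"
  proof -
    obtain c d where "GC.\<Theta> x h = [:c:]" "GC.\<Theta> y h = [:d:]"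
      using TG_props(2)[OF T[OF x] hG[OF h]] TG_props(2)[OF T[OF y] hG[OF h]] by metis
    then show ?thesis using GC.Theta_hom(2)[OF x y] by (simp add: pmul_def mod_modulus_const)
  qed
next
  fix x assume x: "x \<in> carrier GC.R" and z: "\<And>h. h \<in> Cl \<Longrightarrow> coeff (GC.\<Theta> x h) 0 = 0"
  have T: "GC.\<Theta> x \<in> TG" using x by (simp add: TG_def)
  have "GC.\<Theta> x = 0"
  proof (rule TG_eqI[OF T TG_closed(3)])
    fix h assume h: "h \<in> Cl"
    then have "GC.\<Theta> x h = [:coeff (GC.\<Theta> x h) 0:]" using Cl(1) by (intro TG_props(2)[OF T]) blast
    then show "GC.\<Theta> x h = 0 h" unfolding z[OF h] by simp
  qed
  then have "x = \<zero>\<^bsub>GC.R\<^esub>" using x GC.Theta_hom(3,7) GC.Theta_inj by (metis inj_onD)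
  moreover interpret cring GC.R by (rule GC.cring_R)
  show "\<exists>k::nat. x [^]\<^bsub>GC.R\<^esub> k = \<zero>\<^bsub>GC.R\<^esub>" using calculation by (intro exI[of _ 1]) simp
qed

end

context pointed_algebra
begin

lemma simple_has_dim_1:
  fixes S :: "('a, 'v) module"
  assumes S: "simple_module R S"
  shows "has_complex_dim \<lparr>carrier = carrier S, mult = mult S, one = one S, zero = zero S,
    add = add S, smult = (\<lambda>c x. \<iota> c \<odot>\<^bsub>S\<^esub> x)\<rparr> 1" (is "has_complex_dim ?V 1")
proof -
  interpret left_module R S using S by (simp add: simple_module_def)
  obtain v where v: "v \<in> carrier S" "v \<noteq> \<zero>\<^bsub>S\<^esub>" using simple_nonzero[OF S] by blast
  note line = simple_line[OF S v]
  define \<phi> where "\<phi> x = (THE c. x = \<iota> c \<odot>\<^bsub>S\<^esub> v)" for x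
  have \<phi>: "\<phi> (\<iota> c \<odot>\<^bsub>S\<^esub> v) = c" for c
    unfolding \<phi>_def by (rule the_equality) (use line(2) in \<open>auto dest: injD\<close>)
  have ex: "\<exists>c. x = \<iota> c \<odot>\<^bsub>S\<^esub> v" if "x \<in> carrier S" for x using that line(1) by blast
  have ab: "abelian_group ?V"
    by (rule abelian_groupI) (auto simp: M.a_ac intro!: bexI[of _ "\<ominus>\<^bsub>S\<^esub> _"] M.l_neg)
  have sm: "\<iota> c \<odot>\<^bsub>S\<^esub> x \<in> carrier S" if "x \<in> carrier S" for c x using that lm_smult_closed by simp
  have "has_complex_dim ?V (card {()})"
  proof (rule has_complex_dimI[where \<phi> = "\<lambda>_. \<phi>", OF ab])
    fix i :: unit and x y c assume "x \<in> carrier ?V" "y \<in> carrier ?V"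
    then obtain a b where "x = \<iota> a \<odot>\<^bsub>S\<^esub> v" "y = \<iota> b \<odot>\<^bsub>S\<^esub> v" using ex by fastforce
    moreover from this have "x \<oplus>\<^bsub>S\<^esub> y = \<iota> (a + b) \<odot>\<^bsub>S\<^esub> v"
      using lm_smult_l_distr[of "\<iota> a" "\<iota> b" v] v by (simp add: \<iota>_add)
    ultimately show "\<phi> (x \<oplus>\<^bsub>?V\<^esub> y) = \<phi> x + \<phi> y" by (simp add: \<phi>)
  next
    fix i :: unit and x c assume "x \<in> carrier ?V"
    then obtain a where "x = \<iota> a \<odot>\<^bsub>S\<^esub> v" using ex by fastforce
    moreover from this have "\<iota> c \<odot>\<^bsub>S\<^esub> x = \<iota> (c * a) \<odot>\<^bsub>S\<^esub> v"
      using lm_smult_assoc[of "\<iota> c" "\<iota> a" v] v by (simp add: \<iota>_mult)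
    ultimately show "\<phi> (c \<odot>\<^bsub>?V\<^esub> x) = c * \<phi> x" by (simp add: \<phi>)
  next
    fix x assume x: "x \<in> carrier ?V" and z: "\<And>i. i \<in> {()} \<Longrightarrow> \<phi> x = 0"
    obtain a where a: "x = \<iota> a \<odot>\<^bsub>S\<^esub> v" using ex x by fastforce
    then have x0: "x = \<iota> 0 \<odot>\<^bsub>S\<^esub> v" using z \<phi>[of a] by simp
    have "\<iota> 0 \<odot>\<^bsub>S\<^esub> v \<oplus>\<^bsub>S\<^esub> \<iota> 0 \<odot>\<^bsub>S\<^esub> v = \<iota> 0 \<odot>\<^bsub>S\<^esub> v"
      using lm_smult_l_distr[of "\<iota> 0" "\<iota> 0" v] v \<iota>_add[of 0 0] by simp
    then show "x = \<zero>\<^bsub>?V\<^esub>" using sm[OF v(1), of 0] x0 by (simp add: M.add.l_cancel_one')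
  next
    fix i :: unit
    show "\<exists>e\<in>carrier ?V. \<forall>j\<in>{()}. \<phi> e = (if j = i then 1 else 0)"
      using \<phi>[of 1] sm[OF v(1), of 1] by (intro bexI[of _ "\<iota> 1 \<odot>\<^bsub>S\<^esub> v"]) simp_all
  qed (use sm in simp_all)
  then show ?thesis by simp
qed

end

section \<open>Points and radical of the complexified Green ring of H\<close>

context pointed_datum
begin

definition "TH = GH.\<Theta> ` carrier GH.R"

lemma TH_span: "TH = GH.span ((\<lambda>(W, k). Phi (tens W (Mk k))) ` (Irr \<times> {1..n}))"
proof -
  have "(\<lambda>M. Phi (obj_of M)) ` (\<lambda>(W, k). rep_obj (tens W (Mk k))) ` (Irr \<times> {1..n}) =
      (\<lambda>(W, k). Phi (tens W (Mk k))) ` (Irr \<times> {1..n})"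
    unfolding image_image
    by (rule image_cong) (auto simp: rep_obj obj_tens Irr_obj obj_Mk)
  then show ?thesis unfolding TH_def GH.Theta_image by simp
qed

lemma TH_props:
  assumes "f \<in> TH"
  shows "h \<notin> carrier G \<Longrightarrow> f h = 0" "degree (f h) < n"
    "h \<in> carrier G \<Longrightarrow> h' \<in> carrier G \<Longrightarrow> ceq h h' \<Longrightarrow> f h = f h'"
proof -
  have "(\<forall>h. h \<notin> carrier G \<longrightarrow> f h = 0) \<and> (\<forall>h. degree (f h) < n) \<and>
      (\<forall>h\<in>carrier G. \<forall>h'\<in>carrier G. ceq h h' \<longrightarrow> f h = f h')"
    using assms unfolding TH_span
  proof (induction rule: GH.span_induct_alt)
    case base
    then show ?case using n_ge_2 by simp
  next
    case (step c x y)
    then obtain W k where W: "W \<in> Irr" "k \<le> n" "x = Phi (tens W (Mk k))" by auto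
    have "degree ((psc c x + y) h) < n" for h
    proof -
      have "degree (y h) < n" using step(2) by simp
      moreover have "degree (psc c x h) < n"
        using degree_Phi[of "tens W (Mk k)" h] degree_smult_le[of c "x h"] W(3) by (simp add: psc_def)
      ultimately show ?thesis using degree_add_less by simp
    qed
    moreover have "(psc c x + y) h = (psc c x + y) h'" if hh: "h \<in> carrier G" "h' \<in> carrier G" "ceq h h'" for h h'
    proof -
      have "y h = y h'" using step(2) hh by simp
      moreover have "gchar W h = gchar W h'" using hh(3) W(1) by (simp add: ceq_def)
      ultimately show ?thesis using hh W alpha_ceq[OF hh] by (simp add: psc_def Phi_tens_Irr)
    qed
    ultimately show ?case using step(2) W Phi_off by (simp add: psc_def)
  qed
  then show "h \<notin> carrier G \<Longrightarrow> f h = 0" "degree (f h) < n"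
    "h \<in> carrier G \<Longrightarrow> h' \<in> carrier G \<Longrightarrow> ceq h h' \<Longrightarrow> f h = f h'" by blast+
qed

text \<open>On the group the values of f are constants, so the product with \<open>fib\<close> keeps
  degree below n and is already reduced; for f the invariant of W it is that of W \<otimes>
  M_k.\<close>

lemma TH_fib:
  assumes "f \<in> TG" and k: "k \<in> {1..n}"
  shows "(\<lambda>h. f h * fib (\<alpha> h) k) \<in> TH"
  using assms(1) unfolding TG_span
proof (induction rule: GH.span_induct_alt)
  case base
  have "(\<lambda>h. (0 :: 'a \<Rightarrow> complex poly) h * fib (\<alpha> h) k) = 0" by (simp add: fun_eq_iff)
  then show ?case using GH.span_zero by (simp add: TH_span)
next
  case (step c x y)
  then obtain W where W: "W \<in> Irr" "x = Phi W" by blast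
  have "(\<lambda>h. x h * fib (\<alpha> h) k) = Phi (tens W (Mk k))"
  proof (rule ext)
    fix h show "x h * fib (\<alpha> h) k = Phi (tens W (Mk k)) h"
      using W k by (cases "h \<in> carrier G") (simp_all add: Phi_off Phi_Irr Phi_tens_Irr)
  qed
  also have "Phi (tens W (Mk k)) \<in> TH" unfolding TH_span using W k by (intro GH.span_base) force
  finally have x: "(\<lambda>h. x h * fib (\<alpha> h) k) \<in> TH" .
  have "(\<lambda>h. (psc c x + y) h * fib (\<alpha> h) k) = psc c (\<lambda>h. x h * fib (\<alpha> h) k) + (\<lambda>h. y h * fib (\<alpha> h) k)"
    by (simp add: fun_eq_iff psc_def distrib_right)
  then show ?case using x step(2) unfolding TH_span by (simp add: GH.span_add GH.span_scale)
qed

lemma TH_eqI: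
  assumes "f \<in> TH" "k \<in> TH" "\<And>h. h \<in> Cl \<Longrightarrow> f h = k h"
  shows "f = k"
proof (rule ext)
  fix h show "f h = k h"
    using assms(3)[of "crep h"] crep[of h] TH_props(1,3)[OF assms(1), of h] TH_props(1,3)[OF assms(2), of h]
    by (cases "h \<in> carrier G") metis+
qed

lemma TH_lift: assumes "f \<in> TH" obtains x where "x \<in> carrier GH.R" "GH.\<Theta> x = f"
  using assms unfolding TH_def by blast

text \<open>On each level set the ring is a quotient of \<complex>[z] by the modulus, whose points
  are the roots.\<close>

definition "Pt = (SIGMA h:Cl. {z. poly (modulus (\<alpha> h)) z = 0})"

lemma Cl_alpha: "h \<in> Cl \<Longrightarrow> h \<in> carrier G" "h \<in> Cl \<Longrightarrow> \<alpha> h \<noteq> 0"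
  using Cl(1) alpha_nonzero by blast+

lemma finite_Pt: "finite Pt"
  unfolding Pt_def using Cl(2) modulus_roots(2)[OF Cl_alpha(2)] by blast

lemma poly_mod_root: "poly m z = 0 \<Longrightarrow> poly (p mod m) z = poly (p :: complex poly) z"
  by (metis poly_add poly_mult mult_zero_right add_0 mult.commute div_mult_mod_eq)

definition "D3 = {h \<in> Cl. \<alpha> h ^ n = 1 \<and> \<alpha> h \<noteq> 1}"

lemma card_Pt: "card Pt + card D3 = card Cl * n"
proof -
  let ?d = "\<lambda>h. if \<alpha> h ^ n = 1 \<and> \<alpha> h \<noteq> 1 then 1 else 0 :: nat"
  have "card Pt = (\<Sum>h\<in>Cl. card {z. poly (modulus (\<alpha> h)) z = 0})"
    unfolding Pt_def using Cl(2) modulus_roots(2)[OF Cl_alpha(2)] by (intro card_SigmaI) auto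
  moreover have "card D3 = (\<Sum>h\<in>Cl. ?d h)"
    unfolding D3_def using Cl(2) by (simp add: sum.If_cases Int_def)
  ultimately have "card Pt + card D3 = (\<Sum>h\<in>Cl. card {z. poly (modulus (\<alpha> h)) z = 0} + ?d h)"
    by (simp add: sum.distrib)
  also have "\<dots> = (\<Sum>h\<in>Cl. n)"
    by (rule sum.cong) (use modulus_roots(1)[OF Cl_alpha(2)] n_ge_2 in auto)
  finally show ?thesis by simp
qed

sublocale RH: pointed_algebra GH.R GH.unit_map Pt "\<lambda>(h, z) x. poly (GH.\<Theta> x h) z"
proof (rule pointed_algebra.intro[OF GH.cring_R], unfold_locales)
  have T: "GH.\<Theta> x \<in> TH" if "x \<in> carrier GH.R" for x using that by (simp add: TH_def)
  have P: "h \<in> Cl" "h \<in> carrier G" "poly (modulus (\<alpha> h)) z = 0" if "(h, z) \<in> Pt" for h z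
    using that Cl(1) by (auto simp: Pt_def)
  show "finite Pt" by (rule finite_Pt)
  show "GH.unit_map c \<in> carrier GH.R" "GH.unit_map (c + d) = GH.unit_map c \<oplus>\<^bsub>GH.R\<^esub> GH.unit_map d"
    "GH.unit_map (c * d) = GH.unit_map c \<otimes>\<^bsub>GH.R\<^esub> GH.unit_map d" "GH.unit_map 1 = \<one>\<^bsub>GH.R\<^esub>" for c d
    by (rule GH.unit_map)+
  fix l assume "l \<in> Pt"
  moreover obtain h z where l: "l = (h, z)" by (cases l)
  ultimately have p: "(h, z) \<in> Pt" by simp
  show "(case l of (h, z) \<Rightarrow> \<lambda>x. poly (GH.\<Theta> x h) z) (GH.unit_map c) = c" for c
    using P[OF p] by (simp add: l GH.unit_map psc_def pone_def)
  show "\<exists>x\<in>carrier GH.R. (case l of (h, z) \<Rightarrow> \<lambda>x. poly (GH.\<Theta> x h) z) x \<noteq> (case l' of (h, z) \<Rightarrow> \<lambda>x. poly (GH.\<Theta> x h) z) x"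
    if l'P: "l' \<in> Pt" and ne: "l \<noteq> l'" for l'
  proof -
    obtain h' z' where l': "l' = (h', z')" by (cases l')
    then have p': "(h', z') \<in> Pt" using l'P by simp
    note h = P(1)[OF p] and h' = P(1)[OF p']
    show ?thesis
    proof (cases "h = h'")
      case False
      \<comment> \<open>Points over different level sets are separated by an indicator coming from
        R(\<complex>G), points over the same one by the class of \<open>Mk 2\<close>, whose
        invariant is z.\<close>
      have "(\<lambda>x. ind h x * fib (\<alpha> x) 1) \<in> TH" by (rule TH_fib[OF ind(1)[OF h]]) (use n_ge_2 in simp)
      then obtain x where x: "x \<in> carrier GH.R" "GH.\<Theta> x = (\<lambda>x. ind h x * fib (\<alpha> x) 1)"
        by (rule TH_lift)
      then show ?thesis using ind(2)[OF h h] ind(2)[OF h h'] False by (intro bexI[OF _ x(1)]) (simp add: l l')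
    next
      case True
      have "(\<lambda>x. pone x * fib (\<alpha> x) 2) \<in> TH" by (rule TH_fib[OF TG_closed(4)]) (use n_ge_2 in simp)
      then obtain x where x: "x \<in> carrier GH.R" "GH.\<Theta> x = (\<lambda>x. pone x * fib (\<alpha> x) 2)"
        by (rule TH_lift)
      then show ?thesis using P(2)[OF p] True ne
        by (intro bexI[OF _ x(1)]) (simp add: l l' pone_def numeral_2_eq_2)
    qed
  qed
  fix x y assume x: "x \<in> carrier GH.R" and y: "y \<in> carrier GH.R"
  show "(case l of (h, z) \<Rightarrow> \<lambda>x. poly (GH.\<Theta> x h) z) (x \<oplus>\<^bsub>GH.R\<^esub> y) =
      (case l of (h, z) \<Rightarrow> \<lambda>x. poly (GH.\<Theta> x h) z) x + (case l of (h, z) \<Rightarrow> \<lambda>x. poly (GH.\<Theta> x h) z) y"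
    using GH.Theta_hom(1)[OF x y] by (simp add: l)
  show "(case l of (h, z) \<Rightarrow> \<lambda>x. poly (GH.\<Theta> x h) z) (x \<otimes>\<^bsub>GH.R\<^esub> y) =
      (case l of (h, z) \<Rightarrow> \<lambda>x. poly (GH.\<Theta> x h) z) x * (case l of (h, z) \<Rightarrow> \<lambda>x. poly (GH.\<Theta> x h) z) y"
    using GH.Theta_hom(2)[OF x y] poly_mod_root[OF P(3)[OF p]] by (simp add: l pmul_def)
next
  interpret cring GH.R by (rule GH.cring_R)
  fix x assume x: "x \<in> carrier GH.R"
    and z: "\<And>l. l \<in> Pt \<Longrightarrow> (case l of (h, z) \<Rightarrow> \<lambda>x. poly (GH.\<Theta> x h) z) x = 0"
  have T: "GH.\<Theta> x \<in> TH" "GH.\<Theta> (x \<otimes>\<^bsub>GH.R\<^esub> x) \<in> TH" "0 \<in> TH"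
    using x by (simp_all add: TH_def) (use GH.Theta_hom(3,7) in \<open>metis imageI\<close>)
  have "GH.\<Theta> (x \<otimes>\<^bsub>GH.R\<^esub> x) = 0"
  proof (rule TH_eqI[OF T(2,3)])
    fix h assume h: "h \<in> Cl"
    have "poly (GH.\<Theta> x h) \<zeta> = 0" if "poly (modulus (\<alpha> h)) \<zeta> = 0" for \<zeta>
      using z[of "(h, \<zeta>)"] h that by (simp add: Pt_def)
    then have "modulus (\<alpha> h) dvd GH.\<Theta> x h * GH.\<Theta> x h"
      by (rule vanishing_on_roots(3)[OF Cl_alpha(2)[OF h] TH_props(2)[OF T(1)]])
    then show "GH.\<Theta> (x \<otimes>\<^bsub>GH.R\<^esub> x) h = 0 h" using GH.Theta_hom(2)[OF x x] by (simp add: pmul_def)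
  qed
  then have "x \<otimes>\<^bsub>GH.R\<^esub> x = \<zero>\<^bsub>GH.R\<^esub>" using x GH.Theta_hom(3,6,7) GH.Theta_inj by (metis inj_onD)
  then have "x [^]\<^bsub>GH.R\<^esub> (2::nat) = \<zero>\<^bsub>GH.R\<^esub>" using x by (simp add: numeral_2_eq_2)
  then show "\<exists>k::nat. x [^]\<^bsub>GH.R\<^esub> k = \<zero>\<^bsub>GH.R\<^esub>" by blast
qed

section \<open>The exceptional level sets and the radical\<close>

lemma character_order_props: "0 < character_order G \<chi>" "n dvd character_order G \<chi>"
proof -
  let ?P = "\<lambda>k. 0 < k \<and> (\<forall>h\<in>carrier G. \<chi> h ^ k = 1)" and ?l = "character_order G \<chi>"
  have "\<chi> h ^ Coset.order G = 1" if h: "h \<in> carrier G" for h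
  proof -
    have "\<alpha> h ^ Coset.order G = 1" using alpha_pow[OF h, of "Coset.order G"] pow_order_eq_1[OF h] by simp
    then show ?thesis by (simp add: \<alpha>_def power_inverse)
  qed
  moreover have "0 < Coset.order G" using finite_carrier order_gt_0_iff_finite by blast
  ultimately have "?P (Coset.order G)" by blast
  then have l: "?P ?l" unfolding character_order_def by (rule LeastI)
  then show "0 < ?l" by blast
  have "q ^ (?l mod n) = 1"
  proof -
    have "q ^ ?l = q ^ (n * (?l div n) + ?l mod n)" by simp
    also have "\<dots> = q ^ (?l mod n)" unfolding power_add power_mult q_power(1) by simp
    finally show ?thesis using l g_closed by simp
  qed
  then have "?l mod n = 0" using q_power(2)[of "?l mod n"] n_ge_2 by fastforce
  then show "n dvd ?l" by auto
qed

text \<open>Writing t = (l / n) s turns \<omega>^t into exp(2 pi i s / n), so the admissible t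
  correspond to the n-th roots of unity other than 1.\<close>

lemma roots_of_unity_condition:
  assumes l: "0 < l" "n dvd l"
  shows "(\<exists>t<l. a = cis (2 * pi / real l) ^ t \<and> t \<noteq> 0 \<and> (l div n) dvd t) \<longleftrightarrow> a ^ n = 1 \<and> a \<noteq> 1"
proof -
  obtain m where m: "l = n * m" using l(2) by auto
  have pos: "0 < m" "0 < n" using l m by auto
  have ldn: "l div n = m" using pos by (simp add: m)
  have om: "cis (2 * pi / real l) ^ (m * s) = cis (2 * pi * real s / real n)" for s
    using pos by (simp add: Complex.DeMoivre m field_simps)
  have bij: "bij_betw (\<lambda>k. cis (2 * pi * real k / real n)) {..<n} {z. z ^ n = 1}"
    by (rule bij_betw_roots_unity[OF pos(2)])
  show ?thesis
  proof
    assume "\<exists>t<l. a = cis (2 * pi / real l) ^ t \<and> t \<noteq> 0 \<and> (l div n) dvd t"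
    then obtain s where s: "m * s < l" "a = cis (2 * pi / real l) ^ (m * s)" "m * s \<noteq> 0"
      unfolding ldn by (auto elim!: dvdE)
    then have sn: "s < n" "s \<noteq> 0" using pos by (auto simp: m mult.commute)
    have a: "a = cis (2 * pi * real s / real n)" using s(2) unfolding om .
    have "a \<in> {z. z ^ n = 1}" unfolding a using bij sn(1) by (auto simp: bij_betw_def)
    moreover have "a \<noteq> 1"
    proof
      assume "a = 1"
      then have "cis (2 * pi * real s / real n) = cis (2 * pi * real 0 / real n)" using a by simp
      then have "s = 0" using inj_onD[OF bij_betw_imp_inj_on[OF bij], of s 0] sn pos by simp
      then show False using sn by simp
    qed
    ultimately show "a ^ n = 1 \<and> a \<noteq> 1" by simp
  next
    assume a: "a ^ n = 1 \<and> a \<noteq> 1"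
    then have "a \<in> (\<lambda>k. cis (2 * pi * real k / real n)) ` {..<n}" using bij by (simp add: bij_betw_def)
    then obtain s where s: "s < n" "a = cis (2 * pi * real s / real n)" by blast
    have "s \<noteq> 0" using a s by (intro notI) simp
    then show "\<exists>t<l. a = cis (2 * pi / real l) ^ t \<and> t \<noteq> 0 \<and> (l div n) dvd t"
    proof (intro exI conjI)
      show "m * s < l" "m * s \<noteq> 0" using s pos \<open>s \<noteq> 0\<close> by (simp_all add: m mult.commute)
      show "a = cis (2 * pi / real l) ^ (m * s)" unfolding om by (rule s(2))
      show "l div n dvd m * s" by (simp add: ldn)
    qed
  qed
qed

text \<open>On the simple module at h the element a acts by the scalar \<alpha>(h), and scalars act
  faithfully on a line. The condition on t thus says that \<alpha>(h) is \<omega>^t.\<close>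

lemma Omega3_eq: "Omega3 G \<chi> g = RC.points_class ` D3"
proof -
  let ?a = "complex_tensor GC.r 1 (element_a G \<chi>)"
  have aR: "?a \<in> carrier GC.R" by (rule GC.complex_tensor_closed[OF element_a_point(3)])
  have lam_a: "coeff (GC.\<Theta> ?a h) 0 = \<alpha> h" if "h \<in> Cl" for h
    using element_a_point(2)[OF Cl_alpha(1)[OF that]]
    by (simp add: GC.Theta_complex_tensor[OF element_a_point(3)] psc_def)
  have acts: "(\<forall>W\<in>RC.points_class h. \<forall>w\<in>carrier W. ?a \<odot>\<^bsub>W\<^esub> w = GC.unit_map c \<odot>\<^bsub>W\<^esub> w) \<longleftrightarrow> \<alpha> h = c"
    if h: "h \<in> Cl" for h c
  proof
    assume *: "\<forall>W\<in>RC.points_class h. \<forall>w\<in>carrier W. ?a \<odot>\<^bsub>W\<^esub> w = GC.unit_map c \<odot>\<^bsub>W\<^esub> w"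
    from RC.simple_exists[OF h] obtain W where W: "simple_module GC.R W" "RC.acts h W" "W \<in> RC.points_class h"
      unfolding RC.points_class_def by blast
    obtain v where v: "v \<in> carrier W" "v \<noteq> \<zero>\<^bsub>W\<^esub>" using RC.simple_nonzero[OF W(1)] by blast
    have "GC.unit_map (\<alpha> h) \<odot>\<^bsub>W\<^esub> v = GC.unit_map c \<odot>\<^bsub>W\<^esub> v"
      using * W(3) v(1) RC.actsD[OF W(2) aR v(1)] by (simp add: lam_a[OF h])
    then show "\<alpha> h = c" using RC.simple_line(2)[OF W(1) v] by (auto dest: injD)
  next
    assume c: "\<alpha> h = c"
    show "\<forall>W\<in>RC.points_class h. \<forall>w\<in>carrier W. ?a \<odot>\<^bsub>W\<^esub> w = GC.unit_map c \<odot>\<^bsub>W\<^esub> w"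
    proof (intro ballI)
      fix W w assume "W \<in> RC.points_class h" "w \<in> carrier W"
      then show "?a \<odot>\<^bsub>W\<^esub> w = GC.unit_map c \<odot>\<^bsub>W\<^esub> w"
        using RC.actsD[OF _ aR, of h W w] by (simp only: RC.points_class_def mem_Collect_eq lam_a[OF h] c)
    qed
  qed
  let ?l = "character_order G \<chi>"
  have "Omega3 G \<chi> g = {X \<in> simple_classes GC.R. \<exists>t<?l. (\<forall>W\<in>X. \<forall>w\<in>carrier W.
      ?a \<odot>\<^bsub>W\<^esub> w = GC.unit_map (cis (2 * pi / real ?l) ^ t) \<odot>\<^bsub>W\<^esub> w) \<and> t \<noteq> 0 \<and> (?l div n) dvd t}"
    by (simp add: Omega3_def Let_def n_def)
  also have "simple_classes GC.R = RC.points_class ` Cl"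
    using RC.simple_classes_points by (simp add: bij_betw_def)
  also have "{X \<in> RC.points_class ` Cl. \<exists>t<?l. (\<forall>W\<in>X. \<forall>w\<in>carrier W.
      ?a \<odot>\<^bsub>W\<^esub> w = GC.unit_map (cis (2 * pi / real ?l) ^ t) \<odot>\<^bsub>W\<^esub> w) \<and> t \<noteq> 0 \<and> (?l div n) dvd t} =
      RC.points_class ` {h \<in> Cl. \<exists>t<?l. (\<forall>W\<in>RC.points_class h. \<forall>w\<in>carrier W.
      ?a \<odot>\<^bsub>W\<^esub> w = GC.unit_map (cis (2 * pi / real ?l) ^ t) \<odot>\<^bsub>W\<^esub> w) \<and> t \<noteq> 0 \<and> (?l div n) dvd t}" by blast
  also have "{h \<in> Cl. \<exists>t<?l. (\<forall>W\<in>RC.points_class h. \<forall>w\<in>carrier W.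
      ?a \<odot>\<^bsub>W\<^esub> w = GC.unit_map (cis (2 * pi / real ?l) ^ t) \<odot>\<^bsub>W\<^esub> w) \<and> t \<noteq> 0 \<and> (?l div n) dvd t} = D3"
    unfolding D3_def using roots_of_unity_condition[OF character_order_props] by (intro Collect_cong conj_cong refl) (simp add: acts)
  finally show ?thesis .
qed

lemma d3_eq: "d3 G \<chi> g = card D3"
  unfolding d3_def Omega3_eq
  by (rule card_image) (rule inj_on_subset[OF bij_betw_imp_inj_on[OF RC.simple_classes_points]], auto simp: D3_def)

text \<open>At a level set outside \<open>D3\<close> the radical vanishes, at one in
  \<open>D3\<close> its values are multiples of F_n. As F_n is monic of degree n - 1, the
  coefficients at n - 1 over \<open>D3\<close> are coordinates, with the products of indicators and
  F_n as dual basis.\<close>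

lemma jacobson_radical_dim:
  "has_complex_dim (complex_space GH.r ((regular_module GH.R)\<lparr>carrier := jacobson_radical GH.R\<rparr>)) (card D3)"
proof -
  let ?J = "jacobson_radical GH.R"
  let ?V = "complex_space GH.r ((regular_module GH.R)\<lparr>carrier := ?J\<rparr>)"
  have V: "carrier ?V = ?J" "zero ?V = \<zero>\<^bsub>GH.R\<^esub>" "add ?V = add GH.R" "c \<odot>\<^bsub>?V\<^esub> x = GH.unit_map c \<otimes>\<^bsub>GH.R\<^esub> x" for c x
    by (simp_all add: complex_space_def regular_module_def)
  have J: "?J = {x \<in> carrier GH.R. \<forall>h\<in>Cl. \<forall>z. poly (modulus (\<alpha> h)) z = 0 \<longrightarrow> poly (GH.\<Theta> x h) z = 0}"
    unfolding RH.jacobson_radical_points by (auto simp: Pt_def)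
  have T: "GH.\<Theta> x \<in> TH" if "x \<in> carrier GH.R" for x using that by (simp add: TH_def)
  have add: "GH.\<Theta> (x \<oplus>\<^bsub>GH.R\<^esub> y) = GH.\<Theta> x + GH.\<Theta> y" if "x \<in> carrier GH.R" "y \<in> carrier GH.R" for x y
    using GH.Theta_hom(1) that by blast
  have sm: "GH.\<Theta> (GH.unit_map c \<otimes>\<^bsub>GH.R\<^esub> x) = psc c (GH.\<Theta> x)" if x: "x \<in> carrier GH.R" for c x
  proof -
    have "pmul pone (GH.\<Theta> x) = GH.\<Theta> x" using GH.mul_u_span T[OF x] unfolding TH_def GH.Theta_image .
    then show ?thesis using GH.Theta_hom(2)[OF GH.unit_map(1) x] by (simp add: GH.unit_map(2) pmul_props)
  qed
  have Jc: "x \<in> carrier GH.R" if "x \<in> ?J" for x using that by (simp add: J)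
  have smJ: "GH.unit_map c \<otimes>\<^bsub>GH.R\<^esub> x \<in> ?J" if "x \<in> ?J" for c x
    using that sm[OF Jc[OF that]] GH.unit_map(1) by (simp add: J psc_def)
  have addJ: "x \<oplus>\<^bsub>GH.R\<^esub> y \<in> ?J" if "x \<in> ?J" "y \<in> ?J" for x y
    using that by (simp add: J add)
  have zJ: "\<zero>\<^bsub>GH.R\<^esub> \<in> ?J" using GH.Theta_hom(3) by (simp add: J)
  have mJ: "\<ominus>\<^bsub>GH.R\<^esub> x \<in> ?J" if "x \<in> ?J" for x
  proof -
    have "GH.\<Theta> (\<ominus>\<^bsub>GH.R\<^esub> x) + GH.\<Theta> x = 0"
      using add[of "\<ominus>\<^bsub>GH.R\<^esub> x" x] Jc[OF that] GH.Theta_hom(3) by (simp add: RH.l_neg)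
    then have "GH.\<Theta> (\<ominus>\<^bsub>GH.R\<^esub> x) = - GH.\<Theta> x" by (simp add: eq_neg_iff_add_eq_0)
    then show ?thesis using that by (simp add: J)
  qed
  have "\<exists>y\<in>?J. y \<oplus>\<^bsub>GH.R\<^esub> x = \<zero>\<^bsub>GH.R\<^esub>" if "x \<in> ?J" for x
    using mJ[OF that] RH.l_neg[OF Jc[OF that]] by blast
  then have ab: "abelian_group ?V"
    by (intro abelian_groupI; unfold V) (use addJ zJ Jc in \<open>simp_all add: RH.a_ac\<close>)
  have fib_n: "degree (fib a n) = n - 1" "coeff (fib a n) (n - 1) = 1" for a
    using fib_degree[of a "n - 1"] fib_lead[of a "n - 1"] n_Suc by metis+
  show ?thesis
  proof (rule has_complex_dimI[OF ab, where \<phi> = "\<lambda>h x. coeff (GH.\<Theta> x h) (n - 1)"])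
    show "finite D3" using Cl(2) by (simp add: D3_def)
    show "c \<odot>\<^bsub>?V\<^esub> x \<in> carrier ?V" if "x \<in> carrier ?V" for c x using that smJ unfolding V by blast
    show "coeff (GH.\<Theta> (x \<oplus>\<^bsub>?V\<^esub> y) h) (n - 1) = coeff (GH.\<Theta> x h) (n - 1) + coeff (GH.\<Theta> y h) (n - 1)"
      if "x \<in> carrier ?V" "y \<in> carrier ?V" for x y h
      using that Jc by (simp add: V add)
    show "coeff (GH.\<Theta> (c \<odot>\<^bsub>?V\<^esub> x) h) (n - 1) = c * coeff (GH.\<Theta> x h) (n - 1)" if "x \<in> carrier ?V" for c x h
      using that Jc by (simp add: V sm psc_def)
  next
    fix x assume "x \<in> carrier ?V" and z: "\<And>h. h \<in> D3 \<Longrightarrow> coeff (GH.\<Theta> x h) (n - 1) = 0"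
    then have xJ: "x \<in> ?J" unfolding V by blast
    note x = Jc[OF xJ]
    have T0: "0 \<in> TH" unfolding TH_span by (rule GH.span_zero)
    have "GH.\<Theta> x = 0"
    proof (rule TH_eqI[OF T[OF x] T0])
      fix h assume h: "h \<in> Cl"
      have r: "poly (GH.\<Theta> x h) \<zeta> = 0" if "poly (modulus (\<alpha> h)) \<zeta> = 0" for \<zeta> using xJ h that by (simp add: J)
      note v = vanishing_on_roots[OF Cl_alpha(2)[OF h] TH_props(2)[OF T[OF x]] r]
      show "GH.\<Theta> x h = 0 h"
      proof (cases "h \<in> D3")
        case True
        then show ?thesis using v(1) z[OF True] by simp
      next
        case False
        then show ?thesis using v(2) h by (simp add: D3_def)
      qed
    qed
    then show "x = \<zero>\<^bsub>?V\<^esub>" unfolding V using x GH.Theta_hom(3,7) GH.Theta_inj by (metis inj_onD)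
  next
    fix h assume h3: "h \<in> D3"
    then have h: "h \<in> Cl" and ah: "\<alpha> h ^ n = 1" "\<alpha> h \<noteq> 1" by (simp_all add: D3_def)
    have "(\<lambda>x. ind h x * fib (\<alpha> x) n) \<in> TH" by (rule TH_fib[OF ind(1)[OF h]]) (use n_ge_2 in simp)
    then obtain e where e: "e \<in> carrier GH.R" "GH.\<Theta> e = (\<lambda>x. ind h x * fib (\<alpha> x) n)"
      by (rule TH_lift)
    have "poly (fib (\<alpha> h) n) z = 0" if "poly (modulus (\<alpha> h)) z = 0" for z
      using that ah n_ge_2 fib_sum_eq_0[of n "\<alpha> h"] by (auto simp: modulus_root)
    then have "e \<in> ?J" using e ind(2)[OF h] by (auto simp: J)
    moreover have "coeff (GH.\<Theta> e j) (n - 1) = (if j = h then 1 else 0)" if "j \<in> D3" for j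
      using ind(2)[OF h, of j] that fib_n by (simp add: e D3_def)
    ultimately show "\<exists>e\<in>carrier ?V. \<forall>j\<in>D3. coeff (GH.\<Theta> e j) (n - 1) = (if j = h then 1 else 0)"
      unfolding V by blast
  qed
qed

lemma simple_modules:
  "finite (simple_classes GH.R)" "card (simple_classes GH.R) + d3 G \<chi> g = num_simple_reps G * n"
  using bij_betw_finite[OF RH.simple_classes_points] bij_betw_same_card[OF RH.simple_classes_points] finite_Pt
    card_Pt card_Irr by (simp_all add: num_simple_reps d3_eq)

end

theorem proposition5p2:
  fixes G :: "'g monoid" and \<chi> :: "'g \<Rightarrow> complex" and g :: 'g and n :: nat
  assumes "group_datum G \<chi> g"
    and "n = q_order \<chi> g" and "n \<ge> 2"
    and "H = H_hopf G \<chi> g"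
  shows "(finite (simple_classes (complex_green_ring H)) \<and>
      int (card (simple_classes (complex_green_ring H))) =
        int (num_simple_reps G) * int n - int (d3 G \<chi> g) \<and>
      (\<forall>S :: ((((nat \<times> 'g) rep set \<Rightarrow>\<^sub>0 int) set \<Rightarrow>\<^sub>0 complex) set, 'v) module.
        simple_module (complex_green_ring H) S \<longrightarrow>
          has_complex_dim (complex_space (green_ring H) S) 1)) \<and>
    has_complex_dim (complex_space (green_ring H)
      ((regular_module (complex_green_ring H))
         \<lparr>carrier := jacobson_radical (complex_green_ring H)\<rparr>)) (d3 G \<chi> g)"
proof -
  interpret pointed_datum G \<chi> g n
    using assms by (intro pointed_datum.intro pointed_datum_axioms.intro) auto
  have "int (card (simple_classes (complex_green_ring H))) + int (d3 G \<chi> g) = int (num_simple_reps G * n)"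
    using simple_modules(2) unfolding assms(4) by (simp only: of_nat_add[symmetric])
  then have "int (card (simple_classes (complex_green_ring H))) = int (num_simple_reps G) * int n - int (d3 G \<chi> g)"
    by simp
  moreover have "has_complex_dim (complex_space (green_ring H) S) 1" if "simple_module (complex_green_ring H) S"
    for S :: "((((nat \<times> 'g) rep set \<Rightarrow>\<^sub>0 int) set \<Rightarrow>\<^sub>0 complex) set, 'v) module"
    using RH.simple_has_dim_1[OF that[unfolded assms(4)]] by (simp add: complex_space_def assms(4))
  ultimately show ?thesis
    using simple_modules(1) jacobson_radical_dim unfolding assms(4) d3_eq by blast
qed

end
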